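(* Let $\lambda>0$ and let $\psi:\mathbb{R}\to\,]0,+\infty[$ be a Borel function with $\int_x^\infty\psi(z)e^{-\lambda z}dz<\infty$ for all $x\in\mathbb{R}$. Let $$\Phi(y)=1-e^{\lambda y}\int_y^\infty\psi(z)e^{-\lambda z}dz,\qquad \varphi(y)=\Phi'(y)=\psi(y)-\lambda e^{\lambda y}\int_y^\infty\psi(z)e^{-\lambda z}dz,$$ $$M_t^{\lambda,\varphi}=\Big\{(1-\Phi(S_t))\cosh(\lambda(S_t-X_t))+\varphi(S_t)\frac{\sinh(\lambda(S_t-X_t))}{\lambda}\Big\}e^{-\lambda^2t/2}.$$ 1. Let $u>0$, $x\in\mathbb{R}$ and $\Gamma_u\in\mathcal{F}_u$. Then $$\lim_{t\to\infty}\frac{E_x[1_{\Gamma_u}\psi(S_t)e^{\lambda(S_t-X_t)}]}{E_x[\psi(S_t)e^{\lambda(S_t-X_t)}]}=\frac{1}{1-\Phi(x)}E_x[1_{\Gamma_u}M_u^{\lambda,\varphi}].$$ 2. Let $(Q_x^{\lambda,\varphi})_{x\in\mathbb{R}}$ be the family of probabilities on $(\Omega,\mathcal{F}_\infty)$ determined by $Q_x^{\lambda,\varphi}(\Gamma_u)=\frac{1}{1-\Phi(x)}E_x[1_{\Gamma_u}M_u^{\lambda,\varphi}]$ for $u\ge0$, $\Gamma_u\in\mathcal{F}_u$. Then, under $Q_x^{\lambda,\varphi}$, the process $$\Big(X_t-x+\lambda\int_0^t\frac{\varphi(S_u)\cosh(\lambda(S_u-X_u))+\lambda(1-\Phi(S_u))\sinh(\lambda(S_u-X_u))}{\lambda(1-\Phi(S_u))\cosh(\lambda(S_u-X_u))+\varphi(S_u)\sinh(\lambda(S_u-X_u))}\,du;\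 t\ge0\Big)$$ is a Brownian motion started at $0$. 3. There is the absolute continuity relationship $$Q_x^{\lambda,\varphi}=\frac{e^{-\lambda x}}{1-\Phi(x)}\Big(\frac{e^{\lambda S_\infty}\psi(S_\infty)}{2\lambda}\Big)P_x^{(-\lambda)}\quad\text{on }\mathcal{F}_\infty.$$
   Context: $\Omega=\mathcal{C}(\mathbb{R}_+,\mathbb{R})$ is the canonical space, $(X_t)_{t\ge0}$ the coordinate process, $\mathcal{F}_t=\sigma(X_s;0\le s\le t)$, $\mathcal{F}_\infty=\sigma(X_s;s\ge0)$; $P_x$ is the law of Brownian motion started at $x$, with expectation $E_x$; $P_x^{(-\lambda)}$ is the law of Brownian motion with drift $-\lambda$ started at $x$. $S_t=\sup_{0\le u\le t}X_u$ and $S_\infty=\sup_{u\ge0}X_u$. The process $(M_t^{\lambda,\varphi})$ is a $P_x$-martingale with $M_0^{\lambda,\varphi}=1-\Phi(x)$. The equality $\varphi=\Phi'$ is understood almost everywhere, $\varphi$ being given everywhere by the explicit formula. *)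

theory Defs
  imports "HOL-Probability.Probability"
begin

section \<open>Canonical space\<close>

text \<open>A path indexed by the half-line is a real function of a real variable, normalised to be
  undefined at negative times, so that two paths agreeing on the half-line are equal.\<close>

definition path_space :: "(real \<Rightarrow> real) set" where
  "path_space = {w \<in> extensional {0..}. continuous_on {0..} w}"

definition coord :: "real \<Rightarrow> (real \<Rightarrow> real) \<Rightarrow> real" where
  "coord t w = w t"

definition coord_algebra :: "real set \<Rightarrow> (real \<Rightarrow> real) measure" where
  "coord_algebra T =
     sigma path_space {coord s -` A \<inter> path_space | s A. s \<in> T \<and> A \<in> sets borel}"

definition filt :: "real \<Rightarrow> (real \<Rightarrow> real) measure" where
  "filt t = coord_algebra {0..t}"

definition filt_inf :: "(real \<Rightarrow> real) measure" where
  "filt_inf = coord_algebra {0..}"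

definition run_sup :: "real \<Rightarrow> (real \<Rightarrow> real) \<Rightarrow> real" where
  "run_sup t w = (SUP u\<in>{0..t}. coord u w)"

text \<open>For a path that is not bounded above this real supremum is a fixed but unspecified number.
  Such paths form a null set for Brownian motion with negative drift, the only law under which
  the definition is used.\<close>

definition total_sup :: "(real \<Rightarrow> real) \<Rightarrow> real" where
  "total_sup w = (SUP u\<in>{0..}. coord u w)"


section \<open>Brownian motion\<close>

definition brownian_motion :: "'a measure \<Rightarrow> (real \<Rightarrow> 'a \<Rightarrow> real) \<Rightarrow> real \<Rightarrow> bool" where
  "brownian_motion M B x \<longleftrightarrow>
     prob_space M \<and>
     (\<forall>t\<ge>0. B t \<in> borel_measurable M) \<and>
     (AE w in M. B 0 w = x) \<and>
     (AE w in M. continuous_on {0..} (\<lambda>t. B t w)) \<and>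
     (\<forall>s t. 0 \<le> s \<and> s < t \<longrightarrow>
        distributed M lborel (\<lambda>w. B t w - B s w) (\<lambda>y. ennreal (normal_density 0 (sqrt (t - s)) y))) \<and>
     (\<forall>n (t :: nat \<Rightarrow> real). 0 \<le> t 0 \<and> (\<forall>i<n. t i < t (Suc i)) \<longrightarrow>
        prob_space.indep_vars M (\<lambda>_. borel) (\<lambda>i w. B (t (Suc i)) w - B (t i) w) {..<n})"

definition brownian_law :: "real \<Rightarrow> (real \<Rightarrow> real) measure \<Rightarrow> bool" where
  "brownian_law x P \<longleftrightarrow> sets P = sets filt_inf \<and> brownian_motion P coord x"

text \<open>The law of \<open>X\<^sub>t + \<mu> t\<close> when \<open>X\<close> has law \<open>P\<close>.\<close>

definition drift_law :: "real \<Rightarrow> (real \<Rightarrow> real) measure \<Rightarrow> (real \<Rightarrow> real) measure" where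
  "drift_law \<mu> P = distr P filt_inf (\<lambda>w. \<lambda>t\<in>{0..}. w t + \<mu> * t)"


section \<open>The functions and processes attached to the weight\<close>

definition Phi :: "real \<Rightarrow> (real \<Rightarrow> real) \<Rightarrow> real \<Rightarrow> real" where
  "Phi l \<psi> y = 1 - exp (l * y) * (LINT z:{y..}|lborel. \<psi> z * exp (- l * z))"

definition phi :: "real \<Rightarrow> (real \<Rightarrow> real) \<Rightarrow> real \<Rightarrow> real" where
  "phi l \<psi> y = \<psi> y - l * exp (l * y) * (LINT z:{y..}|lborel. \<psi> z * exp (- l * z))"

definition Mproc :: "real \<Rightarrow> (real \<Rightarrow> real) \<Rightarrow> real \<Rightarrow> (real \<Rightarrow> real) \<Rightarrow> real" where
  "Mproc l \<psi> t w =
     ((1 - Phi l \<psi> (run_sup t w)) * cosh (l * (run_sup t w - coord t w))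
        + phi l \<psi> (run_sup t w) * (sinh (l * (run_sup t w - coord t w)) / l))
     * exp (- (l\<^sup>2 * t / 2))"

definition drift_term :: "real \<Rightarrow> (real \<Rightarrow> real) \<Rightarrow> real \<Rightarrow> (real \<Rightarrow> real) \<Rightarrow> real" where
  "drift_term l \<psi> u w =
     (phi l \<psi> (run_sup u w) * cosh (l * (run_sup u w - coord u w))
        + l * (1 - Phi l \<psi> (run_sup u w)) * sinh (l * (run_sup u w - coord u w)))
     / (l * (1 - Phi l \<psi> (run_sup u w)) * cosh (l * (run_sup u w - coord u w))
        + phi l \<psi> (run_sup u w) * sinh (l * (run_sup u w - coord u w)))"

definition penalised_family ::
  "real \<Rightarrow> (real \<Rightarrow> real) \<Rightarrow> (real \<Rightarrow> (real \<Rightarrow> real) measure) \<Rightarrow>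
   (real \<Rightarrow> (real \<Rightarrow> real) measure) \<Rightarrow> bool" where
  "penalised_family l \<psi> P Q \<longleftrightarrow>
     (\<forall>x. prob_space (Q x) \<and> sets (Q x) = sets filt_inf \<and>
        (\<forall>u\<ge>0. \<forall>\<Gamma>\<in>sets (filt u).
           measure (Q x) \<Gamma> = 1 / (1 - Phi l \<psi> x) * (LINT w|P x. indicator \<Gamma> w * Mproc l \<psi> u w)))"

end

theory Submission
  imports Defs
begin

text \<open>No stochastic calculus is needed. Let \<open>R\<close> and \<open>R\<^sub>+\<close> be the laws of Brownian motion from \<open>x\<close> with
  drift \<open>-l\<close> and \<open>l\<close>, so that \<open>R\<^sub>+\<close> has density \<open>exp (2 l (X\<^sub>t - x))\<close> on the past of \<open>t\<close> with respect to \<open>R\<close>.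
  This density is close to the constant \<open>exp (2 l (a - x))\<close> on the cell of a fine grid in which \<open>S\<close> crosses
  the level \<open>a\<close>, hence \<open>R(\<Gamma>, S\<^sub>t > a) + exp (2 l (x - a)) R\<^sub>+(\<Gamma>, S\<^sub>t \<le> a)\<close> does not depend on \<open>t\<close>. As
  \<open>t \<rightarrow> \<infinity>\<close> this shows that given the past of \<open>u\<close> the total supremum is, under \<open>R\<close>, the maximum of \<open>S\<^sub>u\<close>
  and \<open>X\<^sub>u\<close> plus an exponential variable of rate \<open>2 l\<close>.

  With \<open>h z = \<psi> z exp (l z)\<close>, the law \<open>Q\<close> with density proportional to \<open>h S\<^sub>\<infinity>\<close> with respect to \<open>R\<close> therefore has
  a density on the past of \<open>u\<close> that is a multiple of the martingale \<open>M\<^sub>u\<close> after changing back to \<open>P\<close>. The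
  numerator of the limit is, up to a factor that cancels, the integral of \<open>h S\<^sub>t\<close> over \<open>\<Gamma>\<close> under \<open>R\<close>; it
  differs from the integral of \<open>h S\<^sub>\<infinity>\<close> by a boundary term, small by the reflection principle, and a tail term, small
  because \<open>X\<close> tends to infinity under \<open>R\<^sub>+\<close>.

  The crossing argument applied to \<open>exp (i \<theta> X\<^sub>t + \<theta>\<^sup>2 t / 2)\<close> identifies the drift of this process under
  \<open>Q\<close>. Multiplying along a grid by the exponential of the integrated drift removes it, and the resulting
  conditional characteristic functions are those of Brownian motion.\<close>

section \<open>Measurability of the path processes\<close>

text \<open>The weight \<psi> is only Borel, so \<open>Mproc\<close> has no regularity in the
  supremum that a change of variables could use. Every identity is linear in \<psi>; it is therefore
  proved for the indicator of a half-line \<open>{a<..}\<close> and extended by a monotone class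
  argument. For such an indicator the sum in the overview is the probability under \<open>R\<close>
  of \<Gamma> together with the event that \<open>a\<close> is ever exceeded, split by whether this
  has happened by time \<open>t\<close>: from a path still below \<open>a\<close>, the chance of
  passing later is \<open>exp (- 2 * l * (a - coord t w))\<close>, and weighting \<open>R\<close> by
  this factor on the past of \<open>t\<close> gives \<open>hit_weight a\<close> times
  \<open>Rp\<close>. The second obstacle is integrability. The mean of
  \<open>h (run_sup u w)\<close> under \<open>R\<close> is controlled near time 0 only by a multiple
  of \<open>1 / sqrt u\<close>, coming from the law of the running supremum. This is integrable at
  0, which makes the integrated drift finite, and the same bound on the boundary term tends to 0 for
  large times, which serves the limit. No separate treatment of the sign of \<open>phi\<close> is
  needed, since the denominator of the drift is a positive conditional expectation up to a positive
  factor.\<close>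

lemma space_coord_algebra [simp]: "space (coord_algebra T) = path_space"
  unfolding coord_algebra_def by (rule space_measure_of) auto

lemma sets_coord_algebra:
  "sets (coord_algebra T) =
     sigma_sets path_space {coord s -` A \<inter> path_space | s A. s \<in> T \<and> A \<in> sets borel}"
  unfolding coord_algebra_def by (rule sets_measure_of) auto

lemma space_filt [simp]: "space (filt t) = path_space" "space filt_inf = path_space"
  by (simp_all add: filt_def filt_inf_def)

lemma measurable_coord_algebra: "s \<in> T \<Longrightarrow> coord s \<in> borel_measurable (coord_algebra T)"
  by (rule measurableI) (auto simp: sets_coord_algebra intro!: sigma_sets.Basic)

lemma measurable_coord_filt: "0 \<le> s \<Longrightarrow> s \<le> t \<Longrightarrow> coord s \<in> borel_measurable (filt t)"
  by (simp add: filt_def measurable_coord_algebra)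

lemma measurable_coord_filt_inf: "0 \<le> s \<Longrightarrow> coord s \<in> borel_measurable filt_inf"
  by (simp add: filt_inf_def measurable_coord_algebra)

lemma measurable_into_coord_algebra:
  assumes "f \<in> space M \<rightarrow> path_space" "\<And>s. s \<in> T \<Longrightarrow> (\<lambda>w. f w s) \<in> borel_measurable M"
  shows "f \<in> measurable M (coord_algebra T)"
  unfolding coord_algebra_def
proof (rule measurable_measure_of)
  fix y assume "y \<in> {coord s -` A \<inter> path_space |s A. s \<in> T \<and> A \<in> sets borel}"
  then obtain s A where y: "y = coord s -` A \<inter> path_space" "s \<in> T" "A \<in> sets borel" by auto
  have "f -` y \<inter> space M = (\<lambda>w. f w s) -` A \<inter> space M"
    using assms(1) by (auto simp: y coord_def)
  then show "f -` y \<inter> space M \<in> sets M"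
    using measurable_sets[OF assms(2)[OF y(2)] y(3)] by simp
qed (use assms in auto)

lemma sets_coord_algebra_mono: "T \<subseteq> T' \<Longrightarrow> sets (coord_algebra T) \<subseteq> sets (coord_algebra T')"
  unfolding sets_coord_algebra by (rule sigma_sets_mono') auto

lemma sets_filt_mono: "s \<le> t \<Longrightarrow> sets (filt s) \<subseteq> sets (filt t)"
  unfolding filt_def by (rule sets_coord_algebra_mono) auto

lemma sets_filt_inf: "sets (filt s) \<subseteq> sets filt_inf"
  unfolding filt_def filt_inf_def by (rule sets_coord_algebra_mono) auto

lemma measurable_filt_mono: "f \<in> measurable (filt s) N \<Longrightarrow> s \<le> t \<Longrightarrow> f \<in> measurable (filt t) N"
  using sets_filt_mono[of s t] by (auto simp: measurable_def)

lemma measurable_filt_inf: "f \<in> measurable (filt s) N \<Longrightarrow> f \<in> measurable filt_inf N"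
  using sets_filt_inf[of s] by (auto simp: measurable_def)

lemma path_space_continuous: "w \<in> path_space \<Longrightarrow> continuous_on {0..} (\<lambda>t. coord t w)"
  by (auto simp: path_space_def coord_def)

lemma path_space_bdd:
  assumes "w \<in> path_space" shows "bdd_above ((\<lambda>u. coord u w) ` {0..t})"
proof -
  have "compact ((\<lambda>u. coord u w) ` {0..t})"
    by (intro compact_continuous_image continuous_on_subset[OF path_space_continuous[OF assms]]) auto
  then show ?thesis by (simp add: compact_imp_bounded bounded_imp_bdd_above)
qed

lemma coord_le_run_sup:
  "w \<in> path_space \<Longrightarrow> 0 \<le> u \<Longrightarrow> u \<le> t \<Longrightarrow> coord u w \<le> run_sup t w"
  unfolding run_sup_def by (rule cSUP_upper) (auto intro: path_space_bdd)

lemma run_sup_gt_iff: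
  "w \<in> path_space \<Longrightarrow> 0 \<le> t \<Longrightarrow> a < run_sup t w \<longleftrightarrow> (\<exists>u\<in>{0..t}. a < coord u w)"
  unfolding run_sup_def by (rule less_cSUP_iff) (auto intro: path_space_bdd)

lemma run_sup_mono:
  "w \<in> path_space \<Longrightarrow> 0 \<le> s \<Longrightarrow> s \<le> t \<Longrightarrow> run_sup s w \<le> run_sup t w"
  unfolding run_sup_def by (rule cSUP_subset_mono) (auto intro: path_space_bdd)

lemma run_sup_0: "run_sup 0 w = coord 0 w"
  by (simp add: run_sup_def)

text \<open>Writing the times as fractions of \<open>t\<close> keeps the countable index set
  independent of \<open>t\<close>, so the formula survives when \<open>t\<close> itself becomes a
  measurable function.\<close>

lemma run_sup_rational:
  assumes w: "w \<in> path_space" and t: "0 \<le> t"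
  shows "run_sup t w = (SUP q\<in>\<rat> \<inter> {0..1}. coord (q * t) w)"
proof (rule antisym)
  have bdd: "bdd_above ((\<lambda>q. coord (q * t) w) ` (\<rat> \<inter> {0..1}))"
  proof (rule bdd_aboveI2)
    fix q :: real assume "q \<in> \<rat> \<inter> {0..1}"
    then show "coord (q * t) w \<le> run_sup t w"
      using t by (intro coord_le_run_sup w) (auto simp: mult_left_le_one_le)
  qed
  have ne: "(\<rat> \<inter> {0..1} :: real set) \<noteq> {}" by (auto intro!: exI[of _ 0])
  show "(SUP q\<in>\<rat> \<inter> {0..1}. coord (q * t) w) \<le> run_sup t w"
    using t by (intro cSUP_least ne coord_le_run_sup w) (auto simp: mult_left_le_one_le)
  have cont: "continuous_on {0..1} (\<lambda>q. coord (q * t) w)"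
    by (rule continuous_on_compose2[OF path_space_continuous[OF w]]) (use t in \<open>auto intro!: continuous_intros\<close>)
  have cl: "{0..1} \<subseteq> closure (\<rat> \<inter> {0..1::real})"
  proof
    fix x :: real assume x: "x \<in> {0..1}"
    show "x \<in> closure (\<rat> \<inter> {0..1})"
      unfolding closure_approachable
    proof (intro allI impI)
      fix e :: real assume e: "0 < e"
      have "max 0 (x - e) < min 1 (x + e)" using x e by auto
      from Rats_dense_in_real[OF this] obtain r where "r \<in> \<rat>" "max 0 (x - e) < r" "r < min 1 (x + e)"
        by auto
      then show "\<exists>y\<in>\<rat> \<inter> {0..1}. dist y x < e" by (intro bexI[of _ r]) (auto simp: dist_real_def)
    qed
  qed
  moreover have "closure (\<rat> \<inter> {0..1::real}) \<subseteq> {0..1}" by (rule closure_minimal) auto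
  ultimately have cl': "closure (\<rat> \<inter> {0..1::real}) = {0..1}" by auto
  have le_SUP: "coord (q * t) w \<le> (SUP q\<in>\<rat> \<inter> {0..1}. coord (q * t) w)" if "q \<in> {0..1}" for q
  proof (rule continuous_le_on_closure[of "\<rat> \<inter> {0..1::real}" "\<lambda>q. coord (q * t) w"])
    show "coord (x * t) w \<le> (SUP q\<in>\<rat> \<inter> {0..1}. coord (q * t) w)" if "x \<in> \<rat> \<inter> {0..1}" for x
      by (rule cSUP_upper[OF that bdd])
  qed (use cont cl' that in simp_all)
  have *: "coord u w \<le> (SUP q\<in>\<rat> \<inter> {0..1}. coord (q * t) w)" if "u \<in> {0..t}" for u
  proof (cases "t = 0")
    case False
    with t have "0 < t" by simp
    then have "u / t \<in> {0..1}" "u / t * t = u" using that by auto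
    then show ?thesis using le_SUP[of "u / t"] by simp
  qed (use that le_SUP[of 0] in auto)
  show "run_sup t w \<le> (SUP q\<in>\<rat> \<inter> {0..1}. coord (q * t) w)"
    unfolding run_sup_def by (rule cSUP_least) (use t * in auto)
qed

text \<open>Freezing the time outside \<open>[0, T]\<close> makes the processes jointly measurable with respect to
  \<open>filt T\<close> and a time variable ranging over the whole line.\<close>

definition clamp_time :: "real \<Rightarrow> real \<Rightarrow> real" where
  "clamp_time T u = max 0 (min T u)"

lemma clamp_time_eq [simp]: "0 \<le> u \<Longrightarrow> u \<le> T \<Longrightarrow> clamp_time T u = u"
  by (simp add: clamp_time_def)

lemma clamp_time_bounds: "0 \<le> T \<Longrightarrow> 0 \<le> clamp_time T u \<and> clamp_time T u \<le> T"
  by (auto simp: clamp_time_def)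

lemma measurable_clamp_time [measurable]: "clamp_time T \<in> borel_measurable borel"
  unfolding clamp_time_def by measurable

text \<open>By path continuity the evaluation at a varying time is the limit of evaluations at that
  time rounded down to a multiple of \<open>1 / real (Suc n)\<close>, and the rounded time takes
  only countably many values.\<close>

lemma measurable_coord_joint:
  assumes T: "0 \<le> T" and g: "g \<in> borel_measurable M" and p: "p \<in> measurable M (filt T)"
  shows "(\<lambda>z. coord (clamp_time T (g z)) (p z)) \<in> borel_measurable M"
proof -
  have g'[measurable]: "(\<lambda>z. clamp_time T (g z)) \<in> borel_measurable M"
    using g by measurable
  define d where "d n z = clamp_time T (real_of_int \<lfloor>clamp_time T (g z) * real (Suc n)\<rfloor> / real (Suc n))"
    for n :: nat and z
  have "(\<lambda>z. coord (d n z) (p z)) \<in> borel_measurable M" for n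
    unfolding d_def
  proof (rule measurable_compose_countable[where f="\<lambda>i z. coord (clamp_time T (real_of_int i / real (Suc n))) (p z)"])
    show "(\<lambda>z. coord (clamp_time T (real_of_int i / real (Suc n))) (p z)) \<in> borel_measurable M" for i
      by (rule measurable_compose[OF p measurable_coord_filt]) (use clamp_time_bounds[OF T] in auto)
  qed measurable
  moreover have "(\<lambda>n. coord (d n z) (p z)) \<longlonglongrightarrow> coord (clamp_time T (g z)) (p z)" if z: "z \<in> space M" for z
  proof -
    let ?x = "clamp_time T (g z)"
    have "p z \<in> path_space" using measurable_space[OF p z] by simp
    note c = path_space_continuous[OF this]
    have "(\<lambda>n. real_of_int \<lfloor>?x * real (Suc n)\<rfloor> / real (Suc n)) \<longlonglongrightarrow> ?x"
    proof (rule tendsto_sandwich)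
      show "\<forall>\<^sub>F n in sequentially. ?x - 1 / real (Suc n) \<le> real_of_int \<lfloor>?x * real (Suc n)\<rfloor> / real (Suc n)"
      proof (rule always_eventually, rule allI)
        fix n :: nat
        have "?x * real (Suc n) - 1 \<le> real_of_int \<lfloor>?x * real (Suc n)\<rfloor>" by linarith
        then show "?x - 1 / real (Suc n) \<le> real_of_int \<lfloor>?x * real (Suc n)\<rfloor> / real (Suc n)"
          by (simp add: le_divide_eq left_diff_distrib)
      qed
      show "\<forall>\<^sub>F n in sequentially. real_of_int \<lfloor>?x * real (Suc n)\<rfloor> / real (Suc n) \<le> ?x"
      proof (rule always_eventually, rule allI)
        fix n :: nat
        have "real_of_int \<lfloor>?x * real (Suc n)\<rfloor> \<le> ?x * real (Suc n)" by linarith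
        then show "real_of_int \<lfloor>?x * real (Suc n)\<rfloor> / real (Suc n) \<le> ?x"
          by (simp add: field_simps)
      qed
      show "(\<lambda>n. ?x - 1 / real (Suc n)) \<longlonglongrightarrow> ?x"
        using tendsto_diff[OF tendsto_const[of ?x] LIMSEQ_inverse_real_of_nat] by (simp add: divide_inverse)
    qed auto
    moreover have "isCont (clamp_time T) ?x" unfolding clamp_time_def by (intro continuous_intros)
    ultimately have "(\<lambda>n. d n z) \<longlonglongrightarrow> clamp_time T ?x"
      unfolding d_def by (rule isCont_tendsto_compose[rotated])
    then have "(\<lambda>n. d n z) \<longlonglongrightarrow> ?x" using clamp_time_bounds[OF T] by simp
    then show ?thesis
      by (rule continuous_on_tendsto_compose[OF c])
         (use clamp_time_bounds[OF T] in \<open>auto simp: d_def\<close>)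
  qed
  ultimately show ?thesis by (rule borel_measurable_LIMSEQ_real[rotated])
qed

lemma measurable_run_sup_joint:
  assumes T: "0 \<le> T" and g: "g \<in> borel_measurable M" and p: "p \<in> measurable M (filt T)"
  shows "(\<lambda>z. run_sup (clamp_time T (g z)) (p z)) \<in> borel_measurable M"
proof -
  have [measurable]: "(\<lambda>z. coord (q * clamp_time T (g z)) (p z)) \<in> borel_measurable M"
    if "q \<in> \<rat> \<inter> {0..1}" for q
  proof -
    have "(\<lambda>z. coord (clamp_time T (q * clamp_time T (g z))) (p z)) \<in> borel_measurable M"
      using g by (intro measurable_coord_joint T p) measurable
    moreover have "clamp_time T (q * clamp_time T (g z)) = q * clamp_time T (g z)" for z
      using that clamp_time_bounds[OF T, of "g z"]
      by (intro clamp_time_eq) (auto intro: order_trans[OF mult_left_le_one_le])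
    ultimately show ?thesis by simp
  qed
  have "(\<lambda>z. SUP q\<in>\<rat> \<inter> {0..1}. coord (q * clamp_time T (g z)) (p z)) \<in> borel_measurable M"
  proof (rule borel_measurable_cSUP)
    show "countable (\<rat> \<inter> {0..1::real})" by (intro countable_Int1 countable_rat)
    fix z assume "z \<in> space M"
    then have "p z \<in> path_space" using measurable_space[OF p] by simp
    from path_space_bdd[OF this, of T]
    show "bdd_above ((\<lambda>q. coord (q * clamp_time T (g z)) (p z)) ` (\<rat> \<inter> {0..1}))"
      by (rule bdd_above_mono)
         (use clamp_time_bounds[OF T, of "g z"] in \<open>auto intro!: imageI intro: order_trans[OF mult_left_le_one_le]\<close>)
  qed measurable
  then show ?thesis
    by (rule measurable_cong[THEN iffD2, rotated])
       (use run_sup_rational clamp_time_bounds[OF T] measurable_space[OF p] in auto)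
qed

lemma measurable_run_sup:
  assumes "0 \<le> s" "s \<le> t" shows "run_sup s \<in> borel_measurable (filt t)"
  using measurable_run_sup_joint[of t "\<lambda>_. s" "filt t" "\<lambda>w. w"] assms by simp

lemma measurable_run_sup_filt_inf: "0 \<le> s \<Longrightarrow> run_sup s \<in> borel_measurable filt_inf"
  by (rule measurable_filt_inf[OF measurable_run_sup[of s s]]) auto

text \<open>Boundedness of the path is not assumed: on an unbounded path both suprema are
  \<open>Least\<close> of the same empty collection of upper bounds, hence the same unspecified
  number. This gives measurability of \<open>total_sup\<close> on the whole path space.\<close>

lemma total_sup_run_sup:
  assumes w: "w \<in> path_space"
  shows "total_sup w = (SUP n. run_sup (real n) w)"
proof -
  have "total_sup w = (SUP u\<in>(\<Union>n. {0..real n}). coord u w)"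
    unfolding total_sup_def by (rule arg_cong[where f="\<lambda>A. SUP u\<in>A. coord u w"]) (auto intro: real_arch_simple)
  show ?thesis
  proof (cases "bdd_above ((\<lambda>u. coord u w) ` {0..})")
    case True
    show ?thesis
    proof (rule antisym)
      have b: "bdd_above (range (\<lambda>n. run_sup (real n) w))"
      proof (rule bdd_aboveI2)
        show "run_sup (real n) w \<le> (SUP u\<in>{0..}. coord u w)" for n
          unfolding run_sup_def by (rule cSUP_subset_mono) (use True in auto)
      qed
      show "total_sup w \<le> (SUP n. run_sup (real n) w)"
        unfolding total_sup_def
      proof (rule cSUP_least)
        fix u :: real assume "u \<in> {0..}"
        moreover obtain n where "u \<le> real n" using real_arch_simple by blast
        ultimately have "coord u w \<le> run_sup (real n) w" by (intro coord_le_run_sup w) auto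
        also have "\<dots> \<le> (SUP n. run_sup (real n) w)" by (rule cSUP_upper[OF UNIV_I b])
        finally show "coord u w \<le> (SUP n. run_sup (real n) w)" .
      qed simp
      show "(SUP n. run_sup (real n) w) \<le> total_sup w"
        unfolding total_sup_def
        by (rule cSUP_least) (auto simp: run_sup_def intro!: cSUP_subset_mono True)
    qed
  next
    case False
    have nb: "\<not> (\<forall>u\<in>{0..}. coord u w \<le> y)" for y using False by (auto simp: bdd_above_def)
    have nb': "\<not> (\<forall>n. run_sup (real n) w \<le> y)" for y
    proof
      assume *: "\<forall>n. run_sup (real n) w \<le> y"
      have "coord u w \<le> y" if "u \<in> {0..}" for u
      proof -
        obtain n where "u \<le> real n" using real_arch_simple by blast
        then have "coord u w \<le> run_sup (real n) w" using that by (intro coord_le_run_sup w) auto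
        with * show ?thesis by (meson order_trans)
      qed
      with nb show False by auto
    qed
    show ?thesis
      unfolding total_sup_def Sup_real_def
      by (rule arg_cong[where f=Least], rule ext) (use nb nb' in auto)
  qed
qed

lemma measurable_total_sup: "total_sup \<in> borel_measurable filt_inf"
proof -
  have [measurable]: "run_sup (real n) \<in> borel_measurable filt_inf" for n
    by (rule measurable_run_sup_filt_inf) simp
  have "(\<lambda>w. SUP n. run_sup (real n) w) \<in> borel_measurable filt_inf"
  proof -
    \<comment> \<open>The values over \<open>n\<close> may be unbounded above, so the supremum is
      rewritten as minus an infimum, whose measurability rule asks for no bound.\<close>
    have "(\<lambda>w. - (INF n. - run_sup (real n) w)) \<in> borel_measurable filt_inf"
      by (intro borel_measurable_uminus borel_measurable_cINF_real) simp_all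
    then show ?thesis by (simp add: Inf_real_def image_image)
  qed
  then show ?thesis
    by (rule measurable_cong[THEN iffD2, rotated]) (simp add: total_sup_run_sup)
qed

section \<open>Processes with independent Gaussian increments\<close>

definition gauss_law :: "real \<Rightarrow> real \<Rightarrow> real measure" where
  "gauss_law m v = density lborel (\<lambda>y. ennreal (normal_density m (sqrt v) y))"

lemma sets_gauss_law [simp, measurable_cong]: "sets (gauss_law m v) = sets borel"
  and space_gauss_law [simp]: "space (gauss_law m v) = UNIV"
  by (simp_all add: gauss_law_def)

lemma prob_space_gauss_law: "0 < v \<Longrightarrow> prob_space (gauss_law m v)"
  unfolding gauss_law_def by (rule prob_space_normal_density) simp

lemma distr_gauss_law_affine:
  assumes "0 < v" "a \<noteq> 0"
  shows "distr (gauss_law m v) borel (\<lambda>z. b + a * z) = gauss_law (b + a * m) (a\<^sup>2 * v)"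
proof -
  interpret prob_space "gauss_law m v" by (rule prob_space_gauss_law) fact
  have "distributed (gauss_law m v) lborel (\<lambda>x. x) (normal_density m (sqrt v))"
    unfolding distributed_def by (simp add: gauss_law_def distr_id2)
  from normal_density_affine[OF this, of a b] assms
  have "distributed (gauss_law m v) lborel (\<lambda>x. b + a * x) (normal_density (b + a * m) (\<bar>a\<bar> * sqrt v))"
    by simp
  then have "distr (gauss_law m v) lborel (\<lambda>x. b + a * x) = gauss_law (b + a * m) (a\<^sup>2 * v)"
    unfolding distributed_def gauss_law_def by (simp add: real_sqrt_mult)
  then show ?thesis by (simp cong: distr_cong)
qed

lemma emeasure_gauss_law_shift:
  assumes "0 < v" and A: "A \<in> sets borel"
  shows "emeasure (gauss_law m v) ((\<lambda>z. b + z) -` A) = emeasure (gauss_law (b + m) v) A"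
proof -
  have "gauss_law (b + m) v = distr (gauss_law m v) borel (\<lambda>z. b + z)"
    using distr_gauss_law_affine[of v 1 m b] assms by simp
  then show ?thesis using A by (simp add: emeasure_distr)
qed

lemma char_gauss_law:
  assumes v: "0 < v"
  shows "char (gauss_law m v) t = exp (\<i> * of_real (m * t) - of_real (v * t\<^sup>2 / 2))"
proof -
  have std: "gauss_law 0 1 = std_normal_distribution" by (simp add: gauss_law_def)
  have "gauss_law m v = distr std_normal_distribution borel (\<lambda>z. m + sqrt v * z)"
    using distr_gauss_law_affine[of 1 "sqrt v" 0 m] v by (simp add: std)
  then have "char (gauss_law m v) t = (CLINT z|std_normal_distribution. iexp (t * (m + sqrt v * z)))"
    by (simp add: char_def integral_distr)
  also have "\<dots> = (CLINT z|std_normal_distribution. iexp (t * m) * iexp (t * sqrt v * z))"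
    by (simp add: exp_add[symmetric] algebra_simps)
  also have "\<dots> = iexp (t * m) * char std_normal_distribution (t * sqrt v)"
    by (simp add: char_def)
  also have "\<dots> = exp (\<i> * of_real (m * t) - of_real (v * t\<^sup>2 / 2))"
  proof -
    have "char std_normal_distribution (t * sqrt v) = exp (of_real (- (v * t\<^sup>2 / 2)))"
      unfolding char_std_normal_distribution using v by (simp add: power_mult_distrib mult.commute flip: exp_of_real)
    moreover have "\<i> * of_real (m * t) - of_real (v * t\<^sup>2 / 2)
        = \<i> * complex_of_real (t * m) + of_real (- (v * t\<^sup>2 / 2))"
      by (simp add: mult.commute)
    ultimately show ?thesis by (simp only: exp_add)
  qed
  finally show ?thesis .
qed

section \<open>Cylinder sets as an intersection-stable generator\<close>

definition cylinders :: "real set \<Rightarrow> (real \<Rightarrow> real) set set" where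
  "cylinders T = {{w\<in>path_space. \<forall>r\<in>J. coord r w \<in> A r} | J A.
     finite J \<and> J \<subseteq> T \<and> (\<forall>r\<in>J. A r \<in> sets borel)}"

lemma cylinders_sets: "cylinders T \<subseteq> sets (coord_algebra T)"
proof
  fix C assume "C \<in> cylinders T"
  then obtain J A where C: "C = {w\<in>path_space. \<forall>r\<in>J. coord r w \<in> A r}" "finite J" "J \<subseteq> T"
    "\<And>r. r \<in> J \<Longrightarrow> A r \<in> sets borel" by (auto simp: cylinders_def)
  have "{w\<in>space (coord_algebra T). \<forall>r\<in>J. coord r w \<in> A r} \<in> sets (coord_algebra T)"
  proof (rule sets.sets_Collect_finite_All[OF _ C(2)])
    fix r assume "r \<in> J"
    then have "coord r -` A r \<inter> space (coord_algebra T) \<in> sets (coord_algebra T)"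
      using C by (intro measurable_sets[OF measurable_coord_algebra]) auto
    then show "{w\<in>space (coord_algebra T). coord r w \<in> A r} \<in> sets (coord_algebra T)"
      by (simp add: vimage_def Int_def conj_commute)
  qed
  then show "C \<in> sets (coord_algebra T)" by (simp add: C(1))
qed

lemma sigma_sets_cylinders: "sigma_sets path_space (cylinders T) = sets (coord_algebra T)"
proof (rule antisym)
  show "sigma_sets path_space (cylinders T) \<subseteq> sets (coord_algebra T)"
    using sets.sigma_sets_subset[OF cylinders_sets, of T] by simp
  show "sets (coord_algebra T) \<subseteq> sigma_sets path_space (cylinders T)"
    unfolding sets_coord_algebra
  proof (rule sigma_sets_mono')
    show "{coord s -` A \<inter> path_space |s A. s \<in> T \<and> A \<in> sets borel} \<subseteq> cylinders T"
    proof safe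
      fix s A assume "s \<in> T" "A \<in> sets (borel :: real measure)"
      then show "coord s -` A \<inter> path_space \<in> cylinders T"
        unfolding cylinders_def by (auto intro!: exI[of _ "{s}"] exI[of _ "\<lambda>_. A"])
    qed
  qed
qed

lemma Int_stable_cylinders: "Int_stable (cylinders T)"
proof (rule Int_stableI)
  fix C D assume "C \<in> cylinders T" "D \<in> cylinders T"
  then obtain J A K B where
    C: "C = {w\<in>path_space. \<forall>r\<in>J. coord r w \<in> A r}" "finite J" "J \<subseteq> T" "\<forall>r\<in>J. A r \<in> sets borel" and
    D: "D = {w\<in>path_space. \<forall>r\<in>K. coord r w \<in> B r}" "finite K" "K \<subseteq> T" "\<forall>r\<in>K. B r \<in> sets borel"
    unfolding cylinders_def by blast
  have "C \<inter> D = {w\<in>path_space. \<forall>r\<in>J \<union> K. coord r w \<in>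
      (if r \<in> J then A r else UNIV) \<inter> (if r \<in> K then B r else UNIV)}"
    by (auto simp: C D split: if_splits)
  moreover have "\<forall>r\<in>J \<union> K. (if r \<in> J then A r else UNIV) \<inter> (if r \<in> K then B r else UNIV) \<in> sets borel"
    using C D by auto
  ultimately show "C \<inter> D \<in> cylinders T"
    using C(2,3) D(2,3) unfolding cylinders_def
    by (intro CollectI exI[of _ "J \<union> K"] exI[of _ "\<lambda>r. (if r \<in> J then A r else UNIV) \<inter> (if r \<in> K then B r else UNIV)"])
       simp_all
qed

lemma cylinders_Pow: "cylinders T \<subseteq> Pow path_space"
  by (auto simp: cylinders_def)

text \<open>The horizon \<open>T\<close> is there for measures with a density in \<open>filt T\<close>, which acquire the drift
  only up to time \<open>T\<close>.\<close>

definition gauss_increments :: "real \<Rightarrow> real \<Rightarrow> real \<Rightarrow> (real \<Rightarrow> real) measure \<Rightarrow> bool" where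
  "gauss_increments T \<mu> x R \<longleftrightarrow>
     prob_space R \<and> sets R = sets filt_inf \<and> (AE w in R. coord 0 w = x) \<and>
     (\<forall>s t. 0 \<le> s \<and> s < t \<and> t \<le> T \<longrightarrow> (\<forall>\<Gamma>\<in>sets (filt s). \<forall>A\<in>sets borel.
        emeasure R (\<Gamma> \<inter> {w\<in>path_space. coord t w - coord s w \<in> A})
          = emeasure R \<Gamma> * emeasure (gauss_law (\<mu> * (t - s)) (t - s)) A))"

text \<open>The definition of Brownian motion speaks only of finitely many consecutive increments.
  Up to a null set a cylinder over times in \<open>{0..s}\<close> is an event about the increments
  before \<open>s\<close>, since the starting point is almost surely \<open>x\<close>; independence
  of the next increment from cylinders then extends to all of \<open>filt s\<close>, because
  cylinders are stable under intersection.\<close>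

lemma brownian_law_gauss_increments:
  assumes P: "brownian_law x P"
  shows "gauss_increments T 0 x P"
proof -
  have sets_P: "sets P = sets filt_inf" and B: "brownian_motion P coord x"
    using P by (auto simp: brownian_law_def)
  interpret prob_space P using B by (simp add: brownian_motion_def)
  have space_P: "space P = path_space"
    using sets_eq_imp_space_eq[OF sets_P] by simp
  have X: "coord r \<in> borel_measurable P" if "0 \<le> r" for r
    using B that by (simp add: brownian_motion_def)
  have X0: "AE w in P. coord 0 w = x" using B by (simp add: brownian_motion_def)
  have filt_P: "sets (filt s) \<subseteq> events" for s using sets_filt_inf sets_P by auto
  have *: "emeasure P (\<Gamma> \<inter> {w\<in>path_space. coord t w - coord s w \<in> A})
          = emeasure P \<Gamma> * emeasure (gauss_law 0 (t - s)) A"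
    if st: "0 \<le> s" "s < t" and \<Gamma>: "\<Gamma> \<in> sets (filt s)" and A: "A \<in> sets borel" for s t \<Gamma> A
  proof -
    let ?D = "\<lambda>w. coord t w - coord s w"
    have D[measurable]: "?D \<in> borel_measurable P"
      using X[of t] X[of s] st by (intro borel_measurable_diff) auto
    let ?E = "{?D -` A \<inter> space P | A. A \<in> sets borel}"
    have "indep_set (cylinders {0..s}) ?E"
    proof (rule indep_setI)
      show "cylinders {0..s} \<subseteq> events"
        using cylinders_sets[of "{0..s}"] filt_P[of s] by (auto simp: filt_def)
      show "?E \<subseteq> events" by auto
      fix C E assume "C \<in> cylinders {0..s}" "E \<in> ?E"
      then obtain J A B where C: "C = {w\<in>path_space. \<forall>r\<in>J. coord r w \<in> A r}" "finite J" "J \<subseteq> {0..s}"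
          "\<And>r. r \<in> J \<Longrightarrow> A r \<in> sets borel" and E: "E = ?D -` B \<inter> space P" "B \<in> sets borel"
        unfolding cylinders_def by blast
      have C_ev: "C \<in> events" using \<open>C \<in> cylinders {0..s}\<close> \<open>cylinders {0..s} \<subseteq> events\<close> by auto
      \<comment> \<open>Adding 0 and \<open>s\<close> to the times of the cylinder makes the list
        start where the value is known and end where the increment \<open>?D\<close> begins.\<close>
      define xs where "xs = sorted_list_of_set (insert 0 (insert s J))"
      define n where "n = length xs"
      have fin: "finite (insert 0 (insert s J))" using C by simp
      have set_xs: "set xs = insert 0 (insert s J)" unfolding xs_def using fin by (rule set_sorted_list_of_set)
      have xs_mono: "xs ! i < xs ! j" if "i < j" "j < n" for i j
        using sorted_wrt_nth_less[OF strict_sorted_list_of_set[of "insert 0 (insert s J)"] that(1)] that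
        by (simp add: xs_def n_def)
      have n0: "0 < n" unfolding n_def using set_xs by (cases xs) auto
      have xs_in: "xs ! i \<in> {0..s}" if "i < n" for i
      proof -
        have "xs ! i \<in> set xs" using that by (simp add: n_def)
        then show ?thesis using set_xs C(3) st by auto
      qed
      have xs0: "xs ! 0 = 0"
      proof -
        have "0 \<in> set xs" using set_xs by simp
        then obtain i where i: "i < n" "xs ! i = 0" by (auto simp: in_set_conv_nth n_def)
        show ?thesis
        proof (cases "i = 0")
          case False
          with xs_mono[of 0 i] i xs_in[OF n0] show ?thesis by auto
        qed (use i in simp)
      qed
      have xsl: "xs ! (n - 1) = s"
      proof -
        have "s \<in> set xs" using set_xs by simp
        then obtain i where i: "i < n" "xs ! i = s" by (auto simp: in_set_conv_nth n_def)
        show ?thesis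
        proof (cases "i = n - 1")
          case False
          with i n0 have "i < n - 1" "n - 1 < n" by linarith+
          with xs_mono[of i "n - 1"] i xs_in[of "n - 1"] show ?thesis by auto
        qed (use i in simp)
      qed
      \<comment> \<open>The times form an infinite sequence, so after \<open>s\<close> it continues
        with \<open>t\<close>, \<open>t + 1\<close> and so on; the increment with index
        \<open>n - 1\<close> is then exactly the one from \<open>s\<close> to
        \<open>t\<close>.\<close>
      define \<tau> where "\<tau> i = (if i < n then xs ! i else t + real (i - n))" for i
      have \<tau>_mono: "\<tau> i < \<tau> (Suc i)" for i
      proof -
        consider "Suc i < n" | "Suc i = n" | "n \<le> i" by linarith
        then show ?thesis
        proof cases
          case 2
          then have "i = n - 1" by simp
          then show ?thesis using 2 xsl st by (simp add: \<tau>_def)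
        qed (auto simp: \<tau>_def xs_mono Suc_diff_le)
      qed
      have \<tau>0: "\<tau> 0 = 0" using n0 xs0 by (simp add: \<tau>_def)
      define V where "V i w = coord (\<tau> (Suc i)) w - coord (\<tau> i) w" for i w
      have "indep_vars (\<lambda>_. borel) (\<lambda>i w. coord (\<tau> (Suc i)) w - coord (\<tau> i) w) {..<n}"
        using B \<tau>0 \<tau>_mono unfolding brownian_motion_def by simp
      then have ind: "indep_vars (\<lambda>_. borel) V {..<n}" by (simp add: V_def[abs_def])
      have Vl: "V (n - 1) = ?D"
        using n0 xsl by (auto simp: V_def fun_eq_iff \<tau>_def)
      have tele: "coord (xs ! i) w = coord 0 w + (\<Sum>j<i. V j w)" if "i < n" for i w
      proof -
        have "(\<Sum>j<i. V j w) = coord (\<tau> i) w - coord (\<tau> 0) w"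
          unfolding V_def by (induction i) auto
        then show ?thesis using that by (simp add: \<tau>0) (simp add: \<tau>_def)
      qed
      let ?R = "\<lambda>w. restrict (\<lambda>i. V i w) {..<n-1}" and ?S = "\<lambda>w. restrict (\<lambda>i. V i w) {n-1}"
      have iv: "indep_var (PiM {..<n-1} (\<lambda>_. borel)) ?R (PiM {n-1} (\<lambda>_. borel)) ?S"
        by (rule indep_var_restrict[OF ind]) (use n0 in auto)
      \<comment> \<open>The cylinder expressed through increments, with \<open>x\<close> in place of
        \<open>coord 0 w\<close>; for this reason it is recovered only almost surely in
        \<open>eqC\<close>.\<close>
      define Q where "Q = {f\<in>space (PiM {..<n-1} (\<lambda>_. borel)). \<forall>i\<in>{i. i < n \<and> xs ! i \<in> J}. x + (\<Sum>j<i. f j) \<in> A (xs ! i)}"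
      have Q: "Q \<in> sets (PiM {..<n-1} (\<lambda>_. borel :: real measure))"
        unfolding Q_def
      proof (rule sets.sets_Collect_finite_All)
        fix i assume i: "i \<in> {i. i < n \<and> xs ! i \<in> J}"
        have "(\<lambda>f. x + (\<Sum>j<i. f j)) \<in> borel_measurable (PiM {..<n-1} (\<lambda>_. borel))"
          by (intro borel_measurable_add borel_measurable_sum measurable_component_singleton borel_measurable_const)
             (use i in auto)
        from measurable_sets[OF this C(4)[of "xs ! i"]] i
        show "{f\<in>space (PiM {..<n-1} (\<lambda>_. borel)). x + (\<Sum>j<i. f j) \<in> A (xs ! i)} \<in> sets (PiM {..<n-1} (\<lambda>_. borel))"
          by (simp add: vimage_def Int_def conj_commute)
      qed auto
      let ?F = "{f\<in>space (PiM {n-1} (\<lambda>_. borel)). f (n - 1) \<in> B}"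
      have F: "?F \<in> sets (PiM {n-1} (\<lambda>_. borel :: real measure))"
      proof -
        have "(\<lambda>f. f (n - 1)) \<in> borel_measurable (PiM {n-1} (\<lambda>_. borel :: real measure))"
          by (rule measurable_component_singleton) simp
        from measurable_sets[OF this E(2)] show ?thesis
          by (simp add: vimage_def Int_def conj_commute)
      qed
      have eqF: "?S -` ?F \<inter> space P = E"
        by (auto simp: E Vl[simplified] space_PiM)
      have eqC: "AE w in P. w \<in> ?R -` Q \<inter> space P \<longleftrightarrow> w \<in> C"
        using X0
      proof (rule AE_mp, intro AE_I2 impI)
        fix w assume w: "w \<in> space P" and x: "coord 0 w = x"
        have "w \<in> ?R -` Q \<inter> space P \<longleftrightarrow> (\<forall>i\<in>{i. i < n \<and> xs ! i \<in> J}. x + (\<Sum>j<i. V j w) \<in> A (xs ! i))"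
        proof -
          have "(\<Sum>j<i. ?R w j) = (\<Sum>j<i. V j w)" if "i < n" for i
            by (rule sum.cong) (use that in auto)
          then show ?thesis using w by (auto simp: Q_def space_PiM)
        qed
        also have "\<dots> \<longleftrightarrow> (\<forall>i\<in>{i. i < n \<and> xs ! i \<in> J}. coord (xs ! i) w \<in> A (xs ! i))"
          by (auto simp: tele x)
        also have "\<dots> \<longleftrightarrow> (\<forall>r\<in>J. coord r w \<in> A r)"
        proof safe
          fix r assume *: "\<forall>i\<in>{i. i < n \<and> xs ! i \<in> J}. coord (xs ! i) w \<in> A (xs ! i)" "r \<in> J"
          then have "r \<in> set xs" using set_xs by simp
          then obtain i where "i < n" "xs ! i = r" by (auto simp: in_set_conv_nth n_def)
          with * show "coord r w \<in> A r" by auto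
        qed auto
        finally show "w \<in> ?R -` Q \<inter> space P \<longleftrightarrow> w \<in> C" using w by (simp add: C space_P)
      qed
      have R_ev: "?R -` Q \<inter> space P \<in> events"
        by (rule measurable_sets[OF indep_var_rv1[OF iv] Q])
      have E_ev: "E \<in> events" using E by simp
      have "prob (C \<inter> E) = prob ((?R -` Q \<inter> space P) \<inter> (?S -` ?F \<inter> space P))"
        unfolding eqF
        by (rule finite_measure_eq_AE) (use eqC R_ev E_ev C_ev in auto)
      also have "\<dots> = prob ((\<lambda>w. (?R w, ?S w)) -` (Q \<times> ?F) \<inter> space P)"
        by (rule arg_cong[where f=prob]) auto
      also have "\<dots> = prob (?R -` Q \<inter> space P) * prob (?S -` ?F \<inter> space P)"
        by (rule indep_varD[OF iv Q F])
      also have "\<dots> = prob C * prob E"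
        unfolding eqF using finite_measure_eq_AE[OF eqC R_ev C_ev] by simp
      finally show "prob (C \<inter> E) = prob C * prob E" .
    qed
    then have "indep_set (sigma_sets (space P) (cylinders {0..s})) (sigma_sets (space P) ?E)"
    proof (rule indep_set_sigma_sets[OF _ Int_stable_cylinders])
      show "Int_stable ?E"
      proof (rule Int_stableI)
        fix a b assume "a \<in> ?E" "b \<in> ?E"
        then obtain A B where "a = ?D -` A \<inter> space P" "b = ?D -` B \<inter> space P" "A \<in> sets borel" "B \<in> sets borel"
          by auto
        then show "a \<inter> b \<in> ?E" by (auto intro!: exI[of _ "A \<inter> B"])
      qed
    qed
    moreover have "\<Gamma> \<in> sigma_sets (space P) (cylinders {0..s})"
      using \<Gamma> by (simp add: space_P sigma_sets_cylinders filt_def)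
    moreover have "?D -` A \<inter> space P \<in> sigma_sets (space P) ?E"
      using A by (intro sigma_sets.Basic) auto
    ultimately have "prob (\<Gamma> \<inter> (?D -` A \<inter> space P)) = prob \<Gamma> * prob (?D -` A \<inter> space P)"
      by (rule indep_setD)
    moreover have "emeasure P (?D -` A \<inter> space P) = emeasure (gauss_law 0 (t - s)) A"
    proof -
      have "distributed P lborel ?D (\<lambda>y. ennreal (normal_density 0 (sqrt (t - s)) y))"
        using B st by (simp add: brownian_motion_def)
      then have "distr P lborel ?D = gauss_law 0 (t - s)"
        by (simp add: distributed_def gauss_law_def)
      moreover have "emeasure (distr P lborel ?D) A = emeasure P (?D -` A \<inter> space P)"
        using A by (intro emeasure_distr) auto
      ultimately show ?thesis by simp
    qed
    ultimately show ?thesis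
      by (simp add: emeasure_eq_measure space_P vimage_def Int_def conj_commute ennreal_mult'')
  qed
  show ?thesis
    unfolding gauss_increments_def using prob_space_axioms sets_P X0 * by auto
qed

section \<open>Adding a deterministic drift\<close>

lemma measurable_shift:
  assumes "T \<subseteq> {0..}"
  shows "(\<lambda>w. \<lambda>t\<in>{0..}. w t + \<mu> * t) \<in> measurable (coord_algebra T) (coord_algebra T)"
proof (rule measurable_into_coord_algebra)
  show "(\<lambda>w. \<lambda>t\<in>{0..}. w t + \<mu> * t) \<in> space (coord_algebra T) \<rightarrow> path_space"
  proof
    fix w assume "w \<in> space (coord_algebra T)"
    then have "continuous_on {0..} (\<lambda>t. w t + \<mu> * t)"
      by (auto simp: path_space_def intro!: continuous_intros)
    then have "continuous_on {0..} (\<lambda>t\<in>{0..}. w t + \<mu> * t)"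
      by (rule continuous_on_cong[THEN iffD1, rotated 2]) auto
    then show "(\<lambda>t\<in>{0..}. w t + \<mu> * t) \<in> path_space" by (auto simp: path_space_def)
  qed
  fix s assume s: "s \<in> T"
  from measurable_coord_algebra[OF s]
  have "(\<lambda>w. w s + \<mu> * s) \<in> borel_measurable (coord_algebra T)"
    by (auto simp: coord_def[abs_def])
  then show "(\<lambda>w. (\<lambda>t\<in>{0..}. w t + \<mu> * t) s) \<in> borel_measurable (coord_algebra T)"
    using s assms by auto
qed

text \<open>The shift is deterministic: it pulls events of \<open>filt s\<close> back to events of
  \<open>filt s\<close> and translates the increment by the constant
  \<open>\<mu> * (t - s)\<close>.\<close>

lemma drift_law_gauss_increments:
  assumes P: "gauss_increments T 0 x P"
  shows "gauss_increments T \<mu> x (drift_law \<mu> P)"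
proof -
  let ?\<tau> = "\<lambda>w. \<lambda>t\<in>{0..}. w t + \<mu> * t"
  have pr: "prob_space P" and sets_P[measurable_cong]: "sets P = sets filt_inf" and X0: "AE w in P. coord 0 w = x"
    using P by (auto simp: gauss_increments_def)
  have space_P: "space P = path_space" using sets_eq_imp_space_eq[OF sets_P] by simp
  have \<tau>[measurable]: "?\<tau> \<in> measurable P filt_inf"
    using measurable_shift[of "{0..}" \<mu>] by (simp add: filt_inf_def cong: measurable_cong_sets[OF sets_P refl])
       (simp add: measurable_cong_sets[OF sets_P refl] filt_inf_def)
  have "emeasure (drift_law \<mu> P) (\<Gamma> \<inter> {w\<in>path_space. coord t w - coord s w \<in> A})
          = emeasure (drift_law \<mu> P) \<Gamma> * emeasure (gauss_law (\<mu> * (t - s)) (t - s)) A"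
    if st: "0 \<le> s" "s < t" "t \<le> T" and \<Gamma>: "\<Gamma> \<in> sets (filt s)" and A: "A \<in> sets borel" for s t \<Gamma> A
  proof -
    have [measurable]: "coord s \<in> borel_measurable filt_inf" "coord t \<in> borel_measurable filt_inf"
      using st by (auto intro: measurable_coord_filt_inf)
    have D: "{w\<in>path_space. coord t w - coord s w \<in> A} \<in> sets filt_inf"
    proof -
      have "(\<lambda>w. coord t w - coord s w) -` A \<inter> space filt_inf \<in> sets filt_inf"
        using A by measurable
      then show ?thesis by (simp add: vimage_def Int_def conj_commute)
    qed
    have \<Gamma>': "\<Gamma> \<in> sets filt_inf" using \<Gamma> sets_filt_inf by auto
    have pre: "?\<tau> -` \<Gamma> \<inter> path_space \<in> sets (filt s)"
      using measurable_sets[OF measurable_shift[of "{0..s}" \<mu>], of \<Gamma>] \<Gamma> by (auto simp: filt_def)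
    have \<tau>_path: "?\<tau> w \<in> path_space" if "w \<in> path_space" for w
      using measurable_space[OF \<tau>, of w] that by (simp add: space_P)
    have "emeasure (drift_law \<mu> P) (\<Gamma> \<inter> {w\<in>path_space. coord t w - coord s w \<in> A}) =
       emeasure P (?\<tau> -` (\<Gamma> \<inter> {w\<in>path_space. coord t w - coord s w \<in> A}) \<inter> path_space)"
      unfolding drift_law_def using \<Gamma>' D by (subst emeasure_distr) (auto simp: space_P)
    also have "?\<tau> -` (\<Gamma> \<inter> {w\<in>path_space. coord t w - coord s w \<in> A}) \<inter> path_space =
       (?\<tau> -` \<Gamma> \<inter> path_space) \<inter> {w\<in>path_space. coord t w - coord s w \<in> (\<lambda>z. \<mu> * (t - s) + z) -` A}"
      using st \<tau>_path by (auto simp: coord_def algebra_simps)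
    also have "emeasure P \<dots> = emeasure P (?\<tau> -` \<Gamma> \<inter> path_space) *
        emeasure (gauss_law 0 (t - s)) ((\<lambda>z. \<mu> * (t - s) + z) -` A)"
    proof -
      have "(\<lambda>z. \<mu> * (t - s) + z) -` A \<in> sets borel"
        using measurable_sets[of "\<lambda>z. \<mu> * (t - s) + z" borel borel A] A by simp
      moreover have "emeasure P (\<Gamma>' \<inter> {w\<in>path_space. coord t w - coord s w \<in> A'})
          = emeasure P \<Gamma>' * emeasure (gauss_law 0 (t - s)) A'"
        if "\<Gamma>' \<in> sets (filt s)" "A' \<in> sets borel" for \<Gamma>' A'
        using P st that unfolding gauss_increments_def by simp
      ultimately show ?thesis using pre by blast
    qed
    also have "emeasure P (?\<tau> -` \<Gamma> \<inter> path_space) = emeasure (drift_law \<mu> P) \<Gamma>"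
      unfolding drift_law_def using \<Gamma>' by (subst emeasure_distr) (auto simp: space_P)
    also have "emeasure (gauss_law 0 (t - s)) ((\<lambda>z. \<mu> * (t - s) + z) -` A) = emeasure (gauss_law (\<mu> * (t - s)) (t - s)) A"
      using emeasure_gauss_law_shift[of "t - s" A 0 "\<mu> * (t - s)"] st A by simp
    finally show ?thesis .
  qed
  moreover have "prob_space (drift_law \<mu> P)"
    unfolding drift_law_def by (rule prob_space.prob_space_distr[OF pr \<tau>])
  moreover have "AE w in drift_law \<mu> P. coord 0 w = x"
  proof -
    have [measurable]: "coord 0 \<in> borel_measurable filt_inf" by (rule measurable_coord_filt_inf) simp
    have "Measurable.pred filt_inf (\<lambda>w. coord 0 w = x)" by measurable
    then show ?thesis
      unfolding drift_law_def using X0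
      by (subst AE_distr_iff) (auto simp: coord_def pred_def)
  qed
  moreover have "sets (drift_law \<mu> P) = sets filt_inf" by (simp add: drift_law_def)
  ultimately show ?thesis unfolding gauss_increments_def by auto
qed

section \<open>Integration of the past against an independent increment\<close>

lemma gauss_incrementsD:
  assumes "gauss_increments T \<mu> x R"
  shows "prob_space R" "sets R = sets filt_inf" "space R = path_space" "AE w in R. coord 0 w = x"
    "sets (filt s) \<subseteq> sets R" "subalgebra R (filt s)"
proof -
  show "prob_space R" and s: "sets R = sets filt_inf" and "AE w in R. coord 0 w = x"
    using assms by (auto simp: gauss_increments_def)
  show sp: "space R = path_space" using sets_eq_imp_space_eq[OF s] by simp
  show "sets (filt s) \<subseteq> sets R" using s sets_filt_inf by simp
  then show "subalgebra R (filt s)" by (simp add: subalgebra_def sp)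
qed

lemma gauss_increments_measurable:
  assumes "gauss_increments T \<mu> x R"
  shows "f \<in> measurable filt_inf N \<Longrightarrow> f \<in> measurable R N"
    and "f \<in> measurable (filt s) N \<Longrightarrow> f \<in> measurable R N"
proof -
  show "f \<in> measurable filt_inf N \<Longrightarrow> f \<in> measurable R N"
    unfolding measurable_cong_sets[OF gauss_incrementsD(2)[OF assms] refl] .
  then show "f \<in> measurable (filt s) N \<Longrightarrow> f \<in> measurable R N"
    using measurable_filt_inf by blast
qed

lemma gauss_increments_incr:
  assumes "gauss_increments T \<mu> x R" "0 \<le> s" "s < t" "t \<le> T" "\<Gamma> \<in> sets (filt s)" "A \<in> sets borel"
  shows "emeasure R (\<Gamma> \<inter> {w\<in>path_space. coord t w - coord s w \<in> A})
          = emeasure R \<Gamma> * emeasure (gauss_law (\<mu> * (t - s)) (t - s)) A"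
  using assms unfolding gauss_increments_def by simp

text \<open>With \<open>R\<close> restricted to \<open>filt s\<close>, independence of past and
  increment becomes an equality with a product measure, so that Fubini applies to arbitrary
  functions of both.\<close>

lemma distr_increment_pair:
  assumes R: "gauss_increments T \<mu> x R" and st: "0 \<le> s" "s < t" "t \<le> T"
  shows "distr R (filt s \<Otimes>\<^sub>M borel) (\<lambda>w. (w, coord t w - coord s w))
    = restr_to_subalg R (filt s) \<Otimes>\<^sub>M gauss_law (\<mu> * (t - s)) (t - s)"
proof (rule pair_measure_eqI[symmetric])
  note RD = gauss_incrementsD[OF R]
  interpret prob_space R by (rule RD)
  show "sigma_finite_measure (restr_to_subalg R (filt s))"
    by (intro prob_space_imp_sigma_finite prob_space_restr_to_subalg[OF RD(6)]) unfold_locales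
  show "sigma_finite_measure (gauss_law (\<mu> * (t - s)) (t - s))"
    using prob_space_gauss_law[of "t - s"] st by (simp add: prob_space_imp_sigma_finite)
  show "sets (restr_to_subalg R (filt s) \<Otimes>\<^sub>M gauss_law (\<mu> * (t - s)) (t - s)) =
    sets (distr R (filt s \<Otimes>\<^sub>M borel) (\<lambda>w. (w, coord t w - coord s w)))"
    by (simp, rule sets_pair_measure_cong) (simp_all add: sets_restr_to_subalg[OF RD(6)])
  fix A B assume "A \<in> sets (restr_to_subalg R (filt s))" "B \<in> sets (gauss_law (\<mu> * (t - s)) (t - s))"
  then have A: "A \<in> sets (filt s)" and B: "B \<in> sets borel"
    by (simp_all add: sets_restr_to_subalg[OF RD(6)])
  have [measurable]: "coord t \<in> borel_measurable R" "coord s \<in> borel_measurable R"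
    using st by (auto intro!: gauss_increments_measurable(1)[OF R] measurable_coord_filt_inf)
  have [measurable]: "(\<lambda>w. w) \<in> measurable R (filt s)"
    using RD(3) RD(5)[of s] by (auto simp: measurable_def)
  have "A \<subseteq> path_space" using sets.sets_into_space[OF A] by simp
  then have eq: "(\<lambda>w. (w, coord t w - coord s w)) -` (A \<times> B) \<inter> space R
      = A \<inter> {w\<in>path_space. coord t w - coord s w \<in> B}"
    by (auto simp: RD(3))
  show "emeasure (restr_to_subalg R (filt s)) A * emeasure (gauss_law (\<mu> * (t - s)) (t - s)) B =
    emeasure (distr R (filt s \<Otimes>\<^sub>M borel) (\<lambda>w. (w, coord t w - coord s w))) (A \<times> B)"
    using A B by (subst emeasure_distr)
      (auto simp: eq emeasure_restr_to_subalg[OF RD(6) A] gauss_increments_incr[OF R st A B])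
qed

lemma measurable_increment_pair:
  assumes R: "gauss_increments T \<mu> x R" and st: "0 \<le> s" "s < t"
  shows "(\<lambda>w. (w, coord t w - coord s w)) \<in> measurable R (filt s \<Otimes>\<^sub>M borel)"
proof -
  have [measurable]: "coord t \<in> borel_measurable R" "coord s \<in> borel_measurable R"
    using st by (auto intro!: gauss_increments_measurable(1)[OF R] measurable_coord_filt_inf)
  have [measurable]: "(\<lambda>w. w) \<in> measurable R (filt s)"
    using gauss_incrementsD(3)[OF R] gauss_incrementsD(5)[OF R, of s] by (auto simp: measurable_def)
  show ?thesis by measurable
qed

lemma nn_integral_increment:
  assumes R: "gauss_increments T \<mu> x R" and st: "0 \<le> s" "s < t" "t \<le> T"
    and f: "f \<in> borel_measurable (filt s \<Otimes>\<^sub>M borel)"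
  shows "(\<integral>\<^sup>+w. f (w, coord t w - coord s w) \<partial>R)
    = (\<integral>\<^sup>+w. (\<integral>\<^sup>+z. f (w, z) \<partial>gauss_law (\<mu> * (t - s)) (t - s)) \<partial>R)"
proof -
  note RD = gauss_incrementsD[OF R]
  interpret G: prob_space "gauss_law (\<mu> * (t - s)) (t - s)" by (rule prob_space_gauss_law) (use st in simp)
  let ?G = "gauss_law (\<mu> * (t - s)) (t - s)"
  have f': "f \<in> borel_measurable (filt s \<Otimes>\<^sub>M ?G)"
    using f by (simp cong: measurable_cong_sets)
  have f'': "f \<in> borel_measurable (restr_to_subalg R (filt s) \<Otimes>\<^sub>M ?G)"
    using f by (subst measurable_cong_sets[OF sets_pair_measure_cong refl]) (simp_all add: sets_restr_to_subalg[OF RD(6)])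
  have "(\<integral>\<^sup>+w. f (w, coord t w - coord s w) \<partial>R) =
      (\<integral>\<^sup>+p. f p \<partial>distr R (filt s \<Otimes>\<^sub>M borel) (\<lambda>w. (w, coord t w - coord s w)))"
    using f by (subst nn_integral_distr[OF measurable_increment_pair[OF R st(1,2)]]) auto
  also have "\<dots> = (\<integral>\<^sup>+w. (\<integral>\<^sup>+z. f (w, z) \<partial>?G) \<partial>restr_to_subalg R (filt s))"
    unfolding distr_increment_pair[OF R st] by (rule G.nn_integral_fst[OF f'', symmetric])
  also have "\<dots> = (\<integral>\<^sup>+w. (\<integral>\<^sup>+z. f (w, z) \<partial>?G) \<partial>R)"
    by (rule nn_integral_subalgebra2[OF RD(6) G.borel_measurable_nn_integral_fst[OF f']])
  finally show ?thesis .
qed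

lemma integral_char_increment:
  fixes G :: "(real \<Rightarrow> real) \<Rightarrow> complex"
  assumes R: "gauss_increments T \<mu> x R" and st: "0 \<le> s" "s < t" "t \<le> T"
    and G: "G \<in> borel_measurable (filt s)" and C: "\<And>w. norm (G w) \<le> C"
  shows "(LINT w|R. G w * iexp (\<theta> * (coord t w - coord s w)))
    = (LINT w|R. G w) * exp (\<i> * of_real (\<mu> * (t - s) * \<theta>) - of_real ((t - s) * \<theta>\<^sup>2 / 2))"
proof -
  note RD = gauss_incrementsD[OF R]
  interpret prob_space R by (rule RD)
  let ?G = "gauss_law (\<mu> * (t - s)) (t - s)" and ?R = "restr_to_subalg R (filt s)"
  interpret N: prob_space ?G by (rule prob_space_gauss_law) (use st in simp)
  interpret R': prob_space ?R by (rule prob_space_restr_to_subalg[OF RD(6)]) unfold_locales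
  interpret pr: pair_prob_space ?R ?G ..
  have G': "G \<in> borel_measurable ?R" using G by (simp add: measurable_cong_sets[OF sets_restr_to_subalg[OF RD(6)] refl])
  note G'[measurable]
  define f where "f = (\<lambda>(w, z). G w * iexp (\<theta> * z))"
  have f[measurable]: "f \<in> borel_measurable (?R \<Otimes>\<^sub>M ?G)"
  proof -
    have "f \<in> borel_measurable (?R \<Otimes>\<^sub>M borel)" unfolding f_def by measurable
    moreover have "sets (?R \<Otimes>\<^sub>M borel) = sets (?R \<Otimes>\<^sub>M ?G)" by (rule sets_pair_measure_cong) simp_all
    ultimately show ?thesis using measurable_cong_sets[OF _ refl] by blast
  qed
  have f': "f \<in> borel_measurable (filt s \<Otimes>\<^sub>M borel)"
  proof -
    have "sets (filt s \<Otimes>\<^sub>M borel) = sets (?R \<Otimes>\<^sub>M ?G)"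
      by (rule sets_pair_measure_cong) (simp_all add: sets_restr_to_subalg[OF RD(6)])
    from measurable_cong_sets[OF this refl] f show ?thesis by blast
  qed
  have int: "integrable (?R \<Otimes>\<^sub>M ?G) f"
    by (rule pr.integrable_const_bound[where B=C, OF _ f]) (auto simp: f_def norm_mult C intro!: AE_I2)
  have "(LINT w|R. G w * iexp (\<theta> * (coord t w - coord s w))) =
      (LINT p|distr R (filt s \<Otimes>\<^sub>M borel) (\<lambda>w. (w, coord t w - coord s w)). f p)"
    unfolding integral_distr[OF measurable_increment_pair[OF R st(1,2)] f'] by (simp add: f_def)
  also have "\<dots> = (LINT w|?R. (LINT z|?G. f (w, z)))"
    unfolding distr_increment_pair[OF R st] by (rule pr.integral_fst'[OF int, symmetric])
  also have "\<dots> = (LINT w|?R. G w * char ?G \<theta>)"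
    by (simp add: f_def char_def)
  also have "\<dots> = (LINT w|?R. G w) * char ?G \<theta>" by simp
  also have "(LINT w|?R. G w) = (LINT w|R. G w)" by (rule integral_subalgebra2[OF RD(6) G])
  finally show ?thesis using st by (simp add: char_gauss_law)
qed

section \<open>Uniqueness of the law up to the horizon\<close>

lemma cylinder_in_filt:
  assumes "finite J" "J \<subseteq> {0..b}" "\<And>r. r \<in> J \<Longrightarrow> A r \<in> sets borel"
  shows "{w\<in>path_space. \<forall>r\<in>J. coord r w \<in> A r} \<in> sets (filt b)"
  using cylinders_sets[of "{0..b}"] assms unfolding filt_def cylinders_def by blast

lemma nn_integral_markov_step:
  assumes R: "gauss_increments T \<mu> x R" and br: "0 \<le> b" "b < r" "r \<le> T"
    and C: "C \<in> sets (filt b)" and f: "f \<in> borel_measurable borel"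
  shows "(\<integral>\<^sup>+w. indicator C w * f (coord r w) \<partial>R)
    = (\<integral>\<^sup>+w. indicator C w * (\<integral>\<^sup>+z. f (coord b w + z) \<partial>gauss_law (\<mu> * (r - b)) (r - b)) \<partial>R)"
proof -
  note f[measurable] C[measurable]
  have [measurable]: "coord b \<in> borel_measurable (filt b)" by (rule measurable_coord_filt) (use br in auto)
  have "(\<lambda>(w, z). indicator C w * f (coord b w + z)) \<in> borel_measurable (filt b \<Otimes>\<^sub>M borel)"
    by measurable
  from nn_integral_increment[OF R br this]
  show ?thesis by (simp add: nn_integral_cmult)
qed

text \<open>Induction over the largest time of the cylinder. The condition at that time is absorbed
  into the test function, and a later time \<open>r\<close> is integrated out by the Gaussian
  kernel; this is why both \<open>r\<close> and \<open>f\<close> vary in the induction.\<close>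

lemma gauss_increments_marginal_eq:
  assumes R1: "gauss_increments T \<mu> x R1" and R2: "gauss_increments T \<mu> x R2"
    and J: "finite J" "J \<subseteq> {0..T}" "\<And>j. j \<in> J \<Longrightarrow> A j \<in> sets borel"
    and r: "r \<in> {0..T}" "\<And>j. j \<in> J \<Longrightarrow> j \<le> r" and f: "f \<in> borel_measurable borel"
  shows "(\<integral>\<^sup>+w. indicator {w\<in>path_space. \<forall>j\<in>J. coord j w \<in> A j} w * f (coord r w) \<partial>R1)
    = (\<integral>\<^sup>+w. indicator {w\<in>path_space. \<forall>j\<in>J. coord j w \<in> A j} w * f (coord r w) \<partial>R2)"
  using J r f
proof (induction J arbitrary: r f rule: finite_linorder_max_induct)
  case empty
  have zero: "(\<integral>\<^sup>+w. indicator {w\<in>path_space. \<forall>j\<in>{}. coord j w \<in> A j} w * g (coord 0 w) \<partial>R) = g x"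
    if R: "gauss_increments T \<mu> x R" for R and g :: "real \<Rightarrow> ennreal"
  proof -
    interpret prob_space R by (rule gauss_incrementsD[OF R])
    have "(\<integral>\<^sup>+w. indicator {w\<in>path_space. \<forall>j\<in>{}. coord j w \<in> A j} w * g (coord 0 w) \<partial>R) = (\<integral>\<^sup>+w. g x \<partial>R)"
      by (rule nn_integral_cong_AE)
         (use gauss_incrementsD(4)[OF R] AE_space gauss_incrementsD(3)[OF R] in \<open>auto elim!: eventually_elim2\<close>)
    then show ?thesis by (simp add: emeasure_space_1)
  qed
  show ?case
  proof (cases "r = 0")
    case True
    then show ?thesis using zero[OF R1] zero[OF R2] by simp
  next
    case False
    then have r0: "0 < r" "r \<le> T" using empty by auto
    have "{w\<in>path_space. \<forall>j\<in>{}. coord j w \<in> A j} \<in> sets (filt 0)"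
      using sets.top[of "filt 0"] by simp
    note nn_integral_markov_step[OF _ order_refl r0 this empty(5)]
    then show ?thesis using R1 R2 zero[of _ "\<lambda>y. \<integral>\<^sup>+z. f (y + z) \<partial>gauss_law (\<mu> * (r - 0)) (r - 0)"] by simp
  qed
next
  case (insert b J)
  note insert.prems(5)[measurable]
  have b: "b \<in> {0..T}" "b \<le> r" and bT: "0 \<le> b" "b \<le> T" using insert by auto
  have Ab[measurable]: "A b \<in> sets borel" using insert by auto
  have step: "(\<integral>\<^sup>+w. indicator {w\<in>path_space. \<forall>j\<in>insert b J. coord j w \<in> A j} w * g (coord b w) \<partial>R) =
     (\<integral>\<^sup>+w. indicator {w\<in>path_space. \<forall>j\<in>J. coord j w \<in> A j} w * (indicator (A b) (coord b w) * g (coord b w)) \<partial>R)"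
    for R g by (rule nn_integral_cong) (auto split: split_indicator)
  have IH: "(\<integral>\<^sup>+w. indicator {w\<in>path_space. \<forall>j\<in>insert b J. coord j w \<in> A j} w * g (coord b w) \<partial>R1) =
     (\<integral>\<^sup>+w. indicator {w\<in>path_space. \<forall>j\<in>insert b J. coord j w \<in> A j} w * g (coord b w) \<partial>R2)"
    if [measurable]: "g \<in> borel_measurable borel" for g
    unfolding step by (rule insert.IH) (use insert b in \<open>auto intro: less_imp_le\<close>)
  show ?case
  proof (cases "r = b")
    case False
    then have br: "b < r" "r \<le> T" using b insert.prems(3) by simp_all
    have "insert b J \<subseteq> {0..b}"
    proof
      fix j assume j: "j \<in> insert b J"
      then have "j \<le> b" using insert.hyps(2) by auto
      moreover have "0 \<le> j" using j insert.prems(1) by auto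
      ultimately show "j \<in> {0..b}" by simp
    qed
    then have C: "{w\<in>path_space. \<forall>j\<in>insert b J. coord j w \<in> A j} \<in> sets (filt b)"
      by (intro cylinder_in_filt) (use insert.hyps insert.prems in simp_all)
    interpret N: prob_space "gauss_law (\<mu> * (r - b)) (r - b)" by (rule prob_space_gauss_law) (use br in simp)
    have "(\<lambda>y. \<integral>\<^sup>+z. f (y + z) \<partial>gauss_law (\<mu> * (r - b)) (r - b)) \<in> borel_measurable borel"
      by measurable
    from IH[OF this] show ?thesis
      by (simp only: nn_integral_markov_step[OF R1 bT(1) br C insert.prems(5)]
          nn_integral_markov_step[OF R2 bT(1) br C insert.prems(5)])
  qed (use IH[OF insert.prems(5)] in simp)
qed

lemma gauss_increments_unique:
  assumes R1: "gauss_increments T \<mu> x R1" and R2: "gauss_increments T \<mu> x R2" and T: "0 \<le> T"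
  shows "restr_to_subalg R1 (filt T) = restr_to_subalg R2 (filt T)"
proof (rule measure_eqI_generator_eq[where E="cylinders {0..T}" and \<Omega>=path_space and A="\<lambda>_. path_space"])
  note D1 = gauss_incrementsD[OF R1] and D2 = gauss_incrementsD[OF R2]
  interpret R1: prob_space R1 by (rule D1)
  show "Int_stable (cylinders {0..T})" "cylinders {0..T} \<subseteq> Pow path_space"
    by (rule Int_stable_cylinders cylinders_Pow)+
  show "sets (restr_to_subalg R1 (filt T)) = sigma_sets path_space (cylinders {0..T})"
       "sets (restr_to_subalg R2 (filt T)) = sigma_sets path_space (cylinders {0..T})"
    unfolding sets_restr_to_subalg[OF D1(6)] sets_restr_to_subalg[OF D2(6)] sigma_sets_cylinders
    by (simp_all add: filt_def)
  show "range (\<lambda>i::nat. path_space) \<subseteq> cylinders {0..T}" "(\<Union>i::nat. path_space) = path_space"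
    by (auto simp: cylinders_def)
  have "path_space \<in> sets (filt T)" using sets.top[of "filt T"] by simp
  then show "emeasure (restr_to_subalg R1 (filt T)) path_space \<noteq> \<infinity>"
    by (simp add: emeasure_restr_to_subalg[OF D1(6)])
  fix C assume C: "C \<in> cylinders {0..T}"
  then have C': "C \<in> sets (filt T)" using cylinders_sets[of "{0..T}"] by (auto simp: filt_def)
  have ind: "emeasure R C = (\<integral>\<^sup>+w. indicator C w * (\<lambda>_. 1) (coord T w) \<partial>R)" if "gauss_increments T \<mu> x R" for R
    using C' gauss_incrementsD(5)[OF that, of T] by auto
  from C obtain J A where J: "C = {w\<in>path_space. \<forall>r\<in>J. coord r w \<in> A r}" "finite J" "J \<subseteq> {0..T}"
    "\<And>r. r \<in> J \<Longrightarrow> A r \<in> sets borel" by (auto simp: cylinders_def)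
  have "emeasure R1 C = emeasure R2 C"
    unfolding ind[OF R1] ind[OF R2]
    unfolding J(1) by (rule gauss_increments_marginal_eq[OF R1 R2 J(2-4)]) (use T J in auto)
  then show "emeasure (restr_to_subalg R1 (filt T)) C = emeasure (restr_to_subalg R2 (filt T)) C"
    by (simp add: emeasure_restr_to_subalg[OF D1(6) C'] emeasure_restr_to_subalg[OF D2(6) C'])
qed


section \<open>Change of drift by an exponential density\<close>

lemma nn_integral_gauss_law_tilt:
  assumes h: "0 < h" and f: "f \<in> borel_measurable borel"
  shows "(\<integral>\<^sup>+z. f z * ennreal (exp (\<mu> * z - \<mu>\<^sup>2 * h / 2)) \<partial>gauss_law 0 h)
    = (\<integral>\<^sup>+z. f z \<partial>gauss_law (\<mu> * h) h)"
proof -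
  note f[measurable]
  have tilt: "normal_density 0 (sqrt h) z * exp (\<mu> * z - \<mu>\<^sup>2 * h / 2) = normal_density (\<mu> * h) (sqrt h) z" for z
  proof -
    have "- z\<^sup>2 / (2 * h) + (\<mu> * z - \<mu>\<^sup>2 * h / 2) = - (z - \<mu> * h)\<^sup>2 / (2 * h)"
      using h by (simp add: field_simps power2_eq_square)
    then show ?thesis using h
      by (simp add: normal_density_def mult.assoc exp_add[symmetric])
  qed
  have "(\<integral>\<^sup>+z. f z * ennreal (exp (\<mu> * z - \<mu>\<^sup>2 * h / 2)) \<partial>gauss_law 0 h) =
    (\<integral>\<^sup>+z. ennreal (normal_density 0 (sqrt h) z) * (f z * ennreal (exp (\<mu> * z - \<mu>\<^sup>2 * h / 2))) \<partial>lborel)"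
    unfolding gauss_law_def by (rule nn_integral_density) measurable
  also have "\<dots> = (\<integral>\<^sup>+z. ennreal (normal_density (\<mu> * h) (sqrt h) z) * f z \<partial>lborel)"
    by (rule nn_integral_cong) (simp add: tilt[symmetric] ennreal_mult'' mult_ac)
  also have "\<dots> = (\<integral>\<^sup>+z. f z \<partial>gauss_law (\<mu> * h) h)"
    unfolding gauss_law_def by (rule nn_integral_density[symmetric]) measurable
  finally show ?thesis .
qed

text \<open>The Cameron-Martin density, on the past of \<open>t\<close>, of Brownian motion from
  \<open>x\<close> with drift \<mu> with respect to the driftless one.\<close>

definition tilt_density :: "real \<Rightarrow> real \<Rightarrow> real \<Rightarrow> (real \<Rightarrow> real) \<Rightarrow> real" where
  "tilt_density \<mu> x t w = exp (\<mu> * (coord t w - x) - \<mu>\<^sup>2 * t / 2)"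

lemma measurable_tilt_density: "0 \<le> s \<Longrightarrow> s \<le> t \<Longrightarrow> tilt_density \<mu> x s \<in> borel_measurable (filt t)"
  using measurable_coord_filt[of s t] unfolding tilt_density_def by measurable

lemma tilt_density_split:
  "tilt_density \<mu> x t w = tilt_density \<mu> x s w * exp (\<mu> * (coord t w - coord s w) - \<mu>\<^sup>2 * (t - s) / 2)"
  by (simp add: tilt_density_def exp_add[symmetric] algebra_simps diff_divide_distrib)

lemma nn_integral_tilt_density_step:
  fixes f :: "_ \<Rightarrow> ennreal"
  assumes P: "gauss_increments T 0 x P" and st: "0 \<le> s" "s < t" "t \<le> T"
    and f: "f \<in> borel_measurable (filt s)" and g: "g \<in> borel_measurable borel"
  shows "(\<integral>\<^sup>+w. f w * g (coord t w - coord s w) * ennreal (tilt_density \<mu> x t w) \<partial>P)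
    = (\<integral>\<^sup>+w. f w * ennreal (tilt_density \<mu> x s w) \<partial>P) * (\<integral>\<^sup>+z. g z \<partial>gauss_law (\<mu> * (t - s)) (t - s))"
proof -
  note f[measurable] g[measurable]
  have D[measurable]: "tilt_density \<mu> x s \<in> borel_measurable (filt s)" by (rule measurable_tilt_density) (use st in auto)
  let ?e = "\<lambda>z. ennreal (exp (\<mu> * z - \<mu>\<^sup>2 * (t - s) / 2))"
  have "(\<integral>\<^sup>+w. f w * g (coord t w - coord s w) * ennreal (tilt_density \<mu> x t w) \<partial>P) =
     (\<integral>\<^sup>+w. (\<lambda>(w, z). f w * ennreal (tilt_density \<mu> x s w) * (g z * ?e z)) (w, coord t w - coord s w) \<partial>P)"
    by (rule nn_integral_cong) (simp add: tilt_density_split[of \<mu> x t _ s] ennreal_mult'' mult_ac)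
  also have "\<dots> = (\<integral>\<^sup>+w. (\<integral>\<^sup>+z. (\<lambda>(w, z). f w * ennreal (tilt_density \<mu> x s w) * (g z * ?e z)) (w, z) \<partial>gauss_law (0 * (t - s)) (t - s)) \<partial>P)"
    by (rule nn_integral_increment[OF P st]) measurable
  also have "\<dots> = (\<integral>\<^sup>+w. f w * ennreal (tilt_density \<mu> x s w) * (\<integral>\<^sup>+z. g z * ?e z \<partial>gauss_law 0 (t - s)) \<partial>P)"
    by (rule nn_integral_cong) (simp add: nn_integral_cmult)
  also have "\<dots> = (\<integral>\<^sup>+w. f w * ennreal (tilt_density \<mu> x s w) * (\<integral>\<^sup>+z. g z \<partial>gauss_law (\<mu> * (t - s)) (t - s)) \<partial>P)"
    using st by (simp add: nn_integral_gauss_law_tilt)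
  also have "\<dots> = (\<integral>\<^sup>+w. f w * ennreal (tilt_density \<mu> x s w) \<partial>P) * (\<integral>\<^sup>+z. g z \<partial>gauss_law (\<mu> * (t - s)) (t - s))"
    by (rule nn_integral_multc) (intro gauss_increments_measurable(2)[OF P, of _ s], measurable)
  finally show ?thesis .
qed

lemma nn_integral_tilt_density_martingale:
  fixes f :: "_ \<Rightarrow> ennreal"
  assumes P: "gauss_increments T 0 x P" and st: "0 \<le> s" "s \<le> t" "t \<le> T" and f: "f \<in> borel_measurable (filt s)"
  shows "(\<integral>\<^sup>+w. f w * ennreal (tilt_density \<mu> x t w) \<partial>P) = (\<integral>\<^sup>+w. f w * ennreal (tilt_density \<mu> x s w) \<partial>P)"
proof (cases "s = t")
  case False
  with st have "s < t" by simp
  interpret N: prob_space "gauss_law (\<mu> * (t - s)) (t - s)" by (rule prob_space_gauss_law) (use \<open>s < t\<close> in simp)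
  show ?thesis
    using nn_integral_tilt_density_step[OF P st(1) \<open>s < t\<close> st(3) f, of "\<lambda>_. 1" \<mu>] N.emeasure_space_1 by simp
qed simp

lemma density_tilt_gauss_increments:
  assumes P: "gauss_increments T 0 x P" and T: "0 \<le> T"
  shows "gauss_increments T \<mu> x (density P (tilt_density \<mu> x T))"
proof -
  note PD = gauss_incrementsD[OF P]
  interpret P: prob_space P by (rule PD)
  let ?D = "density P (tilt_density \<mu> x T)"
  have DT[measurable]: "tilt_density \<mu> x T \<in> borel_measurable P"
    by (intro gauss_increments_measurable(2)[OF P, of _ T] measurable_tilt_density T) simp
  have em: "emeasure ?D \<Gamma> = (\<integral>\<^sup>+w. indicator \<Gamma> w * ennreal (tilt_density \<mu> x T w) \<partial>P)" if "\<Gamma> \<in> sets P" for \<Gamma>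
    using that by (subst emeasure_density) (auto simp: mult.commute)
  have "prob_space ?D"
  proof
    have "emeasure ?D (space ?D) = (\<integral>\<^sup>+w. (\<lambda>_. 1) w * ennreal (tilt_density \<mu> x T w) \<partial>P)"
      by (subst space_density, subst em) (auto intro!: nn_integral_cong)
    also have "\<dots> = (\<integral>\<^sup>+w. 1 * ennreal (tilt_density \<mu> x 0 w) \<partial>P)"
      by (rule nn_integral_tilt_density_martingale[OF P]) (use T in auto)
    also have "\<dots> = (\<integral>\<^sup>+w. 1 \<partial>P)"
      by (rule nn_integral_cong_AE) (use PD(4) in \<open>auto simp: tilt_density_def elim!: eventually_mono\<close>)
    finally show "emeasure ?D (space ?D) = 1" by (simp add: P.emeasure_space_1)
  qed
  moreover have "emeasure ?D (\<Gamma> \<inter> {w\<in>path_space. coord t w - coord s w \<in> A})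
          = emeasure ?D \<Gamma> * emeasure (gauss_law (\<mu> * (t - s)) (t - s)) A"
    if st: "0 \<le> s" "s < t" "t \<le> T" and \<Gamma>: "\<Gamma> \<in> sets (filt s)" and A: "A \<in> sets borel" for s t \<Gamma> A
  proof -
    note \<Gamma>[measurable] A[measurable]
    have [measurable]: "coord t \<in> borel_measurable (filt t)" "coord s \<in> borel_measurable (filt t)"
      using st by (auto intro!: measurable_coord_filt)
    have \<Gamma>t[measurable]: "\<Gamma> \<in> sets (filt t)" using \<Gamma> sets_filt_mono[of s t] st by auto
    have "\<Gamma> \<inter> {w\<in>space (filt t). coord t w - coord s w \<in> A} \<in> sets (filt t)" by measurable
    then have S: "\<Gamma> \<inter> {w\<in>path_space. coord t w - coord s w \<in> A} \<in> sets (filt t)" by simp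
    have sub: "\<Gamma> \<subseteq> path_space" using sets.sets_into_space[OF \<Gamma>] by simp
    have "emeasure ?D (\<Gamma> \<inter> {w\<in>path_space. coord t w - coord s w \<in> A}) =
      (\<integral>\<^sup>+w. indicator (\<Gamma> \<inter> {w\<in>path_space. coord t w - coord s w \<in> A}) w * ennreal (tilt_density \<mu> x T w) \<partial>P)"
      using S PD(5)[of t] by (intro em) auto
    also have "\<dots> = (\<integral>\<^sup>+w. indicator (\<Gamma> \<inter> {w\<in>path_space. coord t w - coord s w \<in> A}) w * ennreal (tilt_density \<mu> x t w) \<partial>P)"
      by (rule nn_integral_tilt_density_martingale[OF P]) (use st S in auto)
    also have "\<dots> = (\<integral>\<^sup>+w. indicator \<Gamma> w * indicator A (coord t w - coord s w) * ennreal (tilt_density \<mu> x t w) \<partial>P)"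
      by (rule nn_integral_cong) (use sub in \<open>auto split: split_indicator\<close>)
    also have "\<dots> = (\<integral>\<^sup>+w. indicator \<Gamma> w * ennreal (tilt_density \<mu> x s w) \<partial>P) * (\<integral>\<^sup>+z. indicator A z \<partial>gauss_law (\<mu> * (t - s)) (t - s))"
      by (rule nn_integral_tilt_density_step[OF P st]) measurable
    also have "(\<integral>\<^sup>+w. indicator \<Gamma> w * ennreal (tilt_density \<mu> x s w) \<partial>P) = (\<integral>\<^sup>+w. indicator \<Gamma> w * ennreal (tilt_density \<mu> x T w) \<partial>P)"
      by (rule nn_integral_tilt_density_martingale[OF P, symmetric]) (use st in auto)
    also have "\<dots> = emeasure ?D \<Gamma>" using \<Gamma> PD(5)[of s] by (intro em[symmetric]) auto
    finally show ?thesis using A by simp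
  qed
  moreover have "AE w in ?D. coord 0 w = x"
    using PD(4) by (subst AE_density) (auto elim!: eventually_mono)
  moreover have "sets ?D = sets filt_inf" using PD(2) by simp
  ultimately show ?thesis unfolding gauss_increments_def by auto
qed

text \<open>Shifting the paths and tilting the measure both produce Gaussian increments with drift
  \<mu> up to \<open>T\<close>; uniqueness on \<open>filt T\<close> identifies the two.\<close>

lemma nn_integral_drift_law:
  fixes f :: "_ \<Rightarrow> ennreal"
  assumes P: "\<And>T. gauss_increments T 0 x P" and T: "0 \<le> T" and f: "f \<in> borel_measurable (filt T)"
  shows "(\<integral>\<^sup>+w. f w \<partial>drift_law \<mu> P) = (\<integral>\<^sup>+w. f w * ennreal (tilt_density \<mu> x T w) \<partial>P)"
proof -
  note D1 = density_tilt_gauss_increments[OF P T, of \<mu>] and D2 = drift_law_gauss_increments[OF P, of T \<mu>]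
  have [measurable]: "tilt_density \<mu> x T \<in> borel_measurable P" "f \<in> borel_measurable P"
    using f by (auto intro!: gauss_increments_measurable(2)[OF P, of _ T] measurable_tilt_density T)
  have "(\<integral>\<^sup>+w. f w \<partial>drift_law \<mu> P) = (\<integral>\<^sup>+w. f w \<partial>restr_to_subalg (drift_law \<mu> P) (filt T))"
    by (rule nn_integral_subalgebra2[OF gauss_incrementsD(6)[OF D2] f, symmetric])
  also have "restr_to_subalg (drift_law \<mu> P) (filt T) = restr_to_subalg (density P (tilt_density \<mu> x T)) (filt T)"
    by (rule gauss_increments_unique[OF D2 D1 T])
  also have "(\<integral>\<^sup>+w. f w \<partial>restr_to_subalg (density P (tilt_density \<mu> x T)) (filt T)) = (\<integral>\<^sup>+w. f w \<partial>density P (tilt_density \<mu> x T))"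
    by (rule nn_integral_subalgebra2[OF gauss_incrementsD(6)[OF D1] f])
  also have "\<dots> = (\<integral>\<^sup>+w. f w * ennreal (tilt_density \<mu> x T w) \<partial>P)"
    by (subst nn_integral_density) (auto simp: mult.commute)
  finally show ?thesis .
qed

section \<open>Grids and crossings of a level\<close>

text \<open>The index \<open>n\<close> stands for \<open>Suc n\<close> cells, so that the mesh makes
  sense for every \<open>n\<close> without a side condition.\<close>

definition grid :: "real \<Rightarrow> real \<Rightarrow> nat \<Rightarrow> nat \<Rightarrow> real" where
  "grid s t n k = s + (t - s) * real k / real (Suc n)"

lemma grid_0 [simp]: "grid s t n 0 = s"
  and grid_last [simp]: "grid s t n (Suc n) = t"
  and grid_diff: "grid s t n (Suc k) - grid s t n k = (t - s) / real (Suc n)"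
proof -
  show "grid s t n (Suc n) = t"
    using of_nat_neq_0[of n, where 'a=real] by (simp add: grid_def del: of_nat_Suc)
  have "(t - s) * real (Suc k) = (t - s) * real k + (t - s)" by (simp add: algebra_simps)
  then show "grid s t n (Suc k) - grid s t n k = (t - s) / real (Suc n)"
    by (simp add: grid_def add_divide_distrib)
qed (simp add: grid_def)

lemma grid_mono: "s \<le> t \<Longrightarrow> j \<le> k \<Longrightarrow> grid s t n j \<le> grid s t n k"
  by (auto simp: grid_def intro!: divide_right_mono mult_left_mono)

lemma grid_less: "s < t \<Longrightarrow> grid s t n k < grid s t n (Suc k)"
  using grid_diff[of s t n k] by (smt (verit) divide_pos_pos of_nat_0_less_iff zero_less_Suc)

lemma grid_bounds: "s \<le> t \<Longrightarrow> k \<le> Suc n \<Longrightarrow> s \<le> grid s t n k \<and> grid s t n k \<le> t"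
  using grid_mono[of s t 0 k n] grid_mono[of s t k "Suc n" n] by simp

lemma grid_mesh_tendsto: "(\<lambda>n. (t - s) / real (Suc n)) \<longlonglongrightarrow> 0"
  using tendsto_mult_right_zero[OF LIMSEQ_inverse_real_of_nat, of "t - s"] by (simp add: divide_inverse)

text \<open>The closed form of the cell index shows that exactly one term of the step function in
  the Riemann sums is nonzero at a given time.\<close>

lemma grid_cell:
  assumes st: "s < t" and u: "s \<le> u"
  shows "grid s t n k \<le> u \<and> u < grid s t n (Suc k) \<longleftrightarrow> k = nat \<lfloor>(u - s) * real (Suc n) / (t - s)\<rfloor>"
proof -
  let ?y = "(u - s) * real (Suc n) / (t - s)"
  have p: "0 < real (Suc n)" by simp
  have y: "0 \<le> ?y" using st u by (intro divide_nonneg_nonneg mult_nonneg_nonneg) auto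
  have le: "grid s t n j \<le> u \<longleftrightarrow> real j \<le> ?y" for j
  proof -
    have "grid s t n j \<le> u \<longleftrightarrow> (t - s) * real j / real (Suc n) \<le> u - s" unfolding grid_def by linarith
    also have "\<dots> \<longleftrightarrow> (t - s) * real j \<le> (u - s) * real (Suc n)" using p by (simp add: pos_divide_le_eq del: of_nat_Suc)
    also have "\<dots> \<longleftrightarrow> real j \<le> ?y" using st by (simp add: pos_le_divide_eq mult.commute del: of_nat_Suc)
    finally show ?thesis .
  qed
  have "grid s t n k \<le> u \<and> u < grid s t n (Suc k) \<longleftrightarrow> real k \<le> ?y \<and> ?y < real k + 1"
    using le[of k] le[of "Suc k"] by (auto simp: not_le[symmetric])
  also have "\<dots> \<longleftrightarrow> \<lfloor>?y\<rfloor> = int k" by (simp add: floor_eq_iff)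
  also have "\<dots> \<longleftrightarrow> k = nat \<lfloor>?y\<rfloor>" using y by auto
  finally show ?thesis .
qed

text \<open>The function is sampled at left endpoints, so continuity from the left is enough. The
  exceptional point \<open>p\<close> leaves room for the event \<open>a < run_sup u w\<close>, which
  switches once as time grows.\<close>

lemma riemann_sum_tendsto:
  fixes f :: "real \<Rightarrow> complex"
  assumes st: "s < t" and f: "f \<in> borel_measurable borel"
    and bd: "\<And>u. u \<in> {s..t} \<Longrightarrow> norm (f u) \<le> C"
    and cont: "\<And>u. u \<in> {s<..<t} \<Longrightarrow> u \<noteq> p \<Longrightarrow> (f \<longlongrightarrow> f u) (at_left u)"
  shows "(\<lambda>n. \<Sum>k<Suc n. of_real ((t - s) / real (Suc n)) * f (grid s t n k)) \<longlonglongrightarrow> (LINT u:{s..t}|lborel. f u)"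
proof -
  define g where "g n u = (\<Sum>k<Suc n. indicator {grid s t n k..<grid s t n (Suc k)} u *\<^sub>R f (grid s t n k))" for n u
  define K where "K n u = nat \<lfloor>(u - s) * real (Suc n) / (t - s)\<rfloor>" for n u
  have g_eq: "g n u = f (grid s t n (K n u))" "K n u < Suc n" if u: "u \<in> {s..<t}" for n u
  proof -
    have "grid s t n (K n u) \<le> u" using grid_cell[OF st, of u n "K n u"] u by (auto simp: K_def)
    then show K: "K n u < Suc n"
      using u grid_mono[of s t "Suc n" "K n u" n] st by (intro not_le_imp_less) auto
    have "g n u = (\<Sum>k<Suc n. if k = K n u then f (grid s t n k) else 0)"
      unfolding g_def using grid_cell[OF st, of u n] u
      by (intro sum.cong) (auto simp: K_def indicator_def)
    also have "\<dots> = f (grid s t n (K n u))" using K by (simp add: sum.delta)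
    finally show "g n u = f (grid s t n (K n u))" .
  qed
  have g_out: "g n u = 0" if "u \<notin> {s..<t}" for n u
    unfolding g_def
  proof (intro sum.neutral ballI)
    fix k assume "k \<in> {..<Suc n}"
    then have "s \<le> grid s t n k" "grid s t n (Suc k) \<le> t" using grid_bounds[of s t k n] grid_bounds[of s t "Suc k" n] st by auto
    with that have "u \<notin> {grid s t n k..<grid s t n (Suc k)}" by auto
    then show "indicator {grid s t n k..<grid s t n (Suc k)} u *\<^sub>R f (grid s t n k) = 0" by simp
  qed
  have lim: "(\<lambda>n. g n u) \<longlonglongrightarrow> indicator {s..t} u *\<^sub>R f u" if "u \<noteq> s" "u \<noteq> t" "u \<noteq> p" for u
  proof (cases "u \<in> {s<..<t}")
    case True
    have cell: "grid s t n (K n u) \<le> u" "u < grid s t n (Suc (K n u))" for n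
      using grid_cell[OF st, of u n "K n u"] True by (auto simp: K_def)
    have to: "(\<lambda>n. grid s t n (K n u)) \<longlonglongrightarrow> u"
    proof (rule tendsto_sandwich)
      show "\<forall>\<^sub>F n in sequentially. u - (t - s) / real (Suc n) \<le> grid s t n (K n u)"
        using cell(2) grid_diff[of s t] by (intro always_eventually allI) (smt (verit))
      show "(\<lambda>n. u - (t - s) / real (Suc n)) \<longlonglongrightarrow> u"
        using tendsto_diff[OF tendsto_const[of u] grid_mesh_tendsto[of t s]] by simp
    qed (use cell(1) in auto)
    \<comment> \<open>The left endpoint of the cell may coincide with \<open>u\<close>, so the limit
      is taken within the closed ray and without excluding \<open>u\<close>.\<close>
    have "(f \<longlongrightarrow> f u) (at u within {..u})"
    proof (rule Lim_withinI)
      fix e :: real assume "0 < e"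
      with cont[OF True that(3)] obtain d where d: "0 < d"
          "\<And>x. x \<in> {..<u} \<Longrightarrow> 0 < dist x u \<and> dist x u < d \<Longrightarrow> dist (f x) (f u) < e"
        unfolding Lim_within by metis
      have "dist (f x) (f u) \<le> e" if "x \<in> {..u}" "0 < dist x u \<and> dist x u < d" for x
        using d(2)[of x] that by (cases "x = u") (auto intro: less_imp_le)
      with d(1) show "\<exists>d>0. \<forall>x\<in>{..u}. 0 < dist x u \<and> dist x u < d \<longrightarrow> dist (f x) (f u) \<le> e"
        by blast
    qed
    then have "continuous (at u within {..u}) f" by (simp add: continuous_within)
    then have "(\<lambda>n. f (grid s t n (K n u))) \<longlonglongrightarrow> f u"
      by (rule continuous_within_tendsto_compose'[OF _ _ to]) (use cell(1) in auto)
    then show ?thesis using g_eq(1)[of u] True by simp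
  next
    case False
    then have "u \<notin> {s..t}" "u \<notin> {s..<t}" using that by auto
    then show ?thesis using g_out[of u] by simp
  qed
  have gm[measurable]: "g n \<in> borel_measurable lborel" for n unfolding g_def by measurable
  have C0: "0 \<le> C" using bd[of s] st by (meson atLeastAtMost_iff less_imp_le norm_ge_zero order_refl order_trans)
  have int: "integrable lborel (\<lambda>u. indicator {s..t} u *\<^sub>R C)"
    using st by (intro integrable_scaleR_left) (simp add: integrable_indicator_iff)
  have "(\<lambda>n. LINT u|lborel. g n u) \<longlonglongrightarrow> (LINT u|lborel. indicator {s..t} u *\<^sub>R f u)"
  proof (rule integral_dominated_convergence[OF _ _ int])
    show "AE u in lborel. (\<lambda>n. g n u) \<longlonglongrightarrow> indicator {s..t} u *\<^sub>R f u"
    proof (rule AE_mp[OF AE_lborel_singleton[of s]], rule AE_mp[OF AE_lborel_singleton[of t]],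
        rule AE_mp[OF AE_lborel_singleton[of p]], intro AE_I2 impI)
      fix u assume "u \<noteq> p" "u \<noteq> t" "u \<noteq> s" then show "(\<lambda>n. g n u) \<longlonglongrightarrow> indicator {s..t} u *\<^sub>R f u" by (intro lim)
    qed
    show "AE u in lborel. norm (g n u) \<le> indicator {s..t} u *\<^sub>R C" for n
    proof (rule AE_I2)
      fix u
      show "norm (g n u) \<le> indicator {s..t} u *\<^sub>R C"
      proof (cases "u \<in> {s..<t}")
        case True
        then have "norm (g n u) \<le> C"
          using g_eq[of u n] grid_bounds[of s t "K n u" n] st by (auto intro!: bd)
        with True show ?thesis by simp
      qed (use g_out C0 in simp)
    qed
  qed (use f in measurable)
  moreover have "(LINT u|lborel. g n u) = (\<Sum>k<Suc n. of_real ((t - s) / real (Suc n)) * f (grid s t n k))" for n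
  proof -
    have "(LINT u|lborel. g n u) = (\<Sum>k<Suc n. LINT u|lborel. indicator {grid s t n k..<grid s t n (Suc k)} u *\<^sub>R f (grid s t n k))"
      unfolding g_def by (rule Bochner_Integration.integral_sum) (intro integrable_scaleR_left, simp add: integrable_indicator_iff less_imp_le[OF grid_less[OF st]])
    also have "\<dots> = (\<Sum>k<Suc n. of_real ((t - s) / real (Suc n)) * f (grid s t n k))"
      using grid_less[OF st, of n] grid_diff[of s t n] by (intro sum.cong) (simp_all add: scaleR_conv_of_real less_imp_le)
    finally show ?thesis .
  qed
  ultimately show ?thesis by (simp add: set_lebesgue_integral_def)
qed

text \<open>A discrete substitute for the first passage over \<open>a\<close>: on this event the
  passage time, rounded up to the grid, is \<open>grid s t n (Suc k)\<close>. The event belongs to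
  the past of that deterministic time, so no stopping theorem is required.\<close>

definition crosses :: "real \<Rightarrow> real \<Rightarrow> real \<Rightarrow> nat \<Rightarrow> nat \<Rightarrow> (real \<Rightarrow> real) \<Rightarrow> bool" where
  "crosses a s t n k w \<longleftrightarrow> run_sup (grid s t n k) w \<le> a \<and> a < run_sup (grid s t n (Suc k)) w"

lemma crosses_unique:
  assumes "w \<in> path_space" "0 \<le> s" "s \<le> t" "crosses a s t n j w" "crosses a s t n k w"
  shows "j = k"
proof -
  have *: False if "crosses a s t n j w" "crosses a s t n k w" "j < k" for j k
  proof -
    have "run_sup (grid s t n (Suc j)) w \<le> run_sup (grid s t n k) w"
      using assms(1-3) that(3) grid_mono[of s t 0 "Suc j" n] by (intro run_sup_mono grid_mono) auto
    with that show False by (auto simp: crosses_def)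
  qed
  show ?thesis using *[of j k] *[of k j] assms by (cases j k rule: linorder_cases) auto
qed

lemma crosses_exists:
  assumes w: "w \<in> path_space" and st: "0 \<le> s" "s \<le> t" and le: "run_sup s w \<le> a" and gt: "a < run_sup t w"
  shows "\<exists>k<Suc n. crosses a s t n k w"
proof (rule ccontr)
  assume "\<not> ?thesis"
  then have *: "\<And>k. k < Suc n \<Longrightarrow> run_sup (grid s t n k) w \<le> a \<Longrightarrow> run_sup (grid s t n (Suc k)) w \<le> a"
    by (auto simp: crosses_def not_less)
  have "run_sup (grid s t n k) w \<le> a" if "k \<le> Suc n" for k
    using that by (induction k) (use le * in auto)
  from this[of "Suc n"] gt show False by simp
qed

lemma crosses_imp:
  assumes w: "w \<in> path_space" and st: "0 \<le> s" "s \<le> t" and c: "crosses a s t n k w" and k: "k < Suc n"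
  shows "run_sup s w \<le> a" "a < run_sup t w"
proof -
  have "run_sup s w \<le> run_sup (grid s t n k) w" "run_sup (grid s t n (Suc k)) w \<le> run_sup t w"
    using grid_bounds[of s t k n] grid_bounds[of s t "Suc k" n] st k by (auto intro!: run_sup_mono w)
  with c show "run_sup s w \<le> a" "a < run_sup t w" by (auto simp: crosses_def)
qed

lemma crosses_hits:
  assumes w: "w \<in> path_space" and st: "0 \<le> s" "s \<le> t" and c: "crosses a s t n k w"
  shows "\<exists>v\<in>{grid s t n k..grid s t n (Suc k)}. coord v w = a"
proof -
  let ?p = "grid s t n k" and ?q = "grid s t n (Suc k)"
  have p0: "0 \<le> ?p" using grid_mono[of s t 0 k n] st by simp
  have pq: "?p \<le> ?q" using grid_mono[of s t k "Suc k" n] st by simp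
  from c have le: "run_sup ?p w \<le> a" and gt: "a < run_sup ?q w" by (auto simp: crosses_def)
  from gt obtain u where u: "u \<in> {0..?q}" "a < coord u w" using run_sup_gt_iff[OF w] p0 pq by auto
  have up: "?p \<le> u"
    using coord_le_run_sup[OF w, of u ?p] u le by (intro leI) (auto dest: less_imp_le)
  have "coord ?p w \<le> a" using coord_le_run_sup[OF w p0 order_refl] le by simp
  moreover have "continuous_on {?p..u} (\<lambda>v. coord v w)"
    by (rule continuous_on_subset[OF path_space_continuous[OF w]]) (use p0 in auto)
  ultimately obtain v where "?p \<le> v" "v \<le> u" "coord v w = a"
    using IVT'[of "\<lambda>v. coord v w" ?p a u] u up by auto
  then show ?thesis using u by auto
qed

text \<open>Inside the crossing cell the path takes the value \<open>a\<close>, by the intermediate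
  value theorem; uniform continuity on \<open>{0..t}\<close> then bounds its distance from
  \<open>a\<close> at the end of the cell once the mesh is small.\<close>

lemma crosses_near:
  assumes w: "w \<in> path_space" and st: "0 \<le> s" "s < t" and e: "0 < e"
  shows "\<forall>\<^sub>F n in sequentially. \<forall>k<Suc n. crosses a s t n k w \<longrightarrow> \<bar>coord (grid s t n (Suc k)) w - a\<bar> < e"
proof -
  have "uniformly_continuous_on {0..t} (\<lambda>v. coord v w)"
    by (rule compact_uniformly_continuous[OF continuous_on_subset[OF path_space_continuous[OF w]]]) auto
  then obtain d where d: "0 < d" "\<And>u v. u \<in> {0..t} \<Longrightarrow> v \<in> {0..t} \<Longrightarrow> dist v u < d \<Longrightarrow> dist (coord v w) (coord u w) < e"
    by (rule uniformly_continuous_onE[OF _ e]) blast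
  have "\<forall>\<^sub>F n in sequentially. (t - s) / real (Suc n) < d"
    using order_tendstoD(2)[OF grid_mesh_tendsto d(1)] .
  then show ?thesis
  proof eventually_elim
    case (elim n)
    show ?case
    proof (intro allI impI)
      fix k assume k: "k < Suc n" and c: "crosses a s t n k w"
      obtain v where v: "v \<in> {grid s t n k..grid s t n (Suc k)}" "coord v w = a"
        using crosses_hits[OF w st(1) _ c] st by auto
      have "dist (coord (grid s t n (Suc k)) w) (coord v w) < e"
      proof (rule d(2))
        show "v \<in> {0..t}" "grid s t n (Suc k) \<in> {0..t}"
          using v grid_bounds[of s t k n] grid_bounds[of s t "Suc k" n] k st by auto
        show "dist (grid s t n (Suc k)) v < d"
          using v elim grid_diff[of s t n k] by (auto simp: dist_real_def)
      qed
      then show "\<bar>coord (grid s t n (Suc k)) w - a\<bar> < e" by (simp add: v dist_real_def)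
    qed
  qed
qed

text \<open>At most one cell is a crossing cell, so the sum is a single value of \<open>f\<close>
  taken at a point that tends to \<open>a\<close>.\<close>

lemma sum_crosses_tendsto:
  fixes f :: "real \<Rightarrow> real"
  assumes w: "w \<in> path_space" and st: "0 \<le> s" "s < t" and f: "isCont f a"
  shows "(\<lambda>n. \<Sum>k<Suc n. if crosses a s t n k w then f (coord (grid s t n (Suc k)) w) else 0)
     \<longlonglongrightarrow> (if run_sup s w \<le> a \<and> a < run_sup t w then f a else 0)"
proof (cases "run_sup s w \<le> a \<and> a < run_sup t w")
  case False
  have "(\<Sum>k<Suc n. if crosses a s t n k w then f (coord (grid s t n (Suc k)) w) else 0) = 0" for n
    using crosses_imp[OF w st(1) less_imp_le[OF st(2)], of a n] False by (intro sum.neutral) auto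
  then show ?thesis using False by (simp only: if_False tendsto_const)
next
  case True
  obtain K where K: "\<And>n. K n < Suc n" "\<And>n. crosses a s t n (K n) w"
    using crosses_exists[OF w st(1) less_imp_le[OF st(2)]] True by metis
  have eq: "(\<Sum>k<Suc n. if crosses a s t n k w then f (coord (grid s t n (Suc k)) w) else 0)
      = f (coord (grid s t n (Suc (K n))) w)" for n
  proof -
    have "(\<Sum>k<Suc n. if crosses a s t n k w then f (coord (grid s t n (Suc k)) w) else 0)
      = (\<Sum>k<Suc n. if k = K n then f (coord (grid s t n (Suc k)) w) else 0)"
      using crosses_unique[OF w st(1) less_imp_le[OF st(2)]] K by (intro sum.cong) auto
    then show ?thesis using K(1)[of n] by (simp add: sum.delta)
  qed
  have "(\<lambda>n. coord (grid s t n (Suc (K n))) w) \<longlonglongrightarrow> a"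
  proof (rule tendstoI)
    fix e :: real assume "0 < e"
    from crosses_near[OF w st this, of a]
    show "\<forall>\<^sub>F n in sequentially. dist (coord (grid s t n (Suc (K n))) w) a < e"
      by eventually_elim (use K in \<open>auto simp: dist_real_def\<close>)
  qed
  then have "(\<lambda>n. f (coord (grid s t n (Suc (K n))) w)) \<longlonglongrightarrow> f a"
    by (rule isCont_tendsto_compose[OF f])
  then show ?thesis using True by (simp only: eq) simp
qed

lemma sum_crosses_bounded:
  fixes f :: "nat \<Rightarrow> real"
  assumes w: "w \<in> path_space" and st: "0 \<le> s" "s \<le> t" and B: "0 \<le> B" "\<And>k. \<bar>f k\<bar> \<le> B"
  shows "\<bar>\<Sum>k<Suc n. if crosses a s t n k w then f k else 0\<bar> \<le> B"
proof (cases "\<exists>j<Suc n. crosses a s t n j w")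
  case True
  then obtain j where j: "j < Suc n" "crosses a s t n j w" by auto
  have "(\<Sum>k<Suc n. if crosses a s t n k w then f k else 0) = (\<Sum>k<Suc n. if k = j then f k else 0)"
  proof -
    have "crosses a s t n k w \<longleftrightarrow> k = j" for k
      using crosses_unique[OF w st _ j(2), of k] j(2) by blast
    then show ?thesis by (simp only:)
  qed
  also have "\<dots> = f j" using j(1) by (simp only: sum.delta finite_lessThan lessThan_iff if_True)
  finally show ?thesis using B by (simp only:)
next
  case False
  then have "(\<Sum>k<Suc n. if crosses a s t n k w then f k else 0) = 0" by (intro sum.neutral) auto
  then show ?thesis using B by simp
qed

section \<open>Brownian motion with the drifts of either sign\<close>

text \<open>The factor \<open>exp (\<theta>\<^sup>2 * u / 2)\<close> undoes the Gaussian decay of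
  the characteristic function. Hence under drift \<mu> a time step of length \<open>d\<close>
  multiplies its conditional mean by the phase \<open>iexp (\<mu> * d * \<theta>)\<close> only, and
  for \<open>\<theta> = 0\<close> it is the constant 1.\<close>

definition expmart :: "real \<Rightarrow> real \<Rightarrow> (real \<Rightarrow> real) \<Rightarrow> complex" where
  "expmart \<theta> u w = iexp (\<theta> * coord u w) * of_real (exp (\<theta>\<^sup>2 * u / 2))"

lemma norm_expmart: "norm (expmart \<theta> u w) = exp (\<theta>\<^sup>2 * u / 2)"
  by (simp add: expmart_def norm_mult)

lemma norm_expmart_le: "u \<le> t \<Longrightarrow> norm (expmart \<theta> u w) \<le> exp (\<theta>\<^sup>2 * t / 2)"
  by (simp add: norm_expmart mult_left_mono)

lemma measurable_expmart: "0 \<le> u \<Longrightarrow> u \<le> t \<Longrightarrow> expmart \<theta> u \<in> borel_measurable (filt t)"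
  using measurable_coord_filt[of u t] unfolding expmart_def by measurable

lemma integral_expmart_step:
  fixes G :: "(real \<Rightarrow> real) \<Rightarrow> complex"
  assumes R: "gauss_increments T \<mu> x R" and st: "0 \<le> s" "s \<le> t" "t \<le> T"
    and G: "G \<in> borel_measurable (filt s)" and C: "\<And>w. norm (G w) \<le> C"
  shows "(LINT w|R. G w * expmart \<theta> t w) = (LINT w|R. G w * expmart \<theta> s w) * iexp (\<mu> * (t - s) * \<theta>)"
proof (cases "s = t")
  case False
  with st have st': "s < t" by simp
  note G[measurable] measurable_expmart[OF st(1) order_refl, of \<theta>, measurable]
  let ?G = "\<lambda>w. G w * expmart \<theta> s w" and ?e = "exp (\<theta>\<^sup>2 * (t - s) / 2)"
  have eq: "G w * expmart \<theta> t w = of_real ?e * (?G w * iexp (\<theta> * (coord t w - coord s w)))" for w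
  proof -
    have "exp (\<theta>\<^sup>2 * t / 2) = exp (\<theta>\<^sup>2 * s / 2) * ?e"
      by (simp add: exp_add[symmetric] algebra_simps add_divide_distrib diff_divide_distrib)
    moreover have "iexp (\<theta> * coord t w) = iexp (\<theta> * coord s w) * iexp (\<theta> * (coord t w - coord s w))"
      by (simp add: exp_add[symmetric] algebra_simps)
    ultimately show ?thesis by (simp add: expmart_def)
  qed
  have C0: "0 \<le> C" using C[of undefined] norm_ge_zero order_trans by blast
  have A: "(LINT w|R. ?G w * iexp (\<theta> * (coord t w - coord s w)))
    = (LINT w|R. ?G w) * exp (\<i> * of_real (\<mu> * (t - s) * \<theta>) - of_real ((t - s) * \<theta>\<^sup>2 / 2))"
    by (rule integral_char_increment[OF R st(1) st' st(3), where C="C * exp (\<theta>\<^sup>2 * s / 2)"])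
       (use C C0 in \<open>auto simp: norm_mult norm_expmart intro!: mult_mono\<close>)
  have B: "of_real ?e * exp (\<i> * of_real (\<mu> * (t - s) * \<theta>) - of_real ((t - s) * \<theta>\<^sup>2 / 2)) = iexp (\<mu> * (t - s) * \<theta>)"
    unfolding exp_of_real[symmetric] exp_add[symmetric] by (simp add: mult.commute)
  have "(LINT w|R. G w * expmart \<theta> t w) = of_real ?e * (LINT w|R. ?G w * iexp (\<theta> * (coord t w - coord s w)))"
    unfolding eq by (rule integral_mult_right_zero)
  also have "\<dots> = (LINT w|R. ?G w) * (of_real ?e * exp (\<i> * of_real (\<mu> * (t - s) * \<theta>) - of_real ((t - s) * \<theta>\<^sup>2 / 2)))"
    unfolding A by (rule mult.left_commute)
  also have "\<dots> = (LINT w|R. ?G w) * iexp (\<mu> * (t - s) * \<theta>)"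
    unfolding B ..
  finally show ?thesis .
qed simp

text \<open>The factor \<open>min 1 \<bar>y\<bar>\<close> is bounded, continuous and zero at 0, as
  dominated convergence over crossing cells wants; the factor \<open>1 + exp y\<close> splits the
  estimate into an integral under \<open>R\<close> and one under \<open>Rp\<close>.\<close>

lemma abs_one_minus_exp_le: "\<bar>1 - exp y\<bar> \<le> min 1 \<bar>y\<bar> * (1 + exp y)" for y :: real
proof -
  have a: "\<bar>1 - exp y\<bar> \<le> 1 + exp y" using exp_gt_zero[of y] by linarith
  have "\<bar>1 - exp y\<bar> \<le> \<bar>y\<bar> * (1 + exp y)"
  proof (cases "0 \<le> y")
    case True
    have "1 - y \<le> exp (- y)" using exp_ge_add_one_self[of "-y"] by simp
    then have "(1 - y) * exp y \<le> exp (- y) * exp y" by (rule mult_right_mono) simp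
    then have "exp y - y * exp y \<le> 1" by (simp add: exp_minus algebra_simps)
    moreover have "0 \<le> y * exp y" using True by simp
    ultimately have "exp y - 1 \<le> y * (1 + exp y)" using True by (simp add: algebra_simps)
    then show ?thesis using True by simp
  next
    case False
    have "1 - exp y \<le> - y" using exp_ge_add_one_self[of y] by linarith
    moreover have "y * exp y \<le> 0" using False by (simp add: mult_nonpos_nonneg)
    moreover have "\<bar>y\<bar> * (1 + exp y) = - y - y * exp y" using False by (simp add: algebra_simps)
    moreover have "\<bar>1 - exp y\<bar> = 1 - exp y" using False by simp
    ultimately show ?thesis by linarith
  qed
  with a show ?thesis by (simp add: min_def)
qed

lemma iexp_quotient_tendsto: "(\<lambda>n. (iexp (c * (d / real (Suc n))) - 1) / of_real (d / real (Suc n))) \<longlonglongrightarrow> \<i> * of_real c"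
  if "d \<noteq> 0" for c d :: real
proof -
  have "((\<lambda>z. exp (\<i> * of_real c * z)) has_field_derivative \<i> * of_real c) (at 0)"
    by (auto intro!: derivative_eq_intros)
  then have *: "((\<lambda>h. (exp (\<i> * of_real c * h) - 1) / h) \<longlongrightarrow> \<i> * of_real c) (at 0)"
    by (simp add: DERIV_def)
  have "filterlim (\<lambda>n. complex_of_real (d / real (Suc n))) (at 0) sequentially"
  proof (rule filterlim_atI)
    show "(\<lambda>n. complex_of_real (d / real (Suc n))) \<longlonglongrightarrow> 0"
      using tendsto_of_real[OF tendsto_mult_right_zero[OF LIMSEQ_inverse_real_of_nat, of d], where 'a=complex]
      by (simp add: divide_inverse)
  qed (use that in \<open>simp add: of_nat_neq_0 del: of_nat_Suc\<close>)
  from filterlim_compose[OF * this] show ?thesis by (simp add: mult.assoc)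
qed

locale drift_pair =
  fixes P :: "(real \<Rightarrow> real) measure" and x l :: real
  assumes P: "\<And>T. gauss_increments T 0 x P" and l: "0 < l"
begin

abbreviation "R \<equiv> drift_law (- l) P"
abbreviation "Rp \<equiv> drift_law l P"

lemma R: "gauss_increments T (- l) x R" and Rp: "gauss_increments T l x Rp"
  using drift_law_gauss_increments[OF P] by blast+

sublocale P: prob_space P by (rule gauss_incrementsD(1)[OF P])
sublocale R: prob_space R by (rule gauss_incrementsD(1)[OF R])
sublocale Rp: prob_space Rp by (rule gauss_incrementsD(1)[OF Rp])

lemma space_R [simp]: "space R = path_space" and space_Rp [simp]: "space Rp = path_space"
  and space_P [simp]: "space P = path_space"
  using gauss_incrementsD(3)[OF R] gauss_incrementsD(3)[OF Rp] gauss_incrementsD(3)[OF P] by auto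

lemmas measurable_R = gauss_increments_measurable[OF R]
  and measurable_Rp = gauss_increments_measurable[OF Rp]
  and measurable_P = gauss_increments_measurable[OF P]

text \<open>The two Cameron-Martin densities belong to opposite drifts, so their quadratic terms
  cancel in the quotient and only the endpoint of the path remains.\<close>

lemma nn_integral_R_Rp:
  fixes f :: "(real \<Rightarrow> real) \<Rightarrow> ennreal"
  assumes T: "0 \<le> T" and f: "f \<in> borel_measurable (filt T)"
  shows "(\<integral>\<^sup>+w. ennreal (exp (2 * l * (coord T w - x))) * f w \<partial>R) = (\<integral>\<^sup>+w. f w \<partial>Rp)"
proof -
  note f[measurable]
  have [measurable]: "coord T \<in> borel_measurable (filt T)" by (rule measurable_coord_filt) (use T in auto)
  have "(\<integral>\<^sup>+w. ennreal (exp (2 * l * (coord T w - x))) * f w \<partial>R)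
     = (\<integral>\<^sup>+w. ennreal (exp (2 * l * (coord T w - x))) * f w * ennreal (tilt_density (- l) x T w) \<partial>P)"
    by (rule nn_integral_drift_law[OF P T]) measurable
  also have "\<dots> = (\<integral>\<^sup>+w. f w * ennreal (tilt_density l x T w) \<partial>P)"
  proof (rule nn_integral_cong)
    fix w
    have "tilt_density l x T w = exp (2 * l * (coord T w - x)) * tilt_density (- l) x T w"
      by (simp add: tilt_density_def exp_add[symmetric] algebra_simps)
    then show "ennreal (exp (2 * l * (coord T w - x))) * f w * ennreal (tilt_density (- l) x T w)
        = f w * ennreal (tilt_density l x T w)"
      by (simp add: ennreal_mult tilt_density_def mult_ac)
  qed
  also have "\<dots> = (\<integral>\<^sup>+w. f w \<partial>Rp)" by (rule nn_integral_drift_law[OF P T f, symmetric])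
  finally show ?thesis .
qed

lemma restr_Rp:
  assumes T: "0 \<le> T"
  shows "restr_to_subalg Rp (filt T) = density (restr_to_subalg R (filt T)) (\<lambda>w. ennreal (exp (2 * l * (coord T w - x))))"
proof (rule measure_eqI)
  note s = sets_restr_to_subalg[OF gauss_incrementsD(6)[OF R, of T]] and s' = sets_restr_to_subalg[OF gauss_incrementsD(6)[OF Rp, of T]]
  show "sets (restr_to_subalg Rp (filt T)) = sets (density (restr_to_subalg R (filt T)) (\<lambda>w. ennreal (exp (2 * l * (coord T w - x)))))"
    by (simp add: s s')
  fix A assume "A \<in> sets (restr_to_subalg Rp (filt T))"
  then have A[measurable]: "A \<in> sets (filt T)" by (simp add: s')
  have [measurable]: "coord T \<in> borel_measurable (filt T)" by (rule measurable_coord_filt) (use T in auto)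
  have "emeasure (restr_to_subalg Rp (filt T)) A = (\<integral>\<^sup>+w. indicator A w \<partial>Rp)"
    using A subsetD[OF gauss_incrementsD(5)[OF Rp, of T] A] by (simp add: emeasure_restr_to_subalg[OF gauss_incrementsD(6)[OF Rp]])
  also have "\<dots> = (\<integral>\<^sup>+w. ennreal (exp (2 * l * (coord T w - x))) * indicator A w \<partial>R)"
    by (rule nn_integral_R_Rp[OF T, symmetric]) measurable
  also have "\<dots> = (\<integral>\<^sup>+w. ennreal (exp (2 * l * (coord T w - x))) * indicator A w \<partial>restr_to_subalg R (filt T))"
    by (rule nn_integral_subalgebra2[OF gauss_incrementsD(6)[OF R], symmetric]) measurable
  also have "\<dots> = emeasure (density (restr_to_subalg R (filt T)) (\<lambda>w. ennreal (exp (2 * l * (coord T w - x))))) A"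
    by (subst emeasure_density) (auto simp: s cong: measurable_cong_sets)
  finally show "emeasure (restr_to_subalg Rp (filt T)) A
      = emeasure (density (restr_to_subalg R (filt T)) (\<lambda>w. ennreal (exp (2 * l * (coord T w - x))))) A" .
qed

lemma integral_R_Rp:
  fixes F :: "(real \<Rightarrow> real) \<Rightarrow> 'b :: {banach, second_countable_topology}"
  assumes T: "0 \<le> T" and F: "F \<in> borel_measurable (filt T)"
  shows "(LINT w|R. exp (2 * l * (coord T w - x)) *\<^sub>R F w) = (LINT w|Rp. F w)"
    and "integrable R (\<lambda>w. exp (2 * l * (coord T w - x)) *\<^sub>R F w) \<longleftrightarrow> integrable Rp F"
proof -
  let ?E = "\<lambda>w. exp (2 * l * (coord T w - x))"
  have [measurable]: "coord T \<in> borel_measurable (filt T)" by (rule measurable_coord_filt) (use T in auto)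
  note F[measurable]
  have EF: "(\<lambda>w. ?E w *\<^sub>R F w) \<in> borel_measurable (filt T)" by measurable
  note subR = gauss_incrementsD(6)[OF R, of T] and subRp = gauss_incrementsD(6)[OF Rp, of T]
  have m: "f \<in> borel_measurable (filt T) \<Longrightarrow> f \<in> borel_measurable (restr_to_subalg R (filt T))"
    for f :: "(real \<Rightarrow> real) \<Rightarrow> 'c::topological_space"
    by (rule measurable_in_subalg[OF subR])
  have mE: "?E \<in> borel_measurable (filt T)" by measurable
  show "(LINT w|R. ?E w *\<^sub>R F w) = (LINT w|Rp. F w)"
    unfolding integral_subalgebra2[OF subR EF, symmetric] integral_subalgebra2[OF subRp F, symmetric] restr_Rp[OF T]
    by (rule integral_density[symmetric]) (use m[OF F] m[OF mE] in auto)
  have "integrable R (\<lambda>w. ?E w *\<^sub>R F w) \<longleftrightarrow> integrable (restr_to_subalg R (filt T)) (\<lambda>w. ?E w *\<^sub>R F w)"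
    using integrable_in_subalg[OF subR EF] integrable_from_subalg[OF subR] by blast
  also have "\<dots> \<longleftrightarrow> integrable (restr_to_subalg Rp (filt T)) F"
    unfolding restr_Rp[OF T] by (rule integrable_density[symmetric]) (use m[OF F] m[OF mE] in auto)
  also have "\<dots> \<longleftrightarrow> integrable Rp F"
    using integrable_in_subalg[OF subRp F] integrable_from_subalg[OF subRp] by blast
  finally show "integrable R (\<lambda>w. ?E w *\<^sub>R F w) \<longleftrightarrow> integrable Rp F" .
qed

end

section \<open>The exponential process before and after passing a level\<close>

definition up_part :: "real \<Rightarrow> real \<Rightarrow> real \<Rightarrow> (real \<Rightarrow> real) \<Rightarrow> complex" where
  "up_part \<theta> a u w = (if a < run_sup u w then expmart \<theta> u w else 0)"

text \<open>Paths still below the level are followed under \<open>Rp\<close>, those counted in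
  \<open>up_part\<close> under \<open>R\<close>; together they describe \<open>R\<close> weighted by
  the event that \<open>a\<close> is eventually passed.\<close>

definition dn_part :: "real \<Rightarrow> real \<Rightarrow> real \<Rightarrow> (real \<Rightarrow> real) \<Rightarrow> complex" where
  "dn_part \<theta> a u w = (if a < run_sup u w then 0 else expmart \<theta> u w)"

lemma measurable_up_part: "0 \<le> u \<Longrightarrow> u \<le> t \<Longrightarrow> up_part \<theta> a u \<in> borel_measurable (filt t)"
  and measurable_dn_part: "0 \<le> u \<Longrightarrow> u \<le> t \<Longrightarrow> dn_part \<theta> a u \<in> borel_measurable (filt t)"
proof -
  assume "0 \<le> u" "u \<le> t"
  note [measurable] = measurable_expmart[OF this, of \<theta>] measurable_run_sup[OF this]
  show "up_part \<theta> a u \<in> borel_measurable (filt t)" unfolding up_part_def by measurable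
  show "dn_part \<theta> a u \<in> borel_measurable (filt t)" unfolding dn_part_def by measurable
qed

lemma norm_up_part: "u \<le> t \<Longrightarrow> norm (up_part \<theta> a u w) \<le> exp (\<theta>\<^sup>2 * t / 2)"
  and norm_dn_part: "u \<le> t \<Longrightarrow> norm (dn_part \<theta> a u w) \<le> exp (\<theta>\<^sup>2 * t / 2)"
  using norm_expmart_le[of u t \<theta> w] by (auto simp: up_part_def dn_part_def)

lemma measurable_time_expmart:
  assumes w: "w \<in> path_space" and t: "0 \<le> t"
  shows "(\<lambda>u. expmart \<theta> (clamp_time t u) w) \<in> borel_measurable borel"
    and "(\<lambda>u. run_sup (clamp_time t u) w) \<in> borel_measurable borel"
    and "(\<lambda>u. coord (clamp_time t u) w) \<in> borel_measurable borel"
proof -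
  have p: "(\<lambda>_. w) \<in> measurable borel (filt t)" using w by simp
  show "(\<lambda>u. run_sup (clamp_time t u) w) \<in> borel_measurable borel"
    by (rule measurable_run_sup_joint[OF t _ p]) simp
  show [measurable]: "(\<lambda>u. coord (clamp_time t u) w) \<in> borel_measurable borel"
    by (rule measurable_coord_joint[OF t _ p]) simp
  show "(\<lambda>u. expmart \<theta> (clamp_time t u) w) \<in> borel_measurable borel"
    unfolding expmart_def by measurable
qed

lemma continuous_time_expmart:
  assumes w: "w \<in> path_space" and t: "0 \<le> t"
  shows "continuous_on UNIV (\<lambda>u. expmart \<theta> (clamp_time t u) w)"
proof -
  have c: "continuous_on UNIV (clamp_time t)"
    unfolding clamp_time_def by (intro continuous_intros)
  then have "continuous_on UNIV (\<lambda>u. coord (clamp_time t u) w)"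
    by (intro continuous_on_compose2[OF path_space_continuous[OF w]]) (use clamp_time_bounds[OF t] in auto)
  then show ?thesis unfolding expmart_def by (intro continuous_intros c) auto
qed

text \<open>The running supremum is monotone in time, so the event switches at most once. The
  exceptional point is the infimum of the times at which it holds, and an irrelevant value if there
  are none.\<close>

lemma run_sup_level_at_left:
  assumes w: "w \<in> path_space"
  shows "\<exists>p. \<forall>u. 0 < u \<longrightarrow> u \<noteq> p \<longrightarrow> (\<forall>\<^sub>F v in at_left u. a < run_sup v w \<longleftrightarrow> a < run_sup u w)"
proof (intro exI allI impI)
  let ?A = "{u. 0 \<le> u \<and> a < run_sup u w}"
  fix u :: real assume u: "0 < u" "u \<noteq> Inf ?A"
  have bdd: "bdd_below ?A" by (auto intro!: bdd_belowI[of _ 0])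
  show "\<forall>\<^sub>F v in at_left u. a < run_sup v w \<longleftrightarrow> a < run_sup u w"
  proof (cases "a < run_sup u w")
    case False
    have "a < run_sup v w \<longleftrightarrow> a < run_sup u w" if "0 < v" "v < u" for v
      using run_sup_mono[OF w, of v u] that False by auto
    then show ?thesis using eventually_at_left_real[OF u(1)] by (rule eventually_mono[rotated]) auto
  next
    case True
    then have uA: "u \<in> ?A" using u by simp
    then have "Inf ?A < u" using cInf_lower[OF uA bdd] u(2) by simp
    then obtain v where v: "v \<in> ?A" "v < u" using cInf_lessD[of ?A u] uA by blast
    have "a < run_sup v' w \<longleftrightarrow> a < run_sup u w" if "v < v'" "v' < u" for v'
      using run_sup_mono[OF w, of v v'] run_sup_mono[OF w, of v' u] that v by auto
    then show ?thesis using eventually_at_left_real[OF v(2)] by (rule eventually_mono[rotated]) auto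
  qed
qed

text \<open>Dominated convergence takes the pathwise limit of the Riemann sums under the
  expectation; for each \<open>n\<close> the sum is finite and commutes with it.\<close>

lemma integral_riemann_tendsto:
  fixes H :: "real \<Rightarrow> (real \<Rightarrow> real) \<Rightarrow> complex" and G :: "(real \<Rightarrow> real) \<Rightarrow> complex"
  assumes M: "prob_space M" "space M = path_space" and st: "0 \<le> s" "s < t"
    and G: "G \<in> borel_measurable M" and B: "\<And>w. norm (G w) \<le> B"
    and H: "\<And>u. u \<in> {s..t} \<Longrightarrow> H u \<in> borel_measurable M"
    and HB: "\<And>u w. u \<in> {s..t} \<Longrightarrow> norm (H u w) \<le> B'"
    and lim: "\<And>w. w \<in> path_space \<Longrightarrow> (\<lambda>n. \<Sum>k<Suc n. of_real ((t - s) / real (Suc n)) * H (grid s t n k) w) \<longlonglongrightarrow> L w"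
  shows "(\<lambda>n. \<Sum>k<Suc n. of_real ((t - s) / real (Suc n)) * (LINT w|M. G w * H (grid s t n k) w))
    \<longlonglongrightarrow> (LINT w|M. G w * L w)"
proof -
  interpret prob_space M by (rule M)
  have g: "grid s t n k \<in> {s..t}" if "k < Suc n" for n k
    using grid_bounds[of s t k n] that st by auto
  have B0: "0 \<le> B" using B[of undefined] norm_ge_zero order_trans by blast
  have B'0: "0 \<le> B'" using HB[of s undefined] st by (meson atLeastAtMost_iff less_imp_le norm_ge_zero order_refl order_trans)
  let ?S = "\<lambda>n w. \<Sum>k<Suc n. of_real ((t - s) / real (Suc n)) * H (grid s t n k) w"
  have m: "(\<lambda>w. G w * H (grid s t n k) w) \<in> borel_measurable M" if "k < Suc n" for n k
    using G H[OF g[OF that]] by measurable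
  have int: "integrable M (\<lambda>w. G w * H (grid s t n k) w)" if "k < Suc n" for n k
    by (rule integrable_const_bound[where B="B * B'", OF _ m[OF that]])
       (auto simp: norm_mult intro!: AE_I2 mult_mono B HB g that B0)
  have S: "?S n \<in> borel_measurable M" for n
    by (intro borel_measurable_sum borel_measurable_times borel_measurable_const H g) auto
  have "(\<lambda>n. LINT w|M. G w * ?S n w) \<longlonglongrightarrow> (LINT w|M. G w * L w)"
  proof (rule integral_dominated_convergence[where w="\<lambda>_. B * ((t - s) * B')"])
    show "AE w in M. (\<lambda>n. G w * ?S n w) \<longlonglongrightarrow> G w * L w"
      by (rule AE_I2) (intro tendsto_mult_left lim, simp add: M)
    have L: "L \<in> borel_measurable M"
      by (rule borel_measurable_LIMSEQ_metric[OF S]) (use lim M in simp)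
    show "(\<lambda>w. G w * L w) \<in> borel_measurable M" using G L by measurable
    show "(\<lambda>w. G w * ?S n w) \<in> borel_measurable M" for n using G S[of n] by measurable
    show "AE w in M. norm (G w * ?S n w) \<le> B * ((t - s) * B')" for n
    proof (rule AE_I2)
      fix w
      have "norm (?S n w) \<le> (\<Sum>k<Suc n. (t - s) / real (Suc n) * B')"
      proof (rule sum_norm_le)
        fix k assume "k \<in> {..<Suc n}"
        then have "norm (H (grid s t n k) w) \<le> B'" by (intro HB g) simp
        moreover have "0 \<le> (t - s) / real (Suc n)" using st by (intro divide_nonneg_nonneg) auto
        ultimately show "norm (of_real ((t - s) / real (Suc n)) * H (grid s t n k) w) \<le> (t - s) / real (Suc n) * B'"
          unfolding norm_mult norm_of_real by (intro mult_mono) auto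
      qed
      also have "\<dots> = (t - s) * B'" by simp
      finally show "norm (G w * ?S n w) \<le> B * ((t - s) * B')"
        unfolding norm_mult by (intro mult_mono B B0) auto
    qed
  qed simp
  moreover have "(LINT w|M. G w * ?S n w) = (\<Sum>k<Suc n. of_real ((t - s) / real (Suc n)) * (LINT w|M. G w * H (grid s t n k) w))" for n
  proof -
    have "(LINT w|M. G w * ?S n w) = (LINT w|M. (\<Sum>k<Suc n. of_real ((t - s) / real (Suc n)) * (G w * H (grid s t n k) w)))"
      by (simp only: sum_distrib_left mult.left_commute)
    also have "\<dots> = (\<Sum>k<Suc n. LINT w|M. of_real ((t - s) / real (Suc n)) * (G w * H (grid s t n k) w))"
      by (rule Bochner_Integration.integral_sum) (intro integrable_mult_right int, simp)
    finally show ?thesis by (simp only: integral_mult_right_zero)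
  qed
  ultimately show ?thesis by simp
qed

lemma set_integral_clamp:
  fixes f :: "real \<Rightarrow> complex"
  assumes "0 \<le> s"
  shows "(LINT u:{s..t}|lborel. f (clamp_time t u)) = (LINT u:{s..t}|lborel. f u)"
  by (rule set_lebesgue_integral_cong) (use assms in auto)

lemma riemann_sum_up_dn_part:
  assumes w: "w \<in> path_space" and st: "0 \<le> s" "s < t"
  shows "(\<lambda>n. \<Sum>k<Suc n. of_real ((t - s) / real (Suc n)) * up_part \<theta> a (grid s t n k) w)
      \<longlonglongrightarrow> (LINT u:{s..t}|lborel. up_part \<theta> a u w)" (is ?up)
    and "(\<lambda>n. \<Sum>k<Suc n. of_real ((t - s) / real (Suc n)) * dn_part \<theta> a (grid s t n k) w)
      \<longlonglongrightarrow> (LINT u:{s..t}|lborel. dn_part \<theta> a u w)" (is ?dn)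
proof -
  have t0: "0 \<le> t" using st by simp
  note [measurable] = measurable_time_expmart[OF w t0]
  obtain p where p: "\<And>u. 0 < u \<Longrightarrow> u \<noteq> p \<Longrightarrow> \<forall>\<^sub>F v in at_left u. a < run_sup v w \<longleftrightarrow> a < run_sup u w"
    using run_sup_level_at_left[OF w] by metis
  have ev: "\<forall>\<^sub>F v in at_left u. (a < run_sup v w \<longleftrightarrow> a < run_sup u w) \<and> clamp_time t v = v"
    if "u \<in> {s<..<t}" "u \<noteq> p" for u
    using p[of u] that st eventually_at_left_real[of s u]
    by (auto intro!: eventually_conj elim: eventually_mono)
  have lim: "((\<lambda>v. expmart \<theta> (clamp_time t v) w) \<longlongrightarrow> expmart \<theta> u w) (at_left u)" if "u \<in> {s<..<t}" for u
  proof -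
    have "((\<lambda>v. expmart \<theta> (clamp_time t v) w) \<longlongrightarrow> expmart \<theta> (clamp_time t u) w) (at u)"
      using continuous_time_expmart[OF w t0, of \<theta>] by (simp add: continuous_on_def)
    then show ?thesis using that st by (auto intro: tendsto_within_subset)
  qed
  have g: "clamp_time t (grid s t n k) = grid s t n k" if "k < Suc n" for n k
    using grid_bounds[of s t k n] that st by (intro clamp_time_eq) auto
  have "(\<lambda>n. \<Sum>k<Suc n. of_real ((t - s) / real (Suc n)) * up_part \<theta> a (clamp_time t (grid s t n k)) w)
      \<longlonglongrightarrow> (LINT u:{s..t}|lborel. up_part \<theta> a (clamp_time t u) w)"
  proof (rule riemann_sum_tendsto[OF st(2)])
    show "(\<lambda>u. up_part \<theta> a (clamp_time t u) w) \<in> borel_measurable borel"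
      unfolding up_part_def by measurable
    show "norm (up_part \<theta> a (clamp_time t u) w) \<le> exp (\<theta>\<^sup>2 * t / 2)" for u
      by (rule norm_up_part) (use clamp_time_bounds[OF t0] in auto)
    fix u assume u: "u \<in> {s<..<t}" "u \<noteq> p"
    then have [simp]: "clamp_time t u = u" using st by simp
    have "((\<lambda>v. if a < run_sup u w then expmart \<theta> (clamp_time t v) w else 0) \<longlongrightarrow> up_part \<theta> a u w) (at_left u)"
      using lim[OF u(1)] by (auto simp: up_part_def)
    then show "((\<lambda>u. up_part \<theta> a (clamp_time t u) w) \<longlongrightarrow> up_part \<theta> a (clamp_time t u) w) (at_left u)"
      by (simp, rule Lim_transform_eventually) (use ev[OF u] in \<open>auto elim!: eventually_mono simp: up_part_def\<close>)
  qed
  then show ?up using g by (simp add: set_integral_clamp[OF st(1), of t "\<lambda>u. up_part \<theta> a u w"] del: sum.lessThan_Suc of_nat_Suc cong: sum.cong_simp)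
  have "(\<lambda>n. \<Sum>k<Suc n. of_real ((t - s) / real (Suc n)) * dn_part \<theta> a (clamp_time t (grid s t n k)) w)
      \<longlonglongrightarrow> (LINT u:{s..t}|lborel. dn_part \<theta> a (clamp_time t u) w)"
  proof (rule riemann_sum_tendsto[OF st(2)])
    show "(\<lambda>u. dn_part \<theta> a (clamp_time t u) w) \<in> borel_measurable borel"
      unfolding dn_part_def by measurable
    show "norm (dn_part \<theta> a (clamp_time t u) w) \<le> exp (\<theta>\<^sup>2 * t / 2)" for u
      by (rule norm_dn_part) (use clamp_time_bounds[OF t0] in auto)
    fix u assume u: "u \<in> {s<..<t}" "u \<noteq> p"
    then have [simp]: "clamp_time t u = u" using st by simp
    have "((\<lambda>v. if a < run_sup u w then 0 else expmart \<theta> (clamp_time t v) w) \<longlongrightarrow> dn_part \<theta> a u w) (at_left u)"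
      using lim[OF u(1)] by (auto simp: dn_part_def)
    then show "((\<lambda>u. dn_part \<theta> a (clamp_time t u) w) \<longlongrightarrow> dn_part \<theta> a (clamp_time t u) w) (at_left u)"
      by (simp, rule Lim_transform_eventually) (use ev[OF u] in \<open>auto elim!: eventually_mono simp: dn_part_def\<close>)
  qed
  then show ?dn using g by (simp add: set_integral_clamp[OF st(1), of t "\<lambda>u. dn_part \<theta> a u w"] del: sum.lessThan_Suc of_nat_Suc cong: sum.cong_simp)
qed

section \<open>The crossing identity\<close>

context drift_pair
begin

text \<open>After multiplication by \<open>exp (2 * l * (x - a))\<close> the density of
  \<open>Rp\<close> with respect to \<open>R\<close> on the past of \<open>q\<close> is
  \<open>exp (2 * l * (coord q w - a))\<close>. On a crossing event this is close to 1, and the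
  difference of the two integrals is the integral of its distance from 1.\<close>

lemma crossing_error:
  fixes a :: real and F :: "(real \<Rightarrow> real) \<Rightarrow> complex"
  assumes q: "0 \<le> q" and F: "F \<in> borel_measurable (filt q)" and B: "\<And>w. norm (F w) \<le> B"
    and c: "Measurable.pred (filt q) c"
  defines "M \<equiv> \<lambda>w. if c w then min 1 \<bar>2 * l * (coord q w - a)\<bar> else 0"
  shows "norm ((LINT w|R. (if c w then F w else 0)) - of_real (exp (2 * l * (x - a))) * (LINT w|Rp. (if c w then F w else 0)))
    \<le> B * ((LINT w|R. M w) + exp (2 * l * (x - a)) * (LINT w|Rp. M w))"
proof -
  let ?F = "\<lambda>w. if c w then F w else 0" and ?C = "exp (2 * l * (x - a))"
  let ?E = "\<lambda>w. exp (2 * l * (coord q w - a))" and ?Ex = "\<lambda>w. exp (2 * l * (coord q w - x))"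
  note F[measurable] c[measurable]
  have [measurable]: "coord q \<in> borel_measurable (filt q)" by (rule measurable_coord_filt) (use q in auto)
  have Fm: "?F \<in> borel_measurable (filt q)" by measurable
  have Mm: "M \<in> borel_measurable (filt q)" unfolding M_def by measurable
  have B0: "0 \<le> B" using B[of undefined] norm_ge_zero order_trans by blast
  have E: "?E w = ?C * ?Ex w" for w by (simp add: exp_add[symmetric] algebra_simps)
  have iF: "integrable R ?F" "integrable Rp ?F"
    using measurable_R(2)[OF Fm] measurable_Rp(2)[OF Fm] B B0
    by (auto intro!: R.integrable_const_bound[where B=B] Rp.integrable_const_bound[where B=B])
  have iM: "integrable R M" "integrable Rp M"
    using measurable_R(2)[OF Mm] measurable_Rp(2)[OF Mm]
    by (auto intro!: R.integrable_const_bound[where B=1] Rp.integrable_const_bound[where B=1] simp: M_def)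
  have iEF: "integrable R (\<lambda>w. ?Ex w *\<^sub>R ?F w)" and iEM: "integrable R (\<lambda>w. ?Ex w *\<^sub>R M w)"
    using integral_R_Rp(2)[OF q Fm] integral_R_Rp(2)[OF q Mm] iF iM by auto
  have EF: "of_real ?C * (LINT w|Rp. ?F w) = (LINT w|R. ?E w *\<^sub>R ?F w)"
    unfolding integral_R_Rp(1)[OF q Fm, symmetric] E integral_mult_right_zero[symmetric]
    by (simp add: scaleR_conv_of_real mult.assoc)
  have EM: "?C * (LINT w|Rp. M w) = (LINT w|R. ?E w * M w)"
    unfolding integral_R_Rp(1)[OF q Mm, symmetric] E integral_mult_right_zero[symmetric]
    by (simp add: mult.assoc)
  have iEF': "integrable R (\<lambda>w. ?E w *\<^sub>R ?F w)"
    using integrable_scaleR_right[OF iEF, of ?C] unfolding E by simp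
  have iEM': "integrable R (\<lambda>w. ?E w * M w)"
    using integrable_mult_right[OF iEM, of ?C] unfolding E by (simp add: mult.assoc)
  have "(LINT w|R. ?F w) - of_real ?C * (LINT w|Rp. ?F w) = (LINT w|R. ?F w - ?E w *\<^sub>R ?F w)"
    unfolding EF by (rule Bochner_Integration.integral_diff[OF iF(1) iEF', symmetric])
  also have "norm \<dots> \<le> (LINT w|R. B * (M w + ?E w * M w))"
  proof (rule order_trans[OF integral_norm_bound integral_mono])
    show "integrable R (\<lambda>w. norm (?F w - ?E w *\<^sub>R ?F w))"
      by (intro integrable_norm Bochner_Integration.integrable_diff iF iEF')
    show "integrable R (\<lambda>w. B * (M w + ?E w * M w))"
      by (intro integrable_mult_right Bochner_Integration.integrable_add iM iEM')
    fix w
    show "norm (?F w - ?E w *\<^sub>R ?F w) \<le> B * (M w + ?E w * M w)"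
    proof (cases "c w")
      case True
      have "norm (F w - ?E w *\<^sub>R F w) = norm ((1 - ?E w) *\<^sub>R F w)" by (simp add: scaleR_left_diff_distrib)
      also have "\<dots> = \<bar>1 - ?E w\<bar> * norm (F w)" by simp
      also have "\<dots> \<le> (M w * (1 + ?E w)) * B"
        using abs_one_minus_exp_le[of "2 * l * (coord q w - a)"] True
        by (intro mult_mono B) (auto simp: M_def)
      finally show ?thesis using True by (simp add: algebra_simps)
    qed (simp add: M_def)
  qed
  also have "\<dots> = B * ((LINT w|R. M w) + ?C * (LINT w|Rp. M w))"
    unfolding EM by (simp add: Bochner_Integration.integral_add[OF iM(1) iEM'])
  finally show ?thesis .
qed

lemma crossing_sum_tendsto:
  assumes M: "gauss_increments t \<mu> x M" and st: "0 \<le> s" "s < t"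
  shows "(\<lambda>n. \<Sum>k<Suc n. LINT w|M. (if crosses a s t n k w then min 1 \<bar>2 * l * (coord (grid s t n (Suc k)) w - a)\<bar> else 0)) \<longlonglongrightarrow> 0"
proof -
  note MD = gauss_incrementsD[OF M]
  interpret M: prob_space M by (rule MD)
  let ?f = "\<lambda>y. min 1 \<bar>2 * l * (y - a)\<bar>"
  let ?S = "\<lambda>n w. \<Sum>k<Suc n. if crosses a s t n k w then ?f (coord (grid s t n (Suc k)) w) else 0"
  have m: "(\<lambda>w. if crosses a s t n k w then ?f (coord (grid s t n (Suc k)) w) else 0) \<in> borel_measurable M"
    if "k < Suc n" for n k
  proof -
    have *: "0 \<le> grid s t n k" "0 \<le> grid s t n (Suc k)"
      using grid_bounds[of s t k n] grid_bounds[of s t "Suc k" n] that st by auto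
    note [measurable] = gauss_increments_measurable(1)[OF M measurable_run_sup_filt_inf[OF *(1)]]
      gauss_increments_measurable(1)[OF M measurable_run_sup_filt_inf[OF *(2)]]
      gauss_increments_measurable(1)[OF M measurable_coord_filt_inf[OF *(2)]]
    show ?thesis unfolding crosses_def by measurable
  qed
  have int: "integrable M (\<lambda>w. if crosses a s t n k w then ?f (coord (grid s t n (Suc k)) w) else 0)"
    if "k < Suc n" for n k
    by (rule M.integrable_const_bound[where B=1, OF _ m[OF that]]) auto
  have "(\<lambda>n. LINT w|M. ?S n w) \<longlonglongrightarrow> (LINT w|M. 0)"
  proof (rule integral_dominated_convergence[where w="\<lambda>_. 1"])
    show "AE w in M. (\<lambda>n. ?S n w) \<longlonglongrightarrow> 0"
    proof (rule AE_I2)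
      fix w assume "w \<in> space M"
      then have w: "w \<in> path_space" by (simp add: MD(3))
      have "isCont ?f a" by (intro continuous_intros)
      note lim = sum_crosses_tendsto[OF w st this]
      have "(if run_sup s w \<le> a \<and> a < run_sup t w then ?f a else 0) = 0" by simp
      with lim show "(\<lambda>n. ?S n w) \<longlonglongrightarrow> 0" by (simp only:)
    qed
    show "AE w in M. norm (?S n w) \<le> 1" for n
      unfolding real_norm_def
      by (rule AE_I2, rule sum_crosses_bounded) (use st in \<open>auto simp: MD(3)\<close>)
    show "?S n \<in> borel_measurable M" for n by (intro borel_measurable_sum m) auto
  qed simp_all
  moreover have "(LINT w|M. ?S n w) = (\<Sum>k<Suc n. LINT w|M. (if crosses a s t n k w then ?f (coord (grid s t n (Suc k)) w) else 0))" for n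
    by (rule Bochner_Integration.integral_sum) (use int in auto)
  ultimately show ?thesis by simp
qed

text \<open>For \<open>x \<le> a\<close> this is the probability under \<open>R\<close> that the path ever exceeds \<open>a\<close>.\<close>

abbreviation "hit_weight a \<equiv> exp (2 * l * (x - a))"

text \<open>Paths already sorted by time \<open>p\<close> evolve with the drift of their own
  measure. The paths crossing between \<open>p\<close> and \<open>q\<close> enter the upper part
  under \<open>R\<close> and leave the lower part under \<open>Rp\<close>.\<close>

lemma crossing_step:
  fixes a \<theta> :: real and G :: "(real \<Rightarrow> real) \<Rightarrow> complex"
  assumes pq: "0 \<le> p" "p \<le> q" and G: "G \<in> borel_measurable (filt p)" and B: "\<And>w. norm (G w) \<le> B"
  defines "c \<equiv> \<lambda>w. run_sup p w \<le> a \<and> a < run_sup q w"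
  shows "(LINT w|R. G w * up_part \<theta> a q w) = (LINT w|R. G w * up_part \<theta> a p w) * iexp (- l * (q - p) * \<theta>)
      + (LINT w|R. (if c w then G w * expmart \<theta> q w else 0))"
    and "(LINT w|Rp. G w * dn_part \<theta> a q w) = (LINT w|Rp. G w * dn_part \<theta> a p w) * iexp (l * (q - p) * \<theta>)
      - (LINT w|Rp. (if c w then G w * expmart \<theta> q w else 0))"
proof -
  have q: "0 \<le> q" using pq by simp
  have Sp: "run_sup p \<in> borel_measurable (filt p)" using pq by (intro measurable_run_sup) auto
  have Gq: "G \<in> borel_measurable (filt q)" by (rule measurable_filt_mono[OF G pq(2)])
  have Spq: "run_sup p \<in> borel_measurable (filt q)" by (rule measurable_filt_mono[OF Sp pq(2)])
  have Sq: "run_sup q \<in> borel_measurable (filt q)" using q by (intro measurable_run_sup) auto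
  have Eq: "expmart \<theta> q \<in> borel_measurable (filt q)" using q by (intro measurable_expmart) auto
  define G1 where "G1 w = (if a < run_sup p w then G w else 0)" for w
  define G2 where "G2 w = (if a < run_sup p w then 0 else G w)" for w
  have B0: "0 \<le> B" using B[of undefined] norm_ge_zero order_trans by blast
  have G1m: "G1 \<in> borel_measurable (filt p)" and G2m: "G2 \<in> borel_measurable (filt p)"
    unfolding G1_def G2_def using G Sp by measurable
  have G1B: "norm (G1 w) \<le> B" "norm (G2 w) \<le> B" for w using B B0 by (auto simp: G1_def G2_def)
  let ?K = "\<lambda>w. if c w then G w * expmart \<theta> q w else 0"
  have Km: "?K \<in> borel_measurable (filt q)" unfolding c_def using Gq Spq Sq Eq by measurable
  have KB: "norm (?K w) \<le> B * exp (\<theta>\<^sup>2 * q / 2)" for w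
    using B B0 by (auto simp: norm_mult norm_expmart intro: mult_right_mono)
  have GE: "norm (G' w * expmart \<theta> q w) \<le> B * exp (\<theta>\<^sup>2 * q / 2)" if "\<And>w. norm (G' w) \<le> B" for G' w
    using that by (auto simp: norm_mult norm_expmart intro: mult_right_mono)
  have G1q: "(\<lambda>w. G1 w * expmart \<theta> q w) \<in> borel_measurable (filt q)"
      "(\<lambda>w. G2 w * expmart \<theta> q w) \<in> borel_measurable (filt q)"
    using measurable_filt_mono[OF G1m pq(2)] measurable_filt_mono[OF G2m pq(2)] Eq by measurable
  have mono: "a < run_sup p w \<Longrightarrow> a < run_sup q w" if "w \<in> path_space" for w
    using run_sup_mono[OF that pq] by simp
  have "(LINT w|R. G w * up_part \<theta> a q w) = (LINT w|R. G1 w * expmart \<theta> q w + ?K w)"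
    by (rule Bochner_Integration.integral_cong) (use mono in \<open>auto simp: up_part_def G1_def c_def\<close>)
  also have "\<dots> = (LINT w|R. G1 w * expmart \<theta> q w) + (LINT w|R. ?K w)"
    by (intro Bochner_Integration.integral_add R.integrable_const_bound[where B="B * exp (\<theta>\<^sup>2 * q / 2)"] AE_I2
         KB GE G1B measurable_R(2)[OF Km] measurable_R(2)[OF G1q(1)])
  also have "(LINT w|R. G1 w * expmart \<theta> q w) = (LINT w|R. G1 w * expmart \<theta> p w) * iexp (- l * (q - p) * \<theta>)"
    by (rule integral_expmart_step[OF R pq order_refl G1m G1B(1)])
  also have "(LINT w|R. G1 w * expmart \<theta> p w) = (LINT w|R. G w * up_part \<theta> a p w)"
    by (rule Bochner_Integration.integral_cong) (auto simp: G1_def up_part_def)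
  finally show "(LINT w|R. G w * up_part \<theta> a q w) = (LINT w|R. G w * up_part \<theta> a p w) * iexp (- l * (q - p) * \<theta>)
      + (LINT w|R. ?K w)" .
  have "(LINT w|Rp. G w * dn_part \<theta> a q w) = (LINT w|Rp. G2 w * expmart \<theta> q w - ?K w)"
    by (rule Bochner_Integration.integral_cong) (use mono in \<open>auto simp: dn_part_def G2_def c_def\<close>)
  also have "\<dots> = (LINT w|Rp. G2 w * expmart \<theta> q w) - (LINT w|Rp. ?K w)"
    by (intro Bochner_Integration.integral_diff Rp.integrable_const_bound[where B="B * exp (\<theta>\<^sup>2 * q / 2)"] AE_I2
         KB GE G1B measurable_Rp(2)[OF Km] measurable_Rp(2)[OF G1q(2)])
  also have "(LINT w|Rp. G2 w * expmart \<theta> q w) = (LINT w|Rp. G2 w * expmart \<theta> p w) * iexp (l * (q - p) * \<theta>)"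
    by (rule integral_expmart_step[OF Rp pq order_refl G2m G1B(2)])
  also have "(LINT w|Rp. G2 w * expmart \<theta> p w) = (LINT w|Rp. G w * dn_part \<theta> a p w)"
    by (rule Bochner_Integration.integral_cong) (auto simp: G2_def dn_part_def)
  finally show "(LINT w|Rp. G w * dn_part \<theta> a q w) = (LINT w|Rp. G w * dn_part \<theta> a p w) * iexp (l * (q - p) * \<theta>)
      - (LINT w|Rp. ?K w)" .
qed

text \<open>Weighted by \<open>hit_weight a\<close>, the loss of the lower part in a cell almost
  balances the gain of the upper part, and the total imbalance vanishes as the mesh shrinks. What
  survives is the motion inside each part: drift \<open>- l\<close> above the level and drift
  \<open>l\<close> below it.\<close>

lemma crossing_identity:
  fixes a \<theta> :: real and G :: "(real \<Rightarrow> real) \<Rightarrow> complex"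
  assumes st: "0 \<le> s" "s < t" and G: "G \<in> borel_measurable (filt s)" and B: "\<And>w. norm (G w) \<le> B"
  defines "V \<equiv> \<lambda>u. (LINT w|R. G w * up_part \<theta> a u w) + of_real (hit_weight a) * (LINT w|Rp. G w * dn_part \<theta> a u w)"
  shows "V t - V s = \<i> * of_real (- l * \<theta>) * (LINT w|R. G w * (LINT u:{s..t}|lborel. up_part \<theta> a u w))
     + of_real (hit_weight a) * (\<i> * of_real (l * \<theta>) * (LINT w|Rp. G w * (LINT u:{s..t}|lborel. dn_part \<theta> a u w)))"
proof -
  have B0: "0 \<le> B" using B[of undefined] norm_ge_zero order_trans by blast
  let ?h = "\<lambda>n. (t - s) / real (Suc n)" and ?g = "grid s t"
  \<comment> \<open>A difference quotient of the phase that a cell contributes; it tends to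
    \<open>\<i> * of_real b\<close>, and dividing by the mesh turns \<open>U\<close> and
    \<open>D\<close> into Riemann sums in time.\<close>
  define c where "c b n = (iexp (b * ?h n) - 1) / of_real (?h n)" for b n
  define U where "U n = (\<Sum>k<Suc n. of_real (?h n) * (LINT w|R. G w * up_part \<theta> a (?g n k) w))" for n
  define D where "D n = (\<Sum>k<Suc n. of_real (?h n) * (LINT w|Rp. G w * dn_part \<theta> a (?g n k) w))" for n
  define E where "E n k = (LINT w|R. (if crosses a s t n k w then G w * expmart \<theta> (?g n (Suc k)) w else 0))
     - of_real (hit_weight a) * (LINT w|Rp. (if crosses a s t n k w then G w * expmart \<theta> (?g n (Suc k)) w else 0))" for n k
  have hne: "complex_of_real (?h n) \<noteq> 0" for n using st by (simp del: of_nat_Suc)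
  have step: "V (?g n (Suc k)) - V (?g n k) = c (- l * \<theta>) n * (of_real (?h n) * (LINT w|R. G w * up_part \<theta> a (?g n k) w))
     + of_real (hit_weight a) * (c (l * \<theta>) n * (of_real (?h n) * (LINT w|Rp. G w * dn_part \<theta> a (?g n k) w))) + E n k"
    if k: "k < Suc n" for n k
  proof -
    have p: "0 \<le> ?g n k" "?g n k \<le> ?g n (Suc k)" "s \<le> ?g n k"
      using grid_bounds[of s t k n] grid_mono[of s t k "Suc k" n] st k by auto
    have iexp: "iexp (b * ?h n) = 1 + c b n * of_real (?h n)" for b
      unfolding c_def using hne[of n] by (simp del: of_nat_Suc)
    note cs = crossing_step[OF p(1,2) measurable_filt_mono[OF G p(3)] B, of \<theta> a, folded crosses_def]
    have e: "- l * (?g n (Suc k) - ?g n k) * \<theta> = (- l * \<theta>) * ?h n" "l * (?g n (Suc k) - ?g n k) * \<theta> = (l * \<theta>) * ?h n"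
      unfolding grid_diff by simp_all
    show ?thesis
      unfolding V_def cs E_def e iexp by (simp add: algebra_simps del: of_nat_Suc)
  qed
  have "V t - V s = (\<Sum>k<Suc n. V (?g n (Suc k)) - V (?g n k))" for n
    by (subst sum_lessThan_telescope) simp
  then have tele: "V t - V s = (\<Sum>k<Suc n. V (?g n (Suc k)) - V (?g n k))" for n .
  have sum: "V t - V s = c (- l * \<theta>) n * U n + of_real (hit_weight a) * (c (l * \<theta>) n * D n) + (\<Sum>k<Suc n. E n k)" for n
  proof -
    have "V t - V s = (\<Sum>k<Suc n. c (- l * \<theta>) n * (of_real (?h n) * (LINT w|R. G w * up_part \<theta> a (?g n k) w))
       + of_real (hit_weight a) * (c (l * \<theta>) n * (of_real (?h n) * (LINT w|Rp. G w * dn_part \<theta> a (?g n k) w))) + E n k)"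
      unfolding tele[of n] by (rule sum.cong[OF refl step]) simp
    then show ?thesis unfolding U_def D_def by (simp only: sum.distrib sum_distrib_left)
  qed
  have Gm: "G \<in> borel_measurable R" "G \<in> borel_measurable Rp" by (rule measurable_R(2)[OF G] measurable_Rp(2)[OF G])+
  have "U \<longlonglongrightarrow> (LINT w|R. G w * (LINT u:{s..t}|lborel. up_part \<theta> a u w))"
    unfolding U_def
    by (rule integral_riemann_tendsto[OF _ _ st Gm(1) B _ norm_up_part riemann_sum_up_dn_part(1)[OF _ st]])
       (use st in \<open>auto intro!: measurable_R(2)[OF measurable_up_part] R.prob_space_axioms\<close>)
  moreover have "D \<longlonglongrightarrow> (LINT w|Rp. G w * (LINT u:{s..t}|lborel. dn_part \<theta> a u w))"
    unfolding D_def
    by (rule integral_riemann_tendsto[OF _ _ st Gm(2) B _ norm_dn_part riemann_sum_up_dn_part(2)[OF _ st]])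
       (use st in \<open>auto intro!: measurable_Rp(2)[OF measurable_dn_part] Rp.prob_space_axioms\<close>)
  moreover have "c b \<longlonglongrightarrow> \<i> * of_real b" for b
    unfolding c_def by (rule iexp_quotient_tendsto) (use st in simp)
  moreover have "(\<lambda>n. \<Sum>k<Suc n. E n k) \<longlonglongrightarrow> 0"
  proof (rule Lim_null_comparison)
    let ?m = "\<lambda>n k w. if crosses a s t n k w then min 1 \<bar>2 * l * (coord (?g n (Suc k)) w - a)\<bar> else 0"
    let ?BB = "B * exp (\<theta>\<^sup>2 * t / 2)"
    let ?X = "\<lambda>n. ?BB * ((\<Sum>k<Suc n. LINT w|R. ?m n k w) + hit_weight a * (\<Sum>k<Suc n. LINT w|Rp. ?m n k w))"
    have "norm (E n k) \<le> ?BB * ((LINT w|R. ?m n k w) + hit_weight a * (LINT w|Rp. ?m n k w))" if k: "k < Suc n" for n k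
      unfolding E_def
    proof (rule crossing_error)
      have g: "0 \<le> ?g n k" "?g n k \<le> ?g n (Suc k)" "s \<le> ?g n (Suc k)" "?g n (Suc k) \<le> t"
        using grid_bounds[of s t k n] grid_bounds[of s t "Suc k" n] grid_mono[of s t k "Suc k" n] st k by auto
      then show q: "0 \<le> ?g n (Suc k)" by simp
      note [measurable] = measurable_filt_mono[OF G g(3)] measurable_expmart[OF q order_refl, of \<theta>]
        measurable_run_sup[OF g(1,2)] measurable_run_sup[OF q order_refl]
      show "(\<lambda>w. G w * expmart \<theta> (?g n (Suc k)) w) \<in> borel_measurable (filt (?g n (Suc k)))" by measurable
      show "Measurable.pred (filt (?g n (Suc k))) (crosses a s t n k)" unfolding crosses_def[abs_def] by measurable
      show "norm (G w * expmart \<theta> (?g n (Suc k)) w) \<le> ?BB" for w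
        unfolding norm_mult by (intro mult_mono B norm_expmart_le g B0) auto
    qed
    then have "norm (\<Sum>k<Suc n. E n k)
        \<le> (\<Sum>k<Suc n. ?BB * ((LINT w|R. ?m n k w) + hit_weight a * (LINT w|Rp. ?m n k w)))" for n
      by (intro sum_norm_le) simp
    then show "\<forall>\<^sub>F n in sequentially. norm (\<Sum>k<Suc n. E n k) \<le> ?X n"
      by (simp only: sum_distrib_left[symmetric] sum.distrib eventually_True)
    have "?X \<longlonglongrightarrow> ?BB * (0 + hit_weight a * 0)"
      by (intro tendsto_intros crossing_sum_tendsto[OF R st] crossing_sum_tendsto[OF Rp st])
    then show "?X \<longlonglongrightarrow> 0" by simp
  qed
  ultimately have "(\<lambda>n. c (- l * \<theta>) n * U n + of_real (hit_weight a) * (c (l * \<theta>) n * D n) + (\<Sum>k<Suc n. E n k))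
     \<longlonglongrightarrow> \<i> * of_real (- l * \<theta>) * (LINT w|R. G w * (LINT u:{s..t}|lborel. up_part \<theta> a u w))
     + of_real (hit_weight a) * (\<i> * of_real (l * \<theta>) * (LINT w|Rp. G w * (LINT u:{s..t}|lborel. dn_part \<theta> a u w))) + 0"
    by (intro tendsto_add tendsto_mult tendsto_const)
  then show ?thesis unfolding sum[symmetric] by (simp add: LIMSEQ_const_iff)
qed

end

section \<open>The law of the total supremum given the past\<close>

lemma exp_decay_tendsto: "0 < c \<Longrightarrow> (\<lambda>n::nat. K * exp (- c * real n)) \<longlonglongrightarrow> (0::real)"
  by real_asymp

lemma integral_complex_indicator:
  assumes "A \<in> sets M"
  shows "(LINT w|M. (indicator A w :: complex)) = of_real (measure M A)"
proof -
  have "(\<lambda>w. indicator A w :: complex) = (\<lambda>w. of_real (indicator A w))"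
    by (auto split: split_indicator)
  then show ?thesis
    using sets.sets_into_space[OF assms] by (simp add: Int_absorb2)
qed

context drift_pair
begin

text \<open>The exponent \<open>- l\<close> cancels the linear part of the density of
  \<open>Rp\<close> with respect to \<open>P\<close>, leaving a deterministic factor. Its decay in
  \<open>T\<close> is the quantitative form of the escape of the path to infinity under
  \<open>Rp\<close>.\<close>

lemma nn_integral_exp_Rp:
  assumes T: "0 \<le> T"
  shows "(\<integral>\<^sup>+w. ennreal (exp (- l * (coord T w - x))) \<partial>Rp) = ennreal (exp (- l\<^sup>2 * T / 2))"
proof -
  have [measurable]: "coord T \<in> borel_measurable (filt T)" by (rule measurable_coord_filt) (use T in auto)
  have "(\<integral>\<^sup>+w. ennreal (exp (- l * (coord T w - x))) \<partial>Rp)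
      = (\<integral>\<^sup>+w. ennreal (exp (- l * (coord T w - x))) * ennreal (tilt_density l x T w) \<partial>P)"
    by (rule nn_integral_drift_law[OF P T]) measurable
  also have "\<dots> = (\<integral>\<^sup>+w. ennreal (exp (- l\<^sup>2 * T / 2)) \<partial>P)"
    by (rule nn_integral_cong)
       (simp add: tilt_density_def ennreal_mult[symmetric] exp_add[symmetric] algebra_simps)
  finally show ?thesis using P.emeasure_space_1 by simp
qed

text \<open>This is \<open>crossing_identity\<close> at \<open>\<theta> = 0\<close>, where
  \<open>expmart\<close> is 1 and both time integrals carry the factor 0.\<close>

lemma level_constant:
  assumes u: "0 \<le> u" "u \<le> t" and \<Gamma>: "\<Gamma> \<in> sets (filt u)"
  shows "measure R (\<Gamma> \<inter> {w\<in>path_space. a < run_sup t w}) + hit_weight a * measure Rp (\<Gamma> \<inter> {w\<in>path_space. run_sup t w \<le> a})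
    = measure R (\<Gamma> \<inter> {w\<in>path_space. a < run_sup u w}) + hit_weight a * measure Rp (\<Gamma> \<inter> {w\<in>path_space. run_sup u w \<le> a})"
proof (cases "u = t")
  case False
  with u have ut: "u < t" by simp
  let ?G = "\<lambda>w. indicator \<Gamma> w :: complex"
  have G: "?G \<in> borel_measurable (filt u)" using \<Gamma> by measurable
  have sub: "\<Gamma> \<subseteq> path_space" using sets.sets_into_space[OF \<Gamma>] by simp
  have E0: "expmart 0 v w = 1" for v w by (simp add: expmart_def)
  have val: "(LINT w|R. ?G w * up_part 0 a v w) = of_real (measure R (\<Gamma> \<inter> {w\<in>path_space. a < run_sup v w}))"
      "(LINT w|Rp. ?G w * dn_part 0 a v w) = of_real (measure Rp (\<Gamma> \<inter> {w\<in>path_space. run_sup v w \<le> a}))"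
    if "u \<le> v" for v
  proof -
    have v: "0 \<le> v" using u that by simp
    note [measurable] = measurable_run_sup_filt_inf[OF v]
    have "{w\<in>space filt_inf. a < run_sup v w} \<in> sets filt_inf" "{w\<in>space filt_inf. run_sup v w \<le> a} \<in> sets filt_inf"
      by measurable
    moreover have "\<Gamma> \<in> sets filt_inf" using \<Gamma> sets_filt_inf by auto
    ultimately have m: "\<Gamma> \<inter> {w\<in>path_space. a < run_sup v w} \<in> sets R" "\<Gamma> \<inter> {w\<in>path_space. run_sup v w \<le> a} \<in> sets Rp"
      by (auto simp: gauss_incrementsD(2)[OF R] gauss_incrementsD(2)[OF Rp])
    have "(LINT w|R. ?G w * up_part 0 a v w) = (LINT w|R. indicator (\<Gamma> \<inter> {w\<in>path_space. a < run_sup v w}) w)"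
      by (rule Bochner_Integration.integral_cong) (auto simp: up_part_def E0 split: split_indicator)
    also have "\<dots> = of_real (measure R (\<Gamma> \<inter> {w\<in>path_space. a < run_sup v w}))"
      by (rule integral_complex_indicator[OF m(1)])
    finally show "(LINT w|R. ?G w * up_part 0 a v w) = of_real (measure R (\<Gamma> \<inter> {w\<in>path_space. a < run_sup v w}))" .
    have "(LINT w|Rp. ?G w * dn_part 0 a v w) = (LINT w|Rp. indicator (\<Gamma> \<inter> {w\<in>path_space. run_sup v w \<le> a}) w)"
      by (rule Bochner_Integration.integral_cong) (auto simp: dn_part_def E0 split: split_indicator)
    also have "\<dots> = of_real (measure Rp (\<Gamma> \<inter> {w\<in>path_space. run_sup v w \<le> a}))"
      by (rule integral_complex_indicator[OF m(2)])
    finally show "(LINT w|Rp. ?G w * dn_part 0 a v w) = of_real (measure Rp (\<Gamma> \<inter> {w\<in>path_space. run_sup v w \<le> a}))" .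
  qed
  have "norm (?G w) \<le> 1" for w by (simp split: split_indicator)
  from crossing_identity[OF u(1) ut G this, of 0 a]
  have "of_real (measure R (\<Gamma> \<inter> {w\<in>path_space. a < run_sup t w}) + hit_weight a * measure Rp (\<Gamma> \<inter> {w\<in>path_space. run_sup t w \<le> a}))
    = complex_of_real (measure R (\<Gamma> \<inter> {w\<in>path_space. a < run_sup u w}) + hit_weight a * measure Rp (\<Gamma> \<inter> {w\<in>path_space. run_sup u w \<le> a}))"
    using u by (simp add: val)
  then show ?thesis by (simp only: of_real_eq_iff)
qed simp

text \<open>Let the time tend to infinity in \<open>level_constant\<close>: the first term increases
  to the event that the level is ever exceeded, and the second vanishes because paths under
  \<open>Rp\<close> do not stay below \<open>a\<close>.\<close>

lemma level_ever:
  assumes u: "0 \<le> u" and \<Gamma>: "\<Gamma> \<in> sets (filt u)"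
  shows "measure R (\<Gamma> \<inter> {w\<in>path_space. \<exists>n::nat. a < run_sup (real n) w})
    = measure R (\<Gamma> \<inter> {w\<in>path_space. a < run_sup u w}) + hit_weight a * measure Rp (\<Gamma> \<inter> {w\<in>path_space. run_sup u w \<le> a})"
proof -
  let ?A = "\<lambda>n::nat. \<Gamma> \<inter> {w\<in>path_space. a < run_sup (real n) w}"
  let ?B = "\<lambda>n::nat. \<Gamma> \<inter> {w\<in>path_space. run_sup (real n) w \<le> a}"
  have [measurable]: "run_sup (real n) \<in> borel_measurable filt_inf" for n
    by (rule measurable_run_sup_filt_inf) simp
  have [measurable]: "coord (real n) \<in> borel_measurable Rp" for n
    by (rule measurable_Rp(1)[OF measurable_coord_filt_inf]) simp
  have "{w\<in>space filt_inf. a < run_sup (real n) w} \<in> sets filt_inf" "{w\<in>space filt_inf. run_sup (real n) w \<le> a} \<in> sets filt_inf" for n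
    by measurable
  moreover have "\<Gamma> \<in> sets filt_inf" using \<Gamma> sets_filt_inf by auto
  ultimately have m: "?A n \<in> sets R" "?B n \<in> sets Rp" for n
    by (auto simp: gauss_incrementsD(2)[OF R] gauss_incrementsD(2)[OF Rp])
  have "(\<lambda>n. measure R (?A n)) \<longlonglongrightarrow> measure R (\<Union>n. ?A n)"
  proof (rule R.finite_Lim_measure_incseq)
    show "incseq ?A"
      unfolding incseq_def using run_sup_mono by (auto intro: less_le_trans)
  qed (use m in auto)
  moreover have "(\<Union>n. ?A n) = \<Gamma> \<inter> {w\<in>path_space. \<exists>n::nat. a < run_sup (real n) w}" by auto
  moreover have "(\<lambda>n. measure Rp (?B n)) \<longlonglongrightarrow> 0"
  proof (rule tendsto_sandwich[of "\<lambda>_. 0"])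
    \<comment> \<open>Markov's inequality: on \<open>?B n\<close> the endpoint is at most
      \<open>a\<close>, so \<open>exp (- l * (coord (real n) w - x))\<close> is at least
      \<open>exp (- l * (a - x))\<close>, while its mean is known from
      \<open>nn_integral_exp_Rp\<close>.\<close>
    let ?b = "\<lambda>n::nat. exp (l * (a - x)) * exp (- (l\<^sup>2 / 2) * real n)"
    have "measure Rp (?B n) \<le> ?b n" for n
    proof -
      have "emeasure Rp (?B n) = (\<integral>\<^sup>+w. indicator (?B n) w \<partial>Rp)" using m by simp
      also have "\<dots> \<le> (\<integral>\<^sup>+w. ennreal (exp (l * (a - x))) * ennreal (exp (- l * (coord (real n) w - x))) \<partial>Rp)"
      proof (rule nn_integral_mono)
        fix w assume "w \<in> space Rp"
        then have w: "w \<in> path_space" by simp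
        show "indicator (?B n) w \<le> ennreal (exp (l * (a - x))) * ennreal (exp (- l * (coord (real n) w - x)))"
        proof (cases "w \<in> ?B n")
          case True
          then have "coord (real n) w \<le> a" using coord_le_run_sup[OF w, of "real n" "real n"] by auto
          then have "0 \<le> l * (a - x) - l * (coord (real n) w - x)" using l by (simp add: algebra_simps)
          then have "1 \<le> exp (l * (a - x) - l * (coord (real n) w - x))" by simp
          then show ?thesis using True
            by (simp add: ennreal_mult[symmetric] exp_add[symmetric])
        qed simp
      qed
      also have "\<dots> = ennreal (exp (l * (a - x))) * (\<integral>\<^sup>+w. ennreal (exp (- l * (coord (real n) w - x))) \<partial>Rp)"
        by (rule nn_integral_cmult) measurable
      also have "\<dots> = ennreal (?b n)" by (simp add: nn_integral_exp_Rp[simplified] ennreal_mult)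
      finally show ?thesis by (simp add: Rp.emeasure_eq_measure)
    qed
    then show "\<forall>\<^sub>F n in sequentially. measure Rp (?B n) \<le> ?b n" by simp
    show "?b \<longlonglongrightarrow> 0" by (rule exp_decay_tendsto) (use l in simp)
  qed auto
  ultimately have lim: "(\<lambda>n. measure R (?A n) + hit_weight a * measure Rp (?B n)) \<longlonglongrightarrow>
     measure R (\<Gamma> \<inter> {w\<in>path_space. \<exists>n::nat. a < run_sup (real n) w}) + hit_weight a * 0"
    by (intro tendsto_add tendsto_mult tendsto_const) auto
  obtain N :: nat where N: "u \<le> real N" using real_arch_simple by blast
  have "\<forall>\<^sub>F n in sequentially. measure R (?A n) + hit_weight a * measure Rp (?B n) =
     measure R (\<Gamma> \<inter> {w\<in>path_space. a < run_sup u w}) + hit_weight a * measure Rp (\<Gamma> \<inter> {w\<in>path_space. run_sup u w \<le> a})"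
    using eventually_ge_at_top[of N]
    by eventually_elim (rule level_constant[OF u _ \<Gamma>], use N in simp)
  from Lim_transform_eventually[OF lim this] show ?thesis by (simp add: LIMSEQ_const_iff)
qed

text \<open>The probability of ever exceeding a high level \<open>a\<close> is at most
  \<open>hit_weight a\<close>, which tends to 0. Hence \<open>total_sup\<close> is a genuine
  supremum almost surely under \<open>R\<close>.\<close>

lemma AE_bdd_run_sup: "AE w in R. bdd_above (range (\<lambda>n::nat. run_sup (real n) w))"
proof -
  let ?A = "\<lambda>a. {w\<in>path_space. \<exists>n::nat. a < run_sup (real n) w}"
  have [measurable]: "run_sup (real n) \<in> borel_measurable filt_inf" for n
    by (rule measurable_run_sup_filt_inf) simp
  have "{w\<in>space filt_inf. \<exists>n::nat. a < run_sup (real n) w} \<in> sets filt_inf" for a by measurable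
  then have m: "?A a \<in> sets R" for a by (simp add: gauss_incrementsD(2)[OF R])
  have le: "measure R (?A a) \<le> hit_weight a" if "x \<le> a" for a
  proof -
    have "path_space \<in> sets (filt 0)" using sets.top[of "filt 0"] by simp
    from level_ever[OF order_refl this, of a]
    have "measure R (?A a) = measure R {w\<in>path_space. a < coord 0 w} + hit_weight a * measure Rp {w\<in>path_space. coord 0 w \<le> a}"
      by (simp add: run_sup_0 Int_def)
    moreover have "measure R {w\<in>path_space. a < coord 0 w} = 0"
    proof -
      have "AE w in R. \<not> a < coord 0 w" using gauss_incrementsD(4)[OF R] by eventually_elim (use that in simp)
      moreover have [measurable]: "coord 0 \<in> borel_measurable R" by (rule measurable_R(1)[OF measurable_coord_filt_inf]) simp
      moreover have "{w\<in>space R. a < coord 0 w} \<in> sets R" by measurable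
      ultimately show ?thesis using R.prob_Collect_eq_0[of "\<lambda>w. a < coord 0 w"] by simp
    qed
    moreover have "measure Rp {w\<in>path_space. coord 0 w \<le> a} \<le> 1" by (rule Rp.prob_le_1)
    ultimately show ?thesis by (simp add: mult_left_le)
  qed
  let ?N = "{w\<in>path_space. \<not> bdd_above (range (\<lambda>n::nat. run_sup (real n) w))}"
  have N: "?N = (\<Inter>m::nat. ?A (real m))"
  proof -
    have "bdd_above (range (\<lambda>n::nat. run_sup (real n) w)) \<longleftrightarrow> (\<exists>m::nat. \<forall>n::nat. run_sup (real n) w \<le> real m)" for w
      unfolding bdd_above_def by (auto intro: order_trans) (meson order_trans real_arch_simple)
    then show ?thesis by (auto simp: not_le)
  qed
  have "{w\<in>space filt_inf. \<forall>m::nat. \<exists>n::nat. real m < run_sup (real n) w} \<in> sets filt_inf" by measurable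
  moreover have "(\<Inter>m::nat. ?A (real m)) = {w\<in>path_space. \<forall>m::nat. \<exists>n::nat. real m < run_sup (real n) w}" by auto
  ultimately have Nm: "?N \<in> sets R" by (simp add: N gauss_incrementsD(2)[OF R])
  have "measure R ?N \<le> exp (2 * l * x) * exp (- (2 * l) * real m)" if "x \<le> real m" for m :: nat
  proof -
    have "measure R ?N \<le> measure R (?A (real m))" by (rule R.finite_measure_mono) (use m in \<open>auto simp only: N\<close>)
    also have "\<dots> \<le> hit_weight (real m)" by (rule le[OF that])
    finally show ?thesis by (simp add: exp_add[symmetric] algebra_simps)
  qed
  note bound = this
  obtain M :: nat where M: "x \<le> real M" using real_arch_simple by blast
  have ev: "\<forall>\<^sub>F m in sequentially. measure R ?N \<le> exp (2 * l * x) * exp (- (2 * l) * real m)"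
    using eventually_ge_at_top[of M] by eventually_elim (rule bound, use M in linarith)
  have "measure R ?N \<le> 0"
    using tendsto_lowerbound[OF exp_decay_tendsto[of "2 * l" "exp (2 * l * x)"] ev] l by simp
  then have "measure R ?N = 0" using measure_nonneg[of R ?N] by simp
  then show ?thesis
    using R.prob_Collect_eq_0[of "\<lambda>w. \<not> bdd_above (range (\<lambda>n::nat. run_sup (real n) w))"] Nm by simp
qed

text \<open>Rewriting the \<open>Rp\<close> term of \<open>level_ever\<close> under \<open>R\<close>
  turns its weight into \<open>exp (- 2 * l * (a - coord u w))\<close>, the tail of an exponential
  variable of rate \<open>2 * l\<close> added to the present position.\<close>

lemma total_sup_tail:
  assumes u: "0 \<le> u" and \<Gamma>: "\<Gamma> \<in> sets (filt u)"
  shows "emeasure R (\<Gamma> \<inter> {w\<in>path_space. a < total_sup w})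
    = (\<integral>\<^sup>+w. indicator \<Gamma> w * ennreal (if a < run_sup u w then 1 else exp (- 2 * l * (a - coord u w))) \<partial>R)"
proof -
  have [measurable]: "run_sup u \<in> borel_measurable (filt u)" using u by (intro measurable_run_sup) auto
  have [measurable]: "coord u \<in> borel_measurable (filt u)" using u by (intro measurable_coord_filt) auto
  note \<Gamma>[measurable]
  have sub: "\<Gamma> \<subseteq> path_space" using sets.sets_into_space[OF \<Gamma>] by simp
  have "\<Gamma> \<inter> {w\<in>space (filt u). a < run_sup u w} \<in> sets (filt u)" "\<Gamma> \<inter> {w\<in>space (filt u). run_sup u w \<le> a} \<in> sets (filt u)"
    by measurable
  then have m: "\<Gamma> \<inter> {w\<in>path_space. a < run_sup u w} \<in> sets (filt u)" "\<Gamma> \<inter> {w\<in>path_space. run_sup u w \<le> a} \<in> sets (filt u)"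
    by simp_all
  note mR = subsetD[OF gauss_incrementsD(5)[OF R] m(1)] subsetD[OF gauss_incrementsD(5)[OF Rp] m(2)]
  have [measurable]: "total_sup \<in> borel_measurable R" by (rule measurable_R(1)[OF measurable_total_sup])
  have [measurable]: "run_sup (real n) \<in> borel_measurable R" for n
    by (rule measurable_R(1)[OF measurable_run_sup_filt_inf]) simp
  have [measurable]: "\<Gamma> \<in> sets R" by (rule subsetD[OF gauss_incrementsD(5)[OF R] \<Gamma>])
  have "emeasure R (\<Gamma> \<inter> {w\<in>path_space. a < total_sup w}) = emeasure R (\<Gamma> \<inter> {w\<in>path_space. \<exists>n::nat. a < run_sup (real n) w})"
  proof (rule emeasure_eq_AE)
    show "AE w in R. w \<in> \<Gamma> \<inter> {w\<in>path_space. a < total_sup w} \<longleftrightarrow> w \<in> \<Gamma> \<inter> {w\<in>path_space. \<exists>n::nat. a < run_sup (real n) w}"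
      using AE_bdd_run_sup
    proof eventually_elim
      case (elim w)
      have "a < (SUP n::nat. run_sup (real n) w) \<longleftrightarrow> (\<exists>n\<in>UNIV. a < run_sup (real n) w)"
        by (rule less_cSUP_iff) (use elim in auto)
      then show ?case by (auto simp: total_sup_run_sup)
    qed
    have "\<Gamma> \<inter> {w\<in>space R. a < total_sup w} \<in> sets R" "\<Gamma> \<inter> {w\<in>space R. \<exists>n::nat. a < run_sup (real n) w} \<in> sets R"
      by measurable
    then show "\<Gamma> \<inter> {w\<in>path_space. a < total_sup w} \<in> sets R" "\<Gamma> \<inter> {w\<in>path_space. \<exists>n::nat. a < run_sup (real n) w} \<in> sets R"
      by simp_all
  qed
  also have "\<dots> = emeasure R (\<Gamma> \<inter> {w\<in>path_space. a < run_sup u w}) + ennreal (hit_weight a) * emeasure Rp (\<Gamma> \<inter> {w\<in>path_space. run_sup u w \<le> a})"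
    using level_ever[OF u \<Gamma>, of a]
    by (simp add: R.emeasure_eq_measure Rp.emeasure_eq_measure ennreal_mult[symmetric] ennreal_plus[symmetric] del: ennreal_plus)
  also have "emeasure Rp (\<Gamma> \<inter> {w\<in>path_space. run_sup u w \<le> a})
     = (\<integral>\<^sup>+w. ennreal (exp (2 * l * (coord u w - x))) * indicator (\<Gamma> \<inter> {w\<in>path_space. run_sup u w \<le> a}) w \<partial>R)"
    using mR m by (subst nn_integral_R_Rp[OF u]) auto
  also have "ennreal (hit_weight a) * \<dots> = (\<integral>\<^sup>+w. ennreal (hit_weight a) * (ennreal (exp (2 * l * (coord u w - x))) * indicator (\<Gamma> \<inter> {w\<in>path_space. run_sup u w \<le> a}) w) \<partial>R)"
    by (rule nn_integral_cmult[symmetric], rule measurable_R(2)[where s=u]) (use m in measurable)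
  also have "emeasure R (\<Gamma> \<inter> {w\<in>path_space. a < run_sup u w}) = (\<integral>\<^sup>+w. indicator (\<Gamma> \<inter> {w\<in>path_space. a < run_sup u w}) w \<partial>R)"
    using mR by simp
  also have "\<dots> + (\<integral>\<^sup>+w. ennreal (hit_weight a) * (ennreal (exp (2 * l * (coord u w - x))) * indicator (\<Gamma> \<inter> {w\<in>path_space. run_sup u w \<le> a}) w) \<partial>R)
     = (\<integral>\<^sup>+w. indicator (\<Gamma> \<inter> {w\<in>path_space. a < run_sup u w}) w + ennreal (hit_weight a) * (ennreal (exp (2 * l * (coord u w - x))) * indicator (\<Gamma> \<inter> {w\<in>path_space. run_sup u w \<le> a}) w) \<partial>R)"
    by (rule nn_integral_add[symmetric]; rule measurable_R(2)[where s=u]) (use m in measurable)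
  also have "\<dots> = (\<integral>\<^sup>+w. indicator \<Gamma> w * ennreal (if a < run_sup u w then 1 else exp (- 2 * l * (a - coord u w))) \<partial>R)"
    by (rule nn_integral_cong)
       (use sub in \<open>auto simp: ennreal_mult[symmetric] exp_add[symmetric] algebra_simps split: split_indicator\<close>)
  finally show ?thesis .
qed

end

section \<open>Exponential laws and the conditional law of the total supremum\<close>

definition exp_law :: "real \<Rightarrow> real measure" where
  "exp_law c = density lborel (\<lambda>y. ennreal (exponential_density c y))"

lemma sets_exp_law [simp, measurable_cong]: "sets (exp_law c) = sets borel"
  and space_exp_law [simp]: "space (exp_law c) = UNIV"
  by (simp_all add: exp_law_def)

lemma prob_space_exp_law: "0 < c \<Longrightarrow> prob_space (exp_law c)"
  unfolding exp_law_def by (rule prob_space_exponential_density)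

lemma emeasure_exp_law_greaterThan:
  assumes "0 < c" "0 \<le> a" shows "emeasure (exp_law c) {a<..} = ennreal (exp (- c * a))"
proof -
  interpret prob_space "exp_law c" by (rule prob_space_exp_law) fact
  have "distributed (exp_law c) lborel (\<lambda>x. x) (exponential_density c)"
    unfolding distributed_def by (simp add: exp_law_def distr_id2 exponential_density_nonneg)
  from exponential_distributedD_gt[OF this assms(2,1)]
  have "prob {a<..} = exp (- a * c)" by (simp add: greaterThan_def)
  then show ?thesis by (simp add: emeasure_eq_measure mult.commute)
qed

lemma emeasure_exp_law_singleton: "emeasure (exp_law c) {a} = 0"
proof -
  have "{a} \<in> null_sets lborel" by (simp add: null_sets_def)
  then have "AE z in lborel. z \<in> {a} \<longrightarrow> ennreal (exponential_density c z) = 0"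
    using AE_lborel_singleton[of a] by eventually_elim simp
  then have "{a} \<in> null_sets (exp_law c)"
    unfolding exp_law_def by (subst null_sets_density_iff) auto
  then show ?thesis by auto
qed

text \<open>The maximum remains at \<open>S\<close> as long as the exponential variable is below
  \<open>S - X\<close>, which accounts for the atom; beyond that its density appears shifted by
  \<open>X\<close>.\<close>

lemma nn_integral_exp_law_max:
  assumes c: "0 < c" and XS: "X \<le> S" and k: "k \<in> borel_measurable borel"
  shows "(\<integral>\<^sup>+y. k (max S (X + y)) \<partial>exp_law c)
    = k S * ennreal (1 - exp (- c * (S - X))) + (\<integral>\<^sup>+z. ennreal (c * exp (- c * (z - X))) * k z * indicator {S..} z \<partial>lborel)"
proof -
  note k[measurable]
  interpret E: prob_space "exp_law c" by (rule prob_space_exp_law) fact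
  have "(\<integral>\<^sup>+y. k (max S (X + y)) \<partial>exp_law c)
     = (\<integral>\<^sup>+y. k S * indicator {..<S - X} y + k (X + y) * indicator {S - X..} y \<partial>exp_law c)"
    by (rule nn_integral_cong) (auto simp: max_def split: split_indicator)
  also have "\<dots> = k S * emeasure (exp_law c) {..<S - X} + (\<integral>\<^sup>+y. k (X + y) * indicator {S - X..} y \<partial>exp_law c)"
    by (subst nn_integral_add) (auto simp: nn_integral_cmult_indicator)
  also have "emeasure (exp_law c) {..<S - X} = ennreal (1 - exp (- c * (S - X)))"
  proof -
    have "emeasure (exp_law c) {S - X..} = emeasure (exp_law c) {S - X} + emeasure (exp_law c) {S - X<..}"
      by (subst plus_emeasure) (auto intro!: arg_cong[where f="emeasure (exp_law c)"])
    then have "E.prob {S - X..} = exp (- c * (S - X))"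
      using emeasure_exp_law_greaterThan[OF c, of "S - X"] XS
      by (simp add: emeasure_exp_law_singleton E.emeasure_eq_measure)
    moreover have "{..<S - X} = space (exp_law c) - {S - X..}" by auto
    ultimately have "E.prob {..<S - X} = 1 - exp (- c * (S - X))"
      using E.prob_compl[of "{S - X..}"] by simp
    then show ?thesis by (simp add: E.emeasure_eq_measure)
  qed
  also have "(\<integral>\<^sup>+y. k (X + y) * indicator {S - X..} y \<partial>exp_law c)
      = (\<integral>\<^sup>+y. ennreal (exponential_density c y) * (k (X + y) * indicator {S - X..} y) \<partial>lborel)"
    unfolding exp_law_def by (rule nn_integral_density) measurable
  also have "\<dots> = (\<integral>\<^sup>+y. ennreal (c * exp (- c * y)) * k (X + y) * indicator {S..} (X + y) \<partial>lborel)"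
    by (rule nn_integral_cong) (use XS in \<open>auto simp: exponential_density_def mult_ac split: split_indicator\<close>)
  also have "\<dots> = (\<integral>\<^sup>+z. ennreal (c * exp (- c * (z - X))) * k z * indicator {S..} z \<partial>lborel)"
    by (subst nn_integral_real_affine[where c=1 and t="X"]) (auto simp: algebra_simps)
  finally show ?thesis .
qed

lemma gauss_law_symmetric: "0 < v \<Longrightarrow> emeasure (gauss_law 0 v) {..<-a} = emeasure (gauss_law 0 v) {a<..}"
proof -
  assume v: "0 < v"
  have "emeasure (gauss_law 0 v) {a<..} = emeasure (distr (gauss_law 0 v) borel (\<lambda>z. 0 + (-1) * z)) {a<..}"
    using distr_gauss_law_affine[OF v, of "-1" 0 0] by simp
  also have "\<dots> = emeasure (gauss_law 0 v) {..<-a}"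
    by (subst emeasure_distr) (auto intro!: arg_cong[where f="emeasure (gauss_law 0 v)"])
  finally show ?thesis by simp
qed

lemma emeasure_gauss_law_singleton: "emeasure (gauss_law m v) {a} = 0"
proof -
  have "AE z in lborel. z \<in> {a} \<longrightarrow> ennreal (normal_density m (sqrt v) z) = 0"
    using AE_lborel_singleton[of a] by eventually_elim simp
  then have "{a} \<in> null_sets (gauss_law m v)"
    unfolding gauss_law_def by (subst null_sets_density_iff) auto
  then show ?thesis by auto
qed

context drift_pair
begin

text \<open>Both sides integrate \<open>k\<close> against a finite measure on the line: the law of
  \<open>total_sup\<close> on \<Gamma>, and the law on \<Gamma> of the maximum formed with an
  independent exponential variable. \<open>total_sup_tail\<close> says that the two agree on all
  rays \<open>{a<..}\<close>.\<close>

lemma total_sup_conditional: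
  fixes k :: "real \<Rightarrow> ennreal"
  assumes u: "0 \<le> u" and \<Gamma>: "\<Gamma> \<in> sets (filt u)" and k: "k \<in> borel_measurable borel"
  shows "(\<integral>\<^sup>+w. indicator \<Gamma> w * k (total_sup w) \<partial>R)
    = (\<integral>\<^sup>+w. indicator \<Gamma> w * (\<integral>\<^sup>+y. k (max (run_sup u w) (coord u w + y)) \<partial>exp_law (2 * l)) \<partial>R)"
proof -
  interpret E: prob_space "exp_law (2 * l)" by (rule prob_space_exp_law) (use l in simp)
  have [measurable]: "run_sup u \<in> borel_measurable R" by (rule measurable_R(2)[OF measurable_run_sup[OF u order_refl]])
  have [measurable]: "coord u \<in> borel_measurable R" by (rule measurable_R(2)[OF measurable_coord_filt[OF u order_refl]])
  have [measurable]: "total_sup \<in> borel_measurable R" by (rule measurable_R(1)[OF measurable_total_sup])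
  have \<Gamma>R[measurable]: "\<Gamma> \<in> sets R" by (rule subsetD[OF gauss_incrementsD(5)[OF R] \<Gamma>])
  have sub: "\<Gamma> \<subseteq> path_space" using sets.sets_into_space[OF \<Gamma>] by simp
  note k[measurable]
  define D where "D = density R (indicator \<Gamma>)"
  have [measurable_cong]: "sets D = sets R" by (simp add: D_def)
  interpret D: finite_measure D
  proof (rule finite_measureI)
    have "emeasure D (space D) = (\<integral>\<^sup>+w. indicator \<Gamma> w * indicator (space R) w \<partial>R)"
      unfolding D_def space_density by (rule emeasure_density) (auto simp del: space_R)
    also have "\<dots> = (\<integral>\<^sup>+w. indicator \<Gamma> w \<partial>R)"
      by (rule nn_integral_cong) simp
    finally show "emeasure D (space D) \<noteq> \<infinity>" by (simp add: R.emeasure_eq_measure)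
  qed
  interpret pr: pair_sigma_finite D "exp_law (2 * l)" ..
  let ?f = "\<lambda>(w, y). max (run_sup u w) (coord u w + y)"
  have fm: "?f \<in> borel_measurable (D \<Otimes>\<^sub>M borel)" by measurable
  have "sets (D \<Otimes>\<^sub>M exp_law (2 * l)) = sets (D \<Otimes>\<^sub>M borel)" by (rule sets_pair_measure_cong) simp_all
  then have f[measurable]: "?f \<in> borel_measurable (D \<Otimes>\<^sub>M exp_law (2 * l))"
    using fm measurable_cong_sets[OF _ refl] by blast
  have val: "(\<integral>\<^sup>+z. g z \<partial>distr (D \<Otimes>\<^sub>M exp_law (2 * l)) borel ?f)
      = (\<integral>\<^sup>+w. indicator \<Gamma> w * (\<integral>\<^sup>+y. g (max (run_sup u w) (coord u w + y)) \<partial>exp_law (2 * l)) \<partial>R)"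
    if g[measurable]: "g \<in> borel_measurable borel" for g :: "real \<Rightarrow> ennreal"
  proof -
    have gf: "(\<lambda>p. g (?f p)) \<in> borel_measurable (D \<Otimes>\<^sub>M exp_law (2 * l))"
      by (rule measurable_compose[OF f g])
    have "(\<integral>\<^sup>+z. g z \<partial>distr (D \<Otimes>\<^sub>M exp_law (2 * l)) borel ?f) = (\<integral>\<^sup>+p. g (?f p) \<partial>(D \<Otimes>\<^sub>M exp_law (2 * l)))"
      by (rule nn_integral_distr[OF f]) (use g in simp)
    also have "\<dots> = (\<integral>\<^sup>+w. (\<integral>\<^sup>+y. g (?f (w, y)) \<partial>exp_law (2 * l)) \<partial>D)"
      by (rule E.nn_integral_fst[OF gf, symmetric])
    also have "\<dots> = (\<integral>\<^sup>+w. indicator \<Gamma> w * (\<integral>\<^sup>+y. g (?f (w, y)) \<partial>exp_law (2 * l)) \<partial>R)"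
    proof -
      have "(\<lambda>w. \<integral>\<^sup>+y. g (?f (w, y)) \<partial>exp_law (2 * l)) \<in> borel_measurable R"
        using E.borel_measurable_nn_integral_fst[OF gf] by (simp cong: measurable_cong_sets add: D_def)
      then show ?thesis unfolding D_def by (subst nn_integral_density) auto
    qed
    finally show ?thesis by simp
  qed
  have "distr D borel total_sup = distr (D \<Otimes>\<^sub>M exp_law (2 * l)) borel ?f"
  proof (rule measure_eqI_lessThan)
    fix a :: real
    have e1: "emeasure (distr D borel total_sup) {a<..} = emeasure R (\<Gamma> \<inter> {w\<in>path_space. a < total_sup w})"
    proof -
      have "emeasure (distr D borel total_sup) {a<..} = emeasure D (total_sup -` {a<..} \<inter> space D)"
        by (rule emeasure_distr) measurable
      also have "\<dots> = (\<integral>\<^sup>+w. indicator \<Gamma> w * indicator (total_sup -` {a<..} \<inter> space R) w \<partial>R)"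
        unfolding D_def space_density by (rule emeasure_density) measurable
      also have "\<dots> = (\<integral>\<^sup>+w. indicator (\<Gamma> \<inter> (total_sup -` {a<..} \<inter> space R)) w \<partial>R)"
        by (rule nn_integral_cong) (auto split: split_indicator)
      also have "\<dots> = emeasure R (\<Gamma> \<inter> (total_sup -` {a<..} \<inter> space R))"
        by (rule nn_integral_indicator) measurable
      finally show ?thesis using sub by (simp add: Int_def conj_commute)
    qed
    show "emeasure (distr D borel total_sup) {a<..} < \<infinity>"
      unfolding e1 by (simp add: R.emeasure_eq_measure)
    have "emeasure (distr (D \<Otimes>\<^sub>M exp_law (2 * l)) borel ?f) {a<..}
        = (\<integral>\<^sup>+w. indicator \<Gamma> w * (\<integral>\<^sup>+y. indicator {a<..} (max (run_sup u w) (coord u w + y)) \<partial>exp_law (2 * l)) \<partial>R)"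
      by (subst val[symmetric]) auto
    also have "\<dots> = (\<integral>\<^sup>+w. indicator \<Gamma> w * ennreal (if a < run_sup u w then 1 else exp (- 2 * l * (a - coord u w))) \<partial>R)"
    proof (rule nn_integral_cong)
      fix w assume "w \<in> space R"
      then have w: "w \<in> path_space" by simp
      have "(\<integral>\<^sup>+y. indicator {a<..} (max (run_sup u w) (coord u w + y)) \<partial>exp_law (2 * l))
          = ennreal (if a < run_sup u w then 1 else exp (- 2 * l * (a - coord u w)))"
      proof (cases "a < run_sup u w")
        case True
        then have "(\<integral>\<^sup>+y. indicator {a<..} (max (run_sup u w) (coord u w + y)) \<partial>exp_law (2 * l)) = (\<integral>\<^sup>+y. 1 \<partial>exp_law (2 * l))"
          by (intro nn_integral_cong) (auto simp: less_max_iff_disj)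
        then show ?thesis using True E.emeasure_space_1 by simp
      next
        case False
        have "coord u w \<le> run_sup u w" by (rule coord_le_run_sup[OF w u order_refl])
        with False have a0: "0 \<le> a - coord u w" by simp
        have "(\<integral>\<^sup>+y. indicator {a<..} (max (run_sup u w) (coord u w + y)) \<partial>exp_law (2 * l))
            = (\<integral>\<^sup>+y. indicator {a - coord u w<..} y \<partial>exp_law (2 * l))"
          using False by (intro nn_integral_cong) (auto simp: less_max_iff_disj split: split_indicator)
        also have "\<dots> = emeasure (exp_law (2 * l)) {a - coord u w<..}" by simp
        also have "\<dots> = ennreal (exp (- (2 * l) * (a - coord u w)))"
          by (rule emeasure_exp_law_greaterThan) (use l a0 in auto)
        finally show ?thesis using False by simp
      qed
      then show "indicator \<Gamma> w * (\<integral>\<^sup>+y. indicator {a<..} (max (run_sup u w) (coord u w + y)) \<partial>exp_law (2 * l)) =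
         indicator \<Gamma> w * ennreal (if a < run_sup u w then 1 else exp (- 2 * l * (a - coord u w)))" by simp
    qed
    finally show "emeasure (distr D borel total_sup) {a<..} = emeasure (distr (D \<Otimes>\<^sub>M exp_law (2 * l)) borel ?f) {a<..}"
      unfolding e1 total_sup_tail[OF u \<Gamma>] by simp
  qed simp_all
  then have "(\<integral>\<^sup>+z. k z \<partial>distr D borel total_sup) = (\<integral>\<^sup>+z. k z \<partial>distr (D \<Otimes>\<^sub>M exp_law (2 * l)) borel ?f)" by simp
  moreover have "(\<integral>\<^sup>+z. k z \<partial>distr D borel total_sup) = (\<integral>\<^sup>+w. indicator \<Gamma> w * k (total_sup w) \<partial>R)"
    unfolding D_def by (subst nn_integral_distr) (auto simp: nn_integral_density cong: measurable_cong_sets)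
  ultimately show ?thesis unfolding val[OF k] by simp
qed

section \<open>The reflection principle\<close>

lemma AE_coord_neq:
  assumes t: "0 < t"
  shows "AE w in P. coord t w \<noteq> a"
proof -
  have ps: "path_space \<in> sets (filt 0)" using sets.top[of "filt 0"] by simp
  have [measurable]: "coord t \<in> borel_measurable P" "coord 0 \<in> borel_measurable P"
    using t by (auto intro!: measurable_P(1) measurable_coord_filt_inf)
  have "{w\<in>space P. coord t w - coord 0 w \<in> {a - x}} \<in> sets P" by measurable
  moreover have "emeasure P {w\<in>path_space. coord t w - coord 0 w \<in> {a - x}} = 0"
    using gauss_increments_incr[OF P order_refl t order_refl ps, of "{a - x}"]
    by (simp add: emeasure_gauss_law_singleton Int_def)
  ultimately have "AE w in P. \<not> coord t w - coord 0 w = a - x"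
    by (intro AE_I[of _ _ "{w\<in>path_space. coord t w - coord 0 w \<in> {a - x}}"]) auto
  then show ?thesis using gauss_incrementsD(4)[OF P] by eventually_elim auto
qed

text \<open>From the end of the crossing cell the remaining increment is symmetric and independent
  of the past, so its sign has mean 0. As the mesh shrinks, the position at the end of that cell
  tends to \<open>a\<close>, and the sign becomes that of \<open>coord t w - a\<close>.\<close>

lemma reflection_sign:
  assumes t: "0 < t"
  shows "(LINT w|P. (if run_sup 0 w \<le> a \<and> a < run_sup t w then sgn (coord t w - a) else 0)) = 0"
proof -
  let ?f = "\<lambda>n k w. if crosses a 0 t n k w then sgn (coord t w - coord (grid 0 t n (Suc k)) w) else 0"
  let ?L = "\<lambda>w. if run_sup 0 w \<le> a \<and> a < run_sup t w then sgn (coord t w - a) else 0"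
  have g: "0 \<le> grid 0 t n k" "grid 0 t n k \<le> grid 0 t n (Suc k)" "0 \<le> grid 0 t n (Suc k)" "grid 0 t n (Suc k) \<le> t"
    if "k < Suc n" for n k
    using grid_bounds[of 0 t k n] grid_bounds[of 0 t "Suc k" n] grid_mono[of 0 t k "Suc k" n] that t by auto
  have m: "?f n k \<in> borel_measurable P" if k: "k < Suc n" for n k
  proof -
    note [measurable] = measurable_P(1)[OF measurable_run_sup_filt_inf[OF g(1)[OF k]]]
      measurable_P(1)[OF measurable_run_sup_filt_inf[OF g(3)[OF k]]]
      measurable_P(1)[OF measurable_coord_filt_inf[OF g(3)[OF k]]]
      measurable_P(1)[OF measurable_coord_filt_inf[OF less_imp_le[OF t]]]
    show ?thesis unfolding crosses_def by measurable
  qed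
  have zero: "(LINT w|P. ?f n k w) = 0" if k: "k < Suc n" for n k
  proof (cases "grid 0 t n (Suc k) = t")
    \<comment> \<open>In the last cell no time remains, and the sign is that of 0.\<close>
    case True
    then show ?thesis by (simp only: True diff_self sgn_zero if_cancel) simp
  next
    case False
    let ?q = "grid 0 t n (Suc k)"
    have qt: "?q < t" using False g[OF k] by simp
    let ?C = "{w\<in>path_space. crosses a 0 t n k w}"
    note [measurable] = measurable_run_sup[OF g(1,2)[OF k]] measurable_run_sup[OF g(3)[OF k] order_refl]
    have "{w\<in>space (filt ?q). crosses a 0 t n k w} \<in> sets (filt ?q)" unfolding crosses_def by measurable
    then have C: "?C \<in> sets (filt ?q)" by simp
    note inc = gauss_increments_incr[OF P g(3)[OF k] qt order_refl C]
    let ?A = "?C \<inter> {w\<in>path_space. coord t w - coord ?q w \<in> {0<..}}" and ?B = "?C \<inter> {w\<in>path_space. coord t w - coord ?q w \<in> {..<0}}"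
    have AB: "emeasure P ?A = emeasure P ?B"
      using inc[of "{0<..}"] inc[of "{..<0}"] gauss_law_symmetric[of "t - ?q" 0] qt by simp
    have CP[measurable]: "?C \<in> sets P" by (rule subsetD[OF gauss_incrementsD(5)[OF P] C])
    note [measurable] = measurable_P(1)[OF measurable_coord_filt_inf[OF g(3)[OF k]]]
      measurable_P(1)[OF measurable_coord_filt_inf[OF less_imp_le[OF t]]]
    have "?C \<inter> {w\<in>space P. coord t w - coord ?q w \<in> {0<..}} \<in> sets P" "?C \<inter> {w\<in>space P. coord t w - coord ?q w \<in> {..<0}} \<in> sets P"
      by measurable
    then have AP: "?A \<in> sets P" and BP: "?B \<in> sets P" by simp_all
    have "(LINT w|P. ?f n k w) = (LINT w|P. indicator ?A w - indicator ?B w)"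
      by (rule Bochner_Integration.integral_cong) (auto simp: sgn_if split: split_indicator)
    also have "\<dots> = measure P ?A - measure P ?B"
      using AP BP sets.sets_into_space[OF AP] sets.sets_into_space[OF BP]
      by (subst Bochner_Integration.integral_diff) (auto simp: Int_absorb2 P.emeasure_eq_measure)
    finally show ?thesis using AB by (simp add: P.emeasure_eq_measure)
  qed
  have "(\<lambda>n. LINT w|P. (\<Sum>k<Suc n. ?f n k w)) \<longlonglongrightarrow> (LINT w|P. ?L w)"
  proof (rule integral_dominated_convergence[where w="\<lambda>_. 1"])
    note [measurable] = measurable_P(1)[OF measurable_run_sup_filt_inf[OF order_refl]]
      measurable_P(1)[OF measurable_run_sup_filt_inf[OF less_imp_le[OF t]]]
      measurable_P(1)[OF measurable_coord_filt_inf[OF less_imp_le[OF t]]]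
    show "?L \<in> borel_measurable P" by measurable
    show "(\<lambda>w. \<Sum>k<Suc n. ?f n k w) \<in> borel_measurable P" for n by (intro borel_measurable_sum m) auto
    show "AE w in P. norm (\<Sum>k<Suc n. ?f n k w) \<le> 1" for n
      unfolding real_norm_def
      by (rule AE_I2, rule sum_crosses_bounded) (use t in \<open>auto simp: sgn_if\<close>)
    show "AE w in P. (\<lambda>n. \<Sum>k<Suc n. ?f n k w) \<longlonglongrightarrow> ?L w"
      using AE_coord_neq[OF t, of a] AE_space
    proof eventually_elim
      case (elim w)
      then have w: "w \<in> path_space" by simp
      \<comment> \<open>Continuity of the sign holds because the endpoint differs from
        \<open>a\<close> almost surely.\<close>
      have "isCont (\<lambda>y. sgn (coord t w - y)) a"
        using elim by (intro continuous_intros) auto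
      from sum_crosses_tendsto[OF w order_refl t this] show ?case .
    qed
  qed simp
  moreover have "(LINT w|P. (\<Sum>k<Suc n. ?f n k w)) = 0" for n
  proof -
    have "(LINT w|P. (\<Sum>k<Suc n. ?f n k w)) = (\<Sum>k<Suc n. LINT w|P. ?f n k w)"
      by (rule Bochner_Integration.integral_sum, rule P.integrable_const_bound[where B=1, OF _ m])
         (auto simp: sgn_if intro!: AE_I2)
    also have "\<dots> = 0" using zero by (intro sum.neutral) auto
    finally show ?thesis .
  qed
  ultimately show ?thesis by (simp only: LIMSEQ_const_iff)
qed

end

section \<open>The running supremum of Brownian motion\<close>

context drift_pair
begin

lemma emeasure_coord_greater:
  assumes t: "0 < t"
  shows "emeasure P {w\<in>path_space. a < coord t w} = emeasure (gauss_law 0 t) {a - x<..}"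
proof -
  have ps: "path_space \<in> sets (filt 0)" using sets.top[of "filt 0"] by simp
  have [measurable]: "coord t \<in> borel_measurable P" "coord 0 \<in> borel_measurable P"
    using t by (auto intro!: measurable_P(1) measurable_coord_filt_inf)
  have m: "{w\<in>space P. a < coord t w} \<in> sets P" "{w\<in>space P. coord t w - coord 0 w \<in> {a - x<..}} \<in> sets P"
    by measurable
  have "emeasure P {w\<in>path_space. a < coord t w} = emeasure P {w\<in>path_space. coord t w - coord 0 w \<in> {a - x<..}}"
    by (rule emeasure_eq_AE) (use m gauss_incrementsD(4)[OF P] in \<open>auto elim!: eventually_mono\<close>)
  also have "\<dots> = emeasure (gauss_law 0 t) {a - x<..}"
    using gauss_increments_incr[OF P order_refl t order_refl ps, of "{a - x<..}"] P.emeasure_space_1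
    by (simp add: Int_def)
  finally show ?thesis .
qed

text \<open>By \<open>reflection_sign\<close>, the paths that have passed \<open>a\<close> end above
  it and below it with equal probability, and every path ending above it has passed it.\<close>

lemma emeasure_run_sup_greater:
  assumes t: "0 < t" and a: "x \<le> a"
  shows "emeasure P {w\<in>path_space. a < run_sup t w} = 2 * emeasure (gauss_law 0 t) {a - x<..}"
proof -
  note [measurable] = measurable_P(1)[OF measurable_run_sup_filt_inf[OF order_refl]]
    measurable_P(1)[OF measurable_run_sup_filt_inf[OF less_imp_le[OF t]]]
    measurable_P(1)[OF measurable_coord_filt_inf[OF less_imp_le[OF t]]]
  let ?A = "{w\<in>path_space. a < run_sup t w}"
  let ?U = "{w\<in>path_space. a < coord t w}" and ?L = "{w\<in>path_space. a < run_sup t w \<and> coord t w < a}"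
  have "{w\<in>space P. a < run_sup t w} \<in> sets P" "{w\<in>space P. a < coord t w} \<in> sets P"
      "{w\<in>space P. a < run_sup t w \<and> coord t w < a} \<in> sets P" by measurable
  then have m: "?A \<in> sets P" "?U \<in> sets P" "?L \<in> sets P" by simp_all
  have UA: "?U \<subseteq> ?A"
    using coord_le_run_sup[of _ t t] t by (auto intro: less_le_trans)
  have "0 = (LINT w|P. (if run_sup 0 w \<le> a \<and> a < run_sup t w then sgn (coord t w - a) else 0))"
    by (rule reflection_sign[OF t, symmetric])
  also have "\<dots> = (LINT w|P. indicator ?U w - indicator ?L w)"
  proof (rule integral_cong_AE)
    show "(\<lambda>w. if run_sup 0 w \<le> a \<and> a < run_sup t w then sgn (coord t w - a) else 0) \<in> borel_measurable P"
      by measurable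
    show "(\<lambda>w. indicator ?U w - indicator ?L w :: real) \<in> borel_measurable P" using m by measurable
    show "AE w in P. (if run_sup 0 w \<le> a \<and> a < run_sup t w then sgn (coord t w - a) else 0) = indicator ?U w - indicator ?L w"
      using gauss_incrementsD(4)[OF P] AE_space
    proof eventually_elim
      case (elim w)
      then show ?case using UA a by (auto simp: run_sup_0 sgn_if split: split_indicator)
    qed
  qed
  also have "\<dots> = measure P ?U - measure P ?L"
    using m sets.sets_into_space[OF m(2)] sets.sets_into_space[OF m(3)]
    by (subst Bochner_Integration.integral_diff) (auto simp: Int_absorb2 P.emeasure_eq_measure)
  finally have UL: "measure P ?L = measure P ?U" by simp
  have "measure P ?A = measure P (?U \<union> ?L)"
    using AE_coord_neq[OF t, of a] m UA
    by (intro P.finite_measure_eq_AE) (auto elim!: eventually_mono)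
  also have "\<dots> = measure P ?U + measure P ?L"
    using m by (intro P.finite_measure_Union) auto
  finally have "measure P ?A = 2 * measure P ?U" using UL by simp
  then have "emeasure P ?A = 2 * emeasure P ?U"
    by (simp add: P.emeasure_eq_measure ennreal_mult'')
  then show ?thesis by (simp only: emeasure_coord_greater[OF t])
qed

lemma distr_run_sup:
  assumes t: "0 < t"
  shows "distr P borel (run_sup t) = distr (gauss_law 0 t) borel (\<lambda>y. x + \<bar>y\<bar>)"
proof (rule measure_eqI_lessThan)
  interpret N: prob_space "gauss_law 0 t" by (rule prob_space_gauss_law[OF t])
  have S[measurable]: "run_sup t \<in> borel_measurable P"
    by (rule measurable_P(1)[OF measurable_run_sup_filt_inf[OF less_imp_le[OF t]]])
  fix a :: real
  have e1: "emeasure (distr P borel (run_sup t)) {a<..} = emeasure P {w\<in>path_space. a < run_sup t w}"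
    by (subst emeasure_distr) (auto intro!: arg_cong[where f="emeasure P"])
  show "emeasure (distr P borel (run_sup t)) {a<..} < \<infinity>"
    unfolding e1 by (simp add: P.emeasure_eq_measure)
  have "(\<lambda>y. x + \<bar>y\<bar>) -` {a<..} = {y. a - x < \<bar>y\<bar>}" by auto
  then have e2: "emeasure (distr (gauss_law 0 t) borel (\<lambda>y. x + \<bar>y\<bar>)) {a<..} = emeasure (gauss_law 0 t) {y. a - x < \<bar>y\<bar>}"
    by (subst emeasure_distr) auto
  show "emeasure (distr P borel (run_sup t)) {a<..} = emeasure (distr (gauss_law 0 t) borel (\<lambda>y. x + \<bar>y\<bar>)) {a<..}"
  proof (cases "x \<le> a")
    case True
    have "{y. a - x < \<bar>y\<bar>} = {a - x<..} \<union> {..<-(a - x)}" using True by auto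
    then have "emeasure (gauss_law 0 t) {y. a - x < \<bar>y\<bar>} = emeasure (gauss_law 0 t) {a - x<..} + emeasure (gauss_law 0 t) {..<-(a - x)}"
      using True by (simp only:) (subst plus_emeasure, auto)
    also have "\<dots> = 2 * emeasure (gauss_law 0 t) {a - x<..}"
      unfolding gauss_law_symmetric[OF t] by (simp add: mult_2)
    finally show ?thesis unfolding e1 e2 emeasure_run_sup_greater[OF t True] by simp
  next
    case False
    then have "{y. a - x < \<bar>y\<bar>} = space (gauss_law 0 t)" by auto
    then have "emeasure (gauss_law 0 t) {y. a - x < \<bar>y\<bar>} = 1" by (simp only: N.emeasure_space_1)
    moreover have "emeasure P {w\<in>path_space. a < run_sup t w} = 1"
    proof -
      have "AE w in P. a < run_sup t w"
        using gauss_incrementsD(4)[OF P] AE_space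
      proof eventually_elim
        case (elim w)
        then show ?case using coord_le_run_sup[of w 0 t] t False by simp
      qed
      moreover have "{w\<in>space P. a < run_sup t w} \<in> sets P" by measurable
      ultimately show ?thesis using P.prob_Collect_eq_1[of "\<lambda>w. a < run_sup t w"] by (simp add: P.emeasure_eq_measure)
    qed
    ultimately show ?thesis unfolding e1 e2 by simp
  qed
qed simp_all

lemma nn_integral_run_sup_le:
  fixes k :: "real \<Rightarrow> ennreal"
  assumes t: "0 < t" and k: "k \<in> borel_measurable borel"
  shows "(\<integral>\<^sup>+w. k (run_sup t w) \<partial>P) \<le> (\<integral>\<^sup>+z. ennreal (2 * normal_density 0 (sqrt t) (z - x)) * k z * indicator {x..} z \<partial>lborel)"
proof -
  note k[measurable]
  let ?n = "normal_density 0 (sqrt t)"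
  have S[measurable]: "run_sup t \<in> borel_measurable P"
    by (rule measurable_P(1)[OF measurable_run_sup_filt_inf[OF less_imp_le[OF t]]])
  have half: "(\<integral>\<^sup>+y. ennreal (?n y) * k (x + y) * indicator {0..} y \<partial>lborel)
     = (\<integral>\<^sup>+z. ennreal (?n (z - x)) * k z * indicator {x..} z \<partial>lborel)"
    by (subst nn_integral_real_affine[where c=1 and t="- x"]) (auto intro!: nn_integral_cong split: split_indicator)
  have "(\<integral>\<^sup>+w. k (run_sup t w) \<partial>P) = (\<integral>\<^sup>+z. k z \<partial>distr P borel (run_sup t))"
    by (rule nn_integral_distr[symmetric]) auto
  also have "\<dots> = (\<integral>\<^sup>+y. k (x + \<bar>y\<bar>) \<partial>gauss_law 0 t)"
    unfolding distr_run_sup[OF t] by (rule nn_integral_distr) auto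
  also have "\<dots> = (\<integral>\<^sup>+y. ennreal (?n y) * k (x + \<bar>y\<bar>) \<partial>lborel)"
    unfolding gauss_law_def by (rule nn_integral_density) measurable
  \<comment> \<open>The point 0 is counted in both half-lines, so this is an inequality; an upper
    bound is all that is used later.\<close>
  also have "\<dots> \<le> (\<integral>\<^sup>+y. ennreal (?n y) * k (x + y) * indicator {0..} y + ennreal (?n y) * k (x - y) * indicator {..0} y \<partial>lborel)"
    by (rule nn_integral_mono) (auto split: split_indicator simp: abs_if)
  also have "\<dots> = (\<integral>\<^sup>+y. ennreal (?n y) * k (x + y) * indicator {0..} y \<partial>lborel) + (\<integral>\<^sup>+y. ennreal (?n y) * k (x - y) * indicator {..0} y \<partial>lborel)"
    by (rule nn_integral_add) measurable
  also have "(\<integral>\<^sup>+y. ennreal (?n y) * k (x - y) * indicator {..0} y \<partial>lborel) = (\<integral>\<^sup>+y. ennreal (?n y) * k (x + y) * indicator {0..} y \<partial>lborel)"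
    by (subst nn_integral_real_affine[where c="-1" and t=0])
       (auto intro!: nn_integral_cong simp: normal_density_def split: split_indicator)
  also have "(\<integral>\<^sup>+y. ennreal (?n y) * k (x + y) * indicator {0..} y \<partial>lborel) + (\<integral>\<^sup>+y. ennreal (?n y) * k (x + y) * indicator {0..} y \<partial>lborel)
     = 2 * (\<integral>\<^sup>+z. ennreal (?n (z - x)) * k z * indicator {x..} z \<partial>lborel)"
    unfolding half by (simp add: mult_2)
  also have "\<dots> = (\<integral>\<^sup>+z. 2 * (ennreal (?n (z - x)) * k z * indicator {x..} z) \<partial>lborel)"
    by (rule nn_integral_cmult[symmetric]) measurable
  also have "\<dots> = (\<integral>\<^sup>+z. ennreal (2 * ?n (z - x)) * k z * indicator {x..} z \<partial>lborel)"
    by (rule nn_integral_cong) (simp add: ennreal_mult mult_ac)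
  finally show ?thesis .
qed

text \<open>Completing the square: the tilt moves the Gaussian peak to \<open>l * t\<close> and
  leaves its height unchanged, so the bound is uniform in \<open>y\<close>.\<close>

lemma normal_density_tilt_le:
  assumes t: "0 < t"
  shows "normal_density 0 (sqrt t) y * exp (l * y - l\<^sup>2 * t / 2) \<le> 1 / sqrt (2 * pi * t)"
proof -
  have "- y\<^sup>2 / (2 * t) + (l * y - l\<^sup>2 * t / 2) = - (y - l * t)\<^sup>2 / (2 * t)"
    using t by (simp add: field_simps power2_eq_square)
  then have "normal_density 0 (sqrt t) y * exp (l * y - l\<^sup>2 * t / 2) = 1 / sqrt (2 * pi * t) * exp (- (y - l * t)\<^sup>2 / (2 * t))"
    using t by (simp add: normal_density_def mult.assoc exp_add[symmetric])
  also have "\<dots> \<le> 1 / sqrt (2 * pi * t) * 1"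
    using t by (intro mult_left_mono) auto
  finally show ?thesis by simp
qed

text \<open>In the weight times the density of \<open>R\<close> the endpoint has coefficient
  \<open>l\<close>, so replacing it by the larger running supremum gives a function of the supremum
  alone. Under \<open>P\<close> the law of that supremum has a density, and
  \<open>normal_density_tilt_le\<close> extracts the factor of order
  \<open>1 / sqrt u\<close>.\<close>

lemma nn_integral_boundary_le:
  fixes k :: "real \<Rightarrow> ennreal"
  assumes u: "0 < u" and k: "k \<in> borel_measurable borel"
  shows "(\<integral>\<^sup>+w. k (run_sup u w) * ennreal (exp (- 2 * l * (run_sup u w - coord u w))) \<partial>R)
    \<le> ennreal (2 / sqrt (2 * pi * u)) * (\<integral>\<^sup>+z. ennreal (exp (- 2 * l * (z - x))) * k z * indicator {x..} z \<partial>lborel)"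
proof -
  note k[measurable]
  have u0: "0 \<le> u" using u by simp
  have [measurable]: "run_sup u \<in> borel_measurable (filt u)" "coord u \<in> borel_measurable (filt u)"
    using u0 by (auto intro: measurable_run_sup measurable_coord_filt)
  let ?e = "\<lambda>z. exp (- l * (z - x) - l\<^sup>2 * u / 2)"
  have "(\<integral>\<^sup>+w. k (run_sup u w) * ennreal (exp (- 2 * l * (run_sup u w - coord u w))) \<partial>R)
     = (\<integral>\<^sup>+w. k (run_sup u w) * ennreal (exp (- 2 * l * (run_sup u w - coord u w))) * ennreal (tilt_density (- l) x u w) \<partial>P)"
    by (rule nn_integral_drift_law[OF P u0]) measurable
  also have "\<dots> \<le> (\<integral>\<^sup>+w. k (run_sup u w) * ennreal (?e (run_sup u w)) \<partial>P)"
  proof (rule nn_integral_mono)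
    fix w assume "w \<in> space P"
    then have "coord u w \<le> run_sup u w" using coord_le_run_sup[of w u u] u by simp
    then have "0 \<le> l * (run_sup u w - coord u w)" using l by simp
    then have "exp (- 2 * l * (run_sup u w - coord u w)) * tilt_density (- l) x u w \<le> ?e (run_sup u w)"
      unfolding tilt_density_def exp_add[symmetric] by (simp add: algebra_simps)
    then show "k (run_sup u w) * ennreal (exp (- 2 * l * (run_sup u w - coord u w))) * ennreal (tilt_density (- l) x u w)
       \<le> k (run_sup u w) * ennreal (?e (run_sup u w))"
      unfolding mult.assoc
      by (intro mult_left_mono) (auto simp: ennreal_mult[symmetric] tilt_density_def intro!: ennreal_leI)
  qed
  also have "\<dots> \<le> (\<integral>\<^sup>+z. ennreal (2 * normal_density 0 (sqrt u) (z - x)) * (k z * ennreal (?e z)) * indicator {x..} z \<partial>lborel)"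
    by (rule nn_integral_run_sup_le[OF u, of "\<lambda>z. k z * ennreal (?e z)"]) measurable
  also have "\<dots> \<le> (\<integral>\<^sup>+z. ennreal (2 / sqrt (2 * pi * u)) * (ennreal (exp (- 2 * l * (z - x))) * k z * indicator {x..} z) \<partial>lborel)"
  proof (rule nn_integral_mono)
    fix z
    have "2 * normal_density 0 (sqrt u) (z - x) * ?e z
        = 2 * (normal_density 0 (sqrt u) (z - x) * exp (l * (z - x) - l\<^sup>2 * u / 2)) * exp (- 2 * l * (z - x))"
      by (simp add: mult.assoc exp_add[symmetric] algebra_simps)
    also have "\<dots> \<le> 2 * (1 / sqrt (2 * pi * u)) * exp (- 2 * l * (z - x))"
      by (intro mult_right_mono mult_left_mono normal_density_tilt_le u) auto
    finally have *: "ennreal (2 * normal_density 0 (sqrt u) (z - x) * ?e z) \<le> ennreal (2 / sqrt (2 * pi * u) * exp (- 2 * l * (z - x)))"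
      by (intro ennreal_leI) simp
    have "ennreal (2 * normal_density 0 (sqrt u) (z - x)) * (k z * ennreal (?e z)) * indicator {x..} z
        = ennreal (2 * normal_density 0 (sqrt u) (z - x) * ?e z) * (k z * indicator {x..} z)"
      by (simp add: ennreal_mult mult_ac)
    also have "\<dots> \<le> ennreal (2 / sqrt (2 * pi * u) * exp (- 2 * l * (z - x))) * (k z * indicator {x..} z)"
      by (rule mult_right_mono[OF *]) simp
    also have "\<dots> = ennreal (2 / sqrt (2 * pi * u)) * (ennreal (exp (- 2 * l * (z - x))) * k z * indicator {x..} z)"
      using u by (subst ennreal_mult) (auto simp: mult_ac)
    finally show "ennreal (2 * normal_density 0 (sqrt u) (z - x)) * (k z * ennreal (?e z)) * indicator {x..} z
      \<le> ennreal (2 / sqrt (2 * pi * u)) * (ennreal (exp (- 2 * l * (z - x))) * k z * indicator {x..} z)" .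
  qed
  also have "\<dots> = ennreal (2 / sqrt (2 * pi * u)) * (\<integral>\<^sup>+z. ennreal (exp (- 2 * l * (z - x))) * k z * indicator {x..} z \<partial>lborel)"
    by (rule nn_integral_cmult) measurable
  finally show ?thesis .
qed

end

section \<open>Test functions of the supremum\<close>

text \<open>The hypothesis on sets says that the conditional expectation of \<open>U\<close> given
  \<open>F\<close> vanishes almost everywhere; the factor \<open>G\<close> can be taken out of
  it.\<close>

lemma integral_zero_extend_real:
  fixes U G :: "'a \<Rightarrow> real"
  assumes M: "finite_measure M" and sub: "subalgebra M F" and U: "integrable M U"
    and zero: "\<And>A. A \<in> sets F \<Longrightarrow> (LINT w|M. indicator A w * U w) = 0"
    and G: "G \<in> borel_measurable F" and GU: "integrable M (\<lambda>w. G w * U w)"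
  shows "(LINT w|M. G w * U w) = 0"
proof -
  interpret finite_measure_subalgebra M F
    using M sub by (simp add: finite_measure_subalgebra_def finite_measure_subalgebra_axioms_def)
  have "AE w in M. real_cond_exp M F U w = 0"
    by (rule real_cond_exp_charact) (use zero U in \<open>auto simp: set_lebesgue_integral_def\<close>)
  then have AE: "AE w in M. G w * real_cond_exp M F U w = 0" by eventually_elim simp
  have "(LINT w|M. G w * U w) = (LINT w|M. G w * real_cond_exp M F U w)"
    by (rule real_cond_exp_intg(2)[symmetric]) (use G GU U in auto)
  also have "\<dots> = 0" using AE by (rule integral_eq_zero_AE)
  finally show ?thesis .
qed

lemma integral_zero_extend:
  fixes U G :: "'a \<Rightarrow> complex"
  assumes M: "finite_measure M" and sub: "subalgebra M F" and U: "integrable M U"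
    and zero: "\<And>A. A \<in> sets F \<Longrightarrow> (LINT w|M. indicator A w * U w) = 0"
    and G: "G \<in> borel_measurable F" and B: "\<And>w. norm (G w) \<le> B"
  shows "(LINT w|M. G w * U w) = 0"
proof -
  have GM: "G \<in> borel_measurable M" by (rule measurable_from_subalg[OF sub G])
  have GB: "\<bar>Re (G w)\<bar> \<le> B" "\<bar>Im (G w)\<bar> \<le> B" for w
    using B[of w] abs_Re_le_cmod[of "G w"] abs_Im_le_cmod[of "G w"] by auto
  have UR: "integrable M (\<lambda>w. Re (U w))" "integrable M (\<lambda>w. Im (U w))" using U by auto
  have int: "integrable M (\<lambda>w. g w * u w)"
    if "g \<in> borel_measurable M" "\<And>w. \<bar>g w\<bar> \<le> B" "integrable M u" for g u :: "'a \<Rightarrow> real"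
  proof (rule Bochner_Integration.integrable_bound)
    show "integrable M (\<lambda>w. B * u w)" using that(3) by simp
    show "(\<lambda>w. g w * u w) \<in> borel_measurable M" using that by measurable
    show "AE w in M. norm (g w * u w) \<le> norm (B * u w)"
      unfolding real_norm_def abs_mult by (intro AE_I2 mult_right_mono order_trans[OF that(2) abs_ge_self] abs_ge_zero)
  qed
  have z: "(LINT w|M. indicator A w * Re (U w)) = 0" "(LINT w|M. indicator A w * Im (U w)) = 0" if A: "A \<in> sets F" for A
  proof -
    have AM: "A \<in> sets M" using A sub by (auto simp: subalgebra_def)
    have iU: "integrable M (\<lambda>w. indicator A w * U w)"
      by (rule Bochner_Integration.integrable_bound[OF U])
         (use AM U in \<open>auto simp: norm_mult split: split_indicator\<close>)
    have eq: "(\<lambda>w. indicator A w * Re (U w)) = (\<lambda>w. Re (indicator A w * U w))"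
      "(\<lambda>w. indicator A w * Im (U w)) = (\<lambda>w. Im (indicator A w * U w))"
      by (auto split: split_indicator)
    show "(LINT w|M. indicator A w * Re (U w)) = 0" "(LINT w|M. indicator A w * Im (U w)) = 0"
      unfolding eq integral_Re[OF iU] integral_Im[OF iU] zero[OF A] by simp_all
  qed
  have Gm: "(\<lambda>w. Re (G w)) \<in> borel_measurable F" "(\<lambda>w. Im (G w)) \<in> borel_measurable F"
    "(\<lambda>w. Re (G w)) \<in> borel_measurable M" "(\<lambda>w. Im (G w)) \<in> borel_measurable M"
    using G GM by measurable
  note i = int[OF Gm(3) GB(1) UR(1)] int[OF Gm(3) GB(1) UR(2)] int[OF Gm(4) GB(2) UR(1)] int[OF Gm(4) GB(2) UR(2)]
  have zz: "(LINT w|M. Re (G w) * Re (U w)) = 0" "(LINT w|M. Re (G w) * Im (U w)) = 0"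
    "(LINT w|M. Im (G w) * Re (U w)) = 0" "(LINT w|M. Im (G w) * Im (U w)) = 0"
    by (rule integral_zero_extend_real[OF M sub UR(1) z(1) Gm(1) i(1)] integral_zero_extend_real[OF M sub UR(2) z(2) Gm(1) i(2)]
        integral_zero_extend_real[OF M sub UR(1) z(1) Gm(2) i(3)] integral_zero_extend_real[OF M sub UR(2) z(2) Gm(2) i(4)]; assumption)+
  have iGU: "integrable M (\<lambda>w. G w * U w)"
  proof (rule Bochner_Integration.integrable_bound)
    show "integrable M (\<lambda>w. B * norm (U w))" using U by simp
    show "(\<lambda>w. G w * U w) \<in> borel_measurable M" using GM U by measurable
    show "AE w in M. norm (G w * U w) \<le> norm (B * norm (U w))"
      unfolding norm_mult real_norm_def abs_mult abs_norm_cancel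
      by (intro AE_I2 mult_right_mono order_trans[OF B abs_ge_self] norm_ge_zero)
  qed
  show ?thesis
  proof (rule complex_eqI)
    have "Re (LINT w|M. G w * U w) = (LINT w|M. Re (G w) * Re (U w) - Im (G w) * Im (U w))"
      using integral_Re[OF iGU] by simp
    then show "Re (LINT w|M. G w * U w) = Re 0" using i zz by simp
    have "Im (LINT w|M. G w * U w) = (LINT w|M. Re (G w) * Im (U w) + Im (G w) * Re (U w))"
      using integral_Im[OF iGU] by simp
    then show "Im (LINT w|M. G w * U w) = Im 0" using i zz by simp
  qed
qed

text \<open>A monotone class argument for complex weights, on two unrelated measure spaces: from
  rays to Borel sets, then to nonnegative functions. Boundedness of \<open>F1\<close> and
  \<open>F2\<close> lets integrability of \<open>k\<close> alone dominate every limit.\<close>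

lemma integral_eq_of_rays:
  fixes F1 :: "'a \<Rightarrow> complex" and F2 :: "'b \<Rightarrow> complex" and X1 :: "'a \<Rightarrow> real" and X2 :: "'b \<Rightarrow> real"
    and k :: "real \<Rightarrow> real"
  assumes M1: "finite_measure M1" and M2: "finite_measure M2"
    and X1[measurable]: "X1 \<in> borel_measurable M1" and X2[measurable]: "X2 \<in> borel_measurable M2"
    and F1[measurable]: "F1 \<in> borel_measurable M1" and F2[measurable]: "F2 \<in> borel_measurable M2"
    and B1: "\<And>w. norm (F1 w) \<le> B" and B2: "\<And>w. norm (F2 w) \<le> B"
    and rays: "\<And>a. (LINT w|M1. indicator {a<..} (X1 w) *\<^sub>R F1 w) = (LINT w|M2. indicator {a<..} (X2 w) *\<^sub>R F2 w)"
    and k: "k \<in> borel_measurable borel" "\<And>z. 0 \<le> k z"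
    and k1: "integrable M1 (\<lambda>w. k (X1 w))" and k2: "integrable M2 (\<lambda>w. k (X2 w))"
  shows "(LINT w|M1. k (X1 w) *\<^sub>R F1 w) = (LINT w|M2. k (X2 w) *\<^sub>R F2 w)"
proof -
  interpret M1: finite_measure M1 by fact
  interpret M2: finite_measure M2 by fact
  have intF: "integrable M1 F1" "integrable M2 F2"
    by (rule M1.integrable_const_bound[where B=B] M2.integrable_const_bound[where B=B]; use B1 B2 in auto)+
  have bound: "integrable M1 (\<lambda>w. f (X1 w) *\<^sub>R F1 w)" "integrable M2 (\<lambda>w. f (X2 w) *\<^sub>R F2 w)"
    if [measurable]: "f \<in> borel_measurable borel" and "integrable M1 (\<lambda>w. f (X1 w))" "integrable M2 (\<lambda>w. f (X2 w))" for f :: "real \<Rightarrow> real"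
  proof -
    show "integrable M1 (\<lambda>w. f (X1 w) *\<^sub>R F1 w)"
    proof (rule Bochner_Integration.integrable_bound)
      show "integrable M1 (\<lambda>w. B * f (X1 w))" using that by simp
      show "AE w in M1. norm (f (X1 w) *\<^sub>R F1 w) \<le> norm (B * f (X1 w))"
        unfolding norm_scaleR real_norm_def abs_mult mult.commute[of "\<bar>B\<bar>"]
        by (intro AE_I2 mult_left_mono order_trans[OF B1 abs_ge_self] abs_ge_zero)
    qed measurable
    show "integrable M2 (\<lambda>w. f (X2 w) *\<^sub>R F2 w)"
    proof (rule Bochner_Integration.integrable_bound)
      show "integrable M2 (\<lambda>w. B * f (X2 w))" using that by simp
      show "AE w in M2. norm (f (X2 w) *\<^sub>R F2 w) \<le> norm (B * f (X2 w))"
        unfolding norm_scaleR real_norm_def abs_mult mult.commute[of "\<bar>B\<bar>"]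
        by (intro AE_I2 mult_left_mono order_trans[OF B2 abs_ge_self] abs_ge_zero)
    qed measurable
  qed
  have iind: "integrable M1 (\<lambda>w. indicator A (X1 w) :: real)" "integrable M2 (\<lambda>w. indicator A (X2 w) :: real)"
    if [measurable]: "A \<in> sets borel" for A
    by (rule M1.integrable_const_bound[where B=1] M2.integrable_const_bound[where B=1]; auto split: split_indicator)+
  have indm: "(indicator A :: real \<Rightarrow> real) \<in> borel_measurable borel" if "A \<in> sets borel" for A using that by measurable
  note bi = bound[OF indm iind]
  have lim_eq: "(LINT w|M1. g (X1 w) *\<^sub>R F1 w) = (LINT w|M2. g (X2 w) *\<^sub>R F2 w)"
    if gm: "\<And>n. (f n :: real \<Rightarrow> real) \<in> borel_measurable borel" and g: "g \<in> borel_measurable borel"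
      and lim: "\<And>z. (\<lambda>n. f n z) \<longlonglongrightarrow> g z" and le: "\<And>n z. \<bar>f n z\<bar> \<le> d z"
      and d: "d \<in> borel_measurable borel" "integrable M1 (\<lambda>w. d (X1 w))" "integrable M2 (\<lambda>w. d (X2 w))"
      and eq: "\<And>n. (LINT w|M1. f n (X1 w) *\<^sub>R F1 w) = (LINT w|M2. f n (X2 w) *\<^sub>R F2 w)" for f :: "nat \<Rightarrow> real \<Rightarrow> real" and g d
  proof -
    note [measurable] = gm g d(1)
    have d0: "0 \<le> d z" for z using le[of 0 z] by linarith
    have "(\<lambda>n. LINT w|M1. f n (X1 w) *\<^sub>R F1 w) \<longlonglongrightarrow> (LINT w|M1. g (X1 w) *\<^sub>R F1 w)"
    proof (rule integral_dominated_convergence[where w="\<lambda>w. B * d (X1 w)"])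
      show "AE w in M1. norm (f n (X1 w) *\<^sub>R F1 w) \<le> B * d (X1 w)" for n
        unfolding norm_scaleR mult.commute[of B] by (intro AE_I2 mult_mono le B1 d0) auto
      show "AE w in M1. (\<lambda>n. f n (X1 w) *\<^sub>R F1 w) \<longlonglongrightarrow> g (X1 w) *\<^sub>R F1 w"
        by (intro AE_I2 tendsto_intros lim)
    qed (use d in auto)
    moreover have "(\<lambda>n. LINT w|M2. f n (X2 w) *\<^sub>R F2 w) \<longlonglongrightarrow> (LINT w|M2. g (X2 w) *\<^sub>R F2 w)"
    proof (rule integral_dominated_convergence[where w="\<lambda>w. B * d (X2 w)"])
      show "AE w in M2. norm (f n (X2 w) *\<^sub>R F2 w) \<le> B * d (X2 w)" for n
        unfolding norm_scaleR mult.commute[of B] by (intro AE_I2 mult_mono le B2 d0) auto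
      show "AE w in M2. (\<lambda>n. f n (X2 w) *\<^sub>R F2 w) \<longlonglongrightarrow> g (X2 w) *\<^sub>R F2 w"
        by (intro AE_I2 tendsto_intros lim)
    qed (use d in auto)
    ultimately show ?thesis unfolding eq by (rule LIMSEQ_unique)
  qed
  \<comment> \<open>The whole line is the limit of the rays \<open>{- real n<..}\<close>; its case
    is what complements need in the induction over Borel sets.\<close>
  have one: "(LINT w|M1. F1 w) = (LINT w|M2. F2 w)"
  proof -
    have "(LINT w|M1. (\<lambda>_. 1) (X1 w) *\<^sub>R F1 w) = (LINT w|M2. (\<lambda>_. 1) (X2 w) *\<^sub>R F2 w)"
    proof (rule lim_eq[where f="\<lambda>n. indicator {- real n<..}" and d="\<lambda>_. 1"])
      fix z :: real
      obtain N :: nat where "- z < real N" using reals_Archimedean2 by blast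
      have "\<forall>\<^sub>F n in sequentially. 1 = (indicator {- real n<..} z :: real)"
        using eventually_ge_at_top[of N] by eventually_elim (use \<open>- z < real N\<close> in simp)
      then show "(\<lambda>n. indicator {- real n<..} z :: real) \<longlonglongrightarrow> 1"
        by (rule Lim_transform_eventually[OF tendsto_const])
    qed (use rays in \<open>auto split: split_indicator\<close>)
    then show ?thesis by simp
  qed
  have sets_eq: "(LINT w|M1. indicator A (X1 w) *\<^sub>R F1 w) = (LINT w|M2. indicator A (X2 w) *\<^sub>R F2 w)"
    if "A \<in> sets borel" for A :: "real set"
  proof -
    have ist: "Int_stable (range (greaterThan :: real \<Rightarrow> _))"
    proof (rule Int_stableI, safe)
      fix x y :: real show "{x<..} \<inter> {y<..} \<in> range greaterThan" by (intro image_eqI[of _ _ "max x y"]) auto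
    qed
    have A: "A \<in> sigma_sets UNIV (range greaterThan)" using that by (simp add: borel_Ioi)
    have "range greaterThan \<subseteq> Pow (UNIV :: real set)" by simp
    from ist this A show ?thesis
    proof (induction rule: sigma_sets_induct_disjoint)
      fix A assume "A \<in> range (greaterThan :: real \<Rightarrow> _)"
      then show "(LINT w|M1. indicator A (X1 w) *\<^sub>R F1 w) = (LINT w|M2. indicator A (X2 w) *\<^sub>R F2 w)" using rays by auto
    next
      fix A assume "A \<in> sigma_sets UNIV (range (greaterThan :: real \<Rightarrow> _))"
        and IH: "(LINT w|M1. indicator A (X1 w) *\<^sub>R F1 w) = (LINT w|M2. indicator A (X2 w) *\<^sub>R F2 w)"
      then have A: "A \<in> sets borel" by (simp add: borel_Ioi)
      have c: "indicator (UNIV - A) z *\<^sub>R F = F - indicator A z *\<^sub>R F" for z and F :: complex by (auto split: split_indicator)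
      show "(LINT w|M1. indicator (UNIV - A) (X1 w) *\<^sub>R F1 w) = (LINT w|M2. indicator (UNIV - A) (X2 w) *\<^sub>R F2 w)"
        unfolding c using bi[OF A A A] intF one IH by simp
    next
      fix A :: "nat \<Rightarrow> real set"
      assume disj: "disjoint_family A" and "range A \<subseteq> sigma_sets UNIV (range (greaterThan :: real \<Rightarrow> _))"
        and IH: "\<And>i. (LINT w|M1. indicator (A i) (X1 w) *\<^sub>R F1 w) = (LINT w|M2. indicator (A i) (X2 w) *\<^sub>R F2 w)"
      then have A[measurable]: "A i \<in> sets borel" for i by (auto simp: borel_Ioi)
      show "(LINT w|M1. indicator (\<Union>i. A i) (X1 w) *\<^sub>R F1 w) = (LINT w|M2. indicator (\<Union>i. A i) (X2 w) *\<^sub>R F2 w)"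
      proof (rule lim_eq[where f="\<lambda>n. indicator (\<Union>i<n. A i)" and d="\<lambda>_. 1"])
        show "(\<lambda>n. indicator (\<Union>i<n. A i) z :: real) \<longlonglongrightarrow> indicator (\<Union>i. A i) z" for z by (rule LIMSEQ_indicator_UN)
        have ind: "indicator (\<Union>i<n. A i) z = (\<Sum>i<n. indicator (A i) z :: real)" for n z
          by (rule indicator_UN_disjoint) (use disj in \<open>auto simp: disjoint_family_on_def\<close>)
        show "(LINT w|M1. indicator (\<Union>i<n. A i) (X1 w) *\<^sub>R F1 w) = (LINT w|M2. indicator (\<Union>i<n. A i) (X2 w) *\<^sub>R F2 w)" for n
          unfolding ind scaleR_sum_left
          by (simp only: Bochner_Integration.integral_sum[OF bi(1)[OF A A A]] Bochner_Integration.integral_sum[OF bi(2)[OF A A A]] IH)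
      qed (auto split: split_indicator)
    qed simp
  qed
  show ?thesis
    using k k1 k2
  proof (induction k rule: borel_measurable_induct_real)
    case (set A)
    then show ?case using sets_eq by simp
  next
    case (mult u c)
    show ?case
    proof (cases "c = 0")
      case False
      with mult have "integrable M1 (\<lambda>w. u (X1 w))" "integrable M2 (\<lambda>w. u (X2 w))" by simp_all
      with mult.IH show ?thesis by (simp add: scaleR_scaleR[symmetric] del: scaleR_scaleR)
    qed simp
  next
    case (add u v)
    note [measurable] = add.hyps(1,3)
    have "integrable M1 (\<lambda>w. u (X1 w))" "integrable M1 (\<lambda>w. v (X1 w))"
      by (rule Bochner_Integration.integrable_bound[OF add.prems(1)]; use add.hyps in \<open>auto intro!: AE_I2\<close>)+
    moreover have "integrable M2 (\<lambda>w. u (X2 w))" "integrable M2 (\<lambda>w. v (X2 w))"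
      by (rule Bochner_Integration.integrable_bound[OF add.prems(2)]; use add.hyps in \<open>auto intro!: AE_I2\<close>)+
    ultimately show ?case
      using add.IH bound[OF add.hyps(1)] bound[OF add.hyps(3)] by (simp add: scaleR_left_distrib)
  next
    case (seq U)
    have mono: "U i z \<le> k z" for i z
      using seq.hyps(3) seq.hyps(4)[of z] by (intro incseq_le[of "\<lambda>i. U i z"]) (auto simp: incseq_def le_fun_def)
    show ?case
    proof (rule lim_eq[where f=U and d=k])
      show "(LINT w|M1. U n (X1 w) *\<^sub>R F1 w) = (LINT w|M2. U n (X2 w) *\<^sub>R F2 w)" for n
      proof (rule seq.IH)
        note [measurable] = seq.hyps(1)
        show "integrable M1 (\<lambda>w. U n (X1 w))"
          by (rule Bochner_Integration.integrable_bound[OF seq.prems(1)])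
             (use mono seq.hyps(2) in \<open>auto intro!: AE_I2 order_trans[OF _ abs_ge_self]\<close>)
        show "integrable M2 (\<lambda>w. U n (X2 w))"
          by (rule Bochner_Integration.integrable_bound[OF seq.prems(2)])
             (use mono seq.hyps(2) in \<open>auto intro!: AE_I2 order_trans[OF _ abs_ge_self]\<close>)
      qed
    qed (use seq.hyps seq.prems mono k in auto)
  qed
qed

lemma measurable_path_id:
  assumes "sets M = sets filt_inf"
  shows "(\<lambda>w. w) \<in> measurable M (filt t)"
  using sets_filt_inf[of t] sets_eq_imp_space_eq[OF assms]
  by (auto simp: measurable_def assms)

lemma measurable_joint_processes:
  assumes M: "sets M = sets filt_inf" and t: "0 \<le> t"
  shows "(\<lambda>p. coord (clamp_time t (snd p)) (fst p)) \<in> borel_measurable (M \<Otimes>\<^sub>M borel)"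
    and "(\<lambda>p. run_sup (clamp_time t (snd p)) (fst p)) \<in> borel_measurable (M \<Otimes>\<^sub>M borel)"
    and "(\<lambda>p. expmart \<theta> (clamp_time t (snd p)) (fst p)) \<in> borel_measurable (M \<Otimes>\<^sub>M borel)"
proof -
  have f: "fst \<in> measurable (M \<Otimes>\<^sub>M (borel :: real measure)) (filt t)"
    using measurable_compose[OF measurable_fst[of M "borel :: real measure"] measurable_path_id[OF M, of t]] by simp
  show [measurable]: "(\<lambda>p. coord (clamp_time t (snd p)) (fst p)) \<in> borel_measurable (M \<Otimes>\<^sub>M borel)"
    by (rule measurable_coord_joint[OF t _ f]) measurable
  show "(\<lambda>p. run_sup (clamp_time t (snd p)) (fst p)) \<in> borel_measurable (M \<Otimes>\<^sub>M borel)"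
    by (rule measurable_run_sup_joint[OF t _ f]) measurable
  show "(\<lambda>p. expmart \<theta> (clamp_time t (snd p)) (fst p)) \<in> borel_measurable (M \<Otimes>\<^sub>M borel)"
    unfolding expmart_def by measurable
qed

text \<open>Joint measurability is available for the process frozen outside \<open>{0..t}\<close>;
  the indicator of \<open>{s..t}\<close> makes the freezing invisible, so the conclusions other than
  the integral over the product can be stated without it.\<close>

lemma fubini_time:
  fixes G :: "'a \<Rightarrow> complex" and H :: "real \<Rightarrow> 'a \<Rightarrow> complex"
  assumes M: "prob_space M" and st: "0 \<le> s" "s \<le> t"
    and G: "G \<in> borel_measurable M" and B: "\<And>w. norm (G w) \<le> B"
    and H: "(\<lambda>p. H (clamp_time t (snd p)) (fst p)) \<in> borel_measurable (M \<Otimes>\<^sub>M borel)"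
    and HB: "\<forall>u\<in>{s..t}. \<forall>w. norm (H u w) \<le> B'"
  shows "(LINT w|M. G w * (LINT u:{s..t}|lborel. H u w)) = (LINT u:{s..t}|lborel. LINT w|M. G w * H u w)"
    and "set_integrable lborel {s..t} (\<lambda>u. LINT w|M. G w * H u w)"
    and "(LINT p|(M \<Otimes>\<^sub>M lborel). indicator {s..t} (snd p) *\<^sub>R (G (fst p) * H (clamp_time t (snd p)) (fst p)))
       = (LINT u:{s..t}|lborel. LINT w|M. G w * H u w)"
    and "integrable M (\<lambda>w. G w * (LINT u:{s..t}|lborel. H u w))"
proof -
  interpret prob_space M by fact
  interpret pr: pair_sigma_finite M lborel ..
  note [measurable] = G H
  have B0: "0 \<le> B" using B[of undefined] norm_ge_zero order_trans by blast
  define f where "f w u = indicator {s..t} u *\<^sub>R (G w * H (clamp_time t u) w)" for w u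
  have H': "(\<lambda>p. H (clamp_time t (snd p)) (fst p)) \<in> borel_measurable (M \<Otimes>\<^sub>M lborel)"
  proof -
    have "sets (M \<Otimes>\<^sub>M lborel) = sets (M \<Otimes>\<^sub>M borel)" by (rule sets_pair_measure_cong) simp_all
    then show ?thesis using H measurable_cong_sets[OF _ refl] by blast
  qed
  note [measurable] = H'
  have fm: "case_prod f \<in> borel_measurable (M \<Otimes>\<^sub>M lborel)"
    unfolding f_def split_beta' by measurable
  have int: "integrable (M \<Otimes>\<^sub>M lborel) (case_prod f)"
  proof (rule integrableI_bounded_set[where A="space M \<times> {s..t}" and B="B * B'"])
    show "space M \<times> {s..t} \<in> sets (M \<Otimes>\<^sub>M lborel)" by measurable
    show "emeasure (M \<Otimes>\<^sub>M lborel) (space M \<times> {s..t}) < \<infinity>"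
      using st by (subst lborel.emeasure_pair_measure_Times) (auto simp: emeasure_space_1)
    show "AE p in M \<Otimes>\<^sub>M lborel. p \<in> space M \<times> {s..t} \<longrightarrow> norm (case_prod f p) \<le> B * B'"
      using st by (intro AE_I2) (auto simp: f_def norm_mult intro!: mult_mono B HB[rule_format] B0)
    show "AE p in M \<Otimes>\<^sub>M lborel. p \<notin> space M \<times> {s..t} \<longrightarrow> case_prod f p = 0"
      by (rule AE_I2) (auto simp: f_def space_pair_measure indicator_def split: if_splits)
  qed (rule fm)
  have f1: "(LINT u|lborel. f w u) = G w * (LINT u:{s..t}|lborel. H u w)" for w
  proof -
    have "(LINT u|lborel. f w u) = (LINT u|lborel. G w * (indicator {s..t} u *\<^sub>R H u w))"
      by (rule Bochner_Integration.integral_cong) (use st in \<open>auto simp: f_def split: split_indicator\<close>)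
    also have "\<dots> = G w * (LINT u|lborel. indicator {s..t} u *\<^sub>R H u w)" by (rule integral_mult_right_zero)
    finally show ?thesis by (simp only: set_lebesgue_integral_def)
  qed
  have f2: "(LINT w|M. f w u) = indicator {s..t} u *\<^sub>R (LINT w|M. G w * H u w)" for u
    using st by (auto simp: f_def split: split_indicator)
  show "(LINT w|M. G w * (LINT u:{s..t}|lborel. H u w)) = (LINT u:{s..t}|lborel. LINT w|M. G w * H u w)"
    using pr.Fubini_integral[OF int] by (simp add: f1 f2 set_lebesgue_integral_def)
  show "set_integrable lborel {s..t} (\<lambda>u. LINT w|M. G w * H u w)"
    using pr.integrable_snd[OF int] by (simp add: f2 set_integrable_def)
  show "integrable M (\<lambda>w. G w * (LINT u:{s..t}|lborel. H u w))"
    using pr.integrable_fst[OF int] by (simp add: f1)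
  have "(LINT p|(M \<Otimes>\<^sub>M lborel). case_prod f p) = (LINT u|lborel. LINT w|M. f w u)"
    by (rule pr.integral_snd[OF int, symmetric])
  then show "(LINT p|(M \<Otimes>\<^sub>M lborel). indicator {s..t} (snd p) *\<^sub>R (G (fst p) * H (clamp_time t (snd p)) (fst p)))
       = (LINT u:{s..t}|lborel. LINT w|M. G w * H u w)"
    by (simp only: f2 set_lebesgue_integral_def) (simp add: f_def split_beta')
qed

section \<open>The exponential process given the total supremum\<close>

context drift_pair
begin

text \<open>The integrand besides the indicator belongs to the past of \<open>u\<close>, so the
  indicator may be replaced by its conditional probability. Where the level is already passed this
  is 1; elsewhere it is \<open>hit_weight a\<close> times the density of \<open>Rp\<close>.\<close>

lemma integral_total_sup_level:
  fixes G :: "(real \<Rightarrow> real) \<Rightarrow> complex"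
  assumes u: "0 \<le> u" and G: "G \<in> borel_measurable (filt u)" and B: "\<And>w. norm (G w) \<le> B"
  shows "(LINT w|R. indicator {a<..} (total_sup w) *\<^sub>R (G w * expmart \<theta> u w))
    = (LINT w|R. G w * up_part \<theta> a u w) + of_real (hit_weight a) * (LINT w|Rp. G w * dn_part \<theta> a u w)"
proof -
  have B0: "0 \<le> B" using B[of undefined] norm_ge_zero order_trans by blast
  note Sm = measurable_run_sup[OF u order_refl] and Xm = measurable_coord_filt[OF u order_refl] and Em = measurable_expmart[OF u order_refl, of \<theta>]
  note [measurable] = G Sm Xm Em
  \<comment> \<open>The conditional probability under \<open>R\<close>, given \<open>filt u\<close>,
    that the total supremum exceeds \<open>a\<close>, read off from
    \<open>total_sup_tail\<close>.\<close>
  define q where "q w = (if a < run_sup u w then 1 else exp (- 2 * l * (a - coord u w)))" for w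
  have qm: "q \<in> borel_measurable (filt u)" unfolding q_def by measurable
  have q: "0 \<le> q w" "w \<in> path_space \<Longrightarrow> q w \<le> 1" for w
    using coord_le_run_sup[of w u u] u l by (auto simp: q_def mult_nonpos_nonneg)
  have qR[measurable]: "q \<in> borel_measurable R" by (rule measurable_R(2)[OF qm])
  have TR[measurable]: "total_sup \<in> borel_measurable R" by (rule measurable_R(1)[OF measurable_total_sup])
  let ?I = "\<lambda>w. indicator {a<..} (total_sup w) :: real"
  have iI: "integrable R (\<lambda>w. complex_of_real (?I w))" and iq: "integrable R (\<lambda>w. complex_of_real (q w))"
    by (rule R.integrable_const_bound[where B=1]; use q in \<open>auto split: split_indicator\<close>)+
  define U where "U w = complex_of_real (?I w) - of_real (q w)" for w
  have U: "integrable R U" unfolding U_def using iI iq by simp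
  have GE: "(\<lambda>w. G w * expmart \<theta> u w) \<in> borel_measurable (filt u)" by measurable
  have GEB: "norm (G w * expmart \<theta> u w) \<le> B * exp (\<theta>\<^sup>2 * u / 2)" for w
    using B by (auto simp: norm_mult norm_expmart)
  have "(LINT w|R. (G w * expmart \<theta> u w) * U w) = 0"
  proof (rule integral_zero_extend[OF R.finite_measure_axioms gauss_incrementsD(6)[OF R] U _ GE GEB])
    fix A assume A: "A \<in> sets (filt u)"
    have AR[measurable]: "A \<in> sets R" by (rule subsetD[OF gauss_incrementsD(5)[OF R] A])
    have A_sub: "A \<subseteq> path_space" using sets.sets_into_space[OF A] by simp
    have S: "A \<inter> {w\<in>path_space. a < total_sup w} \<in> sets R"
    proof -
      have "A \<inter> {w\<in>space R. a < total_sup w} \<in> sets R" by measurable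
      then show ?thesis by simp
    qed
    have "(LINT w|R. indicator A w * ?I w) = (LINT w|R. indicator (A \<inter> {w\<in>path_space. a < total_sup w}) w)"
      by (rule Bochner_Integration.integral_cong) (auto split: split_indicator)
    also have "\<dots> = measure R (A \<inter> {w\<in>path_space. a < total_sup w})"
      using sets.sets_into_space[OF S] by (simp add: Int_absorb2)
    also have "\<dots> = enn2real (\<integral>\<^sup>+w. indicator A w * ennreal (q w) \<partial>R)"
      unfolding measure_def total_sup_tail[OF u A] q_def by simp
    also have "\<dots> = enn2real (\<integral>\<^sup>+w. ennreal (indicator A w * q w) \<partial>R)"
      by (intro arg_cong[where f=enn2real] nn_integral_cong) (auto split: split_indicator)
    also have "\<dots> = (LINT w|R. indicator A w * q w)"
      by (rule integral_eq_nn_integral[symmetric]) (use q in auto)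
    finally have eq: "(LINT w|R. indicator A w * ?I w) = (LINT w|R. indicator A w * q w)" .
    have i: "integrable R (\<lambda>w. indicator A w * ?I w)" "integrable R (\<lambda>w. indicator A w * q w)"
      by (rule R.integrable_const_bound[where B=1]; use q in \<open>auto split: split_indicator\<close>)+
    have "(LINT w|R. indicator A w * U w) = (LINT w|R. complex_of_real (indicator A w * ?I w - indicator A w * q w))"
      by (rule Bochner_Integration.integral_cong) (auto simp: U_def split: split_indicator)
    also have "\<dots> = of_real (LINT w|R. indicator A w * ?I w - indicator A w * q w)"
      by (rule integral_complex_of_real)
    also have "\<dots> = 0" using eq i by (subst Bochner_Integration.integral_diff) auto
    finally show "(LINT w|R. indicator A w * U w) = 0" .
  qed
  moreover have bint: "integrable R (\<lambda>w. (G w * expmart \<theta> u w) * of_real (f w))"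
    if "f \<in> borel_measurable R" "\<And>w. w \<in> path_space \<Longrightarrow> \<bar>f w\<bar> \<le> 1" for f
  proof (rule R.integrable_const_bound[where B="B * exp (\<theta>\<^sup>2 * u / 2) * 1"])
    show "AE w in R. norm ((G w * expmart \<theta> u w) * of_real (f w)) \<le> B * exp (\<theta>\<^sup>2 * u / 2) * 1"
    proof (rule AE_I2)
      fix w assume "w \<in> space R"
      then show "norm ((G w * expmart \<theta> u w) * of_real (f w)) \<le> B * exp (\<theta>\<^sup>2 * u / 2) * 1"
        unfolding norm_mult[of "G w * expmart \<theta> u w"] norm_of_real
        by (intro mult_mono GEB that(2)) (use B0 in auto)
    qed
    show "(\<lambda>w. (G w * expmart \<theta> u w) * of_real (f w)) \<in> borel_measurable R"
      using measurable_R(2)[OF GE] that(1) by measurable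
  qed
  have i1: "integrable R (\<lambda>w. (G w * expmart \<theta> u w) * of_real (?I w))"
    by (rule bint) (auto split: split_indicator)
  have i2: "integrable R (\<lambda>w. (G w * expmart \<theta> u w) * of_real (q w))"
    by (rule bint) (use q in auto)
  ultimately have "(LINT w|R. (G w * expmart \<theta> u w) * of_real (?I w)) = (LINT w|R. (G w * expmart \<theta> u w) * of_real (q w))"
    unfolding U_def right_diff_distrib by (simp add: Bochner_Integration.integral_diff[OF i1 i2])
  also have "\<dots> = (LINT w|R. G w * up_part \<theta> a u w + of_real (hit_weight a) * (exp (2 * l * (coord u w - x)) *\<^sub>R (G w * dn_part \<theta> a u w)))"
  proof (rule Bochner_Integration.integral_cong[OF refl])
    fix w
    have "exp (- 2 * l * (a - coord u w)) = hit_weight a * exp (2 * l * (coord u w - x))"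
      by (simp add: exp_add[symmetric] algebra_simps)
    then show "(G w * expmart \<theta> u w) * of_real (q w)
        = G w * up_part \<theta> a u w + of_real (hit_weight a) * (exp (2 * l * (coord u w - x)) *\<^sub>R (G w * dn_part \<theta> a u w))"
      by (simp add: q_def up_part_def dn_part_def scaleR_conv_of_real del: of_real_exp)
  qed
  also have "\<dots> = (LINT w|R. G w * up_part \<theta> a u w) + of_real (hit_weight a) * (LINT w|R. exp (2 * l * (coord u w - x)) *\<^sub>R (G w * dn_part \<theta> a u w))"
  proof -
    note [measurable] = measurable_up_part[OF u order_refl, of \<theta> a] measurable_dn_part[OF u order_refl, of \<theta> a]
    have um: "(\<lambda>w. G w * up_part \<theta> a u w) \<in> borel_measurable (filt u)" and dm: "(\<lambda>w. G w * dn_part \<theta> a u w) \<in> borel_measurable (filt u)"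
      by measurable
    have iu: "integrable R (\<lambda>w. G w * up_part \<theta> a u w)"
      by (rule R.integrable_const_bound[where B="B * exp (\<theta>\<^sup>2 * u / 2)", OF _ measurable_R(2)[OF um]])
         (auto simp: norm_mult intro!: AE_I2 mult_mono B B0 norm_up_part)
    have "integrable Rp (\<lambda>w. G w * dn_part \<theta> a u w)"
      by (rule Rp.integrable_const_bound[where B="B * exp (\<theta>\<^sup>2 * u / 2)", OF _ measurable_Rp(2)[OF dm]])
         (auto simp: norm_mult intro!: AE_I2 mult_mono B B0 norm_dn_part)
    then have id: "integrable R (\<lambda>w. exp (2 * l * (coord u w - x)) *\<^sub>R (G w * dn_part \<theta> a u w))"
      using integral_R_Rp(2)[OF u dm] by simp
    show ?thesis
      by (simp only: Bochner_Integration.integral_add[OF iu integrable_mult_right[OF id]] integral_mult_right_zero)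
  qed
  also have "(LINT w|R. exp (2 * l * (coord u w - x)) *\<^sub>R (G w * dn_part \<theta> a u w)) = (LINT w|Rp. G w * dn_part \<theta> a u w)"
    by (rule integral_R_Rp(1)[OF u]) (use measurable_dn_part[OF u order_refl, of \<theta> a] in measurable)
  finally show ?thesis by (simp add: scaleR_conv_of_real mult.commute)
qed

text \<open>Given that \<open>a\<close> is eventually passed, the path has drift \<open>l\<close>
  before the passage and \<open>- l\<close> after it. Compensating with \<open>l\<close> throughout
  leaves \<open>- 2 * l\<close> on the times at which \<open>a < run_sup u w\<close>: a ray of the
  total supremum on the left is matched with the same ray of the running supremum on the right, and
  \<open>integral_eq_of_rays\<close> passes to \<open>k\<close>.\<close>

lemma sup_identity:
  fixes G :: "(real \<Rightarrow> real) \<Rightarrow> complex" and k :: "real \<Rightarrow> real"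
  assumes st: "0 \<le> s" "s < t" and G: "G \<in> borel_measurable (filt s)" and B: "\<And>w. norm (G w) \<le> B"
    and k: "k \<in> borel_measurable borel" "\<And>z. 0 \<le> k z" and k1: "integrable R (\<lambda>w. k (total_sup w))"
    and k2: "integrable (R \<Otimes>\<^sub>M lborel) (\<lambda>p. indicator {s..t} (snd p) *\<^sub>R k (run_sup (clamp_time t (snd p)) (fst p)))"
  shows "(LINT w|R. k (total_sup w) *\<^sub>R (G w * (expmart \<theta> t w - expmart \<theta> s w - \<i> * of_real (l * \<theta>) * (LINT u:{s..t}|lborel. expmart \<theta> u w))))
    = (LINT p|(R \<Otimes>\<^sub>M lborel). indicator {s..t} (snd p) *\<^sub>R (k (run_sup (clamp_time t (snd p)) (fst p))
        *\<^sub>R (- 2 * \<i> * of_real (l * \<theta>) * G (fst p) * expmart \<theta> (clamp_time t (snd p)) (fst p))))"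
proof -
  have t0: "0 \<le> t" and st': "s \<le> t" using st by auto
  have B0: "0 \<le> B" using B[of undefined] norm_ge_zero order_trans by blast
  note sR = gauss_incrementsD(2)[OF R] and sRp = gauss_incrementsD(2)[OF Rp]
  have GR[measurable]: "G \<in> borel_measurable R" and GRp: "G \<in> borel_measurable Rp" by (rule measurable_R(2)[OF G] measurable_Rp(2)[OF G])+
  have TR[measurable]: "total_sup \<in> borel_measurable R" by (rule measurable_R(1)[OF measurable_total_sup])
  have Eb: "norm (expmart \<theta> u w) \<le> exp (\<theta>\<^sup>2 * t / 2)" if "u \<in> {s..t}" for u w using that by (intro norm_expmart_le) auto
  have Eb': "\<forall>u\<in>{s..t}. \<forall>w. norm (expmart \<theta> u w) \<le> exp (\<theta>\<^sup>2 * t / 2)" using Eb by blast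
  note [measurable] = measurable_joint_processes[OF sR t0]
  note jp = measurable_joint_processes[OF sRp t0]
  have EE[measurable]: "expmart \<theta> u \<in> borel_measurable R" if "u \<in> {s..t}" for u
    by (rule measurable_R(2)[OF measurable_expmart[OF _ order_refl]]) (use that st in auto)
  let ?C = "\<lambda>a. complex_of_real (hit_weight a)"
  let ?F1 = "\<lambda>w. G w * (expmart \<theta> t w - expmart \<theta> s w - \<i> * of_real (l * \<theta>) * (LINT u:{s..t}|lborel. expmart \<theta> u w))"
  let ?F2 = "\<lambda>p. - 2 * \<i> * of_real (l * \<theta>) * G (fst p) * expmart \<theta> (clamp_time t (snd p)) (fst p)"
  \<comment> \<open>Time is adjoined as a second coordinate and restricted to \<open>{s..t}\<close>,
    so that the running supremum at a variable time becomes one function on a single finite measure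
    space.\<close>
  let ?M2 = "density (R \<Otimes>\<^sub>M lborel) (\<lambda>p. indicator {s..t} (snd p) :: ennreal)"
  have sp: "sets (R \<Otimes>\<^sub>M lborel) = sets (R \<Otimes>\<^sub>M borel)" by (rule sets_pair_measure_cong) simp_all
  have lb: "f \<in> borel_measurable (R \<Otimes>\<^sub>M lborel)" if "f \<in> borel_measurable (R \<Otimes>\<^sub>M borel)" for f :: "_ \<Rightarrow> 'z::topological_space"
    using that measurable_cong_sets[OF sp refl] by blast
  have F2m: "?F2 \<in> borel_measurable (R \<Otimes>\<^sub>M lborel)" by (rule lb) measurable
  have Sm: "(\<lambda>p. run_sup (clamp_time t (snd p)) (fst p)) \<in> borel_measurable (R \<Otimes>\<^sub>M lborel)" by (rule lb) measurable
  have inm: "(\<lambda>p. indicator {s..t} (snd p) :: real) \<in> borel_measurable (R \<Otimes>\<^sub>M lborel)" by measurable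
  have dens: "?M2 = density (R \<Otimes>\<^sub>M lborel) (\<lambda>p. ennreal (indicator {s..t} (snd p)))"
    by (rule density_cong) (auto split: split_indicator)
  have intM2: "(LINT p|?M2. f p) = (LINT p|(R \<Otimes>\<^sub>M lborel). indicator {s..t} (snd p) *\<^sub>R f p)"
    if "f \<in> borel_measurable (R \<Otimes>\<^sub>M lborel)" for f :: "_ \<Rightarrow> complex"
    unfolding dens by (rule integral_density) (use that inm in auto)
  have Ibound: "norm (LINT u:{s..t}|lborel. expmart \<theta> u w) \<le> (t - s) * exp (\<theta>\<^sup>2 * t / 2)" for w
  proof -
    have "norm (LINT u:{s..t}|lborel. expmart \<theta> u w) \<le> (LINT u|lborel. indicator {s..t} u * exp (\<theta>\<^sup>2 * t / 2))"
      unfolding set_lebesgue_integral_def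
    proof (rule order_trans[OF integral_norm_bound])
      show "(LINT u|lborel. norm (indicator {s..t} u *\<^sub>R expmart \<theta> u w)) \<le> (LINT u|lborel. indicator {s..t} u * exp (\<theta>\<^sup>2 * t / 2))"
        by (rule integral_mono') (use st Eb in \<open>auto split: split_indicator simp: integrable_indicator_iff\<close>)
    qed
    also have "\<dots> = (t - s) * exp (\<theta>\<^sup>2 * t / 2)" using st by simp
    finally show ?thesis .
  qed
  let ?B1 = "B * (exp (\<theta>\<^sup>2 * t / 2) + exp (\<theta>\<^sup>2 * t / 2) + \<bar>l * \<theta>\<bar> * ((t - s) * exp (\<theta>\<^sup>2 * t / 2)))"
  let ?B2 = "2 * \<bar>l * \<theta>\<bar> * B * exp (\<theta>\<^sup>2 * t / 2)"
  have F1B: "norm (?F1 w) \<le> ?B1" for w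
  proof -
    have "norm (expmart \<theta> t w - expmart \<theta> s w - \<i> * of_real (l * \<theta>) * (LINT u:{s..t}|lborel. expmart \<theta> u w))
      \<le> exp (\<theta>\<^sup>2 * t / 2) + exp (\<theta>\<^sup>2 * t / 2) + \<bar>l * \<theta>\<bar> * ((t - s) * exp (\<theta>\<^sup>2 * t / 2))"
      using st by (intro norm_triangle_le_diff add_mono order_trans[OF norm_triangle_ineq4] Eb)
        (auto simp: norm_mult abs_mult mult.assoc intro!: mult_left_mono Ibound)
    then show ?thesis unfolding norm_mult[of "G w"] by (intro mult_mono B B0) auto
  qed
  have F2B: "norm (?F2 p) \<le> ?B2" for p
  proof -
    have "norm (?F2 p) = 2 * \<bar>l * \<theta>\<bar> * norm (G (fst p)) * norm (expmart \<theta> (clamp_time t (snd p)) (fst p))"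
      by (simp add: norm_mult abs_mult)
    also have "\<dots> \<le> ?B2"
      using clamp_time_bounds[OF t0, of "snd p"] B0
      by (intro mult_mono mult_left_mono B norm_expmart_le mult_nonneg_nonneg) auto
    finally show ?thesis .
  qed
  have F1m: "?F1 \<in> borel_measurable R"
  proof -
    have [measurable]: "expmart \<theta> t \<in> borel_measurable R" "expmart \<theta> s \<in> borel_measurable R"
      using EE[of t] EE[of s] st by auto
    have "integrable R (\<lambda>w. 1 * (LINT u:{s..t}|lborel. expmart \<theta> u w))"
      by (rule fubini_time(4)[OF R.prob_space_axioms st(1) st' _ _ measurable_joint_processes(3)[OF sR t0] Eb', of "\<lambda>_. 1" 1]) auto
    then have [measurable]: "(\<lambda>w. LINT u:{s..t}|lborel. expmart \<theta> u w) \<in> borel_measurable R" by simp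
    show ?thesis by measurable
  qed
  have rays: "(LINT w|R. indicator {a<..} (total_sup w) *\<^sub>R ?F1 w)
      = (LINT p|?M2. indicator {a<..} (run_sup (clamp_time t (snd p)) (fst p)) *\<^sub>R ?F2 p)" for a
  proof -
    let ?I = "\<lambda>w. indicator {a<..} (total_sup w) :: real"
    let ?G' = "\<lambda>w. of_real (?I w) * G w"
    let ?A = "\<lambda>u. LINT w|R. G w * up_part \<theta> a u w" and ?D = "\<lambda>u. LINT w|Rp. G w * dn_part \<theta> a u w"
    have G'm: "?G' \<in> borel_measurable R" by measurable
    have G'B: "norm (?G' w) \<le> B" for w using B[of w] B0 by (auto split: split_indicator)
    have level: "(LINT w|R. ?G' w * expmart \<theta> u w) = ?A u + ?C a * ?D u" if "s \<le> u" for u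
      using integral_total_sup_level[OF _ measurable_filt_mono[OF G that] B, of a \<theta>] that st
      by (simp add: scaleR_conv_of_real mult.assoc)
    have upj: "(\<lambda>p. up_part \<theta> a (clamp_time t (snd p)) (fst p)) \<in> borel_measurable (R \<Otimes>\<^sub>M borel)"
      unfolding up_part_def by measurable
    have dnj: "(\<lambda>p. dn_part \<theta> a (clamp_time t (snd p)) (fst p)) \<in> borel_measurable (Rp \<Otimes>\<^sub>M borel)"
      unfolding dn_part_def using jp[measurable] by measurable
    have ub: "\<forall>u\<in>{s..t}. \<forall>w. norm (up_part \<theta> a u w) \<le> exp (\<theta>\<^sup>2 * t / 2)"
      "\<forall>u\<in>{s..t}. \<forall>w. norm (dn_part \<theta> a u w) \<le> exp (\<theta>\<^sup>2 * t / 2)"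
      by (auto intro: norm_up_part norm_dn_part)
    note fA = fubini_time[where H="up_part \<theta> a", OF R.prob_space_axioms st(1) st' GR B upj ub(1)]
    note fD = fubini_time[where H="dn_part \<theta> a", OF Rp.prob_space_axioms st(1) st' GRp B dnj ub(2)]
    note fE = fubini_time[where H="expmart \<theta>", OF R.prob_space_axioms st(1) st' G'm G'B measurable_joint_processes(3)[OF sR t0] Eb']
    have IE: "(LINT w|R. ?G' w * (LINT u:{s..t}|lborel. expmart \<theta> u w)) = (LINT u:{s..t}|lborel. ?A u) + ?C a * (LINT u:{s..t}|lborel. ?D u)"
    proof -
      have "(LINT u:{s..t}|lborel. LINT w|R. ?G' w * expmart \<theta> u w) = (LINT u:{s..t}|lborel. ?A u + ?C a * ?D u)"
        by (rule set_lebesgue_integral_cong) (use level in auto)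
      also have "\<dots> = (LINT u:{s..t}|lborel. ?A u) + (LINT u:{s..t}|lborel. ?C a * ?D u)"
        by (rule set_integral_add) (use fA(2) fD(2) in \<open>auto intro: set_integrable_mult_right\<close>)
      also have "(LINT u:{s..t}|lborel. ?C a * ?D u) = ?C a * (LINT u:{s..t}|lborel. ?D u)" by simp
      finally show ?thesis by (rule trans[OF fE(1)])
    qed
    have iG': "integrable R (\<lambda>w. ?G' w * expmart \<theta> u w)" if u: "u \<in> {s..t}" for u
    proof (rule R.integrable_const_bound[where B="B * exp (\<theta>\<^sup>2 * t / 2)"])
      show "AE w in R. norm (?G' w * expmart \<theta> u w) \<le> B * exp (\<theta>\<^sup>2 * t / 2)"
        unfolding norm_mult[of "of_real _ * _"] by (intro AE_I2 mult_mono G'B Eb u B0) auto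
      show "(\<lambda>w. ?G' w * expmart \<theta> u w) \<in> borel_measurable R" using EE[OF u] by measurable
    qed
    have "(LINT w|R. ?I w *\<^sub>R ?F1 w) = (LINT w|R. ?G' w * expmart \<theta> t w - ?G' w * expmart \<theta> s w
         - \<i> * of_real (l * \<theta>) * (?G' w * (LINT u:{s..t}|lborel. expmart \<theta> u w)))"
      by (rule Bochner_Integration.integral_cong) (simp_all add: scaleR_conv_of_real algebra_simps)
    also have "\<dots> = (LINT w|R. ?G' w * expmart \<theta> t w) - (LINT w|R. ?G' w * expmart \<theta> s w)
         - \<i> * of_real (l * \<theta>) * (LINT w|R. ?G' w * (LINT u:{s..t}|lborel. expmart \<theta> u w))"
      using iG'[of t] iG'[of s] st' fE(4) by simp
    also have "\<dots> = (?A t + ?C a * ?D t) - (?A s + ?C a * ?D s) - \<i> * of_real (l * \<theta>) * ((LINT u:{s..t}|lborel. ?A u) + ?C a * (LINT u:{s..t}|lborel. ?D u))"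
      unfolding IE using level st' by simp
    also have "\<dots> = - 2 * \<i> * of_real (l * \<theta>) * (LINT u:{s..t}|lborel. ?A u)"
      using crossing_identity[OF st G B, of \<theta> a] unfolding fA(1) fD(1) by (simp add: algebra_simps)
    also have "\<dots> = - 2 * \<i> * of_real (l * \<theta>) *
        (LINT p|(R \<Otimes>\<^sub>M lborel). indicator {s..t} (snd p) *\<^sub>R (G (fst p) * up_part \<theta> a (clamp_time t (snd p)) (fst p)))"
      unfolding fA(3) ..
    also have "\<dots> = (LINT p|(R \<Otimes>\<^sub>M lborel). indicator {s..t} (snd p) *\<^sub>R (indicator {a<..} (run_sup (clamp_time t (snd p)) (fst p)) *\<^sub>R ?F2 p))"
      unfolding integral_mult_right_zero[symmetric]
      by (rule Bochner_Integration.integral_cong) (auto simp: up_part_def split: split_indicator)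
    also have "\<dots> = (LINT p|?M2. indicator {a<..} (run_sup (clamp_time t (snd p)) (fst p)) *\<^sub>R ?F2 p)"
      by (rule intM2[symmetric]) (use Sm F2m in measurable)
    finally show ?thesis .
  qed
  have fin: "finite_measure ?M2"
  proof (rule finite_measureI)
    interpret pr: pair_sigma_finite R lborel ..
    have "emeasure ?M2 (space ?M2) = (\<integral>\<^sup>+p. indicator (space R \<times> {s..t}) p \<partial>(R \<Otimes>\<^sub>M lborel))"
      unfolding space_density
      by (subst emeasure_density[OF _ sets.top])
         (auto intro!: nn_integral_cong simp: space_pair_measure split: split_indicator)
    also have "\<dots> = emeasure R (space R) * emeasure lborel {s..t}"
    proof -
      have i: "{s..t} \<in> sets lborel" by simp
      from i sets.top[of R] pair_measureI[OF sets.top[of R] i] show ?thesis by (simp only: nn_integral_indicator lborel.emeasure_pair_measure_Times)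
    qed
    finally show "emeasure ?M2 (space ?M2) \<noteq> \<infinity>" using st by (simp add: R.emeasure_space_1[simplified])
  qed
  have "(LINT w|R. k (total_sup w) *\<^sub>R ?F1 w) = (LINT p|?M2. k (run_sup (clamp_time t (snd p)) (fst p)) *\<^sub>R ?F2 p)"
  proof (rule integral_eq_of_rays[where B="max ?B1 ?B2", OF R.finite_measure_axioms fin TR _ F1m _ _ _ rays k k1])
    show "(\<lambda>p. run_sup (clamp_time t (snd p)) (fst p)) \<in> borel_measurable ?M2" using Sm by simp
    show "?F2 \<in> borel_measurable ?M2" using F2m by simp
    show "norm (?F1 w) \<le> max ?B1 ?B2" for w using F1B[of w] by simp
    show "norm (?F2 p) \<le> max ?B1 ?B2" for p using F2B[of p] by simp
    show "integrable ?M2 (\<lambda>p. k (run_sup (clamp_time t (snd p)) (fst p)))"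
      unfolding dens by (subst integrable_density) (use k2 inm measurable_compose[OF Sm k(1)] in auto)
  qed
  also have "\<dots> = (LINT p|(R \<Otimes>\<^sub>M lborel). indicator {s..t} (snd p) *\<^sub>R (k (run_sup (clamp_time t (snd p)) (fst p)) *\<^sub>R ?F2 p))"
    by (rule intM2) (use measurable_compose[OF Sm k(1)] F2m in measurable)
  finally show ?thesis .
qed

end

section \<open>The weighted law\<close>

locale weighted = drift_pair +
  fixes \<psi> :: "real \<Rightarrow> real"
  assumes \<psi>_borel [measurable]: "\<psi> \<in> borel_measurable borel" and \<psi>_pos: "\<And>y. 0 < \<psi> y"
    and \<psi>_int: "\<And>y. set_integrable lborel {y..} (\<lambda>z. \<psi> z * exp (- l * z))"
begin

definition J :: "real \<Rightarrow> real" where "J y = (LINT z:{y..}|lborel. \<psi> z * exp (- l * z))"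

lemma one_minus_Phi: "1 - Phi l \<psi> y = exp (l * y) * J y"
  by (simp add: Phi_def J_def)

lemma phi_eq: "phi l \<psi> y = \<psi> y - l * (1 - Phi l \<psi> y)"
  by (simp add: one_minus_Phi phi_def J_def)

lemma nn_integral_tail: "(\<integral>\<^sup>+z. ennreal (\<psi> z * exp (- l * z)) * indicator {y..} z \<partial>lborel) = ennreal (J y)"
proof -
  have "ennreal (J y) = (\<integral>\<^sup>+z. ennreal (indicator {y..} z *\<^sub>R (\<psi> z * exp (- l * z))) \<partial>lborel)"
    unfolding J_def set_lebesgue_integral_def
    by (rule nn_integral_eq_integral[symmetric])
       (use \<psi>_int[of y] \<psi>_pos in \<open>auto simp: set_integrable_def less_imp_le intro!: AE_I2\<close>)
  also have "\<dots> = (\<integral>\<^sup>+z. ennreal (\<psi> z * exp (- l * z)) * indicator {y..} z \<partial>lborel)"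
    by (rule nn_integral_cong) (auto split: split_indicator)
  finally show ?thesis by simp
qed

lemma J_pos: "0 < J y"
proof -
  have "0 \<le> J y" unfolding J_def set_lebesgue_integral_def
    by (rule integral_nonneg_AE) (use \<psi>_pos in \<open>auto intro!: AE_I2 simp: less_imp_le\<close>)
  moreover have "J y \<noteq> 0"
  proof
    assume "J y = 0"
    then have "(\<integral>\<^sup>+z. ennreal (\<psi> z * exp (- l * z)) * indicator {y..} z \<partial>lborel) = 0"
      using nn_integral_tail[of y] by simp
    then have "AE z in lborel. ennreal (\<psi> z * exp (- l * z)) * indicator {y..} z = 0"
      by (subst (asm) nn_integral_0_iff_AE) auto
    then have "AE z in lborel. z \<notin> {y..}"
    proof eventually_elim
      case (elim z)
      have "0 < \<psi> z * exp (- l * z)" using \<psi>_pos by simp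
      then have "ennreal (\<psi> z * exp (- l * z)) \<noteq> 0" by (simp only: ennreal_eq_0_iff not_le)
      with elim show ?case by (simp only: mult_eq_0_iff indicator_eq_0_iff) blast
    qed
    then have "{y..} \<in> null_sets lborel" by (subst (asm) AE_iff_null_sets[symmetric]) auto
    then have "emeasure lborel {y..} = 0" by auto
    moreover have "emeasure lborel {y..y+1} \<le> emeasure lborel {y..}" by (rule emeasure_mono) auto
    ultimately show False by simp
  qed
  ultimately show ?thesis by simp
qed

lemma J_antimono: "y \<le> y' \<Longrightarrow> J y' \<le> J y"
proof -
  assume "y \<le> y'"
  then have "ennreal (J y') \<le> ennreal (J y)"
    unfolding nn_integral_tail[symmetric]
    by (intro nn_integral_mono) (auto split: split_indicator)
  then show ?thesis using J_pos[of y] by simp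
qed

lemma measurable_J [measurable]: "J \<in> borel_measurable borel"
proof -
  have "mono (\<lambda>y. - J y)" using J_antimono by (auto simp: mono_def)
  then have "(\<lambda>y. - J y) \<in> borel_measurable borel" by (rule borel_measurable_mono)
  then show ?thesis by simp
qed

lemma one_minus_Phi_pos: "0 < 1 - Phi l \<psi> y"
  unfolding one_minus_Phi using J_pos by simp

definition h :: "real \<Rightarrow> real" where "h z = \<psi> z * exp (l * z)"

lemma h_pos: "0 < h z" using \<psi>_pos by (simp add: h_def)

lemma measurable_h [measurable]: "h \<in> borel_measurable borel" unfolding h_def by measurable

text \<open>The conditional expectation of \<open>h (total_sup w)\<close> given \<open>filt u\<close> under \<open>R\<close>; it is positive although \<open>phi\<close>
  may be negative.\<close>

definition mart :: "real \<Rightarrow> (real \<Rightarrow> real) \<Rightarrow> real" where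
  "mart u w = h (run_sup u w) * (1 - exp (- 2 * l * (run_sup u w - coord u w))) + 2 * l * exp (2 * l * coord u w) * J (run_sup u w)"

text \<open>The integral of \<open>h (total_sup w)\<close> under \<open>R\<close>, equivalently
  \<open>mart 0 w\<close> for a path starting at \<open>x\<close>.\<close>

definition Z :: real where "Z = 2 * l * exp (l * x) * (1 - Phi l \<psi> x)"

lemma Z_pos: "0 < Z" using l one_minus_Phi_pos by (simp add: Z_def)

lemma Z_eq: "Z = 2 * l * exp (2 * l * x) * J x"
  by (simp add: Z_def one_minus_Phi exp_add[symmetric] mult.assoc)

lemma measurable_mart: "0 \<le> u \<Longrightarrow> u \<le> t \<Longrightarrow> mart u \<in> borel_measurable (filt t)"
  using measurable_run_sup[of u t] measurable_coord_filt[of u t] unfolding mart_def by measurable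

lemma mart_pos: assumes "w \<in> path_space" "0 \<le> u" shows "0 < mart u w"
proof -
  have "coord u w \<le> run_sup u w" using assms by (intro coord_le_run_sup) auto
  then have "0 \<le> 1 - exp (- 2 * l * (run_sup u w - coord u w))" using l by (auto simp: mult_nonneg_nonneg)
  then show ?thesis
    unfolding mart_def using h_pos[of "run_sup u w"] J_pos[of "run_sup u w"] l
    by (intro add_nonneg_pos mult_nonneg_nonneg mult_pos_pos) auto
qed

text \<open>In the exponential part the factor \<open>exp (l * z)\<close> of \<open>h\<close> meets
  the density \<open>exp (- 2 * l * z)\<close>, which leaves the integrand
  \<open>\<psi> z * exp (- l * z)\<close> of \<open>J\<close>.\<close>

lemma nn_integral_h_max:
  assumes "w \<in> path_space" "0 \<le> u"
  shows "(\<integral>\<^sup>+y. ennreal (h (max (run_sup u w) (coord u w + y))) \<partial>exp_law (2 * l)) = ennreal (mart u w)"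
proof -
  let ?S = "run_sup u w" and ?X = "coord u w"
  have le: "?X \<le> ?S" using assms by (intro coord_le_run_sup) auto
  have tail: "(\<integral>\<^sup>+z. ennreal (2 * l * exp (- (2 * l) * (z - ?X))) * ennreal (h z) * indicator {?S..} z \<partial>lborel)
      = ennreal (2 * l * exp (2 * l * ?X) * J ?S)"
  proof -
    have id: "2 * l * exp (- (2 * l) * (z - ?X)) * h z = 2 * l * exp (2 * l * ?X) * (\<psi> z * exp (- l * z))" for z
      by (simp add: h_def exp_add[symmetric] algebra_simps)
    have "(\<integral>\<^sup>+z. ennreal (2 * l * exp (- (2 * l) * (z - ?X))) * ennreal (h z) * indicator {?S..} z \<partial>lborel)
      = (\<integral>\<^sup>+z. ennreal (2 * l * exp (2 * l * ?X)) * (ennreal (\<psi> z * exp (- l * z)) * indicator {?S..} z) \<partial>lborel)"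
    proof (intro nn_integral_cong)
      fix z
      have "ennreal (2 * l * exp (- (2 * l) * (z - ?X))) * ennreal (h z) = ennreal (2 * l * exp (2 * l * ?X) * (\<psi> z * exp (- l * z)))"
        unfolding id[symmetric]
        using l h_pos[of z] by (intro ennreal_mult[symmetric]) auto
      also have "\<dots> = ennreal (2 * l * exp (2 * l * ?X)) * ennreal (\<psi> z * exp (- l * z))"
        using l \<psi>_pos[of z] by (intro ennreal_mult) auto
      finally show "ennreal (2 * l * exp (- (2 * l) * (z - ?X))) * ennreal (h z) * indicator {?S..} z
        = ennreal (2 * l * exp (2 * l * ?X)) * (ennreal (\<psi> z * exp (- l * z)) * indicator {?S..} z)"
        by (simp only: mult.assoc)
    qed
    also have "\<dots> = ennreal (2 * l * exp (2 * l * ?X)) * ennreal (J ?S)"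
      unfolding nn_integral_tail[symmetric] by (rule nn_integral_cmult) measurable
    finally show ?thesis using l J_pos[of ?S] by (simp add: ennreal_mult less_imp_le)
  qed
  have e: "0 \<le> 1 - exp (- (2 * l) * (?S - ?X))" using le l by (auto simp: mult_nonneg_nonneg)
  have "(\<integral>\<^sup>+y. ennreal (h (max ?S (?X + y))) \<partial>exp_law (2 * l))
     = ennreal (h ?S) * ennreal (1 - exp (- (2 * l) * (?S - ?X))) + ennreal (2 * l * exp (2 * l * ?X) * J ?S)"
    by (subst nn_integral_exp_law_max[where k="\<lambda>z. ennreal (h z)", OF _ le]) (use l tail in auto)
  also have "\<dots> = ennreal (mart u w)"
    unfolding mart_def using e h_pos[of ?S] J_pos[of ?S] l
    by (subst ennreal_plus) (auto simp: ennreal_mult less_imp_le)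
  finally show ?thesis .
qed

lemma nn_integral_h_total_sup:
  assumes u: "0 \<le> u" and \<Gamma>: "\<Gamma> \<in> sets (filt u)"
  shows "(\<integral>\<^sup>+w. indicator \<Gamma> w * ennreal (h (total_sup w)) \<partial>R) = (\<integral>\<^sup>+w. indicator \<Gamma> w * ennreal (mart u w) \<partial>R)"
  unfolding total_sup_conditional[OF u \<Gamma>, of "\<lambda>z. ennreal (h z)", simplified]
  by (rule nn_integral_cong) (simp add: nn_integral_h_max u)

lemma nn_integral_h_total_sup_UNIV: "(\<integral>\<^sup>+w. ennreal (h (total_sup w)) \<partial>R) = ennreal Z"
proof -
  have ps: "path_space \<in> sets (filt 0)" using sets.top[of "filt 0"] by simp
  have "(\<integral>\<^sup>+w. ennreal (h (total_sup w)) \<partial>R) = (\<integral>\<^sup>+w. indicator path_space w * ennreal (h (total_sup w)) \<partial>R)"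
    by (rule nn_integral_cong) simp
  also have "\<dots> = (\<integral>\<^sup>+w. indicator path_space w * ennreal (mart 0 w) \<partial>R)"
    by (rule nn_integral_h_total_sup[OF order_refl ps])
  also have "\<dots> = (\<integral>\<^sup>+w. ennreal Z \<partial>R)"
    by (rule nn_integral_cong_AE) (use gauss_incrementsD(4)[OF R] AE_space in \<open>eventually_elim, simp add: mart_def run_sup_0 Z_eq\<close>)
  finally show ?thesis using R.emeasure_space_1 by simp
qed

lemma integrable_h_total_sup: "integrable R (\<lambda>w. h (total_sup w))"
  and integral_h_total_sup: "(LINT w|R. h (total_sup w)) = Z"
proof -
  have [measurable]: "total_sup \<in> borel_measurable R" by (rule measurable_R(1)[OF measurable_total_sup])
  show "integrable R (\<lambda>w. h (total_sup w))"
    by (rule integrableI_nonneg) (auto simp: nn_integral_h_total_sup_UNIV h_pos less_imp_le)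
  show "(LINT w|R. h (total_sup w)) = Z"
    by (subst integral_eq_nn_integral) (auto simp: nn_integral_h_total_sup_UNIV h_pos Z_pos less_imp_le)
qed

definition Q0 :: "(real \<Rightarrow> real) measure" where
  "Q0 = density R (\<lambda>w. ennreal (h (total_sup w) / Z))"

lemma sets_Q0 [simp]: "sets Q0 = sets filt_inf" and space_Q0 [simp]: "space Q0 = path_space"
  by (simp_all add: Q0_def gauss_incrementsD(2)[OF R])

lemma measurable_Q0: "f \<in> measurable filt_inf N \<Longrightarrow> f \<in> measurable Q0 N"
    "f \<in> measurable (filt s) N \<Longrightarrow> f \<in> measurable Q0 N"
proof -
  show "f \<in> measurable filt_inf N \<Longrightarrow> f \<in> measurable Q0 N"
    unfolding measurable_cong_sets[OF sets_Q0 refl] .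
  then show "f \<in> measurable (filt s) N \<Longrightarrow> f \<in> measurable Q0 N"
    using measurable_filt_inf by blast
qed

lemma subalgebra_Q0: "subalgebra Q0 (filt u)"
  using sets_filt_inf by (auto simp: subalgebra_def)

lemma emeasure_Q0:
  assumes u: "0 \<le> u" and \<Gamma>: "\<Gamma> \<in> sets (filt u)"
  shows "emeasure Q0 \<Gamma> = (\<integral>\<^sup>+w. indicator \<Gamma> w * ennreal (mart u w / Z) \<partial>R)"
proof -
  have [measurable]: "total_sup \<in> borel_measurable R" by (rule measurable_R(1)[OF measurable_total_sup])
  have [measurable]: "mart u \<in> borel_measurable R" by (rule measurable_R(2)[OF measurable_mart[OF u order_refl]])
  have \<Gamma>R[measurable]: "\<Gamma> \<in> sets R" by (rule subsetD[OF gauss_incrementsD(5)[OF R] \<Gamma>])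
  have div: "ennreal (a / Z) = ennreal a * ennreal (1 / Z)" if "0 \<le> a" for a
    using that Z_pos by (simp add: ennreal_mult[symmetric])
  have "emeasure Q0 \<Gamma> = (\<integral>\<^sup>+w. indicator \<Gamma> w * ennreal (h (total_sup w)) * ennreal (1 / Z) \<partial>R)"
  proof -
    have "emeasure Q0 \<Gamma> = (\<integral>\<^sup>+w. ennreal (h (total_sup w) / Z) * indicator \<Gamma> w \<partial>R)"
      unfolding Q0_def by (rule emeasure_density) measurable
    then show ?thesis by (simp only: div[OF less_imp_le[OF h_pos]] mult.commute mult.left_commute)
  qed
  also have "\<dots> = (\<integral>\<^sup>+w. indicator \<Gamma> w * ennreal (h (total_sup w)) \<partial>R) * ennreal (1 / Z)"
    by (rule nn_integral_multc) measurable
  also have "\<dots> = (\<integral>\<^sup>+w. indicator \<Gamma> w * ennreal (mart u w) * ennreal (1 / Z) \<partial>R)"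
    unfolding nn_integral_h_total_sup[OF u \<Gamma>] by (rule nn_integral_multc[symmetric]) measurable
  also have "\<dots> = (\<integral>\<^sup>+w. indicator \<Gamma> w * ennreal (mart u w / Z) \<partial>R)"
  proof (rule nn_integral_cong)
    fix w assume "w \<in> space R"
    then have "0 \<le> mart u w" using mart_pos[OF _ u, of w] by simp
    from div[OF this] show "indicator \<Gamma> w * ennreal (mart u w) * ennreal (1 / Z) = indicator \<Gamma> w * ennreal (mart u w / Z)"
      by (simp only: mult.assoc)
  qed
  finally show ?thesis .
qed

sublocale Q0: prob_space Q0
proof
  have ps: "path_space \<in> sets (filt 0)" using sets.top[of "filt 0"] by simp
  have "emeasure Q0 (space Q0) = (\<integral>\<^sup>+w. ennreal 1 \<partial>R)"
    unfolding space_Q0 emeasure_Q0[OF order_refl ps]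
  proof (rule nn_integral_cong_AE)
    show "AE w in R. indicator path_space w * ennreal (mart 0 w / Z) = ennreal 1"
      using gauss_incrementsD(4)[OF R] AE_space
    proof eventually_elim
      case (elim w)
      then have "mart 0 w = Z" by (simp add: mart_def run_sup_0 Z_eq)
      then show ?case using elim Z_pos by simp
    qed
  qed
  then show "emeasure Q0 (space Q0) = 1" using R.emeasure_space_1 by simp
qed

lemma restr_Q0:
  assumes u: "0 \<le> u"
  shows "restr_to_subalg Q0 (filt u) = density (restr_to_subalg R (filt u)) (\<lambda>w. ennreal (mart u w / Z))"
proof (rule measure_eqI)
  note s = sets_restr_to_subalg[OF gauss_incrementsD(6)[OF R, of u]] and s' = sets_restr_to_subalg[OF subalgebra_Q0[of u]]
  show "sets (restr_to_subalg Q0 (filt u)) = sets (density (restr_to_subalg R (filt u)) (\<lambda>w. ennreal (mart u w / Z)))"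
    by (simp add: s s')
  fix A assume "A \<in> sets (restr_to_subalg Q0 (filt u))"
  then have A[measurable]: "A \<in> sets (filt u)" by (simp add: s')
  have [measurable]: "mart u \<in> borel_measurable (filt u)" by (rule measurable_mart[OF u order_refl])
  have "emeasure (restr_to_subalg Q0 (filt u)) A = (\<integral>\<^sup>+w. ennreal (mart u w / Z) * indicator A w \<partial>R)"
    by (simp add: emeasure_restr_to_subalg[OF subalgebra_Q0 A] emeasure_Q0[OF u A] mult.commute)
  also have "\<dots> = (\<integral>\<^sup>+w. ennreal (mart u w / Z) * indicator A w \<partial>restr_to_subalg R (filt u))"
    by (rule nn_integral_subalgebra2[OF gauss_incrementsD(6)[OF R], symmetric]) measurable
  also have "\<dots> = emeasure (density (restr_to_subalg R (filt u)) (\<lambda>w. ennreal (mart u w / Z))) A"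
    by (subst emeasure_density) (auto simp: s cong: measurable_cong_sets)
  finally show "emeasure (restr_to_subalg Q0 (filt u)) A = emeasure (density (restr_to_subalg R (filt u)) (\<lambda>w. ennreal (mart u w / Z))) A" .
qed

lemma integral_Q0:
  fixes F :: "(real \<Rightarrow> real) \<Rightarrow> 'b :: {banach, second_countable_topology}"
  assumes u: "0 \<le> u" and F: "F \<in> borel_measurable (filt u)"
  shows "(LINT w|Q0. F w) = (LINT w|R. (mart u w / Z) *\<^sub>R F w)"
proof -
  have mm: "(\<lambda>w. mart u w / Z) \<in> borel_measurable (filt u)" using measurable_mart[OF u order_refl] by measurable
  note [measurable] = F mm
  have EF: "(\<lambda>w. (mart u w / Z) *\<^sub>R F w) \<in> borel_measurable (filt u)" by measurable
  note subR = gauss_incrementsD(6)[OF R, of u]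
  have pos: "AE w in restr_to_subalg R (filt u). 0 \<le> mart u w / Z"
    using mart_pos[OF _ u] Z_pos by (intro AE_I2) (auto simp: space_restr_to_subalg less_imp_le)
  show ?thesis
    unfolding integral_subalgebra2[OF subR EF, symmetric] integral_subalgebra2[OF subalgebra_Q0 F, symmetric] restr_Q0[OF u]
    by (rule integral_density) (use measurable_in_subalg[OF subR F] measurable_in_subalg[OF subR mm] pos in auto)
qed

lemma nn_integral_Q0:
  assumes u: "0 \<le> u" and F: "F \<in> borel_measurable (filt u)"
  shows "(\<integral>\<^sup>+w. F w \<partial>Q0) = (\<integral>\<^sup>+w. ennreal (mart u w / Z) * F w \<partial>R)"
proof -
  have mm: "(\<lambda>w. ennreal (mart u w / Z)) \<in> borel_measurable (filt u)" using measurable_mart[OF u order_refl] by measurable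
  note [measurable] = F mm
  have EF: "(\<lambda>w. ennreal (mart u w / Z) * F w) \<in> borel_measurable (filt u)" by measurable
  note subR = gauss_incrementsD(6)[OF R, of u]
  show ?thesis
    unfolding nn_integral_subalgebra2[OF subR EF, symmetric] nn_integral_subalgebra2[OF subalgebra_Q0 F, symmetric] restr_Q0[OF u]
    by (rule nn_integral_density) (use measurable_in_subalg[OF subR F] measurable_in_subalg[OF subR mm] in auto)
qed

text \<open>The bracket is the denominator of \<open>drift_term\<close> and, up to a deterministic
  factor of time and the constant \<open>l\<close>, \<open>Mproc\<close>; positivity of
  \<open>mart\<close> passes to both although \<open>phi\<close> may be negative.\<close>

lemma mart_hyperbolic:
  "mart u w = 2 * exp (l * coord u w) *
     (l * (1 - Phi l \<psi> (run_sup u w)) * cosh (l * (run_sup u w - coord u w))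
       + phi l \<psi> (run_sup u w) * sinh (l * (run_sup u w - coord u w)))"
proof -
  let ?S = "run_sup u w" and ?X = "coord u w"
  let ?y = "l * (?S - ?X)"
  have eS: "exp (l * ?S) = exp (l * ?X) * exp ?y" by (simp add: exp_add[symmetric] algebra_simps)
  have "mart u w = exp (l * ?X) * (\<psi> ?S * (exp ?y * (1 - exp (- 2 * ?y))) + 2 * (l * (exp (l * ?S) * J ?S)) * exp (- ?y))"
  proof -
    have "2 * l * exp (2 * l * ?X) * J ?S = exp (l * ?X) * (2 * (l * (exp (l * ?S) * J ?S)) * exp (- ?y))"
      by (simp add: eS exp_minus field_simps) (simp add: exp_add[symmetric] algebra_simps)
    moreover have "exp (- 2 * l * (?S - ?X)) = exp (- 2 * ?y)" by (simp add: algebra_simps)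
    ultimately show ?thesis
      unfolding mart_def h_def eS by (simp only:) (simp add: algebra_simps)
  qed
  also have "exp ?y * (1 - exp (- 2 * ?y)) = 2 * sinh ?y"
    by (simp add: sinh_field_def exp_minus right_diff_distrib exp_add[symmetric])
  also have "exp (- ?y) = cosh ?y - sinh ?y" by (simp add: cosh_minus_sinh)
  also have "exp (l * ?S) * J ?S = 1 - Phi l \<psi> ?S" by (simp only: one_minus_Phi)
  finally show ?thesis unfolding phi_eq by (simp add: algebra_simps)
qed

text \<open>Numerator and denominator of \<open>drift_term\<close> add up to
  \<open>\<psi> (run_sup u w) * exp (l * (run_sup u w - coord u w))\<close>, because
  \<open>phi\<close> and \<open>l * (1 - Phi)\<close> add up to \<psi> and \<open>cosh\<close> and
  \<open>sinh\<close> to \<open>exp\<close>. The quotient is therefore this sum over the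
  denominator, minus 1.\<close>

lemma drift_term_eq:
  assumes w: "w \<in> path_space" and u: "0 \<le> u"
  shows "drift_term l \<psi> u w = 2 * h (run_sup u w) / mart u w - 1"
proof -
  let ?S = "run_sup u w" and ?X = "coord u w"
  let ?c = "l * (1 - Phi l \<psi> ?S)" and ?y = "l * (?S - ?X)"
  let ?N = "phi l \<psi> ?S * cosh ?y + ?c * sinh ?y" and ?D = "?c * cosh ?y + phi l \<psi> ?S * sinh ?y"
  have eS: "exp (l * ?S) = exp (l * ?X) * exp ?y" by (simp add: exp_add[symmetric] algebra_simps)
  note D = mart_hyperbolic[of u w]
  have ND: "?N = \<psi> ?S * exp ?y - ?D"
    unfolding phi_eq cosh_plus_sinh[symmetric] by (simp add: algebra_simps)
  have "0 < ?D" using mart_pos[OF w u] unfolding D by (simp add: zero_less_mult_iff)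
  then have "?N / ?D = 2 * (\<psi> ?S * exp (l * ?S)) / (2 * exp (l * ?X) * ?D) - 1"
    unfolding ND eS by (simp add: diff_divide_distrib)
  then show ?thesis unfolding drift_term_def D h_def by (simp add: mult.commute)
qed

lemma mart_Mproc: "mart u w * tilt_density (- l) x u w = 2 * l * exp (l * x) * Mproc l \<psi> u w"
proof -
  let ?S = "run_sup u w" and ?X = "coord u w"
  let ?y = "l * (?S - ?X)"
  have "exp (l * ?X) * tilt_density (- l) x u w = exp (l * x) * exp (- (l\<^sup>2 * u / 2))"
    by (simp add: tilt_density_def exp_add[symmetric] algebra_simps)
  moreover have "l * (1 - Phi l \<psi> ?S) * cosh ?y + phi l \<psi> ?S * sinh ?y
      = l * ((1 - Phi l \<psi> ?S) * cosh ?y + phi l \<psi> ?S * (sinh ?y / l))"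
    using l by (simp add: field_simps)
  ultimately show ?thesis
    unfolding mart_hyperbolic Mproc_def by (simp add: mult_ac)
qed

end

section \<open>Integrability of the drift in time\<close>

lemma nn_integral_inverse_sqrt_finite:
  assumes "0 \<le> t" "0 \<le> c"
  shows "(\<integral>\<^sup>+u. indicator {0..t} u * ennreal (c * u powr (- 1 / 2)) \<partial>lborel) < \<infinity>"
proof -
  have "((\<lambda>u. u powr (- 1 / 2)) has_integral (t powr (- 1 / 2 + 1) / (- 1 / 2 + 1))) {0..t}"
    by (rule has_integral_powr_from_0) (use assms in auto)
  from has_integral_mult_right[OF this, of c]
  have 1: "(\<integral>\<^sup>+u. ennreal (indicator {0..t} u * (c * u powr (- 1 / 2))) \<partial>lborel) = ennreal (c * (t powr (- 1 / 2 + 1) / (- 1 / 2 + 1)))"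
    by (intro nn_integral_has_integral_lebesgue) (use assms in auto)
  have 2: "(\<integral>\<^sup>+u. ennreal (indicator {0..t} u * (c * u powr (- 1 / 2))) \<partial>lborel)
      = (\<integral>\<^sup>+u. indicator {0..t} u * ennreal (c * u powr (- 1 / 2)) \<partial>lborel)"
    by (rule nn_integral_cong) (auto split: split_indicator)
  show ?thesis unfolding trans[OF sym[OF 2] 1] by simp
qed

context weighted
begin

lemma nn_integral_mart:
  assumes u: "0 \<le> u" shows "(\<integral>\<^sup>+w. ennreal (mart u w) \<partial>R) = ennreal Z"
proof -
  have ps: "path_space \<in> sets (filt u)" using sets.top[of "filt u"] by simp
  have "(\<integral>\<^sup>+w. ennreal (mart u w) \<partial>R) = (\<integral>\<^sup>+w. indicator path_space w * ennreal (mart u w) \<partial>R)"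
    by (rule nn_integral_cong) simp
  also have "\<dots> = (\<integral>\<^sup>+w. indicator path_space w * ennreal (h (total_sup w)) \<partial>R)"
    by (rule nn_integral_h_total_sup[OF u ps, symmetric])
  also have "\<dots> = (\<integral>\<^sup>+w. ennreal (h (total_sup w)) \<partial>R)" by (rule nn_integral_cong) simp
  finally show ?thesis by (simp add: nn_integral_h_total_sup_UNIV)
qed

lemma nn_integral_h_boundary:
  assumes u: "0 < u"
  shows "(\<integral>\<^sup>+w. ennreal (h (run_sup u w) * exp (- 2 * l * (run_sup u w - coord u w))) \<partial>R)
     \<le> ennreal (2 / sqrt (2 * pi * u) * (exp (2 * l * x) * J x))"
proof -
  have "(\<integral>\<^sup>+w. ennreal (h (run_sup u w) * exp (- 2 * l * (run_sup u w - coord u w))) \<partial>R)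
     = (\<integral>\<^sup>+w. ennreal (h (run_sup u w)) * ennreal (exp (- 2 * l * (run_sup u w - coord u w))) \<partial>R)"
    by (rule nn_integral_cong, rule ennreal_mult) (auto simp: h_pos less_imp_le)
  also have "\<dots> \<le> ennreal (2 / sqrt (2 * pi * u)) * (\<integral>\<^sup>+z. ennreal (exp (- 2 * l * (z - x))) * ennreal (h z) * indicator {x..} z \<partial>lborel)"
    by (rule nn_integral_boundary_le[OF u]) measurable
  also have "(\<integral>\<^sup>+z. ennreal (exp (- 2 * l * (z - x))) * ennreal (h z) * indicator {x..} z \<partial>lborel)
     = (\<integral>\<^sup>+z. ennreal (exp (2 * l * x)) * (ennreal (\<psi> z * exp (- l * z)) * indicator {x..} z) \<partial>lborel)"
  proof (rule nn_integral_cong)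
    fix z
    have e: "exp (- 2 * l * (z - x)) * h z = exp (2 * l * x) * (\<psi> z * exp (- l * z))"
      by (simp add: h_def exp_add[symmetric] algebra_simps)
    have "ennreal (exp (- 2 * l * (z - x))) * ennreal (h z) = ennreal (exp (- 2 * l * (z - x)) * h z)"
      by (rule ennreal_mult[symmetric]) (auto simp: h_pos less_imp_le)
    also have "\<dots> = ennreal (exp (2 * l * x)) * ennreal (\<psi> z * exp (- l * z))"
      unfolding e by (rule ennreal_mult) (use \<psi>_pos[of z] in auto)
    finally show "ennreal (exp (- 2 * l * (z - x))) * ennreal (h z) * indicator {x..} z
       = ennreal (exp (2 * l * x)) * (ennreal (\<psi> z * exp (- l * z)) * indicator {x..} z)"
      by (simp only: mult.assoc)
  qed
  also have "\<dots> = ennreal (exp (2 * l * x)) * ennreal (J x)"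
    unfolding nn_integral_tail[symmetric] by (rule nn_integral_cmult) measurable
  also have "ennreal (2 / sqrt (2 * pi * u)) * \<dots> = ennreal (2 / sqrt (2 * pi * u) * (exp (2 * l * x) * J x))"
    using u J_pos[of x]
    by (subst ennreal_mult[symmetric], simp, simp, subst ennreal_mult[symmetric]) auto
  finally show ?thesis .
qed

text \<open>\<open>h (run_sup u w)\<close> is at most \<open>mart u w\<close> plus the boundary
  term: the first has the constant mean \<open>Z\<close>, the second has a mean of order
  \<open>1 / sqrt u\<close>. The singularity at time 0 is integrable.\<close>

lemma nn_integral_h_run_sup:
  assumes u: "0 < u"
  shows "(\<integral>\<^sup>+w. ennreal (h (run_sup u w)) \<partial>R) \<le> ennreal (Z + 2 / sqrt (2 * pi * u) * (exp (2 * l * x) * J x))"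
proof -
  have u0: "0 \<le> u" using u by simp
  have [measurable]: "mart u \<in> borel_measurable R" by (rule measurable_R(2)[OF measurable_mart[OF u0 order_refl]])
  have [measurable]: "run_sup u \<in> borel_measurable R" by (rule measurable_R(2)[OF measurable_run_sup[OF u0 order_refl]])
  have [measurable]: "coord u \<in> borel_measurable R" by (rule measurable_R(2)[OF measurable_coord_filt[OF u0 order_refl]])
  let ?b = "\<lambda>w. h (run_sup u w) * exp (- 2 * l * (run_sup u w - coord u w))"
  have "(\<integral>\<^sup>+w. ennreal (h (run_sup u w)) \<partial>R) \<le> (\<integral>\<^sup>+w. ennreal (mart u w) + ennreal (?b w) \<partial>R)"
  proof (rule nn_integral_mono)
    fix w assume "w \<in> space R"
    then have "0 < mart u w" using mart_pos[OF _ u0] by simp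
    moreover have "h (run_sup u w) \<le> mart u w + ?b w"
      using l J_pos[of "run_sup u w"] by (simp add: mart_def algebra_simps)
    ultimately show "ennreal (h (run_sup u w)) \<le> ennreal (mart u w) + ennreal (?b w)"
      by (simp add: ennreal_plus[symmetric] h_pos less_imp_le ennreal_leI del: ennreal_plus)
  qed
  also have "\<dots> = (\<integral>\<^sup>+w. ennreal (mart u w) \<partial>R) + (\<integral>\<^sup>+w. ennreal (?b w) \<partial>R)"
    by (rule nn_integral_add) measurable
  also have "\<dots> \<le> ennreal Z + ennreal (2 / sqrt (2 * pi * u) * (exp (2 * l * x) * J x))"
    unfolding nn_integral_mart[OF u0] by (intro add_left_mono nn_integral_h_boundary u)
  finally show ?thesis using u Z_pos J_pos[of x] by (simp add: ennreal_plus[symmetric] less_imp_le del: ennreal_plus)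
qed

lemma time_integral_h_finite:
  assumes t: "0 \<le> t"
  shows "(\<integral>\<^sup>+u. indicator {0..t} u * (\<integral>\<^sup>+w. ennreal (h (run_sup (clamp_time t u) w)) \<partial>R) \<partial>lborel) < \<infinity>"
proof -
  define c where "c = 2 / sqrt (2 * pi) * (exp (2 * l * x) * J x)"
  have c0: "0 \<le> c" using J_pos[of x] by (simp add: c_def)
  have "(\<integral>\<^sup>+u. indicator {0..t} u * (\<integral>\<^sup>+w. ennreal (h (run_sup (clamp_time t u) w)) \<partial>R) \<partial>lborel)
     \<le> (\<integral>\<^sup>+u. ennreal Z * indicator {0..t} u + indicator {0..t} u * ennreal (c * u powr (- 1 / 2)) \<partial>lborel)"
  proof (rule nn_integral_mono_AE)
    show "AE u in lborel. indicator {0..t} u * (\<integral>\<^sup>+w. ennreal (h (run_sup (clamp_time t u) w)) \<partial>R)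
       \<le> ennreal Z * indicator {0..t} u + indicator {0..t} u * ennreal (c * u powr (- 1 / 2))"
      using AE_lborel_singleton[of 0]
    proof eventually_elim
      case (elim u)
      show ?case
      proof (cases "u \<in> {0..t}")
        case True
        with elim have u: "0 < u" by simp
        have "u powr (- 1 / 2) = 1 / sqrt u"
          using u by (simp add: powr_minus_divide powr_half_sqrt)
        then have "2 / sqrt (2 * pi * u) * (exp (2 * l * x) * J x) = c * u powr (- 1 / 2)"
          by (simp add: c_def real_sqrt_mult)
        with nn_integral_h_run_sup[OF u] have "(\<integral>\<^sup>+w. ennreal (h (run_sup u w)) \<partial>R) \<le> ennreal (Z + c * u powr (- 1 / 2))"
          by simp
        then show ?thesis using True Z_pos c0 by (simp add: ennreal_plus less_imp_le)
      qed simp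
    qed
  qed
  also have "\<dots> = ennreal Z * emeasure lborel {0..t} + (\<integral>\<^sup>+u. indicator {0..t} u * ennreal (c * u powr (- 1 / 2)) \<partial>lborel)"
    by (subst nn_integral_add) (auto simp: nn_integral_cmult_indicator)
  also have "\<dots> < \<infinity>"
    using nn_integral_inverse_sqrt_finite[OF t c0] t by (simp add: ennreal_mult_less_top)
  finally show ?thesis .
qed

lemma measurable_mart_joint:
  assumes T: "0 \<le> T" and g: "g \<in> borel_measurable M" and p: "p \<in> measurable M (filt T)"
  shows "(\<lambda>z. mart (clamp_time T (g z)) (p z)) \<in> borel_measurable M"
proof -
  note [measurable] = measurable_run_sup_joint[OF T g p] measurable_coord_joint[OF T g p]
  show ?thesis unfolding mart_def by measurable
qed

lemma measurable_drift_joint: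
  assumes T: "0 \<le> T" and g: "g \<in> borel_measurable M" and p: "p \<in> measurable M (filt T)"
  shows "(\<lambda>z. drift_term l \<psi> (clamp_time T (g z)) (p z)) \<in> borel_measurable M"
proof -
  note [measurable] = measurable_run_sup_joint[OF T g p] measurable_mart_joint[OF T g p]
  have "(\<lambda>z. 2 * h (run_sup (clamp_time T (g z)) (p z)) / mart (clamp_time T (g z)) (p z) - 1) \<in> borel_measurable M"
    by measurable
  then show ?thesis
    by (rule measurable_cong[THEN iffD2, rotated])
       (use drift_term_eq measurable_space[OF p] clamp_time_bounds[OF T] in auto)
qed

lemma measurable_drift_Q0:
  assumes T: "0 \<le> T"
  shows "(\<lambda>p. drift_term l \<psi> (clamp_time T (snd p)) (fst p)) \<in> borel_measurable (Q0 \<Otimes>\<^sub>M lborel)"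
    and "(\<lambda>p. drift_term l \<psi> (clamp_time T (snd p)) (fst p)) \<in> borel_measurable (Q0 \<Otimes>\<^sub>M borel)"
proof -
  show *: "(\<lambda>p. drift_term l \<psi> (clamp_time T (snd p)) (fst p)) \<in> borel_measurable (Q0 \<Otimes>\<^sub>M borel)"
  proof (rule measurable_drift_joint[OF T])
    show "fst \<in> measurable (Q0 \<Otimes>\<^sub>M (borel :: real measure)) (filt T)"
      using measurable_compose[OF measurable_fst[of Q0 "borel :: real measure"] measurable_path_id[OF sets_Q0, of T]] by simp
  qed measurable
  have "sets (Q0 \<Otimes>\<^sub>M lborel) = sets (Q0 \<Otimes>\<^sub>M borel)" by (rule sets_pair_measure_cong) simp_all
  from * measurable_cong_sets[OF this refl]
  show "(\<lambda>p. drift_term l \<psi> (clamp_time T (snd p)) (fst p)) \<in> borel_measurable (Q0 \<Otimes>\<^sub>M lborel)" by blast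
qed

lemma measurable_run_sup_pair:
  assumes M: "sets M = sets filt_inf" and T: "0 \<le> T"
  shows "(\<lambda>p. run_sup (clamp_time T (snd p)) (fst p)) \<in> borel_measurable (M \<Otimes>\<^sub>M lborel)"
proof -
  have "sets (M \<Otimes>\<^sub>M lborel) = sets (M \<Otimes>\<^sub>M borel)" by (rule sets_pair_measure_cong) simp_all
  from measurable_joint_processes(2)[OF M T] measurable_cong_sets[OF this refl] show ?thesis by blast
qed

lemma integrable_h_run_sup:
  assumes t: "0 \<le> t"
  shows "integrable (R \<Otimes>\<^sub>M lborel) (\<lambda>p. indicator {0..t} (snd p) *\<^sub>R h (run_sup (clamp_time t (snd p)) (fst p)))"
proof (rule integrableI_nonneg)
  interpret pr: pair_sigma_finite R lborel ..
  note [measurable] = measurable_run_sup_pair[OF gauss_incrementsD(2)[OF R] t]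
  show m: "(\<lambda>p. indicator {0..t} (snd p) *\<^sub>R h (run_sup (clamp_time t (snd p)) (fst p))) \<in> borel_measurable (R \<Otimes>\<^sub>M lborel)"
    by measurable
  have "(\<integral>\<^sup>+p. ennreal (indicator {0..t} (snd p) *\<^sub>R h (run_sup (clamp_time t (snd p)) (fst p))) \<partial>(R \<Otimes>\<^sub>M lborel))
    = (\<integral>\<^sup>+u. (\<integral>\<^sup>+w. ennreal (indicator {0..t} u *\<^sub>R h (run_sup (clamp_time t u) w)) \<partial>R) \<partial>lborel)"
    by (subst pr.nn_integral_snd[symmetric]) (use m in \<open>simp_all add: split_beta'\<close>)
  also have "\<dots> = (\<integral>\<^sup>+u. indicator {0..t} u * (\<integral>\<^sup>+w. ennreal (h (run_sup (clamp_time t u) w)) \<partial>R) \<partial>lborel)"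
    by (rule nn_integral_cong) (auto split: split_indicator)
  also have "\<dots> < \<infinity>" by (rule time_integral_h_finite[OF t])
  finally show "(\<integral>\<^sup>+p. ennreal (indicator {0..t} (snd p) *\<^sub>R h (run_sup (clamp_time t (snd p)) (fst p))) \<partial>(R \<Otimes>\<^sub>M lborel)) < \<infinity>" .
qed (auto simp: h_pos less_imp_le)

text \<open>The density \<open>mart u w / Z\<close> of \<open>Q0\<close> cancels the denominator
  that \<open>drift_term_eq\<close> exhibits, so only the mean of \<open>h (run_sup u w)\<close>
  under \<open>R\<close> remains.\<close>

lemma nn_integral_drift_Q0:
  assumes u: "0 \<le> u"
  shows "(\<integral>\<^sup>+w. ennreal \<bar>drift_term l \<psi> u w\<bar> \<partial>Q0) \<le> ennreal (2 / Z) * (\<integral>\<^sup>+w. ennreal (h (run_sup u w)) \<partial>R) + 1"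
proof -
  note [measurable] = measurable_mart[OF u order_refl] measurable_run_sup[OF u order_refl]
  have rm: "(\<lambda>w. ennreal (2 * h (run_sup u w) / mart u w)) \<in> borel_measurable (filt u)" by measurable
  have rQ: "(\<lambda>w. ennreal (2 * h (run_sup u w) / mart u w)) \<in> borel_measurable Q0" by (rule measurable_Q0(2)[OF rm])
  have SR[measurable]: "run_sup u \<in> borel_measurable R" by (rule measurable_R(2)[OF measurable_run_sup[OF u order_refl]])
  have "(\<integral>\<^sup>+w. ennreal \<bar>drift_term l \<psi> u w\<bar> \<partial>Q0) \<le> (\<integral>\<^sup>+w. ennreal (2 * h (run_sup u w) / mart u w) + 1 \<partial>Q0)"
  proof (rule nn_integral_mono)
    fix w assume "w \<in> space Q0"
    then have w: "w \<in> path_space" by simp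
    have p: "0 \<le> 2 * h (run_sup u w) / mart u w"
      using h_pos[of "run_sup u w"] mart_pos[OF w u] by simp
    then have "\<bar>drift_term l \<psi> u w\<bar> \<le> 2 * h (run_sup u w) / mart u w + 1"
      unfolding drift_term_eq[OF w u] by linarith
    from ennreal_leI[OF this] p show "ennreal \<bar>drift_term l \<psi> u w\<bar> \<le> ennreal (2 * h (run_sup u w) / mart u w) + 1"
      by (simp add: ennreal_plus)
  qed
  also have "\<dots> = (\<integral>\<^sup>+w. ennreal (2 * h (run_sup u w) / mart u w) \<partial>Q0) + 1"
    using rQ by (subst nn_integral_add) (auto simp: Q0.emeasure_space_1[simplified])
  also have "(\<integral>\<^sup>+w. ennreal (2 * h (run_sup u w) / mart u w) \<partial>Q0)
      = (\<integral>\<^sup>+w. ennreal (mart u w / Z) * ennreal (2 * h (run_sup u w) / mart u w) \<partial>R)"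
    by (rule nn_integral_Q0[OF u rm])
  also have "\<dots> = (\<integral>\<^sup>+w. ennreal (2 / Z) * ennreal (h (run_sup u w)) \<partial>R)"
  proof (rule nn_integral_cong)
    fix w assume "w \<in> space R"
    then have m: "0 < mart u w" using mart_pos[OF _ u] by simp
    then have "mart u w / Z * (2 * h (run_sup u w) / mart u w) = 2 / Z * h (run_sup u w)" by simp
    then show "ennreal (mart u w / Z) * ennreal (2 * h (run_sup u w) / mart u w) = ennreal (2 / Z) * ennreal (h (run_sup u w))"
      using m Z_pos h_pos[of "run_sup u w"] by (simp only: ennreal_mult[symmetric] divide_nonneg_nonneg less_imp_le mult_nonneg_nonneg zero_le_numeral)
  qed
  also have "\<dots> = ennreal (2 / Z) * (\<integral>\<^sup>+w. ennreal (h (run_sup u w)) \<partial>R)"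
    by (rule nn_integral_cmult) measurable
  finally show ?thesis .
qed

lemma integrable_drift:
  assumes t: "0 \<le> t"
  shows "integrable (Q0 \<Otimes>\<^sub>M lborel) (\<lambda>p. indicator {0..t} (snd p) *\<^sub>R drift_term l \<psi> (clamp_time t (snd p)) (fst p))"
proof (rule integrableI_bounded)
  interpret pr: pair_sigma_finite Q0 lborel ..
  interpret prR: pair_sigma_finite R lborel ..
  note [measurable] = measurable_drift_Q0(1)[OF t] measurable_run_sup_pair[OF gauss_incrementsD(2)[OF R] t]
  let ?f = "\<lambda>p. indicator {0..t} (snd p) *\<^sub>R drift_term l \<psi> (clamp_time t (snd p)) (fst p)"
  show m: "?f \<in> borel_measurable (Q0 \<Otimes>\<^sub>M lborel)" by measurable
  have hm: "(\<lambda>p. ennreal (h (run_sup (clamp_time t (snd p)) (fst p)))) \<in> borel_measurable (R \<Otimes>\<^sub>M lborel)" by measurable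
  have hm': "(\<lambda>u. \<integral>\<^sup>+w. ennreal (h (run_sup (clamp_time t u) w)) \<partial>R) \<in> borel_measurable lborel"
    using R.borel_measurable_nn_integral_fst[OF measurable_compose[OF measurable_pair_swap' hm]] by (simp add: split_beta')
  have "(\<integral>\<^sup>+p. ennreal (norm (?f p)) \<partial>(Q0 \<Otimes>\<^sub>M lborel))
    = (\<integral>\<^sup>+u. (\<integral>\<^sup>+w. ennreal (norm (?f (w, u))) \<partial>Q0) \<partial>lborel)"
    by (subst pr.nn_integral_snd[symmetric]) (use m in \<open>simp_all add: split_beta'\<close>)
  also have "\<dots> \<le> (\<integral>\<^sup>+u. ennreal (2 / Z) * (indicator {0..t} u * (\<integral>\<^sup>+w. ennreal (h (run_sup (clamp_time t u) w)) \<partial>R)) + indicator {0..t} u \<partial>lborel)"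
    by (rule nn_integral_mono)
       (use nn_integral_drift_Q0 clamp_time_bounds[OF t] in \<open>auto split: split_indicator\<close>)
  also have "\<dots> = ennreal (2 / Z) * (\<integral>\<^sup>+u. indicator {0..t} u * (\<integral>\<^sup>+w. ennreal (h (run_sup (clamp_time t u) w)) \<partial>R) \<partial>lborel) + emeasure lborel {0..t}"
    using hm' by (subst nn_integral_add) (auto simp: nn_integral_cmult)
  also have "\<dots> < \<infinity>" using time_integral_h_finite[OF t] t by (simp add: ennreal_mult_less_top)
  finally show "(\<integral>\<^sup>+p. ennreal (norm (?f p)) \<partial>(Q0 \<Otimes>\<^sub>M lborel)) < \<infinity>" .
qed

lemma AE_set_integrable_drift:
  "AE w in Q0. \<forall>t\<ge>0. set_integrable lborel {0..t} (\<lambda>u. drift_term l \<psi> u w)"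
proof -
  interpret pr: pair_sigma_finite Q0 lborel ..
  have "AE w in Q0. set_integrable lborel {0..real n} (\<lambda>u. drift_term l \<psi> u w)" for n
  proof (rule eventually_mono[OF pr.AE_integrable_fst'[OF integrable_drift[OF of_nat_0_le_iff[of n]]]])
    fix w
    have "(\<lambda>u. indicator {0..real n} u *\<^sub>R drift_term l \<psi> (clamp_time (real n) u) w) = (\<lambda>u. indicator {0..real n} u *\<^sub>R drift_term l \<psi> u w)"
      by (auto split: split_indicator)
    then show "integrable lborel (\<lambda>y. indicator {0..real n} (snd (w, y)) *\<^sub>R drift_term l \<psi> (clamp_time (real n) (snd (w, y))) (fst (w, y)))
      \<Longrightarrow> set_integrable lborel {0..real n} (\<lambda>u. drift_term l \<psi> u w)"
      by (simp add: set_integrable_def)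
  qed
  then have "AE w in Q0. \<forall>n::nat. set_integrable lborel {0..real n} (\<lambda>u. drift_term l \<psi> u w)"
    by (simp add: AE_all_countable)
  then show ?thesis
  proof eventually_elim
    case (elim w)
    show ?case
    proof (intro allI impI)
      fix t :: real assume "0 \<le> t"
      obtain n :: nat where "t \<le> real n" using real_arch_simple by blast
      then show "set_integrable lborel {0..t} (\<lambda>u. drift_term l \<psi> u w)"
        by (intro set_integrable_subset[OF elim[rule_format, of n]]) auto
    qed
  qed
qed

end

section \<open>The drift under the weighted law\<close>

lemma integrable_bounded_scaleR:
  fixes f :: "'a \<Rightarrow> real" and g :: "'a \<Rightarrow> complex"
  assumes f: "integrable M f" and g: "g \<in> borel_measurable M" and B: "\<And>w. norm (g w) \<le> B"
  shows "integrable M (\<lambda>w. f w *\<^sub>R g w)"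
proof (rule Bochner_Integration.integrable_bound)
  show "integrable M (\<lambda>w. B * f w)" using f by simp
  show "(\<lambda>w. f w *\<^sub>R g w) \<in> borel_measurable M" using f g by measurable
  show "AE w in M. norm (f w *\<^sub>R g w) \<le> norm (B * f w)"
    unfolding norm_scaleR real_norm_def abs_mult mult.commute[of "\<bar>B\<bar>"]
    by (intro AE_I2 mult_left_mono order_trans[OF B abs_ge_self] abs_ge_zero)
qed

context weighted
begin

text \<open>Apply \<open>sup_identity\<close> with \<open>k = h\<close> and divide by
  \<open>Z\<close>. In passing from \<open>R\<close> to \<open>Q0\<close>,
  \<open>h (run_sup u w)\<close> becomes \<open>Z / 2\<close> times \<open>drift_term + 1\<close>;
  the summand 1 cancels the compensating drift \<open>l\<close>, and the drift \<open>- l\<close>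
  times \<open>drift_term\<close> is left.\<close>

lemma drift_identity:
  fixes G :: "(real \<Rightarrow> real) \<Rightarrow> complex"
  assumes st: "0 \<le> s" "s < t" and G: "G \<in> borel_measurable (filt s)" and B: "\<And>w. norm (G w) \<le> B"
  shows "(LINT w|Q0. G w * (expmart \<theta> t w - expmart \<theta> s w))
      = - \<i> * of_real (l * \<theta>) * (LINT w|Q0. G w * (LINT u:{s..t}|lborel. drift_term l \<psi> u w *\<^sub>R expmart \<theta> u w))" (is ?eq)
    and "integrable Q0 (\<lambda>w. G w * (LINT u:{s..t}|lborel. drift_term l \<psi> u w *\<^sub>R expmart \<theta> u w))" (is ?int)
proof -
  interpret pQ: pair_sigma_finite Q0 lborel ..
  interpret pR: pair_sigma_finite R lborel ..
  have t0: "0 \<le> t" and st': "s \<le> t" using st by auto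
  have B0: "0 \<le> B" using B[of undefined] norm_ge_zero order_trans by blast
  note sR = gauss_incrementsD(2)[OF R]
  let ?c = "- 2 * \<i> * complex_of_real (l * \<theta>)"
  let ?E = "\<lambda>p. expmart \<theta> (clamp_time t (snd p)) (fst p)" and ?b = "\<lambda>p. drift_term l \<psi> (clamp_time t (snd p)) (fst p)"
  let ?I = "\<lambda>p. indicator {s..t} (snd p) :: real" and ?S = "\<lambda>p. run_sup (clamp_time t (snd p)) (fst p)"
  have GR: "G \<in> borel_measurable R" and GQ: "G \<in> borel_measurable Q0" by (rule measurable_R(2)[OF G] measurable_Q0(2)[OF G])+
  have EE: "expmart \<theta> u \<in> borel_measurable (filt u)" if "s \<le> u" for u using that st by (intro measurable_expmart) auto
  have Eb: "\<forall>u\<in>{s..t}. \<forall>w. norm (expmart \<theta> u w) \<le> exp (\<theta>\<^sup>2 * t / 2)" by (auto intro: norm_expmart_le)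
  have lbR: "f \<in> borel_measurable (R \<Otimes>\<^sub>M lborel)" if "f \<in> borel_measurable (R \<Otimes>\<^sub>M borel)" for f :: "_ \<Rightarrow> 'z::topological_space"
  proof -
    have "sets (R \<Otimes>\<^sub>M lborel) = sets (R \<Otimes>\<^sub>M borel)" by (rule sets_pair_measure_cong) simp_all
    from that measurable_cong_sets[OF this refl] show ?thesis by blast
  qed
  have lbQ: "f \<in> borel_measurable (Q0 \<Otimes>\<^sub>M lborel)" if "f \<in> borel_measurable (Q0 \<Otimes>\<^sub>M borel)" for f :: "_ \<Rightarrow> 'z::topological_space"
  proof -
    have "sets (Q0 \<Otimes>\<^sub>M lborel) = sets (Q0 \<Otimes>\<^sub>M borel)" by (rule sets_pair_measure_cong) simp_all
    from that measurable_cong_sets[OF this refl] show ?thesis by blast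
  qed
  note ER = lbR[OF measurable_joint_processes(3)[OF sR t0]] and EQ = lbQ[OF measurable_joint_processes(3)[OF sets_Q0 t0]]
  have GE: "norm (G (fst p) * ?E p) \<le> B * exp (\<theta>\<^sup>2 * t / 2)" for p :: "(real \<Rightarrow> real) \<times> real"
    unfolding norm_mult using clamp_time_bounds[OF t0, of "snd p"] B0
    by (intro mult_mono B norm_expmart_le) auto
  have GEQ: "(\<lambda>p. G (fst p) * ?E p) \<in> borel_measurable (Q0 \<Otimes>\<^sub>M lborel)" using GQ EQ by measurable
  have GER: "(\<lambda>p. G (fst p) * ?E p) \<in> borel_measurable (R \<Otimes>\<^sub>M lborel)" using GR ER by measurable
  have sub_ind: "integrable N (\<lambda>p. ?I p *\<^sub>R f p)"
    if "integrable N (\<lambda>p. indicator {0..t} (snd p) *\<^sub>R f p)" "f \<in> borel_measurable N" "?I \<in> borel_measurable N"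
    for N :: "((real \<Rightarrow> real) \<times> real) measure" and f :: "(real \<Rightarrow> real) \<times> real \<Rightarrow> real"
    by (rule Bochner_Integration.integrable_bound[OF that(1)])
       (use st that in \<open>auto split: split_indicator\<close>)
  have ib: "integrable (Q0 \<Otimes>\<^sub>M lborel) (\<lambda>p. ?I p *\<^sub>R ?b p)"
    by (rule sub_ind[OF integrable_drift[OF t0] measurable_drift_Q0(1)[OF t0]]) measurable
  have k2: "integrable (R \<Otimes>\<^sub>M lborel) (\<lambda>p. ?I p *\<^sub>R h (?S p))"
    by (rule sub_ind[OF integrable_h_run_sup[OF t0]])
       (use measurable_compose[OF measurable_run_sup_pair[OF sR t0] measurable_h] in measurable)
  have ifb: "integrable (Q0 \<Otimes>\<^sub>M lborel) (\<lambda>p. (?I p *\<^sub>R ?b p) *\<^sub>R (G (fst p) * ?E p))"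
    by (rule integrable_bounded_scaleR[OF ib GEQ GE])
  note fQ = fubini_time[where H="expmart \<theta>", OF Q0.prob_space_axioms st(1) st' GQ B measurable_joint_processes(3)[OF sets_Q0 t0] Eb]
  have if1: "integrable (Q0 \<Otimes>\<^sub>M lborel) (\<lambda>p. ?I p *\<^sub>R (G (fst p) * ?E p))"
  proof (rule integrable_bounded_scaleR[OF _ GEQ GE])
    have "emeasure (Q0 \<Otimes>\<^sub>M lborel) (space Q0 \<times> {s..t}) = emeasure Q0 (space Q0) * emeasure lborel {s..t}"
      by (rule lborel.emeasure_pair_measure_Times) (rule sets.top, simp)
    then have "emeasure (Q0 \<Otimes>\<^sub>M lborel) (space Q0 \<times> {s..t}) < \<infinity>" using st' unfolding Q0.emeasure_space_1 by simp
    moreover have "space Q0 \<times> {s..t} \<in> sets (Q0 \<Otimes>\<^sub>M lborel)" by (rule pair_measureI[OF sets.top]) simp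
    ultimately have "integrable (Q0 \<Otimes>\<^sub>M lborel) (\<lambda>p. indicator (space Q0 \<times> {s..t}) p :: real)"
      by (simp only: integrable_indicator_iff) (auto simp: Int_absorb2 sets.sets_into_space)
    then show "integrable (Q0 \<Otimes>\<^sub>M lborel) ?I"
      by (rule Bochner_Integration.integrable_cong[THEN iffD1, rotated 2]) (auto simp: space_pair_measure split: split_indicator)
  qed
  have fst_b: "(LINT u|lborel. (?I (w, u) *\<^sub>R ?b (w, u)) *\<^sub>R (G w * ?E (w, u)))
      = G w * (LINT u:{s..t}|lborel. drift_term l \<psi> u w *\<^sub>R expmart \<theta> u w)" for w
  proof -
    have "(LINT u|lborel. (?I (w, u) *\<^sub>R ?b (w, u)) *\<^sub>R (G w * ?E (w, u)))
      = (LINT u|lborel. G w * (indicator {s..t} u *\<^sub>R (drift_term l \<psi> u w *\<^sub>R expmart \<theta> u w)))"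
      by (rule Bochner_Integration.integral_cong) (use st in \<open>auto split: split_indicator\<close>)
    also have "\<dots> = G w * (LINT u|lborel. indicator {s..t} u *\<^sub>R (drift_term l \<psi> u w *\<^sub>R expmart \<theta> u w))"
      by (rule integral_mult_right_zero)
    finally show ?thesis by (simp only: set_lebesgue_integral_def)
  qed
  have ifb': "integrable (Q0 \<Otimes>\<^sub>M lborel) (\<lambda>(w, u). (?I (w, u) *\<^sub>R ?b (w, u)) *\<^sub>R (G w * ?E (w, u)))"
    using ifb by (simp add: split_beta')
  show ?int using pQ.integrable_fst[OF ifb'] unfolding fst_b .
  have Lb: "(LINT p|(Q0 \<Otimes>\<^sub>M lborel). (?I p *\<^sub>R ?b p) *\<^sub>R (G (fst p) * ?E p))
      = (LINT w|Q0. G w * (LINT u:{s..t}|lborel. drift_term l \<psi> u w *\<^sub>R expmart \<theta> u w))"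
    using pQ.integral_fst[OF ifb'] unfolding fst_b by (simp add: split_beta')
  have ihF: "integrable (R \<Otimes>\<^sub>M lborel) (\<lambda>p. (?I p *\<^sub>R h (?S p)) *\<^sub>R (G (fst p) * ?E p))"
    by (rule integrable_bounded_scaleR[OF k2 GER GE])
  \<comment> \<open>For fixed \<open>u\<close> the integrand belongs to \<open>filt u\<close>, where
    the density of \<open>Q0\<close> is \<open>mart u w / Z\<close>; solving
    \<open>drift_term_eq\<close> for \<open>h (run_sup u w)\<close> gives the factor
    \<open>drift_term + 1\<close>.\<close>
  have inner: "(LINT w|R. (?I (w, u) *\<^sub>R h (?S (w, u))) *\<^sub>R (G w * ?E (w, u)))
     = (LINT w|Q0. (Z / 2) *\<^sub>R ((?I (w, u) *\<^sub>R ?b (w, u)) *\<^sub>R (G w * ?E (w, u)) + ?I (w, u) *\<^sub>R (G w * ?E (w, u))))" for u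
  proof (cases "u \<in> {s..t}")
    case True
    then have u: "0 \<le> u" "s \<le> u" and [simp]: "clamp_time t u = u" using st by auto
    have bm: "drift_term l \<psi> u \<in> borel_measurable (filt u)"
      using measurable_drift_joint[OF u(1), of "\<lambda>_. u" "filt u" "\<lambda>w. w"] u by simp
    have Fm: "(\<lambda>w. (Z / 2) *\<^sub>R (drift_term l \<psi> u w *\<^sub>R (G w * expmart \<theta> u w) + G w * expmart \<theta> u w)) \<in> borel_measurable (filt u)"
      using bm EE[OF u(2)] measurable_filt_mono[OF G u(2)] by measurable
    have "(LINT w|Q0. (Z / 2) *\<^sub>R (drift_term l \<psi> u w *\<^sub>R (G w * expmart \<theta> u w) + G w * expmart \<theta> u w))
       = (LINT w|R. (mart u w / Z) *\<^sub>R ((Z / 2) *\<^sub>R (drift_term l \<psi> u w *\<^sub>R (G w * expmart \<theta> u w) + G w * expmart \<theta> u w)))"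
      by (rule integral_Q0[OF u(1) Fm])
    also have "\<dots> = (LINT w|R. h (run_sup u w) *\<^sub>R (G w * expmart \<theta> u w))"
    proof (rule Bochner_Integration.integral_cong[OF refl])
      fix w assume "w \<in> space R"
      then have w: "w \<in> path_space" by simp
      have eq: "mart u w / Z * (Z / 2) * (drift_term l \<psi> u w + 1) = h (run_sup u w)"
        unfolding drift_term_eq[OF w u(1)] using mart_pos[OF w u(1)] Z_pos by simp
      have "(mart u w / Z) *\<^sub>R ((Z / 2) *\<^sub>R (drift_term l \<psi> u w *\<^sub>R (G w * expmart \<theta> u w) + G w * expmart \<theta> u w))
         = (mart u w / Z * (Z / 2) * (drift_term l \<psi> u w + 1)) *\<^sub>R (G w * expmart \<theta> u w)"
        by (simp only: scaleR_left_distrib scaleR_one scaleR_scaleR mult.assoc[symmetric] scaleR_right_distrib distrib_left mult_1_right)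
      then show "(mart u w / Z) *\<^sub>R ((Z / 2) *\<^sub>R (drift_term l \<psi> u w *\<^sub>R (G w * expmart \<theta> u w) + G w * expmart \<theta> u w))
         = h (run_sup u w) *\<^sub>R (G w * expmart \<theta> u w)" unfolding eq .
    qed
    finally show ?thesis using True by simp
  next
    case False
    then have "?I (w, u) = 0" for w by simp
    then show ?thesis by simp
  qed
  have iQ: "integrable (Q0 \<Otimes>\<^sub>M lborel) (\<lambda>p. (Z / 2) *\<^sub>R ((?I p *\<^sub>R ?b p) *\<^sub>R (G (fst p) * ?E p) + ?I p *\<^sub>R (G (fst p) * ?E p)))"
    by (intro integrable_scaleR_right Bochner_Integration.integrable_add ifb if1)
  have RQ: "(LINT p|(R \<Otimes>\<^sub>M lborel). (?I p *\<^sub>R h (?S p)) *\<^sub>R (G (fst p) * ?E p))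
     = (LINT p|(Q0 \<Otimes>\<^sub>M lborel). (Z / 2) *\<^sub>R ((?I p *\<^sub>R ?b p) *\<^sub>R (G (fst p) * ?E p) + ?I p *\<^sub>R (G (fst p) * ?E p)))"
  proof -
    have "(LINT p|(R \<Otimes>\<^sub>M lborel). (?I p *\<^sub>R h (?S p)) *\<^sub>R (G (fst p) * ?E p))
       = (LINT u|lborel. LINT w|R. (?I (w, u) *\<^sub>R h (?S (w, u))) *\<^sub>R (G w * ?E (w, u)))"
      using pR.integral_snd[of "\<lambda>w u. (?I (w, u) *\<^sub>R h (?S (w, u))) *\<^sub>R (G w * ?E (w, u))"] ihF by (simp add: split_beta')
    also have "\<dots> = (LINT u|lborel. LINT w|Q0. (Z / 2) *\<^sub>R ((?I (w, u) *\<^sub>R ?b (w, u)) *\<^sub>R (G w * ?E (w, u)) + ?I (w, u) *\<^sub>R (G w * ?E (w, u))))"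
      unfolding inner ..
    also have "\<dots> = (LINT p|(Q0 \<Otimes>\<^sub>M lborel). (Z / 2) *\<^sub>R ((?I p *\<^sub>R ?b p) *\<^sub>R (G (fst p) * ?E p) + ?I p *\<^sub>R (G (fst p) * ?E p)))"
      using pQ.integral_snd[of "\<lambda>w u. (Z / 2) *\<^sub>R ((?I (w, u) *\<^sub>R ?b (w, u)) *\<^sub>R (G w * ?E (w, u)) + ?I (w, u) *\<^sub>R (G w * ?E (w, u)))"] iQ
      by (simp add: split_beta')
    finally show ?thesis .
  qed
  let ?L = "\<lambda>w. LINT u:{s..t}|lborel. expmart \<theta> u w"
  let ?F1 = "\<lambda>w. G w * (expmart \<theta> t w - expmart \<theta> s w - \<i> * of_real (l * \<theta>) * ?L w)"
  have iGL: "integrable Q0 (\<lambda>w. G w * ?L w)" by (rule fQ(4))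
  have iGE: "integrable Q0 (\<lambda>w. G w * expmart \<theta> u w)" if u: "u \<in> {s..t}" for u
  proof (rule Q0.integrable_const_bound[where B="B * exp (\<theta>\<^sup>2 * t / 2)"])
    show "AE w in Q0. norm (G w * expmart \<theta> u w) \<le> B * exp (\<theta>\<^sup>2 * t / 2)"
      unfolding norm_mult using u by (intro AE_I2 mult_mono B norm_expmart_le B0) auto
    show "(\<lambda>w. G w * expmart \<theta> u w) \<in> borel_measurable Q0"
      using GQ measurable_Q0(2)[OF EE[of u]] u by auto
  qed
  have iG: "integrable Q0 (\<lambda>w. G w * (expmart \<theta> t w - expmart \<theta> s w))"
    unfolding right_diff_distrib using iGE st' by simp
  have F1_eq: "?F1 w = G w * (expmart \<theta> t w - expmart \<theta> s w) - \<i> * of_real (l * \<theta>) * (G w * ?L w)" for w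
    by (simp add: algebra_simps)
  have F1_int: "integrable Q0 ?F1" unfolding F1_eq using iG iGL by simp
  have F1R: "?F1 \<in> borel_measurable R"
    using borel_measurable_integrable[OF F1_int] measurable_cong_sets[OF sets_Q0 refl] measurable_cong_sets[OF sR refl] by blast
  have TR: "total_sup \<in> borel_measurable R" by (rule measurable_R(1)[OF measurable_total_sup])
  have "Z *\<^sub>R (LINT w|Q0. ?F1 w) = Z *\<^sub>R (LINT w|R. (h (total_sup w) / Z) *\<^sub>R ?F1 w)"
    unfolding Q0_def
    by (subst integral_density[OF F1R]) (use measurable_compose[OF TR measurable_h] h_pos Z_pos in \<open>auto simp: less_imp_le\<close>)
  also have "\<dots> = (LINT w|R. Z *\<^sub>R ((h (total_sup w) / Z) *\<^sub>R ?F1 w))" by (rule integral_scaleR_right[symmetric])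
  also have "\<dots> = (LINT w|R. h (total_sup w) *\<^sub>R ?F1 w)"
    using Z_pos by (simp only: scaleR_scaleR) simp
  also have "\<dots> = (LINT p|(R \<Otimes>\<^sub>M lborel). ?I p *\<^sub>R (h (?S p) *\<^sub>R (?c * G (fst p) * ?E p)))"
    by (rule sup_identity[OF st G B measurable_h less_imp_le[OF h_pos] integrable_h_total_sup k2])
  also have "\<dots> = (LINT p|(R \<Otimes>\<^sub>M lborel). ?c * ((?I p *\<^sub>R h (?S p)) *\<^sub>R (G (fst p) * ?E p)))"
    by (rule Bochner_Integration.integral_cong) (simp_all add: scaleR_conv_of_real)
  also have "\<dots> = ?c * (LINT p|(R \<Otimes>\<^sub>M lborel). (?I p *\<^sub>R h (?S p)) *\<^sub>R (G (fst p) * ?E p))"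
    by (rule integral_mult_right_zero)
  also have "\<dots> = ?c * ((Z / 2) *\<^sub>R ((LINT p|(Q0 \<Otimes>\<^sub>M lborel). (?I p *\<^sub>R ?b p) *\<^sub>R (G (fst p) * ?E p)) + (LINT p|(Q0 \<Otimes>\<^sub>M lborel). ?I p *\<^sub>R (G (fst p) * ?E p))))"
    unfolding RQ integral_scaleR_right Bochner_Integration.integral_add[OF ifb if1] ..
  also have "\<dots> = Z *\<^sub>R (- \<i> * of_real (l * \<theta>) * ((LINT w|Q0. G w * (LINT u:{s..t}|lborel. drift_term l \<psi> u w *\<^sub>R expmart \<theta> u w)) + (LINT w|Q0. G w * ?L w)))"
    unfolding Lb fQ(3) fQ(1)[symmetric] by (simp add: scaleR_conv_of_real)
  finally have A: "(LINT w|Q0. ?F1 w) = - \<i> * of_real (l * \<theta>) * ((LINT w|Q0. G w * (LINT u:{s..t}|lborel. drift_term l \<psi> u w *\<^sub>R expmart \<theta> u w)) + (LINT w|Q0. G w * ?L w))"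
    using Z_pos by (simp only: scaleR_cancel_left) simp
  have D: "(LINT w|Q0. ?F1 w) = (LINT w|Q0. G w * (expmart \<theta> t w - expmart \<theta> s w)) - \<i> * of_real (l * \<theta>) * (LINT w|Q0. G w * ?L w)"
    unfolding F1_eq Bochner_Integration.integral_diff[OF iG integrable_mult_right[OF iGL]] integral_mult_right_zero ..
  have alg: "y = - \<i> * c * a" if "F = - \<i> * c * (a + b)" "F = y - \<i> * c * b" for F y a b c :: complex
    using that by (simp add: algebra_simps)
  show ?eq by (rule alg[OF A D])
qed

end

lemma norm_iexp_minus_le: "norm (iexp a - 1) \<le> \<bar>a\<bar>" "norm (iexp a - 1 - \<i> * of_real a) \<le> a\<^sup>2 / 2"
  using iexp_approx1[of a 0] iexp_approx1[of a 1] by (simp_all add: numeral_2_eq_2 power2_eq_square algebra_simps)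

text \<open>With \<open>a\<close> the integral of \<open>b\<close> over a cell and \<open>q\<close>
  its right end, each bracket is \<open>E q * (iexp a - 1 - \<i> * a)\<close> plus \<i> times the
  integral of \<open>b v * (E q - E v)\<close>. The first is quadratic in \<open>a\<close>, the
  second carries the oscillation of \<open>E\<close>; both are small multiples of the integral of
  the absolute value of \<open>b\<close> over the cell. As \<open>b\<close> is merely integrable,
  smallness of \<open>a\<close> comes from uniform continuity of that indefinite integral.\<close>

lemma grid_product_sum:
  fixes b :: "real \<Rightarrow> real" and E :: "real \<Rightarrow> complex" and c :: "nat \<Rightarrow> nat \<Rightarrow> complex"
  assumes st: "s < t" and b: "set_integrable lborel {s..t} b" and E: "continuous_on {s..t} E"
    and M: "\<And>v. v \<in> {s..t} \<Longrightarrow> norm (E v) \<le> M" and c: "\<And>n k. norm (c n k) \<le> 1"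
  defines "D \<equiv> \<lambda>n. \<Sum>k<Suc n. c n k * (E (grid s t n (Suc k)) * (iexp (LINT v:{grid s t n k..grid s t n (Suc k)}|lborel. b v) - 1)
      - \<i> * (LINT v:{grid s t n k..grid s t n (Suc k)}|lborel. b v *\<^sub>R E v))"
  shows "norm (D n) \<le> 2 * M * (LINT v:{s..t}|lborel. \<bar>b v\<bar>)" and "D \<longlonglongrightarrow> 0"
proof -
  let ?g = "grid s t"
  have M0: "0 \<le> M" using M[of s] st by (meson atLeastAtMost_iff less_imp_le norm_ge_zero order_refl order_trans)
  have babs: "set_integrable lborel {s..t} (\<lambda>v. \<bar>b v\<bar>)" by (rule set_integrable_abs[OF b])
  define I where "I p q = (LINT v:{p..q}|lborel. \<bar>b v\<bar>)" for p q
  have sub: "{p..q} \<subseteq> {s..t}" if "s \<le> p" "q \<le> t" for p q using that by auto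
  have b': "set_integrable lborel {p..q} b" and babs': "set_integrable lborel {p..q} (\<lambda>v. \<bar>b v\<bar>)"
    if "s \<le> p" "q \<le> t" for p q
    by (rule set_integrable_subset[OF b _ sub[OF that]] set_integrable_subset[OF babs _ sub[OF that]]; simp)+
  have I_HK: "I p q = integral {p..q} (\<lambda>v. \<bar>b v\<bar>)" if "s \<le> p" "q \<le> t" for p q
    unfolding I_def by (rule set_borel_integral_eq_integral(2)[OF babs'[OF that]])
  have HK: "(\<lambda>v. \<bar>b v\<bar>) integrable_on {s..t}" by (rule set_borel_integral_eq_integral(1)[OF babs])
  have I_nonneg: "0 \<le> I p q" for p q
    unfolding I_def set_lebesgue_integral_def by (rule integral_nonneg_AE) (auto intro!: AE_I2)
  have I_add: "I s p + I p q = I s q" if "s \<le> p" "p \<le> q" "q \<le> t" for p q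
  proof -
    have "(\<lambda>v. \<bar>b v\<bar>) integrable_on {s..q}" by (rule integrable_subinterval_real[OF HK]) (use that in auto)
    from Henstock_Kurzweil_Integration.integral_combine[OF that(1,2) this] show ?thesis
      using that by (simp add: I_HK)
  qed
  have gb: "s \<le> ?g n k" "?g n k \<le> ?g n (Suc k)" "?g n (Suc k) \<le> t" if "k < Suc n" for n k
    using grid_bounds[of s t k n] grid_bounds[of s t "Suc k" n] grid_mono[of s t k "Suc k" n] st that by auto
  have I_sum: "(\<Sum>k<Suc n. I (?g n k) (?g n (Suc k))) = I s t" for n
  proof -
    have "(\<Sum>k<Suc n. I (?g n k) (?g n (Suc k))) = (\<Sum>k<Suc n. I s (?g n (Suc k)) - I s (?g n k))"
      using I_add[OF gb(1,2,3)] by (intro sum.cong) (auto simp: eq_diff_eq add.commute)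
    also have "\<dots> = I s t - I s s" by (subst sum_lessThan_telescope) simp
    also have "I s s = 0" using I_HK[of s s] st by simp
    finally show ?thesis by simp
  qed
  let ?a = "\<lambda>n k. LINT v:{?g n k..?g n (Suc k)}|lborel. b v"
  let ?L = "\<lambda>n k. LINT v:{?g n k..?g n (Suc k)}|lborel. b v *\<^sub>R E v"
  let ?T = "\<lambda>n k. E (?g n (Suc k)) * (iexp (?a n k) - 1) - \<i> * ?L n k"
  have a_le: "\<bar>?a n k\<bar> \<le> I (?g n k) (?g n (Suc k))" for n k
  proof -
    have "\<bar>LINT v|lborel. indicator {?g n k..?g n (Suc k)} v *\<^sub>R b v\<bar> \<le> (LINT v|lborel. norm (indicator {?g n k..?g n (Suc k)} v *\<^sub>R b v))"
      using integral_norm_bound[of lborel "\<lambda>v. indicator {?g n k..?g n (Suc k)} v *\<^sub>R b v"] by simp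
    then show ?thesis by (simp add: I_def set_lebesgue_integral_def abs_mult)
  qed
  have L_le: "norm (LINT v:{p..q}|lborel. b v *\<^sub>R F v) \<le> K * I p q"
    if p: "s \<le> p" "q \<le> t" and F: "\<And>v. v \<in> {p..q} \<Longrightarrow> norm (F v) \<le> K" for p q K and F :: "real \<Rightarrow> complex"
  proof -
    have "norm (LINT v:{p..q}|lborel. b v *\<^sub>R F v) \<le> (LINT v|lborel. norm (indicator {p..q} v *\<^sub>R (b v *\<^sub>R F v)))"
      unfolding set_lebesgue_integral_def by (rule integral_norm_bound)
    also have "\<dots> \<le> (LINT v|lborel. K * (indicator {p..q} v *\<^sub>R \<bar>b v\<bar>))"
    proof -
      have bound: "norm (indicator {p..q} v *\<^sub>R (b v *\<^sub>R F v)) \<le> K * (indicator {p..q} v *\<^sub>R \<bar>b v\<bar>)" for v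
        using mult_right_mono[OF F[of v], of "\<bar>b v\<bar>"] by (auto simp: mult.commute split: split_indicator)
      show ?thesis
      proof (rule integral_mono')
        show "integrable lborel (\<lambda>v. K * (indicator {p..q} v *\<^sub>R \<bar>b v\<bar>))"
          using babs'[OF p] unfolding set_integrable_def by (rule integrable_mult_right)
      qed (rule bound, rule order_trans[OF norm_ge_zero bound])
    qed
    also have "\<dots> = K * I p q" unfolding I_def set_lebesgue_integral_def by (rule integral_mult_right_zero)
    finally show ?thesis .
  qed
  have DT: "D n = (\<Sum>k<Suc n. c n k * ?T n k)" for n unfolding D_def ..
  have D_le: "norm (D n) \<le> K * I s t"
    if "\<And>k. k < Suc n \<Longrightarrow> norm (?T n k) \<le> K * I (?g n k) (?g n (Suc k))" for n K
  proof -
    have "norm (D n) \<le> (\<Sum>k<Suc n. K * I (?g n k) (?g n (Suc k)))"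
      unfolding DT
    proof (rule sum_norm_le)
      fix k assume "k \<in> {..<Suc n}"
      then have "norm (?T n k) \<le> K * I (?g n k) (?g n (Suc k))" by (intro that) simp
      moreover have "norm (c n k * ?T n k) \<le> 1 * norm (?T n k)" unfolding norm_mult by (rule mult_right_mono[OF c]) simp
      ultimately show "norm (c n k * ?T n k) \<le> K * I (?g n k) (?g n (Suc k))" by simp
    qed
    also have "\<dots> = K * I s t" by (simp only: sum_distrib_left[symmetric] I_sum)
    finally show ?thesis .
  qed
  show "norm (D n) \<le> 2 * M * (LINT v:{s..t}|lborel. \<bar>b v\<bar>)"
    unfolding I_def[symmetric]
  proof (rule D_le)
    fix k assume k: "k < Suc n"
    have "norm (E (?g n (Suc k)) * (iexp (?a n k) - 1)) \<le> M * I (?g n k) (?g n (Suc k))"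
      unfolding norm_mult using gb[OF k] order_trans[OF norm_iexp_minus_le(1) a_le]
      by (intro mult_mono M M0) auto
    moreover have "norm (\<i> * ?L n k) \<le> M * I (?g n k) (?g n (Suc k))"
      using L_le[OF gb(1,3)[OF k], of E M] M gb[OF k] by (simp add: norm_mult)
    ultimately show "norm (?T n k) \<le> 2 * M * I (?g n k) (?g n (Suc k))"
      using norm_triangle_ineq4[of "E (?g n (Suc k)) * (iexp (?a n k) - 1)" "\<i> * ?L n k"] by linarith
  qed
  show "D \<longlonglongrightarrow> 0"
  proof (rule tendstoI)
    fix e :: real assume e: "0 < e"
    \<comment> \<open>The tolerance on cells is chosen so that
      \<open>(M / 2 + 1) * d * I s t\<close> stays below \<open>e\<close>; the 1 added in the
      denominator covers the case that the integral vanishes.\<close>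
    define d where "d = e / ((M / 2 + 1) * I s t + 1)"
    have p: "0 < (M / 2 + 1) * I s t + 1" using M0 I_nonneg[of s t] by (intro add_nonneg_pos mult_nonneg_nonneg) auto
    have d0: "0 < d" using p e by (simp add: d_def)
    have d_small: "(M / 2 + 1) * d * I s t < e"
    proof -
      have "(M / 2 + 1) * d * I s t = e * ((M / 2 + 1) * I s t / ((M / 2 + 1) * I s t + 1))" by (simp add: d_def)
      also have "\<dots> < e * 1" using p e by (intro mult_strict_left_mono) auto
      finally show ?thesis by simp
    qed
    have "uniformly_continuous_on {s..t} (\<lambda>u. integral {s..u} (\<lambda>v. \<bar>b v\<bar>))"
      by (rule compact_uniformly_continuous[OF indefinite_integral_continuous_1[OF HK]]) simp
    then obtain d1 where d1: "0 < d1" "\<And>u v. u \<in> {s..t} \<Longrightarrow> v \<in> {s..t} \<Longrightarrow> dist v u < d1 \<Longrightarrow>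
        dist (integral {s..v} (\<lambda>v. \<bar>b v\<bar>)) (integral {s..u} (\<lambda>v. \<bar>b v\<bar>)) < d"
      by (rule uniformly_continuous_onE[OF _ d0]) blast
    have "uniformly_continuous_on {s..t} E" by (rule compact_uniformly_continuous[OF E]) simp
    then obtain d2 where d2: "0 < d2" "\<And>u v. u \<in> {s..t} \<Longrightarrow> v \<in> {s..t} \<Longrightarrow> dist v u < d2 \<Longrightarrow> dist (E v) (E u) < d"
      by (rule uniformly_continuous_onE[OF _ d0]) blast
    have "\<forall>\<^sub>F n in sequentially. (t - s) / real (Suc n) < min d1 d2"
      by (rule order_tendstoD(2)[OF grid_mesh_tendsto]) (use d1(1) d2(1) in simp)
    then show "\<forall>\<^sub>F n in sequentially. dist (D n) 0 < e"
    proof eventually_elim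
      case (elim n)
      have "norm (D n) \<le> (M / 2 + 1) * d * I s t"
      proof (rule D_le)
        fix k assume k: "k < Suc n"
        let ?p = "?g n k" and ?q = "?g n (Suc k)"
        note g = gb[OF k]
        have mesh: "?q - ?p < d1" "?q - ?p < d2" using elim grid_diff[of s t n k] by auto
        have "dist (integral {s..?q} (\<lambda>v. \<bar>b v\<bar>)) (integral {s..?p} (\<lambda>v. \<bar>b v\<bar>)) < d"
          by (rule d1(2)) (use g mesh in \<open>auto simp: dist_real_def\<close>)
        moreover have "I ?p ?q = integral {s..?q} (\<lambda>v. \<bar>b v\<bar>) - integral {s..?p} (\<lambda>v. \<bar>b v\<bar>)"
          using I_add[OF g] g by (simp add: I_HK)
        ultimately have I_d: "I ?p ?q \<le> d" by (simp add: dist_real_def)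
        have osc: "norm (E ?q - E v) \<le> d" if "v \<in> {?p..?q}" for v
        proof -
          have "dist (E ?q) (E v) < d" by (rule d2(2)) (use g mesh that in \<open>auto simp: dist_real_def\<close>)
          then show ?thesis by (simp add: dist_norm)
        qed
        have iE: "set_integrable lborel {?p..?q} (\<lambda>v. b v *\<^sub>R F v)"
          if F: "continuous_on {s..t} F" "\<And>v. v \<in> {s..t} \<Longrightarrow> norm (F v) \<le> K" for F :: "real \<Rightarrow> complex" and K
        proof -
          have "integrable lborel (\<lambda>v. indicator {s..t} v *\<^sub>R b v)" using b by (simp add: set_integrable_def)
          moreover have "(\<lambda>v. indicator {s..t} v *\<^sub>R F v) \<in> borel_measurable lborel"
            using borel_measurable_continuous_on_indicator[OF _ F(1)] by simp
          moreover have "norm (indicator {s..t} v *\<^sub>R F v) \<le> max K 0" for v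
            using F(2)[of v] by (auto split: split_indicator)
          ultimately have "integrable lborel (\<lambda>v. (indicator {s..t} v *\<^sub>R b v) *\<^sub>R (indicator {s..t} v *\<^sub>R F v))"
            by (rule integrable_bounded_scaleR)
          moreover have "(\<lambda>v. (indicator {s..t} v *\<^sub>R b v) *\<^sub>R (indicator {s..t} v *\<^sub>R F v)) = (\<lambda>v. indicator {s..t} v *\<^sub>R (b v *\<^sub>R F v))"
            by (auto split: split_indicator)
          ultimately have "set_integrable lborel {s..t} (\<lambda>v. b v *\<^sub>R F v)" by (simp add: set_integrable_def)
          then show ?thesis by (rule set_integrable_subset) (use g in auto)
        qed
        \<comment> \<open>Replacing \<open>E v\<close> by its value at the right end inside the
          integral produces the first-order term that the exponential is compared with.\<close>
        have "?T n k = E ?q * (iexp (?a n k) - 1 - \<i> * of_real (?a n k)) + \<i> * (LINT v:{?p..?q}|lborel. b v *\<^sub>R (E ?q - E v))"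
        proof -
          have "(LINT v:{?p..?q}|lborel. b v *\<^sub>R (E ?q - E v)) = (LINT v:{?p..?q}|lborel. b v *\<^sub>R E ?q) - ?L n k"
            unfolding scaleR_right_diff_distrib
            by (rule set_integral_diff(2)) (rule iE[where K="norm (E ?q)"], simp, simp, rule iE[OF E M])
          also have "(LINT v:{?p..?q}|lborel. b v *\<^sub>R E ?q) = of_real (?a n k) * E ?q"
          proof -
            have "(LINT v:{?p..?q}|lborel. b v *\<^sub>R E ?q) = (LINT v|lborel. (indicator {?p..?q} v *\<^sub>R b v) *\<^sub>R E ?q)"
              unfolding set_lebesgue_integral_def by (simp only: scaleR_scaleR real_scaleR_def)
            also have "\<dots> = ?a n k *\<^sub>R E ?q"
              unfolding set_lebesgue_integral_def
              by (rule integral_scaleR_left) (use b'[OF g(1,3)] in \<open>simp add: set_integrable_def\<close>)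
            finally show ?thesis by (simp only: scaleR_conv_of_real)
          qed
          finally have eq: "(LINT v:{?p..?q}|lborel. b v *\<^sub>R (E ?q - E v)) = of_real (?a n k) * E ?q - ?L n k" .
          show ?thesis unfolding eq by (simp add: algebra_simps)
        qed
        also have "norm \<dots> \<le> M * ((?a n k)\<^sup>2 / 2) + d * I ?p ?q"
        proof (rule order_trans[OF norm_triangle_ineq add_mono])
          show "norm (E ?q * (iexp (?a n k) - 1 - \<i> * of_real (?a n k))) \<le> M * ((?a n k)\<^sup>2 / 2)"
            unfolding norm_mult using g by (intro mult_mono M norm_iexp_minus_le(2) M0) auto
          show "norm (\<i> * (LINT v:{?p..?q}|lborel. b v *\<^sub>R (E ?q - E v))) \<le> d * I ?p ?q"
            using L_le[OF g(1,3), of "\<lambda>v. E ?q - E v" d] osc by (simp add: norm_mult)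
        qed
        also have "\<dots> \<le> M * (d * I ?p ?q / 2) + d * I ?p ?q"
        proof -
          have "(?a n k)\<^sup>2 = \<bar>?a n k\<bar> * \<bar>?a n k\<bar>" by (simp add: power2_eq_square)
          also have "\<dots> \<le> d * I ?p ?q"
            using order_trans[OF a_le I_d] a_le d0 by (intro mult_mono) auto
          finally show ?thesis using M0 by (intro add_right_mono mult_left_mono divide_right_mono) auto
        qed
        finally show "norm (?T n k) \<le> (M / 2 + 1) * d * I ?p ?q" by (simp add: algebra_simps)
      qed
      with d_small show ?case by simp
    qed
  qed
qed

section \<open>Compensating the drift of the exponential process\<close>

context weighted
begin

definition cum_drift :: "real \<Rightarrow> real \<Rightarrow> (real \<Rightarrow> real) \<Rightarrow> real" where
  "cum_drift s t w = (LINT u:{s..t}|lborel. drift_term l \<psi> u w)"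

lemma measurable_cum_drift:
  assumes "0 \<le> s" "0 \<le> q"
  shows "cum_drift s q \<in> borel_measurable (filt q)"
proof -
  have "(\<lambda>p. drift_term l \<psi> (clamp_time q (snd p)) (fst p)) \<in> borel_measurable (filt q \<Otimes>\<^sub>M (borel :: real measure))"
    by (rule measurable_drift_joint[OF assms(2)]) measurable
  moreover have "sets (filt q \<Otimes>\<^sub>M lborel) = sets (filt q \<Otimes>\<^sub>M (borel :: real measure))" by (rule sets_pair_measure_cong) simp_all
  ultimately have [measurable]: "(\<lambda>p. drift_term l \<psi> (clamp_time q (snd p)) (fst p)) \<in> borel_measurable (filt q \<Otimes>\<^sub>M lborel)"
    using measurable_cong_sets[OF _ refl] by blast
  have "(\<lambda>w. LINT u|lborel. indicator {s..q} u *\<^sub>R drift_term l \<psi> (clamp_time q u) w) \<in> borel_measurable (filt q)"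
    by (rule lborel.borel_measurable_lebesgue_integral) (simp add: split_beta')
  moreover have "cum_drift s q w = (LINT u|lborel. indicator {s..q} u *\<^sub>R drift_term l \<psi> (clamp_time q u) w)" for w
    unfolding cum_drift_def set_lebesgue_integral_def
    by (rule Bochner_Integration.integral_cong) (use assms in \<open>auto split: split_indicator\<close>)
  ultimately show ?thesis by (simp cong: measurable_cong)
qed

lemma cum_drift_refl [simp]: "cum_drift s s w = 0"
  unfolding cum_drift_def set_lebesgue_integral_def
proof (rule integral_eq_zero_AE)
  show "AE u in lborel. indicator {s..s} u *\<^sub>R drift_term l \<psi> u w = 0"
    using AE_lborel_singleton[of s] by eventually_elim simp
qed

lemma cum_drift_add:
  assumes "\<forall>t\<ge>0. set_integrable lborel {0..t} (\<lambda>u. drift_term l \<psi> u w)" "0 \<le> p" "p \<le> q" "q \<le> r"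
  shows "cum_drift p q w + cum_drift q r w = cum_drift p r w"
proof -
  have i: "set_integrable lborel {a..b} (\<lambda>u. drift_term l \<psi> u w)" if "0 \<le> a" "0 \<le> b" for a b
    by (rule set_integrable_subset[OF assms(1)[rule_format, OF that(2)]]) (use that in auto)
  have HK: "cum_drift a b w = integral {a..b} (\<lambda>u. drift_term l \<psi> u w)" if "0 \<le> a" "0 \<le> b" for a b
    unfolding cum_drift_def by (rule set_borel_integral_eq_integral(2)[OF i[OF that]])
  have "(\<lambda>u. drift_term l \<psi> u w) integrable_on {p..r}"
    by (rule set_borel_integral_eq_integral(1)[OF i]) (use assms in auto)
  from Henstock_Kurzweil_Integration.integral_combine[OF assms(3,4) this] show ?thesis
    using assms by (simp add: HK)
qed

lemma integrable_cum_abs_drift: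
  assumes st: "0 \<le> s" "s \<le> t"
  shows "integrable Q0 (\<lambda>w. LINT v:{s..t}|lborel. \<bar>drift_term l \<psi> v w\<bar>)"
proof -
  interpret pr: pair_sigma_finite Q0 lborel ..
  have t0: "0 \<le> t" using st by simp
  note [measurable] = measurable_drift_Q0(1)[OF t0]
  let ?f = "\<lambda>p. indicator {s..t} (snd p) *\<^sub>R \<bar>drift_term l \<psi> (clamp_time t (snd p)) (fst p)\<bar>"
  have "integrable (Q0 \<Otimes>\<^sub>M lborel) ?f"
    by (rule Bochner_Integration.integrable_bound[OF integrable_drift[OF t0]])
       (measurable, use st in \<open>auto split: split_indicator\<close>)
  then have "integrable (Q0 \<Otimes>\<^sub>M lborel) (\<lambda>(w, v). ?f (w, v))" by (simp add: split_beta')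
  from pr.integrable_fst[OF this]
  have "integrable Q0 (\<lambda>w. LINT v|lborel. ?f (w, v))" .
  moreover have "(LINT v|lborel. ?f (w, v)) = (LINT v:{s..t}|lborel. \<bar>drift_term l \<psi> v w\<bar>)" for w
    unfolding set_lebesgue_integral_def
    by (rule Bochner_Integration.integral_cong) (use st in \<open>auto split: split_indicator\<close>)
  ultimately show ?thesis by simp
qed

text \<open>Along a grid the factor \<open>iexp (\<theta> * l * cum_drift)\<close> compensates the drift of \<open>expmart\<close> to first order in each
  cell; the sum of the remainders is the one of \<open>grid_product_sum\<close>.\<close>

lemma exp_martingale:
  fixes G :: "(real \<Rightarrow> real) \<Rightarrow> complex"
  assumes st: "0 \<le> s" "s < t" and G: "G \<in> borel_measurable (filt s)" and B: "\<And>w. norm (G w) \<le> B"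
  shows "(LINT w|Q0. G w * expmart \<theta> t w * iexp (\<theta> * l * cum_drift s t w)) = (LINT w|Q0. G w * expmart \<theta> s w)"
proof -
  have B0: "0 \<le> B" using B[of undefined] norm_ge_zero order_trans by blast
  let ?g = "grid s t" and ?M = "exp (\<theta>\<^sup>2 * t / 2)"
  let ?e = "\<lambda>q w. iexp (\<theta> * l * cum_drift s q w)"
  define F where "F q w = G w * expmart \<theta> q w * ?e q w" for q w
  \<comment> \<open>By \<open>drift_identity\<close> the last summand has the same integral as the
    increment of \<open>expmart\<close> over the cell weighted by the earlier factors, so the
    integral of \<open>U n k\<close> is the increment of the integral of \<open>F\<close> and the
    sum telescopes. Pointwise, \<open>U n k\<close> is the remainder estimated by
    \<open>grid_product_sum\<close>.\<close>
  define U where "U n k w = F (?g n (Suc k)) w - G w * ?e (?g n k) w * expmart \<theta> (?g n (Suc k)) w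
      + (- \<i> * of_real (l * \<theta>) * (G w * ?e (?g n k) w * (LINT u:{?g n k..?g n (Suc k)}|lborel. drift_term l \<psi> u w *\<^sub>R expmart \<theta> u w)))" for n k w
  define D where "D n w = (\<Sum>k<Suc n. ?e (?g n k) w * (expmart \<theta> (?g n (Suc k)) w * (iexp (LINT v:{?g n k..?g n (Suc k)}|lborel. \<theta> * l * drift_term l \<psi> v w) - 1)
      - \<i> * (LINT v:{?g n k..?g n (Suc k)}|lborel. (\<theta> * l * drift_term l \<psi> v w) *\<^sub>R expmart \<theta> v w)))" for n w
  have g: "s \<le> ?g n k" "?g n k < ?g n (Suc k)" "s \<le> ?g n (Suc k)" "?g n (Suc k) \<le> t" if "k < Suc n" for n k
    using grid_bounds[of s t k n] grid_bounds[of s t "Suc k" n] grid_less[OF st(2), of n k] st that by auto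
  have em: "?e q \<in> borel_measurable (filt q)" if "s \<le> q" for q
  proof -
    have q0: "0 \<le> q" using that st by simp
    note [measurable] = measurable_cum_drift[OF st(1) q0]
    show ?thesis by measurable
  qed
  have Gq: "G \<in> borel_measurable (filt q)" if "s \<le> q" for q by (rule measurable_filt_mono[OF G that])
  have Em: "expmart \<theta> q \<in> borel_measurable (filt q)" if "s \<le> q" for q using that st by (intro measurable_expmart) auto
  have ne: "norm (?e q w) = 1" for q w by simp
  have GeB: "norm (G w * ?e q w) \<le> B" for q w unfolding norm_mult ne using B by simp
  have Gem: "(\<lambda>w. G w * ?e q w) \<in> borel_measurable (filt q)" if "s \<le> q" for q
    using Gq[OF that] em[OF that] by measurable
  have int1: "integrable Q0 (\<lambda>w. G w * ?e p w * expmart \<theta> q w)" if "s \<le> p" "p \<le> q" for p q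
  proof (rule Q0.integrable_const_bound[where B="B * exp (\<theta>\<^sup>2 * q / 2)"])
    show "AE w in Q0. norm (G w * ?e p w * expmart \<theta> q w) \<le> B * exp (\<theta>\<^sup>2 * q / 2)"
      unfolding norm_mult[of "_ * _"] by (intro AE_I2 mult_mono GeB norm_expmart_le B0) auto
    show "(\<lambda>w. G w * ?e p w * expmart \<theta> q w) \<in> borel_measurable Q0"
      by (rule borel_measurable_times[OF measurable_Q0(2)[OF Gem[OF that(1)]] measurable_Q0(2)[OF Em[OF order_trans[OF that]]]])
  qed
  have F_alt: "F q w = G w * ?e q w * expmart \<theta> q w" for q w by (simp add: F_def mult_ac)
  have intF: "integrable Q0 (F q)" if "s \<le> q" for q
    using int1[OF that order_refl] by (simp only: F_alt[abs_def])
  note di = drift_identity[OF _ _ Gem GeB]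
  have intU: "integrable Q0 (U n k)" if k: "k < Suc n" for n k
    unfolding U_def
    using intF[OF g(3)[OF k]] int1[OF g(1)[OF k] less_imp_le[OF g(2)[OF k]]]
      di(2)[OF _ g(2)[OF k] g(1)[OF k], of \<theta>] g(1)[OF k] st
    by (intro Bochner_Integration.integrable_add Bochner_Integration.integrable_diff integrable_mult_right) auto
  have stepU: "(LINT w|Q0. U n k w) = (LINT w|Q0. F (?g n (Suc k)) w) - (LINT w|Q0. F (?g n k) w)" if k: "k < Suc n" for n k
  proof -
    let ?p = "?g n k" and ?q = "?g n (Suc k)"
    have p0: "0 \<le> ?p" using g(1)[OF k] st by simp
    note i1 = intF[OF g(3)[OF k]] and i2 = int1[OF g(1)[OF k] less_imp_le[OF g(2)[OF k]]]
      and i3 = di(2)[OF p0 g(2)[OF k] g(1)[OF k], of \<theta>] and i4 = int1[OF g(1)[OF k] order_refl]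
    have "(LINT w|Q0. U n k w) = (LINT w|Q0. F ?q w) - (LINT w|Q0. G w * ?e ?p w * expmart \<theta> ?q w)
       + (- \<i> * of_real (l * \<theta>) * (LINT w|Q0. G w * ?e ?p w * (LINT u:{?p..?q}|lborel. drift_term l \<psi> u w *\<^sub>R expmart \<theta> u w)))"
      unfolding U_def
      by (simp only: Bochner_Integration.integral_add[OF Bochner_Integration.integrable_diff[OF i1 i2] integrable_mult_right[OF i3]]
          Bochner_Integration.integral_diff[OF i1 i2] integral_mult_right_zero)
    also have "- \<i> * of_real (l * \<theta>) * (LINT w|Q0. G w * ?e ?p w * (LINT u:{?p..?q}|lborel. drift_term l \<psi> u w *\<^sub>R expmart \<theta> u w))
       = (LINT w|Q0. G w * ?e ?p w * (expmart \<theta> ?q w - expmart \<theta> ?p w))"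
      by (rule di(1)[OF p0 g(2)[OF k] g(1)[OF k], symmetric])
    also have "\<dots> = (LINT w|Q0. G w * ?e ?p w * expmart \<theta> ?q w) - (LINT w|Q0. F ?p w)"
      unfolding right_diff_distrib F_alt by (rule Bochner_Integration.integral_diff[OF i2 i4])
    finally show ?thesis by simp
  qed
  have tele: "(LINT w|Q0. (\<Sum>k<Suc n. U n k w)) = (LINT w|Q0. F t w) - (LINT w|Q0. F s w)" for n
  proof -
    have "(LINT w|Q0. (\<Sum>k<Suc n. U n k w)) = (\<Sum>k<Suc n. LINT w|Q0. U n k w)"
      by (rule Bochner_Integration.integral_sum) (use intU in auto)
    also have "\<dots> = (\<Sum>k<Suc n. (LINT w|Q0. F (?g n (Suc k)) w) - (LINT w|Q0. F (?g n k) w))"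
      by (rule sum.cong[OF refl]) (use stepU in auto)
    also have "\<dots> = (LINT w|Q0. F t w) - (LINT w|Q0. F s w)" by (subst sum_lessThan_telescope) simp
    finally show ?thesis .
  qed
  have UD: "(\<Sum>k<Suc n. U n k w) = G w * D n w"
    if w: "\<forall>t\<ge>0. set_integrable lborel {0..t} (\<lambda>u. drift_term l \<psi> u w)" for n w
    unfolding D_def sum_distrib_left
  proof (rule sum.cong[OF refl])
    fix k assume "k \<in> {..<Suc n}"
    then have k: "k < Suc n" by simp
    let ?p = "?g n k" and ?q = "?g n (Suc k)"
    have a: "(LINT v:{?p..?q}|lborel. \<theta> * l * drift_term l \<psi> v w) = \<theta> * l * cum_drift ?p ?q w"
      unfolding cum_drift_def by simp
    have b: "(LINT v:{?p..?q}|lborel. (\<theta> * l * drift_term l \<psi> v w) *\<^sub>R expmart \<theta> v w)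
        = of_real (l * \<theta>) * (LINT v:{?p..?q}|lborel. drift_term l \<psi> v w *\<^sub>R expmart \<theta> v w)"
    proof -
      have "(LINT v:{?p..?q}|lborel. (\<theta> * l * drift_term l \<psi> v w) *\<^sub>R expmart \<theta> v w)
         = (LINT v:{?p..?q}|lborel. of_real (l * \<theta>) * (drift_term l \<psi> v w *\<^sub>R expmart \<theta> v w))"
        by (rule arg_cong[where f="\<lambda>f. set_lebesgue_integral lborel {?p..?q} f"]) (auto simp: scaleR_conv_of_real)
      also have "\<dots> = of_real (l * \<theta>) * (LINT v:{?p..?q}|lborel. drift_term l \<psi> v w *\<^sub>R expmart \<theta> v w)"
        by (rule set_integral_mult_right)
      finally show ?thesis .
    qed
    have c: "cum_drift s ?p w + cum_drift ?p ?q w = cum_drift s ?q w"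
      by (rule cum_drift_add[OF w]) (use st g(1,2)[OF k] in auto)
    have "?e ?q w = ?e ?p w * iexp (\<theta> * l * cum_drift ?p ?q w)"
      unfolding exp_add[symmetric] c[symmetric] by (simp add: algebra_simps)
    then show "U n k w = G w * (?e ?p w * (expmart \<theta> ?q w * (iexp (LINT v:{?p..?q}|lborel. \<theta> * l * drift_term l \<psi> v w) - 1)
      - \<i> * (LINT v:{?p..?q}|lborel. (\<theta> * l * drift_term l \<psi> v w) *\<^sub>R expmart \<theta> v w)))"
      unfolding a b U_def F_def by (simp add: algebra_simps)
  qed
  have Dlim: "(\<lambda>n. D n w) \<longlonglongrightarrow> 0" "norm (D n w) \<le> 2 * ?M * (\<bar>\<theta> * l\<bar> * (LINT v:{s..t}|lborel. \<bar>drift_term l \<psi> v w\<bar>))"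
    if w: "\<forall>t\<ge>0. set_integrable lborel {0..t} (\<lambda>u. drift_term l \<psi> u w)" and wp: "w \<in> path_space" for n w
  proof -
    have t0: "0 \<le> t" using st by simp
    have "set_integrable lborel {s..t} (\<lambda>u. drift_term l \<psi> u w)"
      by (rule set_integrable_subset[OF w[rule_format, OF t0]]) (use st in auto)
    then have bi: "set_integrable lborel {s..t} (\<lambda>u. \<theta> * l * drift_term l \<psi> u w)" by simp
    have "continuous_on {s..t} (\<lambda>v. expmart \<theta> (clamp_time t v) w)"
      by (rule continuous_on_subset[OF continuous_time_expmart[OF wp t0]]) simp
    then have cE: "continuous_on {s..t} (\<lambda>v. expmart \<theta> v w)"
      by (rule continuous_on_cong[THEN iffD1, rotated 2]) (use st in auto)
    have Eb: "norm (expmart \<theta> v w) \<le> ?M" if "v \<in> {s..t}" for v using that by (intro norm_expmart_le) auto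
    have eb: "norm (?e (?g n k) w) \<le> 1" for n k by simp
    note gp = grid_product_sum[where c="\<lambda>n k. ?e (?g n k) w", OF st(2) bi cE Eb eb]
    show "(\<lambda>n. D n w) \<longlonglongrightarrow> 0" unfolding D_def by (rule gp(2))
    have "(LINT v:{s..t}|lborel. \<bar>\<theta> * l * drift_term l \<psi> v w\<bar>) = \<bar>\<theta> * l\<bar> * (LINT v:{s..t}|lborel. \<bar>drift_term l \<psi> v w\<bar>)"
      by (simp add: abs_mult)
    with gp(1)[of n] show "norm (D n w) \<le> 2 * ?M * (\<bar>\<theta> * l\<bar> * (LINT v:{s..t}|lborel. \<bar>drift_term l \<psi> v w\<bar>))"
      unfolding D_def by simp
  qed
  have "(\<lambda>n. LINT w|Q0. (\<Sum>k<Suc n. U n k w)) \<longlonglongrightarrow> (LINT w|Q0. 0)"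
  proof (rule integral_dominated_convergence[where w="\<lambda>w. B * (2 * ?M * (\<bar>\<theta> * l\<bar> * (LINT v:{s..t}|lborel. \<bar>drift_term l \<psi> v w\<bar>)))"])
    show "integrable Q0 (\<lambda>w. B * (2 * ?M * (\<bar>\<theta> * l\<bar> * (LINT v:{s..t}|lborel. \<bar>drift_term l \<psi> v w\<bar>))))"
      by (intro integrable_mult_right integrable_cum_abs_drift) (use st in auto)
    show "(\<lambda>w. \<Sum>k<Suc n. U n k w) \<in> borel_measurable Q0" for n
      by (intro borel_measurable_sum borel_measurable_integrable intU) simp
    show "AE w in Q0. (\<lambda>n. \<Sum>k<Suc n. U n k w) \<longlonglongrightarrow> 0"
      using AE_set_integrable_drift AE_space
    proof eventually_elim
      case (elim w)
      have "(\<lambda>n. G w * D n w) \<longlonglongrightarrow> G w * 0" by (intro tendsto_mult_left Dlim(1)) (use elim in auto)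
      then show ?case unfolding UD[OF elim(1)] by simp
    qed
    show "AE w in Q0. norm (\<Sum>k<Suc n. U n k w) \<le> B * (2 * ?M * (\<bar>\<theta> * l\<bar> * (LINT v:{s..t}|lborel. \<bar>drift_term l \<psi> v w\<bar>)))" for n
      using AE_set_integrable_drift AE_space
    proof eventually_elim
      case (elim w)
      show ?case unfolding UD[OF elim(1)] norm_mult
        by (intro mult_mono B Dlim(2) B0) (use elim in auto)
    qed
  qed simp
  then have "(LINT w|Q0. F t w) - (LINT w|Q0. F s w) = 0" unfolding tele by (simp add: LIMSEQ_const_iff)
  then show ?thesis by (simp add: F_def)
qed

end

section \<open>Brownian motion under the weighted law\<close>

text \<open>Independence of each variable from its own past lets the last factor be split off, and
  induction does the rest. The past enters only through \<sigma>-algebras for which the earlier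
  variables are measurable.\<close>

lemma (in prob_space) indep_vars_adapted:
  fixes X :: "nat \<Rightarrow> 'a \<Rightarrow> real" and N :: "nat \<Rightarrow> 'a measure"
  assumes X: "\<And>i. i < n \<Longrightarrow> X i \<in> borel_measurable M"
    and N: "\<And>i. space (N i) = space M" "\<And>i j. j < i \<Longrightarrow> i < n \<Longrightarrow> X j \<in> borel_measurable (N i)"
    and ind: "\<And>i \<Gamma> A. i < n \<Longrightarrow> \<Gamma> \<in> sets (N i) \<Longrightarrow> A \<in> sets borel \<Longrightarrow>
      prob (\<Gamma> \<inter> (X i -` A \<inter> space M)) = prob \<Gamma> * prob (X i -` A \<inter> space M)"
  shows "indep_vars (\<lambda>_. borel) X {..<n}"
proof (cases "n = 0")
  case True
  then show ?thesis by (simp add: indep_vars_def indep_sets_def)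
next
  case False
  have "indep_vars (\<lambda>_. borel) X {..<n} \<longleftrightarrow>
    (\<forall>A\<in>(\<Pi> i\<in>{..<n}. sets borel). prob (\<Inter>j\<in>{..<n}. X j -` A j \<inter> space M) = (\<Prod>j\<in>{..<n}. prob (X j -` A j \<inter> space M)))"
  proof (rule indep_vars_finite)
    show "{..<n} \<noteq> {}" using False by auto
    show "sets borel = sigma_sets (space (borel :: real measure)) (sets borel)"
      by (simp add: sets.sigma_sets_eq[of borel, simplified])
  qed (use X in \<open>auto simp: sets.Int_stable[of borel, simplified]\<close>)
  moreover have "prob (\<Inter>j\<in>{..<n}. X j -` A j \<inter> space M) = (\<Prod>j\<in>{..<n}. prob (X j -` A j \<inter> space M))"
    if A: "\<And>j. j < n \<Longrightarrow> A j \<in> sets borel" for A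
  proof -
    \<comment> \<open>Intersecting with \<open>space M\<close> makes the empty intersection at
      \<open>m = 0\<close> the sure event.\<close>
    have "prob (space M \<inter> (\<Inter>j\<in>{..<m}. X j -` A j \<inter> space M)) = (\<Prod>j\<in>{..<m}. prob (X j -` A j \<inter> space M))" if "m \<le> n" for m
      using that
    proof (induction m)
      case 0
      then show ?case by (simp add: prob_space)
    next
      case (Suc m)
      let ?G = "space M \<inter> (\<Inter>j\<in>{..<m}. X j -` A j \<inter> space M)"
      have "X j -` A j \<inter> space M \<in> sets (N m)" if "j < m" for j
        using measurable_sets[OF N(2)[OF that], of "A j"] Suc.prems that A by (simp add: N(1))
      then have "(\<Inter>j\<in>{..<m}. X j -` A j \<inter> space M) \<inter> space (N m) \<in> sets (N m)"
        by (cases "m = 0") (auto intro!: sets.Int sets.finite_INT simp del: INT_simps)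
      then have "?G \<in> sets (N m)" by (simp add: N(1) Int_commute)
      from ind[OF _ this, of "A m"] Suc A
      have "prob (?G \<inter> (X m -` A m \<inter> space M)) = (\<Prod>j\<in>{..<m}. prob (X j -` A j \<inter> space M)) * prob (X m -` A m \<inter> space M)"
        by simp
      moreover have "?G \<inter> (X m -` A m \<inter> space M) = space M \<inter> (\<Inter>j\<in>{..<Suc m}. X j -` A j \<inter> space M)"
        by (auto simp: lessThan_Suc)
      ultimately show ?case by simp
    qed
    from this[of n] have "prob (space M \<inter> (\<Inter>j\<in>{..<n}. X j -` A j \<inter> space M)) = (\<Prod>j\<in>{..<n}. prob (X j -` A j \<inter> space M))" by simp
    moreover have "space M \<inter> (\<Inter>j\<in>{..<n}. X j -` A j \<inter> space M) = (\<Inter>j\<in>{..<n}. X j -` A j \<inter> space M)" using False by auto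
    ultimately show ?thesis by simp
  qed
  ultimately show ?thesis by (auto simp: Pi_iff)
qed

context weighted
begin

definition bm :: "real \<Rightarrow> (real \<Rightarrow> real) \<Rightarrow> real" where
  "bm t w = coord t w - x + l * cum_drift 0 t w"

lemma measurable_bm:
  assumes "0 \<le> s" "s \<le> t" shows "bm s \<in> borel_measurable (filt t)"
proof -
  have [measurable]: "coord s \<in> borel_measurable (filt t)" by (rule measurable_coord_filt) fact+
  have [measurable]: "cum_drift 0 s \<in> borel_measurable (filt t)"
    by (rule measurable_filt_mono[OF measurable_cum_drift assms(2)]) (use assms in auto)
  show ?thesis unfolding bm_def by measurable
qed

lemma bm_increment:
  assumes "\<forall>t\<ge>0. set_integrable lborel {0..t} (\<lambda>u. drift_term l \<psi> u w)" "0 \<le> s" "s \<le> t"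
  shows "bm t w - bm s w = coord t w - coord s w + l * cum_drift s t w"
  unfolding bm_def cum_drift_add[OF assms(1) order_refl assms(2,3), symmetric] by (simp add: algebra_simps)

text \<open>Put \<open>iexp (- (\<theta> * coord s w))\<close> and the indicator of \<Gamma> into
  the factor \<open>G\<close> of \<open>exp_martingale\<close>. The positions at \<open>s\<close>
  cancel on the right, and the deterministic factors of \<open>expmart\<close> at \<open>s\<close>
  and \<open>t\<close> combine to the Gaussian characteristic function.\<close>

lemma char_bm_increment:
  assumes st: "0 \<le> s" "s < t" and \<Gamma>: "\<Gamma> \<in> sets (filt s)"
  shows "(LINT w|Q0. indicator \<Gamma> w * iexp (\<theta> * (bm t w - bm s w))) = of_real (measure Q0 \<Gamma>) * char (gauss_law 0 (t - s)) \<theta>"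
proof -
  let ?c = "complex_of_real (exp (- (\<theta>\<^sup>2 * t / 2)))"
  define G where "G w = indicator \<Gamma> w * iexp (- (\<theta> * coord s w))" for w
  have [measurable]: "coord s \<in> borel_measurable (filt s)" by (rule measurable_coord_filt) (use st in auto)
  have Gm: "G \<in> borel_measurable (filt s)" using \<Gamma> unfolding G_def by measurable
  have Gb: "norm (G w) \<le> 1" for w by (auto simp: G_def norm_mult split: split_indicator)
  have et: "?c * complex_of_real (exp (\<theta>\<^sup>2 * t / 2)) = 1"
    by (simp only: of_real_mult[symmetric] exp_add[symmetric]) simp
  have "(LINT w|Q0. indicator \<Gamma> w * iexp (\<theta> * (bm t w - bm s w)))
     = (LINT w|Q0. ?c * (G w * expmart \<theta> t w * iexp (\<theta> * l * cum_drift s t w)))"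
  proof (rule integral_cong_AE)
    have [measurable]: "bm t \<in> borel_measurable Q0" "bm s \<in> borel_measurable Q0"
      using st by (auto intro!: measurable_Q0(2)[OF measurable_bm[OF _ order_refl]])
    have [measurable]: "\<Gamma> \<in> sets Q0" using \<Gamma> subalgebra_Q0[of s] by (auto simp: subalgebra_def)
    show "(\<lambda>w. indicator \<Gamma> w * iexp (\<theta> * (bm t w - bm s w))) \<in> borel_measurable Q0" by measurable
    have t0: "0 \<le> t" using st by simp
    have [measurable]: "G \<in> borel_measurable Q0" "expmart \<theta> t \<in> borel_measurable Q0" "cum_drift s t \<in> borel_measurable Q0"
      using measurable_Q0(2)[OF Gm] measurable_Q0(2)[OF measurable_expmart[OF t0 order_refl]] measurable_Q0(2)[OF measurable_cum_drift[OF st(1) t0]] by auto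
    show "(\<lambda>w. ?c * (G w * expmart \<theta> t w * iexp (\<theta> * l * cum_drift s t w))) \<in> borel_measurable Q0" by measurable
    show "AE w in Q0. indicator \<Gamma> w * iexp (\<theta> * (bm t w - bm s w)) = ?c * (G w * expmart \<theta> t w * iexp (\<theta> * l * cum_drift s t w))"
      using AE_set_integrable_drift
    proof eventually_elim
      case (elim w)
      have "iexp (\<theta> * (bm t w - bm s w)) = iexp (- (\<theta> * coord s w)) * iexp (\<theta> * coord t w) * iexp (\<theta> * l * cum_drift s t w)"
        unfolding bm_increment[OF elim st(1) less_imp_le[OF st(2)]] exp_add[symmetric] by (simp add: algebra_simps)
      moreover have "?c * (G w * expmart \<theta> t w * iexp (\<theta> * l * cum_drift s t w))
         = (?c * complex_of_real (exp (\<theta>\<^sup>2 * t / 2))) * (indicator \<Gamma> w * (iexp (- (\<theta> * coord s w)) * iexp (\<theta> * coord t w) * iexp (\<theta> * l * cum_drift s t w)))"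
        unfolding G_def expmart_def by (simp only: mult_ac)
      ultimately show ?case unfolding et by simp
    qed
  qed
  also have "\<dots> = ?c * (LINT w|Q0. G w * expmart \<theta> s w)"
    unfolding exp_martingale[OF st Gm Gb, symmetric] by (rule integral_mult_right_zero)
  also have "(LINT w|Q0. G w * expmart \<theta> s w) = (LINT w|Q0. indicator \<Gamma> w * of_real (exp (\<theta>\<^sup>2 * s / 2)))"
  proof (rule Bochner_Integration.integral_cong[OF refl])
    fix w
    have "iexp (- (\<theta> * coord s w)) * iexp (\<theta> * coord s w) = 1" unfolding exp_add[symmetric] by simp
    then show "G w * expmart \<theta> s w = indicator \<Gamma> w * of_real (exp (\<theta>\<^sup>2 * s / 2))"
      unfolding G_def expmart_def by (metis (no_types, opaque_lifting) mult.assoc mult_1)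
  qed
  also have "\<dots> = of_real (measure Q0 \<Gamma>) * of_real (exp (\<theta>\<^sup>2 * s / 2))"
    unfolding integral_mult_left_zero
    by (subst integral_complex_indicator) (use \<Gamma> subalgebra_Q0[of s] in \<open>auto simp: subalgebra_def\<close>)
  also have "?c * (of_real (measure Q0 \<Gamma>) * of_real (exp (\<theta>\<^sup>2 * s / 2))) = of_real (measure Q0 \<Gamma>) * char (gauss_law 0 (t - s)) \<theta>"
  proof -
    have "char (gauss_law 0 (t - s)) \<theta> = of_real (exp (- (\<theta>\<^sup>2 * t / 2)) * exp (\<theta>\<^sup>2 * s / 2))"
      using st by (subst char_gauss_law) (auto simp: exp_of_real[symmetric] exp_add[symmetric] algebra_simps diff_divide_distrib)
    then show ?thesis by (simp add: mult_ac)
  qed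
  finally show ?thesis .
qed

text \<open>For \<Gamma> of positive probability, \<open>char_bm_increment\<close> computes the
  characteristic function of the increment conditioned on \<Gamma>. Since it does not depend on
  \<Gamma>, uniqueness of characteristic functions gives both the Gaussian law and
  independence.\<close>

lemma prob_bm_increment:
  assumes st: "0 \<le> s" "s < t" and \<Gamma>: "\<Gamma> \<in> sets (filt s)" and A: "A \<in> sets borel"
  shows "measure Q0 (\<Gamma> \<inter> ((\<lambda>w. bm t w - bm s w) -` A \<inter> path_space)) = measure Q0 \<Gamma> * measure (gauss_law 0 (t - s)) A"
proof (cases "measure Q0 \<Gamma> = 0")
  case True
  have "\<Gamma> \<in> sets Q0" using \<Gamma> subalgebra_Q0[of s] by (auto simp: subalgebra_def)
  then have "measure Q0 (\<Gamma> \<inter> ((\<lambda>w. bm t w - bm s w) -` A \<inter> path_space)) \<le> measure Q0 \<Gamma>"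
    by (intro Q0.finite_measure_mono) auto
  then show ?thesis using True measure_nonneg[of Q0 "\<Gamma> \<inter> ((\<lambda>w. bm t w - bm s w) -` A \<inter> path_space)"] by simp
next
  case False
  let ?D = "\<lambda>w. bm t w - bm s w" and ?p = "measure Q0 \<Gamma>"
  have p: "0 < ?p" using False by (simp add: zero_less_measure_iff)
  have \<Gamma>Q[measurable]: "\<Gamma> \<in> sets Q0" using \<Gamma> subalgebra_Q0[of s] by (auto simp: subalgebra_def)
  have [measurable]: "bm t \<in> borel_measurable Q0" "bm s \<in> borel_measurable Q0"
    using st by (auto intro!: measurable_Q0(2)[OF measurable_bm[OF _ order_refl]])
  let ?U = "uniform_measure Q0 \<Gamma>"
  have e: "emeasure Q0 \<Gamma> \<noteq> 0" "emeasure Q0 \<Gamma> \<noteq> \<infinity>" using p by (auto simp: Q0.emeasure_eq_measure)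
  interpret U: prob_space ?U by (rule prob_space_uniform_measure[OF e])
  have U: "?U = density Q0 (\<lambda>w. ennreal (indicator \<Gamma> w / ?p))"
    unfolding uniform_measure_def
    by (rule density_cong) (auto simp: Q0.emeasure_eq_measure divide_ennreal[OF _ p] ennreal_indicator[symmetric] split: split_indicator)
  have D[measurable]: "?D \<in> borel_measurable ?U" "?D \<in> borel_measurable Q0" by measurable
  have "distr ?U borel ?D = gauss_law 0 (t - s)"
  proof (rule Levy_uniqueness)
    show "real_distribution (distr ?U borel ?D)"
      by (intro real_distribution.intro real_distribution_axioms.intro U.prob_space_distr D) simp_all
    show "real_distribution (gauss_law 0 (t - s))"
      using st by (intro real_distribution.intro real_distribution_axioms.intro prob_space_gauss_law) simp_all
    show "char (distr ?U borel ?D) = char (gauss_law 0 (t - s))"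
    proof
      fix \<theta>
      have "char (distr ?U borel ?D) \<theta> = (LINT w|?U. iexp (\<theta> * ?D w))"
        unfolding char_def by (rule integral_distr) measurable
      also have "\<dots> = (LINT w|Q0. (indicator \<Gamma> w / ?p) *\<^sub>R iexp (\<theta> * ?D w))"
        unfolding U by (rule integral_density) (use p in \<open>auto intro!: AE_I2\<close>)
      also have "\<dots> = (LINT w|Q0. (indicator \<Gamma> w * iexp (\<theta> * ?D w)) * of_real (1 / ?p))"
        by (rule Bochner_Integration.integral_cong) (auto simp: scaleR_conv_of_real split: split_indicator)
      also have "\<dots> = char (gauss_law 0 (t - s)) \<theta>"
        unfolding integral_mult_left_zero char_bm_increment[OF st \<Gamma>] using p by simp
      finally show "char (distr ?U borel ?D) \<theta> = char (gauss_law 0 (t - s)) \<theta>" .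
    qed
  qed
  then have "measure (gauss_law 0 (t - s)) A = measure ?U (?D -` A \<inter> path_space)"
    using measure_distr[OF D(1) A] by simp
  also have "\<dots> = measure Q0 (\<Gamma> \<inter> (?D -` A \<inter> path_space)) / ?p"
    using measurable_sets[OF D(2) A] by (subst measure_uniform_measure[OF e]) auto
  finally show ?thesis using p by simp
qed

lemma AE_continuous_bm: "AE w in Q0. continuous_on {0..} (\<lambda>t. bm t w)"
  using AE_set_integrable_drift AE_space
proof eventually_elim
  case (elim w)
  have HK: "(\<lambda>u. drift_term l \<psi> u w) integrable_on {0..t}" "cum_drift 0 t w = integral {0..t} (\<lambda>u. drift_term l \<psi> u w)" if "0 \<le> t" for t
    using set_borel_integral_eq_integral[OF elim(1)[rule_format, OF that]] by (auto simp: cum_drift_def)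
  have "continuous_on {0..t} (\<lambda>t. bm t w)" if "0 \<le> t" for t
  proof -
    have "continuous_on {0..t} (\<lambda>v. coord v w)"
      by (rule continuous_on_subset[OF path_space_continuous]) (use elim(2) in auto)
    then have "continuous_on {0..t} (\<lambda>v. coord v w - x + l * integral {0..v} (\<lambda>u. drift_term l \<psi> u w))"
      by (intro continuous_intros indefinite_integral_continuous_1 HK that)
    then show ?thesis
      by (rule continuous_on_cong[THEN iffD1, rotated 2]) (auto simp: bm_def HK(2))
  qed
  then have c: "continuous (at v within {0..v + 1}) (\<lambda>t. bm t w)" if "0 \<le> v" for v
    using that by (auto simp: continuous_on_eq_continuous_within)
  show ?case
    unfolding continuous_on_eq_continuous_within
  proof
    fix v :: real assume "v \<in> {0..}"
    moreover have "at v within {0..} = at v within {0..v + 1}"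
      by (rule at_within_nhd[of _ "{..<v + 1}"]) auto
    ultimately show "continuous (at v within {0..}) (\<lambda>t. bm t w)" using c[of v] by simp
  qed
qed

lemma brownian_motion_bm: "brownian_motion Q0 bm 0"
  unfolding brownian_motion_def
proof (intro conjI allI impI)
  show "prob_space Q0" by (rule Q0.prob_space_axioms)
  show bm: "bm t \<in> borel_measurable Q0" if "0 \<le> t" for t
    by (rule measurable_Q0(2)[OF measurable_bm[OF that order_refl]])
  have "AE w in Q0. coord 0 w = x"
    unfolding Q0_def by (subst AE_density) (use gauss_incrementsD(4)[OF R] measurable_R(1)[OF measurable_total_sup] in auto)
  then show "AE w in Q0. bm 0 w = 0" by eventually_elim (simp add: bm_def)
  show "AE w in Q0. continuous_on {0..} (\<lambda>t. bm t w)" by (rule AE_continuous_bm)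
  have law: "measure Q0 ((\<lambda>w. bm t w - bm s w) -` A \<inter> path_space) = measure (gauss_law 0 (t - s)) A"
    if st: "0 \<le> s" "s < t" and A: "A \<in> sets borel" for s t A
    using prob_bm_increment[OF st _ A, of path_space] sets.top[of "filt s"] Q0.prob_space
    by (simp add: Int_absorb1[OF Int_lower2])
  show "distributed Q0 lborel (\<lambda>w. bm t w - bm s w) (\<lambda>y. ennreal (normal_density 0 (sqrt (t - s)) y))"
    if "0 \<le> s \<and> s < t" for s t
    unfolding distributed_def
  proof (intro conjI)
    have st: "0 \<le> s" "s < t" "0 \<le> t" using that by auto
    show D: "(\<lambda>w. bm t w - bm s w) \<in> measurable Q0 lborel" using bm[OF st(1)] bm[OF st(3)] by measurable
    interpret G: prob_space "gauss_law 0 (t - s)" by (rule prob_space_gauss_law) (use st in simp)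
    show "distr Q0 lborel (\<lambda>w. bm t w - bm s w) = density lborel (\<lambda>y. ennreal (normal_density 0 (sqrt (t - s)) y))"
      unfolding gauss_law_def[symmetric]
    proof (rule measure_eqI)
      fix A assume "A \<in> sets (distr Q0 lborel (\<lambda>w. bm t w - bm s w))"
      then have A: "A \<in> sets borel" by simp
      show "emeasure (distr Q0 lborel (\<lambda>w. bm t w - bm s w)) A = emeasure (gauss_law 0 (t - s)) A"
        using law[OF st(1,2) A] by (subst emeasure_distr[OF D]) (auto simp: A Q0.emeasure_eq_measure G.emeasure_eq_measure)
    qed simp
  qed measurable
  fix n and t :: "nat \<Rightarrow> real" assume t: "0 \<le> t 0 \<and> (\<forall>i<n. t i < t (Suc i))"
  have mono: "t i \<le> t j" if "i \<le> j" "j \<le> n" for i j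
    using that
  proof (induction j rule: dec_induct)
    case (step k)
    then have "t i \<le> t k" "t k < t (Suc k)" using t by auto
    then show ?case by simp
  qed simp
  have pos: "0 \<le> t i" if "i \<le> n" for i using mono[of 0 i] t that by auto
  show "Q0.indep_vars (\<lambda>_. borel) (\<lambda>i w. bm (t (Suc i)) w - bm (t i) w) {..<n}"
  proof (rule Q0.indep_vars_adapted[where N="\<lambda>i. filt (t i)"])
    show "(\<lambda>w. bm (t (Suc i)) w - bm (t i) w) \<in> borel_measurable Q0" if "i < n" for i
      using that by (intro borel_measurable_diff bm pos) auto
    show "(\<lambda>w. bm (t (Suc j)) w - bm (t j) w) \<in> borel_measurable (filt (t i))" if "j < i" "i < n" for i j
      using that by (intro borel_measurable_diff measurable_bm pos mono) auto
    fix i \<Gamma> and A :: "real set" assume i: "i < n" and \<Gamma>: "\<Gamma> \<in> sets (filt (t i))" and A: "A \<in> sets borel"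
    have st: "0 \<le> t i" "t i < t (Suc i)" using i pos t by auto
    show "measure Q0 (\<Gamma> \<inter> ((\<lambda>w. bm (t (Suc i)) w - bm (t i) w) -` A \<inter> space Q0))
      = measure Q0 \<Gamma> * measure Q0 ((\<lambda>w. bm (t (Suc i)) w - bm (t i) w) -` A \<inter> space Q0)"
      using prob_bm_increment[OF st \<Gamma> A] law[OF st A] by simp
  qed simp
qed

end

section \<open>Differentiability almost everywhere\<close>

lemma AE_lborel_negligible:
  fixes N :: "real set"
  assumes "negligible N" shows "AE y in lborel. y \<notin> N"
proof -
  obtain M where "M \<in> null_sets lborel" "N \<subseteq> M"
    using assms null_sets_completion_iff2[of N lborel] by (auto simp: negligible_iff_null_sets)
  then show ?thesis by (auto simp: eventually_ae_filter)
qed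

text \<open>The differentiation theorem applied here controls averages over intervals to the right
  of a point. Applying it also to the reflected function \<open>\<lambda>z. g (- z)\<close> controls
  those to the left.\<close>

lemma AE_DERIV_of_increments:
  fixes g F :: "real \<Rightarrow> real"
  assumes g: "\<And>a b. g integrable_on {a..b}" and F: "\<And>a b. a \<le> b \<Longrightarrow> F b - F a = integral {a..b} g"
  shows "AE y in lborel. (F has_real_derivative g y) (at y)"
proof -
  have right: "\<exists>N. negligible N \<and> (\<forall>y e. y \<notin> N \<longrightarrow> 0 < e \<longrightarrow> (\<exists>d>0. \<forall>h. 0 < h \<and> h < d \<longrightarrow> \<bar>integral {y..y + h} f / h - f y\<bar> < e))"
    if f: "\<And>a b. f integrable_on {a..b}" for f :: "real \<Rightarrow> real"
  proof -
    have f': "f integrable_on cbox a b" for a b using f by simp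
    from integrable_ccontinuous_explicit[OF f'] obtain N where N: "negligible N"
      "\<And>y e. y \<notin> N \<Longrightarrow> 0 < e \<Longrightarrow> \<exists>d>0. \<forall>h. 0 < h \<and> h < d \<longrightarrow> norm (integral (cbox y (y + h *\<^sub>R One)) f /\<^sub>R h ^ DIM(real) - f y) < e"
      by blast
    show ?thesis
      by (intro exI[of _ N] conjI N(1) allI impI) (use N(2) in \<open>simp add: divide_inverse mult.commute\<close>)
  qed
  have g': "(\<lambda>z. g (- z)) integrable_on {a..b}" for a b
    using g[of "- b" "- a"] Henstock_Kurzweil_Integration.integrable_reflect_real[where f=g and a="- b" and b="- a"] by simp
  obtain N where N: "negligible N" "\<And>y e. y \<notin> N \<Longrightarrow> 0 < e \<Longrightarrow> \<exists>d>0. \<forall>h. 0 < h \<and> h < d \<longrightarrow> \<bar>integral {y..y + h} g / h - g y\<bar> < e"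
    using right[OF g] by blast
  obtain N' where N': "negligible N'" "\<And>y e. y \<notin> N' \<Longrightarrow> 0 < e \<Longrightarrow> \<exists>d>0. \<forall>h. 0 < h \<and> h < d \<longrightarrow> \<bar>integral {y..y + h} (\<lambda>z. g (- z)) / h - g (- y)\<bar> < e"
    using right[OF g'] by blast
  \<comment> \<open>Reflection preserves Lebesgue measure, so the exceptional set of the reflected
    function pulls back to a null set.\<close>
  have "AE y in distr lborel borel uminus. y \<notin> N'"
    unfolding lborel_distr_uminus by (rule AE_lborel_negligible[OF N'(1)])
  then have "AE y in lborel. - y \<notin> N'" by (rule AE_distrD[rotated]) simp
  with AE_lborel_negligible[OF N(1)] show ?thesis
  proof eventually_elim
    case (elim y)
    show ?case
      unfolding DERIV_def LIM_def
    proof (intro allI impI)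
      fix e :: real assume "0 < e"
      obtain d where d: "0 < d" "\<And>h. 0 < h \<Longrightarrow> h < d \<Longrightarrow> \<bar>integral {y..y + h} g / h - g y\<bar> < e"
        using N(2)[OF elim(1) \<open>0 < e\<close>] by blast
      obtain d' where d': "0 < d'" "\<And>h. 0 < h \<Longrightarrow> h < d' \<Longrightarrow> \<bar>integral {- y..- y + h} (\<lambda>z. g (- z)) / h - g y\<bar> < e"
        using N'(2)[OF elim(2) \<open>0 < e\<close>] by auto
      show "\<exists>s>0. \<forall>h::real. h \<noteq> 0 \<and> dist h 0 < s \<longrightarrow> dist ((F (y + h) - F y) / h) (g y) < e"
      proof (intro exI[of _ "min d d'"] conjI allI impI)
        show "0 < min d d'" using d d' by simp
        fix h :: real assume h: "h \<noteq> 0 \<and> dist h 0 < min d d'"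
        show "dist ((F (y + h) - F y) / h) (g y) < e"
        proof (cases "0 < h")
          case True
          then show ?thesis using d(2)[of h] h F[of y "y + h"] by (simp add: dist_real_def)
        next
          case False
          then have "h < 0" using h by simp
          then have "y + h \<le> y" by simp
          have "integral {- y..- y + - h} (\<lambda>z. g (- z)) = integral {y + h..y} g"
            using Henstock_Kurzweil_Integration.integral_reflect_real[where f=g and a="y + h" and b=y] by simp
          moreover have "(F (y + h) - F y) / h = integral {y + h..y} g / - h"
            unfolding F[OF \<open>y + h \<le> y\<close>, symmetric] by (rule minus_divide_divide[symmetric, of "F (y + h) - F y" h, simplified minus_diff_eq])
          ultimately show ?thesis using d'(2)[of "- h"] h \<open>h < 0\<close> by (simp only: dist_real_def) simp
        qed
      qed
    qed
  qed
qed

context weighted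
begin

text \<open>As \<psi> may be discontinuous, the fundamental theorem of calculus for its tail
  integral \<open>J\<close> holds almost everywhere only; the exponential factor then contributes
  through the product rule.\<close>

lemma AE_DERIV_Phi: "AE y in lborel. (Phi l \<psi> has_real_derivative phi l \<psi> y) (at y)"
proof -
  let ?g = "\<lambda>z. \<psi> z * exp (- l * z)"
  have si: "set_integrable lborel {a..b} ?g" for a b
    by (rule set_integrable_subset[OF \<psi>_int]) auto
  have g: "?g integrable_on {a..b}" for a b by (rule set_borel_integral_eq_integral(1)[OF si])
  have J: "J b - J a = - integral {a..b} ?g" if "a \<le> b" for a b
  proof -
    have "{a..} = {a..<b} \<union> {b..}" using that by auto
    moreover have siab: "set_integrable lborel {a..<b} ?g"
      by (rule set_integrable_subset[OF si[of a b]]) auto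
    ultimately have "J a = (LINT z:{a..<b}|lborel. ?g z) + J b"
      unfolding J_def
      by (simp only:) (rule set_integral_Un[OF _ siab \<psi>_int], auto)
    also have "(LINT z:{a..<b}|lborel. ?g z) = (LINT z:{a..b}|lborel. ?g z)"
      unfolding set_lebesgue_integral_def
      by (rule integral_cong_AE) (use AE_lborel_singleton[of b] in \<open>auto split: split_indicator\<close>)
    also have "\<dots> = integral {a..b} ?g" by (rule set_borel_integral_eq_integral(2)[OF si])
    finally show ?thesis by simp
  qed
  have "AE y in lborel. (J has_real_derivative - ?g y) (at y)"
    by (rule AE_DERIV_of_increments) (use g J integrable_neg[OF g] in auto)
  then show ?thesis
  proof eventually_elim
    case (elim y)
    have "((\<lambda>y. 1 - exp (l * y) * J y) has_real_derivative - (l * exp (l * y) * J y + exp (l * y) * - ?g y)) (at y)"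
      using elim by (auto intro!: derivative_eq_intros)
    also have "- (l * exp (l * y) * J y + exp (l * y) * - ?g y) = phi l \<psi> y"
      by (simp add: phi_eq one_minus_Phi exp_minus)
    also have "(\<lambda>y. 1 - exp (l * y) * J y) = Phi l \<psi>"
      by (rule ext) (simp flip: one_minus_Phi)
    finally show ?case .
  qed
qed

end

section \<open>The penalisation limit\<close>

lemma integrable_nonnegI:
  assumes "f \<in> borel_measurable M" "AE w in M. 0 \<le> f w" "(\<integral>\<^sup>+w. ennreal (f w) \<partial>M) \<le> ennreal c" "0 \<le> c"
  shows "integrable M f" "(LINT w|M. f w) \<le> (c :: real)"
proof -
  show "integrable M f" by (rule integrableI_nonneg[OF assms(1,2)]) (use assms(3) in \<open>auto intro: le_less_trans\<close>)
  show "(LINT w|M. f w) \<le> c"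
    unfolding integral_eq_nn_integral[OF assms(1,2)] using enn2real_mono[OF assms(3)] assms(4) by simp
qed

text \<open>A cylinder involves finitely many times and so belongs to \<open>filt b\<close> with
  \<open>b\<close> their maximum; agreement on all finite horizons therefore covers a generator of
  \<open>filt_inf\<close>.\<close>

lemma prob_eqI_filt:
  assumes M: "prob_space M" "sets M = sets filt_inf" and N: "prob_space N" "sets N = sets filt_inf"
    and eq: "\<And>u \<Gamma>. 0 \<le> u \<Longrightarrow> \<Gamma> \<in> sets (filt u) \<Longrightarrow> measure M \<Gamma> = measure N \<Gamma>"
  shows "M = N"
proof (rule measure_eqI_generator_eq[where E="cylinders {0..}" and \<Omega>=path_space and A="\<lambda>_. path_space"])
  interpret M: prob_space M by fact
  interpret N: prob_space N by fact
  show "Int_stable (cylinders {0..})" "cylinders {0..} \<subseteq> Pow path_space"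
    by (rule Int_stable_cylinders cylinders_Pow)+
  show "sets M = sigma_sets path_space (cylinders {0..})" "sets N = sigma_sets path_space (cylinders {0..})"
    unfolding sigma_sets_cylinders M(2) N(2) by (simp_all add: filt_inf_def)
  have "{w\<in>path_space. \<forall>r\<in>{}. coord r w \<in> UNIV} \<in> cylinders {0..}"
    unfolding cylinders_def by blast
  then show "range (\<lambda>_. path_space) \<subseteq> cylinders {0..}" by simp
  show "(\<Union>i::nat. path_space) = path_space" by simp
  show "emeasure M path_space \<noteq> \<infinity>" by simp
  fix C assume "C \<in> cylinders {0..}"
  then obtain K A where C: "C = {w\<in>path_space. \<forall>r\<in>K. coord r w \<in> A r}" "finite K" "K \<subseteq> {0..}" "\<And>r. r \<in> K \<Longrightarrow> A r \<in> sets borel"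
    unfolding cylinders_def by blast
  define b where "b = Max (insert 0 K)"
  have b: "0 \<le> b" "K \<subseteq> {0..b}" using C(2,3) by (auto simp: b_def)
  have "C \<in> sets (filt b)" unfolding C(1) by (rule cylinder_in_filt[OF C(2) b(2) C(4)])
  then show "emeasure M C = emeasure N C"
    using eq[OF b(1)] by (simp add: M.emeasure_eq_measure N.emeasure_eq_measure)
qed

context weighted
begin

lemma Mproc_eq: "Mproc l \<psi> u w = mart u w * tilt_density (- l) x u w / (2 * l * exp (l * x))"
  using l mart_Mproc[of u w] by (simp add: field_simps)

lemma measure_Q0:
  assumes u: "0 \<le> u" and \<Gamma>: "\<Gamma> \<in> sets (filt u)"
  shows "measure Q0 \<Gamma> = 1 / (1 - Phi l \<psi> x) * (LINT w|P. indicator \<Gamma> w * Mproc l \<psi> u w)"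
proof -
  let ?c = "1 / (1 - Phi l \<psi> x)"
  have [measurable]: "mart u \<in> borel_measurable (filt u)" "tilt_density (- l) x u \<in> borel_measurable (filt u)"
    using measurable_mart[OF u order_refl] measurable_tilt_density[OF u order_refl] by auto
  note \<Gamma>[measurable]
  have Mm[measurable]: "Mproc l \<psi> u \<in> borel_measurable (filt u)"
    unfolding Mproc_eq by measurable
  have id: "mart u w / Z * tilt_density (- l) x u w = ?c * Mproc l \<psi> u w" for w
    unfolding Mproc_eq Z_def by simp
  have nn: "0 \<le> ?c * (indicator \<Gamma> w * Mproc l \<psi> u w)" if "w \<in> path_space" for w
    using mart_pos[OF that u] l one_minus_Phi_pos[of x]
    unfolding Mproc_eq by (intro mult_nonneg_nonneg divide_nonneg_pos) (auto simp: tilt_density_def)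
  have "(LINT w|P. ?c * (indicator \<Gamma> w * Mproc l \<psi> u w)) = enn2real (\<integral>\<^sup>+w. ennreal (?c * (indicator \<Gamma> w * Mproc l \<psi> u w)) \<partial>P)"
    by (rule integral_eq_nn_integral) (use nn in \<open>auto intro!: AE_I2 measurable_P(2)[of _ u]\<close>)
  also have "(\<integral>\<^sup>+w. ennreal (?c * (indicator \<Gamma> w * Mproc l \<psi> u w)) \<partial>P)
     = (\<integral>\<^sup>+w. (indicator \<Gamma> w * ennreal (mart u w / Z)) * ennreal (tilt_density (- l) x u w) \<partial>P)"
  proof (rule nn_integral_cong)
    fix w assume "w \<in> space P"
    then have "0 \<le> mart u w / Z" using mart_pos[OF _ u, of w] Z_pos by simp
    then have "ennreal (mart u w / Z * tilt_density (- l) x u w) = ennreal (mart u w / Z) * ennreal (tilt_density (- l) x u w)"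
      by (rule ennreal_mult) (simp add: tilt_density_def)
    then have eq: "ennreal (mart u w / Z) * ennreal (tilt_density (- l) x u w) = ennreal (?c * Mproc l \<psi> u w)"
      unfolding id ..
    show "ennreal (?c * (indicator \<Gamma> w * Mproc l \<psi> u w)) = (indicator \<Gamma> w * ennreal (mart u w / Z)) * ennreal (tilt_density (- l) x u w)"
      by (cases "w \<in> \<Gamma>") (simp_all only: indicator_simps not_False_eq_True mult_1 mult_zero_left mult_zero_right ennreal_0 eq)
  qed
  also have "\<dots> = (\<integral>\<^sup>+w. indicator \<Gamma> w * ennreal (mart u w / Z) \<partial>R)"
    by (rule nn_integral_drift_law[OF P u, symmetric]) measurable
  also have "enn2real \<dots> = measure Q0 \<Gamma>" unfolding emeasure_Q0[OF u \<Gamma>, symmetric] by (simp add: measure_def)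
  finally show ?thesis by simp
qed

lemma Q0_eq: "Q0 = density R (\<lambda>w. ennreal (exp (- l * x) / (1 - Phi l \<psi> x)
                      * (exp (l * total_sup w) * \<psi> (total_sup w) / (2 * l))))"
proof -
  have "a * b / (2 * l * e * D) = inverse e / D * (b * a / (2 * l))" for a b e D :: real by (simp only: divide_inverse inverse_mult_distrib mult_ac)
  then have "h (total_sup w) / Z = exp (- l * x) / (1 - Phi l \<psi> x) * (exp (l * total_sup w) * \<psi> (total_sup w) / (2 * l))" for w
    unfolding h_def Z_def mult_minus_left exp_minus .
  then show ?thesis unfolding Q0_def by simp
qed

section \<open>The error of using the running in place of the total supremum\<close>

lemma J_vanishes:
  assumes "0 < \<epsilon>" obtains A where "J A < \<epsilon>"
proof -
  let ?g = "\<lambda>z. \<psi> z * exp (- l * z)"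
  have "(\<lambda>n. LINT z|lborel. indicator {real n..} z *\<^sub>R ?g z) \<longlonglongrightarrow> (LINT z|(lborel :: real measure). 0)"
  proof (rule integral_dominated_convergence)
    show "integrable lborel (\<lambda>z. indicator {0..} z *\<^sub>R ?g z)"
      using \<psi>_int[of 0] by (simp only: set_integrable_def)
    show "AE z in lborel. (\<lambda>n. indicator {real n..} z *\<^sub>R ?g z) \<longlonglongrightarrow> 0"
    proof (rule AE_I2)
      fix z :: real
      obtain m :: nat where "z < real m" using reals_Archimedean2 by blast
      then have "\<forall>\<^sub>F n in sequentially. indicator {real n..} z *\<^sub>R ?g z = 0"
        by (intro eventually_mono[OF eventually_ge_at_top[of m]]) (auto split: split_indicator)
      then show "(\<lambda>n. indicator {real n..} z *\<^sub>R ?g z) \<longlonglongrightarrow> 0" by (rule tendsto_eventually)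
    qed
    show "AE z in lborel. norm (indicator {real n..} z *\<^sub>R ?g z) \<le> indicator {0..} z *\<^sub>R ?g z" for n
      by (rule AE_I2) (use \<psi>_pos in \<open>auto simp: less_imp_le abs_mult split: split_indicator\<close>)
  qed measurable
  then have "(\<lambda>n. J (real n)) \<longlonglongrightarrow> 0" by (simp add: J_def[abs_def] set_lebesgue_integral_def)
  from order_tendstoD(2)[OF this assms] obtain n where "J (real n) < \<epsilon>"
    by (auto simp: eventually_sequentially)
  then show ?thesis by (rule that)
qed

text \<open>Split at an auxiliary level \<open>A\<close>: above it \<open>J\<close> is at most
  \<open>J A\<close>, and below it the endpoint is at most \<open>A\<close>, where
  \<open>exp (l * (A - coord t w))\<close> is at least 1 and has an exponentially small mean under
  \<open>Rp\<close>.\<close>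

lemma nn_integral_J_Rp:
  assumes t: "0 \<le> t"
  shows "(\<integral>\<^sup>+w. ennreal (J (run_sup t w)) \<partial>Rp) \<le> ennreal (J A + J x * exp (l * (A - x)) * exp (- l\<^sup>2 * t / 2))"
proof -
  let ?c = "J x * exp (l * (A - x))"
  have c: "0 \<le> ?c" using J_pos[of x] by simp
  have [measurable]: "coord t \<in> borel_measurable Rp" by (rule measurable_Rp(2)[OF measurable_coord_filt[OF t order_refl]])
  have "(\<integral>\<^sup>+w. ennreal (J (run_sup t w)) \<partial>Rp) \<le> (\<integral>\<^sup>+w. ennreal (J A) + ennreal ?c * ennreal (exp (- l * (coord t w - x))) \<partial>Rp)"
  proof (rule nn_integral_mono_AE)
    show "AE w in Rp. ennreal (J (run_sup t w)) \<le> ennreal (J A) + ennreal ?c * ennreal (exp (- l * (coord t w - x)))"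
      using gauss_incrementsD(4)[OF Rp] AE_space
    proof eventually_elim
      case (elim w)
      then have w: "w \<in> path_space" by simp
      have "J (run_sup t w) \<le> J A + ?c * exp (- l * (coord t w - x))"
      proof (cases "A \<le> run_sup t w")
        case True
        then have "J (run_sup t w) \<le> J A" by (rule J_antimono)
        moreover have "0 \<le> ?c * exp (- l * (coord t w - x))" using c by simp
        ultimately show ?thesis by linarith
      next
        case False
        then have "coord t w \<le> A" using coord_le_run_sup[OF w t order_refl] by simp
        then have "1 \<le> exp (l * (A - coord t w))" using l by simp
        also have "exp (l * (A - coord t w)) = exp (l * (A - x)) * exp (- l * (coord t w - x))"
          by (simp add: exp_add[symmetric] algebra_simps)
        finally have "J x * 1 \<le> J x * (exp (l * (A - x)) * exp (- l * (coord t w - x)))"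
          using J_pos[of x] by (intro mult_left_mono) auto
        moreover have "J (run_sup t w) \<le> J x"
          using run_sup_mono[OF w order_refl t] elim(1) by (intro J_antimono) (simp add: run_sup_0)
        ultimately show ?thesis using J_pos[of A] by (simp add: mult.assoc)
      qed
      then have "ennreal (J (run_sup t w)) \<le> ennreal (J A + ?c * exp (- l * (coord t w - x)))"
        by (rule ennreal_leI)
      also have "\<dots> = ennreal (J A) + ennreal (?c * exp (- l * (coord t w - x)))"
        by (rule ennreal_plus) (use J_pos[of A] c in auto)
      also have "ennreal (?c * exp (- l * (coord t w - x))) = ennreal ?c * ennreal (exp (- l * (coord t w - x)))"
        by (rule ennreal_mult) (use c in auto)
      finally show ?case .
    qed
  qed
  also have "\<dots> = ennreal (J A) + ennreal ?c * ennreal (exp (- l\<^sup>2 * t / 2))"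
    by (simp only: nn_integral_exp_Rp[OF t, symmetric], subst nn_integral_add, measurable)
       (simp add: nn_integral_cmult Rp.emeasure_space_1[simplified])
  also have "\<dots> = ennreal (J A + ?c * exp (- l\<^sup>2 * t / 2))"
    using J_pos[of A] c by (simp only: ennreal_mult[symmetric] exp_ge_zero, subst ennreal_plus[symmetric]) auto
  finally show ?thesis .
qed

text \<open>The part of \<open>mart t\<close> due to a future increase of the supremum. Its
  exponential factor is, up to a constant, the density of \<open>Rp\<close> with respect to
  \<open>R\<close>, so its mean is a multiple of that of \<open>J (run_sup t w)\<close> under
  \<open>Rp\<close>.\<close>

definition tail_term :: "real \<Rightarrow> (real \<Rightarrow> real) \<Rightarrow> real" where
  "tail_term t w = 2 * l * exp (2 * l * coord t w) * J (run_sup t w)"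

text \<open>The present weight times the conditional probability that the supremum will still
  increase; it is what \<open>h (run_sup t w)\<close> has in excess of the atomic part of
  \<open>mart t\<close>.\<close>

definition boundary_term :: "real \<Rightarrow> (real \<Rightarrow> real) \<Rightarrow> real" where
  "boundary_term t w = h (run_sup t w) * exp (- 2 * l * (run_sup t w - coord t w))"

lemma h_run_sup_eq: "h (run_sup t w) = mart t w + boundary_term t w - tail_term t w"
  by (simp add: mart_def boundary_term_def tail_term_def algebra_simps)

lemma terms_nonneg: "0 \<le> tail_term t w" "0 \<le> boundary_term t w"
  using l J_pos[of "run_sup t w"] h_pos[of "run_sup t w"] by (auto simp: tail_term_def boundary_term_def)

lemma
  assumes t: "0 \<le> t"
  shows measurable_tail_term: "tail_term t \<in> borel_measurable R"
    and measurable_boundary_term: "boundary_term t \<in> borel_measurable R"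
proof -
  have [measurable]: "run_sup t \<in> borel_measurable R" "coord t \<in> borel_measurable R"
    using measurable_R(2)[OF measurable_run_sup[OF t order_refl]] measurable_R(2)[OF measurable_coord_filt[OF t order_refl]] by auto
  show "tail_term t \<in> borel_measurable R" "boundary_term t \<in> borel_measurable R"
    unfolding tail_term_def boundary_term_def by measurable
qed

lemma tail_term_bound:
  assumes t: "0 \<le> t"
  shows "integrable R (tail_term t)"
    and "(LINT w|R. tail_term t w) \<le> 2 * l * exp (2 * l * x) * (J A + J x * exp (l * (A - x)) * exp (- l\<^sup>2 * t / 2))"
proof -
  let ?K = "2 * l * exp (2 * l * x)" and ?b = "\<lambda>A. J A + J x * exp (l * (A - x)) * exp (- l\<^sup>2 * t / 2)"
  have [measurable]: "run_sup t \<in> borel_measurable (filt t)" by (rule measurable_run_sup[OF t order_refl])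
  have Jm: "(\<lambda>w. ennreal (J (run_sup t w))) \<in> borel_measurable (filt t)" by measurable
  have K: "0 \<le> ?K" using l by simp
  have b: "0 \<le> ?b A" for A using J_pos[of A] J_pos[of x] by simp
  have [measurable]: "tail_term t \<in> borel_measurable R" "run_sup t \<in> borel_measurable R" "coord t \<in> borel_measurable R"
    using measurable_tail_term[OF t] measurable_R(2)[OF measurable_run_sup[OF t order_refl]] measurable_R(2)[OF measurable_coord_filt[OF t order_refl]] by auto
  have "(\<integral>\<^sup>+w. ennreal (tail_term t w) \<partial>R)
     = (\<integral>\<^sup>+w. ennreal ?K * (ennreal (exp (2 * l * (coord t w - x))) * ennreal (J (run_sup t w))) \<partial>R)"
  proof (rule nn_integral_cong)
    fix w
    have "tail_term t w = ?K * (exp (2 * l * (coord t w - x)) * J (run_sup t w))"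
      unfolding tail_term_def by (simp add: right_diff_distrib exp_diff)
    then show "ennreal (tail_term t w) = ennreal ?K * (ennreal (exp (2 * l * (coord t w - x))) * ennreal (J (run_sup t w)))"
      using K J_pos[of "run_sup t w"] by (simp only: ennreal_mult[symmetric] exp_ge_zero less_imp_le mult_nonneg_nonneg)
  qed
  also have "\<dots> = ennreal ?K * (\<integral>\<^sup>+w. ennreal (J (run_sup t w)) \<partial>Rp)"
    by (subst nn_integral_cmult, measurable) (simp only: nn_integral_R_Rp[OF t Jm])
  finally have "(\<integral>\<^sup>+w. ennreal (tail_term t w) \<partial>R) \<le> ennreal (?K * ?b A)" for A
    using mult_left_mono[OF nn_integral_J_Rp[OF t, of A], of "ennreal ?K"] K b[of A] by (simp only: ennreal_mult[symmetric] zero_le)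
  from integrable_nonnegI[OF measurable_tail_term[OF t] AE_I2[OF terms_nonneg(1)] this mult_nonneg_nonneg[OF K b]]
  show "integrable R (tail_term t)" "(LINT w|R. tail_term t w) \<le> ?K * ?b A" by blast+
qed

lemma boundary_term_bound:
  assumes t: "0 < t"
  shows "integrable R (boundary_term t)"
    and "(LINT w|R. boundary_term t w) \<le> 2 / sqrt (2 * pi * t) * (exp (2 * l * x) * J x)"
proof -
  have b: "0 \<le> 2 / sqrt (2 * pi * t) * (exp (2 * l * x) * J x)" using t J_pos[of x] by simp
  from integrable_nonnegI[OF measurable_boundary_term[OF less_imp_le[OF t]] AE_I2[OF terms_nonneg(2)]
      nn_integral_h_boundary[OF t, folded boundary_term_def] b]
  show "integrable R (boundary_term t)"
    "(LINT w|R. boundary_term t w) \<le> 2 / sqrt (2 * pi * t) * (exp (2 * l * x) * J x)" by blast+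
qed

lemma tail_term_tendsto: "((\<lambda>t. LINT w|R. tail_term t w) \<longlongrightarrow> 0) at_top"
proof (rule tendstoI)
  fix e :: real assume e: "0 < e"
  let ?K = "2 * l * exp (2 * l * x)"
  have K: "0 < ?K" using l by simp
  \<comment> \<open>The level is fixed before the time: \<open>J A\<close> absorbs the part that
    does not decay in \<open>t\<close>, and the remainder decays exponentially.\<close>
  obtain A where A: "J A < e / ?K" using J_vanishes[of "e / ?K"] e K by auto
  have "((\<lambda>t. exp (- (l\<^sup>2 / 2) * t)) \<longlongrightarrow> 0) at_top" if "0 < l\<^sup>2 / 2"
    using that by real_asymp
  then have "((\<lambda>t. exp (- l\<^sup>2 * t / 2)) \<longlongrightarrow> 0) at_top" using l by (simp add: field_simps)
  then have "((\<lambda>t. ?K * (J A + J x * exp (l * (A - x)) * exp (- l\<^sup>2 * t / 2))) \<longlongrightarrow> ?K * (J A + J x * exp (l * (A - x)) * 0)) at_top"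
    by (intro tendsto_intros)
  then have "\<forall>\<^sub>F t in at_top. ?K * (J A + J x * exp (l * (A - x)) * exp (- l\<^sup>2 * t / 2)) < e"
    by (rule order_tendstoD(2)) (use A K in \<open>simp add: field_simps\<close>)
  with eventually_ge_at_top[of 0] show "\<forall>\<^sub>F t in at_top. dist (LINT w|R. tail_term t w) 0 < e"
  proof eventually_elim
    case (elim t)
    have "0 \<le> (LINT w|R. tail_term t w)" by (rule Bochner_Integration.integral_nonneg) (rule terms_nonneg)
    then show ?case using tail_term_bound(2)[OF elim(1), of A] elim(2) by (simp add: dist_real_def)
  qed
qed

lemma boundary_term_tendsto: "((\<lambda>t. LINT w|R. boundary_term t w) \<longlongrightarrow> 0) at_top"
proof (rule tendsto_sandwich[OF _ _ tendsto_const])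
  show "\<forall>\<^sub>F t in at_top. 0 \<le> (LINT w|R. boundary_term t w)"
    by (intro always_eventually allI Bochner_Integration.integral_nonneg terms_nonneg)
  show "\<forall>\<^sub>F t in at_top. (LINT w|R. boundary_term t w) \<le> 2 / sqrt (2 * pi * t) * (exp (2 * l * x) * J x)"
    using eventually_gt_at_top[of 0] by eventually_elim (rule boundary_term_bound(2))
  have "((\<lambda>t. 2 / sqrt (2 * pi * t)) \<longlongrightarrow> 0) at_top" by real_asymp
  then show "((\<lambda>t. 2 / sqrt (2 * pi * t) * (exp (2 * l * x) * J x)) \<longlongrightarrow> 0) at_top" by (rule tendsto_mult_left_zero)
qed

text \<open>In the decomposition \<open>h_run_sup_eq\<close> the \<open>mart\<close> part integrates
  over \<Gamma> to exactly \<open>Z * measure Q0 \<Gamma>\<close> for every \<open>t\<close> beyond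
  \<open>u\<close>. The other two terms are nonnegative, so their integrals over \<Gamma> are
  bounded by the full ones, which vanish in the limit.\<close>

lemma integral_h_run_sup_tendsto:
  assumes u: "0 \<le> u" and \<Gamma>: "\<Gamma> \<in> sets (filt u)"
  shows "((\<lambda>t. LINT w|R. indicator \<Gamma> w * h (run_sup t w)) \<longlongrightarrow> Z * measure Q0 \<Gamma>) at_top"
proof (rule Lim_transform_bound[where g="\<lambda>t. (LINT w|R. boundary_term t w) + (LINT w|R. tail_term t w)", THEN Lim_null[THEN iffD2]])
  show "((\<lambda>t. (LINT w|R. boundary_term t w) + (LINT w|R. tail_term t w)) \<longlongrightarrow> 0) at_top"
    using tendsto_add[OF boundary_term_tendsto tail_term_tendsto] by simp
  show "\<forall>\<^sub>F t in at_top. norm ((LINT w|R. indicator \<Gamma> w * h (run_sup t w)) - Z * measure Q0 \<Gamma>)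
     \<le> norm ((LINT w|R. boundary_term t w) + (LINT w|R. tail_term t w))"
    using eventually_ge_at_top[of u] eventually_gt_at_top[of 0]
  proof eventually_elim
    case (elim t)
    then have t0: "0 \<le> t" and \<Gamma>t: "\<Gamma> \<in> sets (filt t)" using u \<Gamma> sets_filt_mono[of u t] by auto
    have \<Gamma>R[measurable]: "\<Gamma> \<in> sets R" using \<Gamma> gauss_incrementsD(5)[OF R, of u] by auto
    have mi: "integrable R (mart t)"
      by (rule integrable_nonnegI[OF measurable_R(2)[OF measurable_mart[OF t0 order_refl]]])
         (use nn_integral_mart[OF t0] Z_pos mart_pos[OF _ t0] in \<open>auto intro!: AE_I2 simp: less_imp_le\<close>)
    have ii: "integrable R (\<lambda>w. indicator \<Gamma> w * f w)" if "integrable R f" for f :: "(real \<Rightarrow> real) \<Rightarrow> real"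
      by (rule integrable_real_mult_indicator[OF \<Gamma>R that, unfolded mult.commute[of _ "indicator \<Gamma> _"]])
    note i = ii[OF mi] ii[OF boundary_term_bound(1)[OF elim(2)]] ii[OF tail_term_bound(1)[OF t0]]
    have \<Gamma>Q: "\<Gamma> \<in> sets Q0" using \<Gamma> subalgebra_Q0[of u] by (auto simp: subalgebra_def)
    have "measure Q0 \<Gamma> = (LINT w|Q0. indicator \<Gamma> w)"
      using sets.Int_space_eq2[OF \<Gamma>Q] by simp
    also have "\<dots> = (LINT w|R. (mart t w / Z) *\<^sub>R indicator \<Gamma> w)"
      by (rule integral_Q0[OF t0]) (use \<Gamma>t in measurable)
    also have "\<dots> = (LINT w|R. indicator \<Gamma> w * mart t w * (1 / Z))"
      by (rule Bochner_Integration.integral_cong) auto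
    finally have m: "(LINT w|R. indicator \<Gamma> w * mart t w) = Z * measure Q0 \<Gamma>"
      unfolding integral_mult_left_zero using Z_pos by simp
    have "(LINT w|R. indicator \<Gamma> w * h (run_sup t w)) =
        (LINT w|R. indicator \<Gamma> w * mart t w + indicator \<Gamma> w * boundary_term t w - indicator \<Gamma> w * tail_term t w)"
      unfolding h_run_sup_eq by (simp add: algebra_simps)
    also have "\<dots> = Z * measure Q0 \<Gamma> + (LINT w|R. indicator \<Gamma> w * boundary_term t w) - (LINT w|R. indicator \<Gamma> w * tail_term t w)"
      unfolding m[symmetric] using i
      by (simp add: Bochner_Integration.integral_add Bochner_Integration.integral_diff)
    finally have eq: "(LINT w|R. indicator \<Gamma> w * h (run_sup t w)) - Z * measure Q0 \<Gamma> =
       (LINT w|R. indicator \<Gamma> w * boundary_term t w) - (LINT w|R. indicator \<Gamma> w * tail_term t w)" by simp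
    have le: "0 \<le> (LINT w|R. indicator \<Gamma> w * f w)" "(LINT w|R. indicator \<Gamma> w * f w) \<le> (LINT w|R. f w)"
      if "integrable R f" "\<And>w. 0 \<le> f w" for f :: "(real \<Rightarrow> real) \<Rightarrow> real"
      by (rule Bochner_Integration.integral_nonneg integral_mono[OF ii[OF that(1)] that(1)]; use that(2) in \<open>simp split: split_indicator\<close>)+
    show ?case
      unfolding eq using le[OF boundary_term_bound(1)[OF elim(2)] terms_nonneg(2)] le[OF tail_term_bound(1)[OF t0] terms_nonneg(1)]
      by simp
  qed
qed

text \<open>The weight equals \<open>h (run_sup t w)\<close> times the density of \<open>R\<close>
  with respect to \<open>P\<close>, up to the factor \<open>exp (l\<^sup>2 * t / 2 - l * x)\<close>.
  This factor does not depend on \<Gamma> and cancels in the quotient.\<close>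

lemma integral_weight_P:
  assumes t: "0 \<le> t" and \<Gamma>: "\<Gamma> \<in> sets (filt t)"
  shows "(LINT w|P. indicator \<Gamma> w * (\<psi> (run_sup t w) * exp (l * (run_sup t w - coord t w))))
     = exp (l\<^sup>2 * t / 2 - l * x) * (LINT w|R. indicator \<Gamma> w * h (run_sup t w))"
proof -
  let ?c = "exp (l\<^sup>2 * t / 2 - l * x)" and ?f = "\<lambda>w. indicator \<Gamma> w * h (run_sup t w)"
  note \<Gamma>[measurable]
  have [measurable]: "run_sup t \<in> borel_measurable (filt t)" "tilt_density (- l) x t \<in> borel_measurable (filt t)"
    using measurable_run_sup[OF t order_refl] measurable_tilt_density[OF t order_refl] by auto
  have fm: "(\<lambda>w. ?f w * tilt_density (- l) x t w) \<in> borel_measurable (filt t)" by measurable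
  have f0: "0 \<le> ?f w" for w using h_pos[of "run_sup t w"] by simp
  have "(LINT w|R. ?f w) = enn2real (\<integral>\<^sup>+w. ennreal (?f w) \<partial>R)"
    by (rule integral_eq_nn_integral) (auto intro!: measurable_R(2)[of _ t] AE_I2 f0)
  also have "(\<integral>\<^sup>+w. ennreal (?f w) \<partial>R) = (\<integral>\<^sup>+w. ennreal (?f w) * ennreal (tilt_density (- l) x t w) \<partial>P)"
    by (rule nn_integral_drift_law[OF P t]) measurable
  also have "\<dots> = (\<integral>\<^sup>+w. ennreal (?f w * tilt_density (- l) x t w) \<partial>P)"
    by (rule nn_integral_cong, rule ennreal_mult[symmetric]) (auto simp: f0 tilt_density_def)
  also have "enn2real \<dots> = (LINT w|P. ?f w * tilt_density (- l) x t w)"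
    by (rule integral_eq_nn_integral[OF measurable_P(2)[OF fm], symmetric])
       (auto intro!: AE_I2 mult_nonneg_nonneg f0 simp: tilt_density_def[of "- l" x t])
  finally have "?c * (LINT w|R. ?f w) = (LINT w|P. ?c * (?f w * tilt_density (- l) x t w))"
    by (simp only: integral_mult_right_zero)
  also have "\<dots> = (LINT w|P. indicator \<Gamma> w * (\<psi> (run_sup t w) * exp (l * (run_sup t w - coord t w))))"
  proof (rule Bochner_Integration.integral_cong[OF refl])
    fix w
    have "?c * exp (l * run_sup t w) * tilt_density (- l) x t w = exp (l * (run_sup t w - coord t w))"
      unfolding tilt_density_def exp_add[symmetric] by (simp add: algebra_simps)
    then show "?c * (?f w * tilt_density (- l) x t w) = indicator \<Gamma> w * (\<psi> (run_sup t w) * exp (l * (run_sup t w - coord t w)))"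
      unfolding h_def by (metis (no_types, opaque_lifting) mult.assoc mult.left_commute)
  qed
  finally show ?thesis by simp
qed

lemma penalised_limit:
  assumes u: "0 \<le> u" and \<Gamma>: "\<Gamma> \<in> sets (filt u)"
  shows "((\<lambda>t. (LINT w|P. indicator \<Gamma> w * (\<psi> (run_sup t w) * exp (l * (run_sup t w - coord t w))))
           / (LINT w|P. \<psi> (run_sup t w) * exp (l * (run_sup t w - coord t w))))
        \<longlongrightarrow> measure Q0 \<Gamma>) at_top"
proof -
  have ps: "path_space \<in> sets (filt t)" for t using sets.top[of "filt t"] by simp
  have "((\<lambda>t. (LINT w|R. indicator \<Gamma> w * h (run_sup t w)) / (LINT w|R. indicator path_space w * h (run_sup t w)))
    \<longlongrightarrow> (Z * measure Q0 \<Gamma>) / (Z * measure Q0 path_space)) at_top"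
    by (intro tendsto_divide integral_h_run_sup_tendsto[OF u] \<Gamma> ps) (use Z_pos Q0.prob_space in simp)
  moreover have "(Z * measure Q0 \<Gamma>) / (Z * measure Q0 path_space) = measure Q0 \<Gamma>"
    using Z_pos Q0.prob_space by simp
  moreover have "\<forall>\<^sub>F t in at_top. (LINT w|R. indicator \<Gamma> w * h (run_sup t w)) / (LINT w|R. indicator path_space w * h (run_sup t w))
     = (LINT w|P. indicator \<Gamma> w * (\<psi> (run_sup t w) * exp (l * (run_sup t w - coord t w))))
           / (LINT w|P. \<psi> (run_sup t w) * exp (l * (run_sup t w - coord t w)))"
    using eventually_ge_at_top[of u]
  proof eventually_elim
    case (elim t)
    then have t: "0 \<le> t" and \<Gamma>t: "\<Gamma> \<in> sets (filt t)" using u \<Gamma> sets_filt_mono[of u t] by auto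
    have "(LINT w|P. \<psi> (run_sup t w) * exp (l * (run_sup t w - coord t w)))
       = (LINT w|P. indicator path_space w * (\<psi> (run_sup t w) * exp (l * (run_sup t w - coord t w))))"
      by (rule Bochner_Integration.integral_cong) auto
    then show ?case by (simp only: integral_weight_P[OF t \<Gamma>t] integral_weight_P[OF t ps]) simp
  qed
  ultimately show ?thesis by (simp add: tendsto_cong)
qed

end

text \<open>The Bochner integral of a function that is not integrable is 0 by convention, so the
  Brownian motion clause is accompanied by almost sure integrability of the drift on every bounded
  interval. Existence and uniqueness of the penalised family ensure that the clauses quantified over
  such families are not vacuous and concern a single family.\<close>

theorem theorem3p9:
  fixes l :: real and \<psi> :: "real \<Rightarrow> real" and P :: "real \<Rightarrow> (real \<Rightarrow> real) measure"
  assumes P: "\<And>x. brownian_law x (P x)"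
    and l: "l > 0"
    and \<psi>_borel: "\<psi> \<in> borel_measurable borel"
    and \<psi>_pos: "\<And>y. \<psi> y > 0"
    and \<psi>_int: "\<And>x. set_integrable lborel {x..} (\<lambda>z. \<psi> z * exp (- l * z))"
  shows "(AE y in lborel. (Phi l \<psi> has_real_derivative phi l \<psi> y) (at y))
     \<and> (\<forall>u>0. \<forall>x. \<forall>\<Gamma>\<in>sets (filt u).
      ((\<lambda>t. (LINT w|P x. indicator \<Gamma> w * (\<psi> (run_sup t w) * exp (l * (run_sup t w - coord t w))))
           / (LINT w|P x. \<psi> (run_sup t w) * exp (l * (run_sup t w - coord t w))))
        \<longlongrightarrow> 1 / (1 - Phi l \<psi> x) * (LINT w|P x. indicator \<Gamma> w * Mproc l \<psi> u w)) at_top)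
     \<and> (\<exists>!Q. penalised_family l \<psi> P Q)
     \<and> (\<forall>Q. penalised_family l \<psi> P Q \<longrightarrow> (\<forall>x.
      (AE w in Q x. \<forall>t\<ge>0. set_integrable lborel {0..t} (\<lambda>u. drift_term l \<psi> u w)) \<and>
      brownian_motion (Q x)
        (\<lambda>t w. coord t w - x + l * (LINT u:{0..t}|lborel. drift_term l \<psi> u w)) 0))
     \<and> (\<forall>Q. penalised_family l \<psi> P Q \<longrightarrow> (\<forall>x.
      Q x = density (drift_law (- l) (P x))
              (\<lambda>w. ennreal (exp (- l * x) / (1 - Phi l \<psi> x)
                      * (exp (l * total_sup w) * \<psi> (total_sup w) / (2 * l))))))"
proof -
  define Q where "Q x = density (drift_law (- l) (P x)) (\<lambda>w. ennreal (exp (- l * x) / (1 - Phi l \<psi> x)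
                      * (exp (l * total_sup w) * \<psi> (total_sup w) / (2 * l))))" for x
  have W: "weighted (P x) x l \<psi>" for x
    by unfold_locales (use P l \<psi>_borel \<psi>_pos \<psi>_int in \<open>auto intro: brownian_law_gauss_increments\<close>)
  have Q: "weighted.Q0 (P x) x l \<psi> = Q x" for x
    unfolding Q_def by (rule weighted.Q0_eq[OF W])
  have fam: "penalised_family l \<psi> P Q"
    unfolding penalised_family_def
  proof (intro allI conjI impI ballI)
    fix x
    interpret weighted "P x" x l \<psi> by (rule W)
    show "prob_space (Q x)" "sets (Q x) = sets filt_inf"
      using Q0.prob_space_axioms sets_Q0 unfolding Q by auto
    show "measure (Q x) \<Gamma> = 1 / (1 - Phi l \<psi> x) * (LINT w|P x. indicator \<Gamma> w * Mproc l \<psi> u w)"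
      if "0 \<le> u" "\<Gamma> \<in> sets (filt u)" for u \<Gamma>
      using measure_Q0[OF that] unfolding Q .
  qed
  have uniq: "Q' = Q" if "penalised_family l \<psi> P Q'" for Q'
  proof
    fix x show "Q' x = Q x"
      by (rule prob_eqI_filt) (use that fam in \<open>auto simp: penalised_family_def\<close>)
  qed
  have 1: "AE y in lborel. (Phi l \<psi> has_real_derivative phi l \<psi> y) (at y)"
    by (rule weighted.AE_DERIV_Phi[OF W])
  have 2: "((\<lambda>t. (LINT w|P x. indicator \<Gamma> w * (\<psi> (run_sup t w) * exp (l * (run_sup t w - coord t w))))
           / (LINT w|P x. \<psi> (run_sup t w) * exp (l * (run_sup t w - coord t w))))
        \<longlongrightarrow> 1 / (1 - Phi l \<psi> x) * (LINT w|P x. indicator \<Gamma> w * Mproc l \<psi> u w)) at_top"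
    if "0 < u" "\<Gamma> \<in> sets (filt u)" for u x \<Gamma>
    unfolding weighted.measure_Q0[OF W less_imp_le[OF that(1)] that(2), symmetric]
    by (rule weighted.penalised_limit[OF W less_imp_le[OF that(1)] that(2)])
  have 3: "AE w in Q x. \<forall>t\<ge>0. set_integrable lborel {0..t} (\<lambda>u. drift_term l \<psi> u w)" for x
    using weighted.AE_set_integrable_drift[OF W, of x] unfolding Q .
  have 4: "brownian_motion (Q x) (\<lambda>t w. coord t w - x + l * (LINT u:{0..t}|lborel. drift_term l \<psi> u w)) 0" for x
    using weighted.brownian_motion_bm[OF W, of x]
    unfolding Q weighted.bm_def[OF W, abs_def] weighted.cum_drift_def[OF W] .
  show ?thesis
  proof (intro conjI)
    show "\<forall>Q'. penalised_family l \<psi> P Q' \<longrightarrow> (\<forall>x.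
      (AE w in Q' x. \<forall>t\<ge>0. set_integrable lborel {0..t} (\<lambda>u. drift_term l \<psi> u w)) \<and>
      brownian_motion (Q' x) (\<lambda>t w. coord t w - x + l * (LINT u:{0..t}|lborel. drift_term l \<psi> u w)) 0)"
      using 3 4 uniq by blast
    show "\<forall>Q'. penalised_family l \<psi> P Q' \<longrightarrow> (\<forall>x. Q' x = density (drift_law (- l) (P x))
              (\<lambda>w. ennreal (exp (- l * x) / (1 - Phi l \<psi> x) * (exp (l * total_sup w) * \<psi> (total_sup w) / (2 * l)))))"
      unfolding Q_def[symmetric] using uniq by blast
  qed (use 1 2 fam uniq in blast)+
qed

end
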